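(* Let $0<T<\infty$ and let $f_0,g_0$ be tagged-admissible and background-admissible probability densities on $U\times\mathbb{R}^3$. Let $P^0_t$ be the idealised distribution (with $\varepsilon=0$) and $\hat P^\varepsilon_t$ the empirical distribution ($N\varepsilon^2=1$) on the set of collision trees $\mathcal{MT}$. Then, uniformly for $t\in[0,T]$, $$\lim_{\varepsilon\to0}\ \sup_{S\subset\mathcal{MT}}\left|\int_SP^0_t(\Phi)-\hat P^\varepsilon_t(\Phi)\,d\Phi\right|=0,$$ where the supremum is over measurable $S$.
   Context: $U=[0,1]^3$ with periodic boundary conditions (the torus $\mathbb{R}^3/\mathbb{Z}^3$); distances in $U$ are torus distances; $[a]_+=\max(a,0)$. Admissibility. A probability density $f_0\in L^1(U\times\mathbb{R}^3)$ is tagged-admissible if $\int_{U\times\mathbb{R}^3} f_0(x,v)(1+|v|^2)\,dx\,dv<\infty$. For a probability density $g_0\in L^1(U\times\mathbb{R}^3)$ put $\bar g(v)=\operatorname{ess\,sup}_{x\in U}g_0(x,v)$. Then $g_0$ is background-admissible if: $\int_{\mathbb{R}^3}\bar g(v)(1+|v|^2)\,dv<\infty$; $\operatorname{ess\,sup}_{v}\bar g(v)(1+|v|)<\infty$; for almost all $v$, $g_0(\cdot,v)\in W^{1,1}(U)$, and $\operatorname{ess\,sup}_{x\in U}\int_{\mathbb{R}^3}|\partial_x g_0(x,v)|(1+|v|)\,dv<\infty$; and there are $M>0$ and $0<\alpha\le 1$ such that for almost all $v$ and all $x,y\in U$, $|g_0(x,v)-g_0(y,v)|<M|x-y|^\alpha$.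 Put $g_t(x,v)=g_0(x-tv,v)$. Particle dynamics. One tagged particle and $N$ background particles, unit mass, diameter $\varepsilon=N^{-1/2}$; independent initial data, tagged particle with density $f_0$, each background particle with density $g_0$. Background particles do not interact with each other; an initial overlap (distance $\le\varepsilon$ at time $0$) between the tagged particle and a background particle is ignored (they pass through each other); otherwise whenever the tagged particle $(x,v)$ and a background particle $(x_j,v_j)$ come to distance $\varepsilon$ they collide elastically: with $\nu=(x_j-x)/|x_j-x|$, $v\mapsto v-(\nu\cdot(v-v_j))\nu$, $v_j\mapsto v_j+(\nu\cdot(v-v_j))\nu$; otherwise all velocities are constant. Trees. $\mathcal{MT}$ is the set of all $\Phi=((x_0,v_0),(t_1,\nu_1,v_1),\dots,(t_n,\nu_n,v_n))$ with $n=n(\Phi)\ge0$, $(x_0,v_0)\in U\times\mathbb{R}^3$, $(t_j,\nu_j,v_j)\in[0,T]\times\mathbb{S}^2\times\mathbb{R}^3$, $t_1<\dots<t_n$, with Lebesgue measure $d\Phi$ (surface measure on $\mathbb{S}^2$) on each component. $\tau=0$ if $n=0$, $\tau=t_n$ if $n\ge1$; for $n\ge1$ $(\tau,\nu,v')=(t_n,\nu_n,v_n)$ and $\bar\Phi$ is $\Phi$ with the last collision removed. A tree determines the root trajectory $(x(t),v(t))$ on $[0,T]$: start at $(x_0,v_0)$, $\dot x=v$, $v$ piecewise constant, $v(t_j)=v(t_j^-)-(\nu_j\cdot(v(t_j^-)-v_j))\nu_j$. Empirical distribution. $\hat P^\varepsilon_t$ is the probability measure on $\mathcal{MT}$ given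 by the law of the collision history of the tagged particle up to time $t$: its initial state and, for each collision, the time, the collision parameter (unit vector from tagged to background particle) and the incoming velocity of the background particle. $\int_S\hat P^\varepsilon_t(\Phi)\,d\Phi$ denotes $\hat P^\varepsilon_t(S)$. Idealised distribution. With $L^0_t(\Phi)=\int_{\mathbb{S}^2}\int_{\mathbb{R}^3}g_t(x(t),\bar v)[(v(t)-\bar v)\cdot\nu]_+\,d\bar v\,d\nu$, $P^0_t$ is defined recursively: $P^0_t(\Phi)=\exp(-\int_0^tL^0_\sigma(\Phi)\,d\sigma)f_0(x_0,v_0)$ if $n=0$, and for $n\ge1$, $P^0_t(\Phi)=\mathbb{1}_{t\ge\tau}\exp(-\int_\tau^tL^0_\sigma(\Phi)\,d\sigma)\,P^0_\tau(\bar\Phi)\,g_\tau(x(\tau),v')[(v(\tau^-)-v')\cdot\nu]_+$. *)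

theory Defs
  imports "HOL-Probability.Probability"
begin

section \<open>The torus and admissible densities\<close>

text \<open>
  A function on the torus is a function on \<open>real^3\<close> that is invariant under translation by
  integer vectors.  Integration over the torus is integration over the fundamental domain \<open>cell\<close>.
  A phase is a pair (position, velocity).
\<close>

type_synonym phase = "(real^3) \<times> (real^3)"

definition lattice :: "(real^3) set" where
  "lattice = {k. \<forall>i. k $ i \<in> \<int>}"

definition cell :: "(real^3) set" where
  "cell = {x. \<forall>i. 0 \<le> x $ i \<and> x $ i < 1}"

definition torus_vol :: "(real^3) measure" where
  "torus_vol = restrict_space lborel cell"

definition phase_vol :: "phase measure" where
  "phase_vol = torus_vol \<Otimes>\<^sub>M lborel"

definition torus_dist :: "real^3 \<Rightarrow> real^3 \<Rightarrow> real" where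
  "torus_dist x y = (INF k\<in>lattice. norm (x - y - k))"

text \<open>
  An element of \<open>L\<^sup>1\<close> of the phase space is given by a Borel representative that is
  nonnegative and periodic in position.
\<close>

definition prob_density :: "(phase \<Rightarrow> real) \<Rightarrow> bool" where
  "prob_density h \<longleftrightarrow>
     h \<in> borel_measurable borel \<and> (\<forall>z. 0 \<le> h z) \<and>
     (\<forall>x v. \<forall>k\<in>lattice. h (x + k, v) = h (x, v)) \<and>
     (\<integral>\<^sup>+ z. ennreal (h z) \<partial>phase_vol) = 1"

definition tagged_admissible :: "(phase \<Rightarrow> real) \<Rightarrow> bool" where
  "tagged_admissible f \<longleftrightarrow>
     prob_density f \<and>
     (\<integral>\<^sup>+ (x, v). ennreal (f (x, v) * (1 + (norm v)\<^sup>2)) \<partial>phase_vol) < \<infinity>"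

definition partial_deriv :: "3 \<Rightarrow> (real^3 \<Rightarrow> real) \<Rightarrow> real^3 \<Rightarrow> real" where
  "partial_deriv i \<phi> x = frechet_derivative \<phi> (at x) (axis i 1)"

primrec cont_diff :: "nat \<Rightarrow> (real^3 \<Rightarrow> real) \<Rightarrow> bool" where
  "cont_diff 0 \<phi> \<longleftrightarrow> continuous_on UNIV \<phi>"
| "cont_diff (Suc m) \<phi> \<longleftrightarrow>
     (\<forall>x. \<phi> differentiable (at x)) \<and> (\<forall>i. cont_diff m (partial_deriv i \<phi>))"

definition torus_test_function :: "(real^3 \<Rightarrow> real) \<Rightarrow> bool" where
  "torus_test_function \<phi> \<longleftrightarrow>
     (\<forall>m. cont_diff m \<phi>) \<and> (\<forall>x. \<forall>k\<in>lattice. \<phi> (x + k) = \<phi> x)"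

definition W11_with_gradient :: "(real^3 \<Rightarrow> real) \<Rightarrow> (real^3 \<Rightarrow> real^3) \<Rightarrow> bool" where
  "W11_with_gradient u h \<longleftrightarrow>
     integrable torus_vol u \<and> integrable torus_vol h \<and>
     (\<forall>\<phi> i. torus_test_function \<phi> \<longrightarrow>
        (LINT x|torus_vol. u x * partial_deriv i \<phi> x) = - (LINT x|torus_vol. h x $ i * \<phi> x))"

definition ess_sup_position :: "(phase \<Rightarrow> real) \<Rightarrow> real^3 \<Rightarrow> ennreal" where
  "ess_sup_position g v = esssup torus_vol (\<lambda>x. ennreal (g (x, v)))"

text \<open>
  The strict Hoelder inequality is required for points that are distinct in the torus; at
  coinciding points it would read \<open>0 < 0\<close>.
\<close>

definition background_admissible :: "(phase \<Rightarrow> real) \<Rightarrow> bool" where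
  "background_admissible g \<longleftrightarrow>
     prob_density g \<and>
     (\<integral>\<^sup>+ v. ess_sup_position g v * ennreal (1 + (norm v)\<^sup>2) \<partial>lborel) < \<infinity> \<and>
     esssup lborel (\<lambda>v. ess_sup_position g v * ennreal (1 + norm v)) < \<infinity> \<and>
     (\<exists>Dg :: phase \<Rightarrow> real^3. Dg \<in> borel_measurable borel \<and>
        (AE v in lborel. W11_with_gradient (\<lambda>x. g (x, v)) (\<lambda>x. Dg (x, v))) \<and>
        esssup torus_vol
          (\<lambda>x. \<integral>\<^sup>+ v. ennreal (norm (Dg (x, v)) * (1 + norm v)) \<partial>lborel) < \<infinity>) \<and>
     (\<exists>M \<alpha>. 0 < M \<and> 0 < \<alpha> \<and> \<alpha> \<le> 1 \<and>
        (AE v in lborel. \<forall>x y. x - y \<notin> lattice \<longrightarrow>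
           \<bar>g (x, v) - g (y, v)\<bar> < M * torus_dist x y powr \<alpha>))"

definition transported :: "(phase \<Rightarrow> real) \<Rightarrow> real \<Rightarrow> phase \<Rightarrow> real" where
  "transported g t = (\<lambda>(x, v). g (x - t *\<^sub>R v, v))"


section \<open>Collision trees\<close>

text \<open>A collision is (time, collision parameter, incoming background velocity).\<close>

type_synonym collision = "real \<times> (real^3) \<times> (real^3)"
type_synonym tree = "phase \<times> collision list"

definition collision_trees :: "real \<Rightarrow> tree set" where
  "collision_trees T = {((x, v), cs). x \<in> cell \<and>
     (\<forall>(s, \<nu>, w)\<in>set cs. s \<in> {0..T} \<and> norm \<nu> = 1) \<and> sorted_wrt (<) (map fst cs)}"

text \<open>
  Surface measure on the unit sphere by polar coordinates: the area of a set \<open>A\<close> of unit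
  vectors is three times the volume of the cone of all \<open>r *\<^sub>R \<nu>\<close> with \<open>\<nu> \<in> A\<close>, \<open>0 < r < 1\<close>.
\<close>

definition sphere_measure :: "(real^3) measure" where
  "sphere_measure = scale_measure 3
     (distr (restrict_space lborel (ball 0 1 - {0})) (restrict_space borel (sphere 0 1)) sgn)"

definition collision_vol :: "real \<Rightarrow> collision measure" where
  "collision_vol T = restrict_space lborel {0..T} \<Otimes>\<^sub>M (sphere_measure \<Otimes>\<^sub>M lborel)"

definition tree_coords_vol :: "real \<Rightarrow> nat \<Rightarrow> (phase \<times> (nat \<Rightarrow> collision)) measure" where
  "tree_coords_vol T n = phase_vol \<Otimes>\<^sub>M PiM {..<n} (\<lambda>_. collision_vol T)"

definition tree_component :: "real \<Rightarrow> nat \<Rightarrow> tree set \<Rightarrow> (phase \<times> (nat \<Rightarrow> collision)) set" where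
  "tree_component T n S =
     {(z, c) \<in> space (tree_coords_vol T n). (z, map c [0..<n]) \<in> S}"

definition tree_vol :: "real \<Rightarrow> tree measure" where
  "tree_vol T = measure_of (collision_trees T)
     {S. S \<subseteq> collision_trees T \<and> (\<forall>n. tree_component T n S \<in> sets (tree_coords_vol T n))}
     (\<lambda>S. \<Sum>n. emeasure (tree_coords_vol T n) (tree_component T n S))"


section \<open>The idealised distribution\<close>

definition root_vel :: "tree \<Rightarrow> real \<Rightarrow> real^3" where
  "root_vel \<Phi> s =
     fold (\<lambda>(r, \<nu>, w) v. v - (\<nu> \<bullet> (v - w)) *\<^sub>R \<nu>) (filter (\<lambda>c. fst c \<le> s) (snd \<Phi>)) (snd (fst \<Phi>))"

text \<open>The left limit of the root velocity.\<close>

definition root_vel_left :: "tree \<Rightarrow> real \<Rightarrow> real^3" where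
  "root_vel_left \<Phi> s =
     fold (\<lambda>(r, \<nu>, w) v. v - (\<nu> \<bullet> (v - w)) *\<^sub>R \<nu>) (filter (\<lambda>c. fst c < s) (snd \<Phi>)) (snd (fst \<Phi>))"

definition root_pos :: "tree \<Rightarrow> real \<Rightarrow> real^3" where
  "root_pos \<Phi> s = fst (fst \<Phi>) + integral {0..s} (root_vel \<Phi>)"

definition loss_rate :: "(phase \<Rightarrow> real) \<Rightarrow> real \<Rightarrow> tree \<Rightarrow> real" where
  "loss_rate g t \<Phi> = (LINT \<nu>|sphere_measure. LINT w|lborel.
     transported g t (root_pos \<Phi> t, w) * max 0 ((root_vel \<Phi> t - w) \<bullet> \<nu>))"

function idealised :: "(phase \<Rightarrow> real) \<Rightarrow> (phase \<Rightarrow> real) \<Rightarrow> real \<Rightarrow> tree \<Rightarrow> real" where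
  "idealised f g t (z, cs) =
     (if cs = [] then exp (- (LINT \<sigma>:{0..t}|lborel. loss_rate g \<sigma> (z, cs))) * f z
      else (let (\<tau>, \<nu>, w) = last cs in
        (if \<tau> \<le> t then 1 else 0) * exp (- (LINT \<sigma>:{\<tau>..t}|lborel. loss_rate g \<sigma> (z, cs))) *
        idealised f g \<tau> (z, butlast cs) *
        transported g \<tau> (root_pos (z, cs) \<tau>, w) *
        max 0 ((root_vel_left (z, cs) \<tau> - w) \<bullet> \<nu>)))"
  by pat_completeness auto
termination
  by (relation "Wellfounded.measure (\<lambda>(f, g, t, \<Phi>). length (snd \<Phi>))") auto

declare idealised.simps [simp del]


section \<open>Particle dynamics and the empirical distribution\<close>

text \<open>
  Trajectories are lifted from the torus to \<open>real^3\<close> and velocities are right-continuous.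
  A contact at time \<open>s\<close> is an arrival at distance \<open>\<epsilon>\<close> from a larger distance.  Hence two
  particles that overlap initially pass through each other until they have separated.
\<close>

definition contact :: "real \<Rightarrow> (real \<Rightarrow> real^3) \<Rightarrow> (real \<Rightarrow> real^3) \<Rightarrow> real \<Rightarrow> bool" where
  "contact \<epsilon> x y s \<longleftrightarrow>
     0 < s \<and> torus_dist (x s) (y s) = \<epsilon> \<and> (\<forall>\<^sub>F r in at_left s. \<epsilon> < torus_dist (x r) (y r))"

text \<open>
  The unit vector pointing from \<open>x\<close> to \<open>y\<close> in the torus, for points at distance \<open>\<epsilon>\<close>; it is
  unique for \<open>\<epsilon> < 1/2\<close>.
\<close>

definition torus_normal :: "real \<Rightarrow> real^3 \<Rightarrow> real^3 \<Rightarrow> real^3 \<Rightarrow> bool" where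
  "torus_normal \<epsilon> x y \<nu> \<longleftrightarrow> norm \<nu> = 1 \<and> y - x - \<epsilon> *\<^sub>R \<nu> \<in> lattice"

text \<open>
  Evolution on \<open>{0..t}\<close> of a tagged particle \<open>(x, v)\<close> and background particles
  \<open>(y j, w j)\<close>, \<open>j < N\<close>, with finitely many collisions and no simultaneous ones.
\<close>

definition rayleigh_evolution ::
  "nat \<Rightarrow> real \<Rightarrow> real \<Rightarrow> phase \<times> (nat \<Rightarrow> phase) \<Rightarrow> (real \<Rightarrow> real^3) \<Rightarrow> (real \<Rightarrow> real^3) \<Rightarrow>
   (nat \<Rightarrow> real \<Rightarrow> real^3) \<Rightarrow> (nat \<Rightarrow> real \<Rightarrow> real^3) \<Rightarrow> bool" where
  "rayleigh_evolution N \<epsilon> t \<omega> x v y w \<longleftrightarrow>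
     (x 0, v 0) = fst \<omega> \<and> (\<forall>j<N. (y j 0, w j 0) = snd \<omega> j) \<and>
     finite {s \<in> {0<..t}. \<exists>j<N. contact \<epsilon> x (y j) s} \<and>
     (\<forall>s\<in>{0<..t}. \<forall>i<N. \<forall>j<N. contact \<epsilon> x (y i) s \<and> contact \<epsilon> x (y j) s \<longrightarrow> i = j) \<and>
     (\<forall>s\<in>{0..t}. x s = x 0 + integral {0..s} v \<and>
        (\<forall>j<N. y j s = y j 0 + integral {0..s} (w j))) \<and>
     (\<forall>a b. 0 \<le> a \<and> a \<le> b \<and> b \<le> t \<longrightarrow>
        ((\<forall>j<N. \<forall>s\<in>{a<..b}. \<not> contact \<epsilon> x (y j) s) \<longrightarrow> v b = v a) \<and>
        (\<forall>j<N. (\<forall>s\<in>{a<..b}. \<not> contact \<epsilon> x (y j) s) \<longrightarrow> w j b = w j a)) \<and>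
     (\<forall>s\<in>{0<..t}. \<forall>j<N. contact \<epsilon> x (y j) s \<longrightarrow>
        (\<exists>\<nu> v' w'. torus_normal \<epsilon> (x s) (y j s) \<nu> \<and>
           (v \<longlongrightarrow> v') (at_left s) \<and> (w j \<longlongrightarrow> w') (at_left s) \<and>
           v s = v' - (\<nu> \<bullet> (v' - w')) *\<^sub>R \<nu> \<and> w j s = w' + (\<nu> \<bullet> (v' - w')) *\<^sub>R \<nu>))"

definition is_history :: "nat \<Rightarrow> real \<Rightarrow> real \<Rightarrow> phase \<times> (nat \<Rightarrow> phase) \<Rightarrow> tree \<Rightarrow> bool" where
  "is_history N \<epsilon> t \<omega> \<Phi> \<longleftrightarrow>
     (\<exists>x v y w. rayleigh_evolution N \<epsilon> t \<omega> x v y w \<and>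
        fst \<Phi> = fst \<omega> \<and> sorted_wrt (<) (map fst (snd \<Phi>)) \<and>
        set (snd \<Phi>) = {(s, \<nu>, w'). s \<in> {0<..t} \<and>
          (\<exists>j<N. contact \<epsilon> x (y j) s \<and> torus_normal \<epsilon> (x s) (y j s) \<nu> \<and>
             (w j \<longlongrightarrow> w') (at_left s))})"

text \<open>
  For exceptional initial data (simultaneous or infinitely many collisions) there is no unique
  history, and the tree without collisions is used instead.
\<close>

definition history :: "nat \<Rightarrow> real \<Rightarrow> real \<Rightarrow> phase \<times> (nat \<Rightarrow> phase) \<Rightarrow> tree" where
  "history N \<epsilon> t \<omega> =
     (if \<exists>!\<Phi>. is_history N \<epsilon> t \<omega> \<Phi> then THE \<Phi>. is_history N \<epsilon> t \<omega> \<Phi> else (fst \<omega>, []))"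

definition initial_law ::
  "(phase \<Rightarrow> real) \<Rightarrow> (phase \<Rightarrow> real) \<Rightarrow> nat \<Rightarrow> (phase \<times> (nat \<Rightarrow> phase)) measure" where
  "initial_law f g N = density phase_vol (\<lambda>z. ennreal (f z)) \<Otimes>\<^sub>M
     PiM {..<N} (\<lambda>_. density phase_vol (\<lambda>z. ennreal (g z)))"

text \<open>
  The completion makes the law insensitive to the values of the history on null sets of initial
  data.  Trees carry the collision times in \<open>{0..T}\<close>, so this is meant for \<open>t \<in> {0..T}\<close>.
\<close>

definition empirical ::
  "(phase \<Rightarrow> real) \<Rightarrow> (phase \<Rightarrow> real) \<Rightarrow> nat \<Rightarrow> real \<Rightarrow> real \<Rightarrow> real \<Rightarrow> tree measure" where
  "empirical f g N \<epsilon> T t =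
     distr (completion (initial_law f g N)) (tree_vol T) (history N \<epsilon> t)"


section \<open>The volume on trees is well defined\<close>

lemma tree_component_UN:
  "tree_component T n (\<Union>i. A i) = (\<Union>i. tree_component T n (A i))"
  by (auto simp: tree_component_def)

lemma tree_component_Diff:
  "tree_component T n (A - B) = tree_component T n A - tree_component T n B"
  by (auto simp: tree_component_def)

lemma space_tree_coords_vol:
  "space (tree_coords_vol T n) = (cell \<times> UNIV) \<times> ({..<n} \<rightarrow>\<^sub>E {0..T} \<times> sphere 0 1 \<times> UNIV)"
  by (simp add: tree_coords_vol_def phase_vol_def torus_vol_def collision_vol_def
      sphere_measure_def space_pair_measure space_PiM space_restrict_space space_scale_measure)

lemma tree_component_trees:
  "tree_component T n (collision_trees T) =
     {(z, c) \<in> space (tree_coords_vol T n). \<forall>j<n. \<forall>i<j. fst (c i) < fst (c j)}"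
proof -
  have "(z, map c [0..<n]) \<in> collision_trees T \<longleftrightarrow> (\<forall>j<n. \<forall>i<j. fst (c i) < fst (c j))"
    if zc: "(z, c) \<in> space (tree_coords_vol T n)" for z c
  proof -
    have "fst z \<in> cell" and "\<And>i. i < n \<Longrightarrow> c i \<in> {0..T} \<times> sphere 0 1 \<times> UNIV"
      using zc by (auto simp: space_tree_coords_vol PiE_iff)
    then have "fst z \<in> cell" and "\<And>i. i < n \<Longrightarrow> case c i of (s, \<nu>, w) \<Rightarrow> s \<in> {0..T} \<and> norm \<nu> = 1"
      by (fastforce split: prod.split)+
    then show ?thesis
      by (simp add: collision_trees_def sorted_wrt_iff_nth_less case_prod_beta) (use less_trans in blast)
  qed
  then show ?thesis
    unfolding tree_component_def by blast
qed

lemma tree_component_trees_sets: "tree_component T n (collision_trees T) \<in> sets (tree_coords_vol T n)"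
proof -
  have m: "(\<lambda>zc. fst (snd zc i)) \<in> borel_measurable (tree_coords_vol T n)" if "i < n" for i
  proof -
    have "fst \<in> borel_measurable (collision_vol T)"
      unfolding collision_vol_def
      by (rule measurable_compose[OF measurable_fst])
         (simp add: measurable_restrict_space1)
    moreover have "(\<lambda>zc. snd zc i) \<in> measurable (tree_coords_vol T n) (collision_vol T)"
      unfolding tree_coords_vol_def
      by (rule measurable_compose[OF measurable_snd])
         (rule measurable_component_singleton, use that in simp)
    ultimately show ?thesis by (rule measurable_compose[rotated])
  qed
  have "tree_component T n (collision_trees T) =
    {zc \<in> space (tree_coords_vol T n).
       \<forall>j\<in>{..<n}. \<forall>i\<in>{..<j}. fst (snd zc i) < fst (snd zc j)}"
    unfolding tree_component_trees by (simp add: set_eq_iff Ball_def)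
  also have "\<dots> \<in> sets (tree_coords_vol T n)"
  proof (intro sets.sets_Collect_finite_All finite_lessThan)
    fix j i assume "j \<in> {..<n}" "i \<in> {..<j}"
    then have "i < n" "j < n" by simp_all
    then show "{zc \<in> space (tree_coords_vol T n). fst (snd zc i) < fst (snd zc j)}
        \<in> sets (tree_coords_vol T n)"
      by (intro borel_measurable_less m)
  qed
  finally show ?thesis .
qed

lemma sigma_algebra_trees:
  "sigma_algebra (collision_trees T)
     {S. S \<subseteq> collision_trees T \<and> (\<forall>n. tree_component T n S \<in> sets (tree_coords_vol T n))}"
  unfolding sigma_algebra_iff2
proof (intro conjI allI ballI impI)
  let ?A = "{S. S \<subseteq> collision_trees T \<and> (\<forall>n. tree_component T n S \<in> sets (tree_coords_vol T n))}"
  show "?A \<subseteq> Pow (collision_trees T)"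
    by blast
  show "{} \<in> ?A"
    by (simp add: tree_component_def)
  show "collision_trees T - S \<in> ?A" if "S \<in> ?A" for S
    using that by (simp add: tree_component_Diff tree_component_trees_sets sets.Diff)
  show "(\<Union>i. A i) \<in> ?A" if "range A \<subseteq> ?A" for A :: "nat \<Rightarrow> tree set"
  proof -
    have *: "A i \<subseteq> collision_trees T" "tree_component T n (A i) \<in> sets (tree_coords_vol T n)" for i n
      using that by blast+
    then show ?thesis
      by (simp add: tree_component_UN UN_subset_iff sets.countable_UN image_subset_iff)
  qed
qed

lemma space_tree_vol: "space (tree_vol T) = collision_trees T"
  by (simp add: tree_vol_def space_measure_of_conv)

lemma sets_tree_vol:
  "sets (tree_vol T) =
     {S. S \<subseteq> collision_trees T \<and> (\<forall>n. tree_component T n S \<in> sets (tree_coords_vol T n))}"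
  unfolding tree_vol_def
  by (rule sigma_algebra.sets_measure_of_eq[OF sigma_algebra_trees])

lemma suminf_swap_ennreal:
  fixes f :: "nat \<Rightarrow> nat \<Rightarrow> ennreal"
  shows "(\<Sum>i. \<Sum>n. f i n) = (\<Sum>n. \<Sum>i. f i n)"
proof -
  have "(\<Sum>i. \<Sum>n. f i n) = (\<Sum>i. \<integral>\<^sup>+ n. f i n \<partial>count_space UNIV)"
    by (simp only: nn_integral_count_space_nat)
  also have "\<dots> = (\<integral>\<^sup>+ n. (\<Sum>i. f i n) \<partial>count_space UNIV)"
    by (rule nn_integral_suminf[symmetric]) simp
  also have "\<dots> = (\<Sum>n. \<Sum>i. f i n)"
    by (simp only: nn_integral_count_space_nat)
  finally show ?thesis .
qed

lemma emeasure_tree_vol: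
  assumes "S \<in> sets (tree_vol T)"
  shows "emeasure (tree_vol T) S =
    (\<Sum>n. emeasure (tree_coords_vol T n) (tree_component T n S))"
  unfolding tree_vol_def
proof (rule emeasure_measure_of_sigma[OF sigma_algebra_trees])
  let ?\<mu> = "\<lambda>S. \<Sum>n. emeasure (tree_coords_vol T n) (tree_component T n S)"
  let ?A = "{S. S \<subseteq> collision_trees T \<and> (\<forall>n. tree_component T n S \<in> sets (tree_coords_vol T n))}"
  show "positive ?A ?\<mu>"
    by (simp add: positive_def tree_component_def)
  show "countably_additive ?A ?\<mu>"
  proof (rule countably_additiveI)
    fix A :: "nat \<Rightarrow> tree set"
    assume A: "range A \<subseteq> ?A" "disjoint_family A"
    have "(\<Sum>i. ?\<mu> (A i)) =
      (\<Sum>n. \<Sum>i. emeasure (tree_coords_vol T n) (tree_component T n (A i)))"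
      by (rule suminf_swap_ennreal)
    also have "\<dots> = ?\<mu> (\<Union>i. A i)"
    proof (intro suminf_cong)
      fix n
      have "disjoint_family (\<lambda>i. tree_component T n (A i))"
        using A(2) unfolding disjoint_family_on_def tree_component_def by blast
      moreover have "range (\<lambda>i. tree_component T n (A i)) \<subseteq> sets (tree_coords_vol T n)"
        using A(1) by blast
      ultimately show "(\<Sum>i. emeasure (tree_coords_vol T n) (tree_component T n (A i))) =
          emeasure (tree_coords_vol T n) (tree_component T n (\<Union>i. A i))"
        unfolding tree_component_UN by (rule suminf_emeasure[rotated])
    qed
    finally show "(\<Sum>i. ?\<mu> (A i)) = ?\<mu> (\<Union>i. A i)" .
  qed
  show "S \<in> ?A" using assms by (simp add: sets_tree_vol)
qed

end

(*
  Scheffe's argument: the idealised distribution and the empirical distribution both have total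
  mass one, so it suffices to bound the empirical distribution from below by a density that
  converges to the idealised one almost everywhere.  In the particle system a tree without
  recollisions arises when the initial data of the particles that collide are the pull-back of the
  tree along their free flights (a change of variables with Jacobian given by the hard-sphere
  kernel) and no other particle hits the tagged particle.  The probability of the latter tends to
  the exponential loss term by Hoelder continuity of the background density, and almost every tree
  has no recollisions in the limit of point particles.
*)
theory Submission
  imports Defs
begin

text \<open>The limit must have mass exactly one, so collisions must not accumulate. The weight
  \<open>(1 + norm v) * exp (- 2 * Cr * \<tau>)\<close> of a tree, with \<open>v\<close> the current
  velocity and \<open>\<tau>\<close> the last collision time, does not increase in mean; this makes
  the expected number of collisions finite. The same bound, independent of \<open>t\<close>,
  dominates the sum over the number of collisions. Uniformity in time needs no estimate in
  \<open>t\<close>: convergence is proved along an arbitrary sequence of times and then applied to a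
  bad time for each \<open>N\<close>. Measurability shapes the conditions on trees. Distances are
  compared at rational times only, and only closed inequalities survive the passage to all times.
  Strict separation from particles that have collided or will collide is therefore encoded by a
  margin growing linearly in time, and separation from all others by a radius
  \<open>eps' N > eps N\<close> with ratio tending to one. On the torus a collision may happen
  through any lattice translate. Positions are unfolded to the whole space, and uniqueness of the
  labelled history ensures that no initial configuration is counted twice.\<close>

abbreviation (input) bm :: "'a measure => ('a => 'b::topological_space) set" where
 "bm R == borel_measurable R"

notation (input) scaleR (infixr "*." 75)

syntax
 "_NN" :: "pttrn => ennreal => 'a measure => ennreal" ("NN(2 _./ _)/ \<partial>_" [60,61] 110)
translations
 "NN x. f \<partial>R" => "CONST nn_integral R (%x. f)"

section \<open>Collision times of free flights\<close>

text \<open>A quarter of the discriminant of the squared equation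
  \<open>norm (p + h *. u) = ep\<close>, quadratic in \<open>h\<close>. Its smaller solution
  \<open>root\<close> is the time at which a point moving from \<open>p\<close> with velocity
  \<open>u\<close> enters the ball of radius \<open>ep\<close>.\<close>

definition disc :: "real => real^3 => real^3 => real" where
 "disc ep p u = (p \<bullet> u)\<^sup>2 - (u \<bullet> u) * (p \<bullet> p - ep\<^sup>2)"

definition root :: "real => real^3 => real^3 => real" where
 "root ep p u = (- (p \<bullet> u) - sqrt (disc ep p u)) / (u \<bullet> u)"

lemma disc_pos_nonzero: "0 < disc ep p u ==> u \<noteq> 0"
 by (auto simp: disc_def)

text \<open>Completing the square with \<open>q = (p + h *. u) \<bullet> u\<close> leaves
  \<open>q ^ 2 = disc ep p u\<close>. The sign of \<open>q\<close> selects the smaller root and so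
  separates entries from exits; grazing, \<open>q = 0\<close>, counts as an entry.\<close>

lemma root_iff:
 fixes p u :: "real^3"
 assumes "u \<noteq> 0" "0 < ep"
 shows "norm (p + h *. u) = ep & (p + h *. u) \<bullet> u <= 0 \<longleftrightarrow> 0 <= disc ep p u & h = root ep p u"
proof -
 have A: "u \<bullet> u > 0" using assms by simp
 define q where "q = p \<bullet> u + h * (u \<bullet> u)"
 have q: "(p + h *. u) \<bullet> u = q" by (simp add: q_def inner_simps)
 have "(u \<bullet> u) * ((norm (p + h *. u))\<^sup>2 - ep\<^sup>2) = q\<^sup>2 - disc ep p u"
  unfolding power2_norm_eq_inner q_def disc_def
  by (simp add: inner_simps inner_commute algebra_simps power2_eq_square)
 then have "norm (p + h *. u) = ep \<longleftrightarrow> q\<^sup>2 = disc ep p u"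
  using A assms(2) by (smt (verit) mult_eq_0_iff norm_ge_zero power2_eq_iff_nonneg)
 moreover have "q\<^sup>2 = disc ep p u & q <= 0 \<longleftrightarrow> 0 <= disc ep p u & q = - sqrt (disc ep p u)"
  by (smt (verit) real_sqrt_abs real_sqrt_ge_zero real_sqrt_pow2 power2_minus zero_le_power2)
 moreover have "q = - sqrt (disc ep p u) \<longleftrightarrow> h = root ep p u"
  using A unfolding q_def root_def by (auto simp: field_simps)
 ultimately show ?thesis unfolding q by metis
qed

lemma root_props:
 fixes p u :: "real^3"
 assumes "u \<noteq> 0" "0 < ep" "0 <= disc ep p u"
 shows "norm (p + root ep p u *. u) = ep"
  and "(p + root ep p u *. u) \<bullet> u = - sqrt (disc ep p u)"
 using root_iff[OF assms(1,2), of p "root ep p u"] assms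
 by (auto simp: root_def inner_simps)

lemma measurable_disc[measurable (raw)]:
 assumes [measurable]: "f : bm M" "g : bm M"
 shows "(%x. disc ep (f x) (g x)) : bm M"
 unfolding disc_def by measurable

lemma measurable_root[measurable (raw)]:
 assumes [measurable]: "f : bm M" "g : bm M"
 shows "(%x. root ep (f x) (g x)) : bm M"
 unfolding root_def by measurable

text \<open>Seen from the tagged particle, a background particle moves with velocity
  \<open>- v\<close>. From \<open>ep *. nu + s *. v\<close> it arrives at \<open>ep *. nu\<close>
  after time \<open>s\<close>, and \<open>0 < v \<bullet> nu\<close> makes this arrival an
  entry.\<close>

lemma disc_cylinder:
 fixes nu v :: "real^3"
 assumes "norm nu = 1" "0 < v \<bullet> nu" "0 < ep"
 shows "0 < disc ep (ep *. nu + s *. v) (- v)" "root ep (ep *. nu + s *. v) (- v) = s"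
proof -
 let ?p = "ep *. nu + s *. v"
 have v: "- v \<noteq> 0" using assms by auto
 have "norm (?p + s *. - v) = ep" "(?p + s *. - v) \<bullet> (- v) < 0"
  using assms by (simp_all add: inner_commute)
 with root_iff[OF v assms(3), of ?p s] root_props[OF v assms(3), of ?p]
 show "0 < disc ep ?p (- v)" "root ep ?p (- v) = s" by auto
qed

section \<open>Surface measure and cylinders\<close>

lemma sets_sphere_measure[measurable_cong]: "sets sphere_measure = sets (restrict_space borel (sphere 0 1))"
 by (simp add: sphere_measure_def)

lemma space_sphere_measure: "space sphere_measure = sphere 0 1"
 by (simp add: sphere_measure_def space_restrict_space space_scale_measure)

lemma sgn_measurable[measurable]: "(sgn :: real^3 => real^3) : bm borel"
proof -
 have "(sgn :: real^3 => real^3) = (%x. x /\<^sub>R norm x)" by (simp add: fun_eq_iff sgn_div_norm)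
 then show ?thesis by simp
qed

lemma nn_integral_sphere:
 assumes [measurable]: "F : bm borel"
 shows "(NN nu. F nu \<partial>sphere_measure) = 3 * (NN y. F (sgn y) * indicator (ball 0 1 - {0}) y \<partial>lborel)"
proof -
 have m: "sgn : measurable (restrict_space lborel (ball 0 1 - {0})) (restrict_space borel (sphere (0::real^3) 1))"
  by (intro measurable_restrict_space2 measurable_restrict_space1)
   (auto simp: space_restrict_space norm_sgn)
 have F: "F : bm (restrict_space borel (sphere (0::real^3) 1))"
  by (rule measurable_restrict_space1) simp
 show ?thesis
  unfolding sphere_measure_def
  by (subst nn_integral_scale_measure)
   (simp_all add: F nn_integral_distr[OF m] nn_integral_restrict_space)
qed

lemma finite_sphere: "emeasure sphere_measure (space sphere_measure) < \<infinity>"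
proof -
 have "emeasure sphere_measure (space sphere_measure) = (NN nu. 1 \<partial>sphere_measure)" by simp
 also have "... = 3 * emeasure lborel (ball (0::real^3) 1 - {0})"
  by (subst nn_integral_sphere) simp_all
 also have "... < \<infinity>"
  using emeasure_bounded_finite[of "ball (0::real^3) 1 - {0}"] by (simp add: bounded_diff ennreal_mult_less_top)
 finally show ?thesis .
qed

interpretation sphere_measure: finite_measure sphere_measure
 by standard (use finite_sphere in auto)

section \<open>The Jacobian of the map from a cone to a cylinder\<close>

text \<open>The matrix determinant lemma in dimension three.\<close>

lemma det_scalar_plus_rank_one:
 fixes n w :: "real^3"
 shows "det (\<chi> i j. (if i = j then a else 0) + w $ i * n $ j) = a ^ 3 + a\<^sup>2 * (w \<bullet> n)"
 by (simp add: det_3 inner_vec_def sum_3 power2_eq_square power3_eq_cube algebra_simps)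

lemma det_projection_plus_rank_one:
 fixes n v :: "real^3"
 assumes "norm n = 1"
 shows "det (\<chi> i j. a * ((if i = j then 1 else 0) - n $ i * n $ j) + c * v $ i * n $ j) = a\<^sup>2 * c * (v \<bullet> n)"
proof -
 have eq: "(\<chi> i j. a * ((if i = j then 1 else 0) - n $ i * n $ j) + c * v $ i * n $ j)
   = (\<chi> i j. (if i = j then a else 0) + (c *. v - a *. n) $ i * n $ j)"
  by (simp add: vec_eq_iff algebra_simps)
 have "n \<bullet> n = 1" using assms by (simp add: norm_eq_1)
 then show ?thesis unfolding eq det_scalar_plus_rank_one
  by (simp add: inner_simps power2_eq_square power3_eq_cube algebra_simps)
qed

definition cone_map :: "real => real => real^3 => real^3 => real^3" where
 "cone_map ep h v y = (norm y ^ 3 * h) *. v + ep *. sgn y"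

definition cone_map_deriv :: "real => real => real^3 => real^3 => real^3 => real^3" where
 "cone_map_deriv ep h v y et = (3 * (sgn y \<bullet> et) * (norm y)\<^sup>2 * h) *. v
  + (ep / norm y) *. (et - (sgn y \<bullet> et) *. sgn y)"

lemma cone_map_has_derivative:
 assumes "y \<noteq> 0"
 shows "(cone_map ep h v has_derivative cone_map_deriv ep h v y) (at y within S)"
proof -
 have *: "cone_map ep h v = (%y. (norm y ^ 3 * h) *. v + ep *. (inverse (norm y) *. y))"
  by (simp add: fun_eq_iff cone_map_def sgn_div_norm divide_inverse)
 have n: "(norm has_derivative (%et. sgn y \<bullet> et)) (at y within S)"
  using has_derivative_norm[OF assms] by (simp add: inner_commute has_derivative_at_withinI)
 show ?thesis unfolding *
  apply (rule derivative_eq_intros n refl | simp add: assms)+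
  apply (simp add: fun_eq_iff cone_map_deriv_def sgn_div_norm field_simps scaleR_diff_right assms power2_eq_square)
  done
qed

text \<open>The two tangential directions contribute \<open>(ep / norm y) ^ 2\<close>; the
  derivative of the cubed radius contributes \<open>3 * norm y ^ 2\<close> and cancels the
  dependence on the radius.\<close>

lemma det_cone_map:
 assumes "y \<noteq> 0"
 shows "det (matrix (cone_map_deriv ep h v y)) = 3 * h * ep\<^sup>2 * (v \<bullet> sgn y)"
proof -
 have "matrix (cone_map_deriv ep h v y) =
  (\<chi> i j. (ep / norm y) * ((if i = j then 1 else 0) - sgn y $ i * sgn y $ j) + (3 * (norm y)\<^sup>2 * h) * v $ i * sgn y $ j)"
  by (simp add: vec_eq_iff matrix_def cone_map_deriv_def cart_eq_inner_axis[symmetric] algebra_simps) (simp add: axis_def)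
 also have "det ... = (ep / norm y)\<^sup>2 * (3 * (norm y)\<^sup>2 * h) * (v \<bullet> sgn y)"
  by (rule det_projection_plus_rank_one) (simp add: norm_sgn assms)
 also have "... = 3 * h * ep\<^sup>2 * (v \<bullet> sgn y)"
  using assms by (simp add: field_simps power2_eq_square)
 finally show ?thesis .
qed

text \<open>The point of entry into the ball, rescaled to the unit sphere. It becomes the collision
  parameter.\<close>

definition cyl_norm :: "real => real^3 => real^3 => real^3" where
 "cyl_norm ep p u = (p + root ep p u *. u) /\<^sub>R ep"

lemma measurable_cyl_norm[measurable (raw)]:
 assumes [measurable]: "f : bm M" "g : bm M"
 shows "(%x. cyl_norm ep (f x) (g x)) : bm M"
 unfolding cyl_norm_def by measurable

lemma cyl_norm_props:
 fixes p v :: "real^3"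
 assumes "0 < ep" "0 < disc ep p (- v)"
 shows "norm (cyl_norm ep p (- v)) = 1" "0 < v \<bullet> cyl_norm ep p (- v)"
  "ep *. cyl_norm ep p (- v) + root ep p (- v) *. v = p"
proof -
 note v = disc_pos_nonzero[OF assms(2)]
 note r = root_props[OF v assms(1), of p]
 have d: "0 <= disc ep p (- v)" using assms by simp
 show "norm (cyl_norm ep p (- v)) = 1" unfolding cyl_norm_def using r(1)[OF d] assms(1) by simp
 have "(p + root ep p (- v) *. - v) \<bullet> v = sqrt (disc ep p (- v))"
  using r(2)[OF d] by simp
 moreover have "0 < sqrt (disc ep p (- v))" using assms by simp
 ultimately show "0 < v \<bullet> cyl_norm ep p (- v)"
  unfolding cyl_norm_def using assms(1) by (simp add: inner_commute)
 show "ep *. cyl_norm ep p (- v) + root ep p (- v) *. v = p"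
  unfolding cyl_norm_def using assms(1) by simp
qed

lemma cyl_norm_cylinder:
 assumes "norm nu = 1" "0 < v \<bullet> nu" "0 < ep"
 shows "cyl_norm ep (ep *. nu + s *. v) (- v) = nu"
 using assms by (simp add: cyl_norm_def disc_cylinder)

text \<open>
 The map \<open>cone_map\<close> sends the cone over a set of unit vectors, which defines surface measure, onto a
 piece of cylinder; the cube of the radius makes its Jacobian independent of the radius.
\<close>

lemma emeasure_cylinder_piece:
 assumes ep: "0 < ep" and h: "0 < h" and B[measurable]: "B : sets borel"
 shows "emeasure lborel {p. 0 < disc ep p (- v) & root ep p (- v) : {0<..<h} & cyl_norm ep p (- v) : B}
  = ennreal h * (NN nu. ennreal (ep\<^sup>2 * max 0 (v \<bullet> nu)) * indicator B nu \<partial>sphere_measure)" (is "emeasure lborel ?C = _")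
proof -
 define S where "S = {y::real^3. y \<noteq> 0 & norm y < 1 & sgn y : B & 0 < v \<bullet> sgn y}"
 have S[measurable]: "S : sets borel" unfolding S_def by measurable
 have C[measurable]: "?C : sets borel" by measurable
 let ?T = "cone_map ep h v"
 have T: "0 < disc ep (?T y) (- v)" "root ep (?T y) (- v) = norm y ^ 3 * h" "cyl_norm ep (?T y) (- v) = sgn y"
  if "y : S" for y
  using that disc_cylinder[of "sgn y" v ep "norm y ^ 3 * h"] cyl_norm_cylinder[of "sgn y" v ep "norm y ^ 3 * h"] ep
  by (auto simp: S_def cone_map_def norm_sgn add.commute)
 have img: "?T ` S = ?C"
 proof
  show "?T ` S \<subseteq> ?C"
  proof (rule image_subsetI)
   fix y assume y: "y : S"
   then have "0 < norm y" "norm y < 1" by (auto simp: S_def)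
   then have "norm y ^ 3 < 1" by (simp add: power_less_one_iff)
   then show "?T y : ?C" using T[OF y] y h \<open>0 < norm y\<close> by (auto simp: S_def)
  qed
  show "?C \<subseteq> ?T ` S"
  proof
   fix p assume p: "p : ?C"
   \<comment> \<open>The fraction of the height that has been reached is the cube of the radius in
     the cone, hence the cube root.\<close>
   define r where "r = NthRoot.root 3 (root ep p (- v) / h)"
   have r: "0 < r" "r < 1" "r ^ 3 * h = root ep p (- v)"
    using p h by (auto simp: r_def real_root_lt_1_iff)
   define y where "y = r *. cyl_norm ep p (- v)"
   have c: "norm (cyl_norm ep p (- v)) = 1" "0 < v \<bullet> cyl_norm ep p (- v)"
    "ep *. cyl_norm ep p (- v) + root ep p (- v) *. v = p"
    using cyl_norm_props[OF ep, of p v] p by auto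
   have "sgn y = cyl_norm ep p (- v)" "norm y = r"
    using r c by (simp_all add: y_def sgn_div_norm)
   then have "y : S" "?T y = p"
    using r c p by (auto simp: S_def cone_map_def add.commute)
   then show "p : ?T ` S" by blast
  qed
 qed
 have inj: "inj_on ?T S"
 proof (rule inj_onI)
  fix x y assume xy: "x : S" "y : S" "?T x = ?T y"
  have "norm x ^ 3 * h = norm y ^ 3 * h" "sgn x = sgn y" using T xy by metis+
  then have "norm x = norm y" using h by (simp add: power_eq_iff_eq_base)
  then show "x = y" using \<open>sgn x = sgn y\<close> xy(1,2) by (auto simp: S_def sgn_div_norm)
 qed
 let ?d = "%y. 3 * h * ep\<^sup>2 * (v \<bullet> sgn y)"
 have der: "(?T has_derivative cone_map_deriv ep h v y) (at y within S)" if "y : S" for y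
  using that by (intro cone_map_has_derivative) (auto simp: S_def)
 have det: "\<bar>det (matrix (cone_map_deriv ep h v y))\<bar> = ?d y" if "y : S" for y
  using that h ep by (subst det_cone_map) (auto simp: S_def)
 have Sfin: "emeasure lborel S < \<infinity>"
  by (rule emeasure_bounded_finite[OF bounded_subset[of "ball 0 1"]]) (auto simp: S_def)
 have int: "integrable lborel (%y. indicator S y * ?d y)"
 proof (rule Bochner_Integration.integrable_bound[of _ "%y. (3 * h * ep\<^sup>2 * norm v) * indicator S y"])
  show "integrable lborel (%y. (3 * h * ep\<^sup>2 * norm v) * indicator S y)"
   using Sfin by simp
  show "AE y in lborel. norm (indicator S y * ?d y) <= norm ((3 * h * ep\<^sup>2 * norm v) * indicator S y)"
  proof (intro AE_I2)
   fix y
   have "\<bar>v \<bullet> sgn y\<bar> <= norm v" if "y : S"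
    using Cauchy_Schwarz_ineq2[of v "sgn y"] that by (auto simp: S_def norm_sgn)
   then show "norm (indicator S y * ?d y) <= norm ((3 * h * ep\<^sup>2 * norm v) * indicator S y)"
    using h by (auto simp: indicator_def abs_mult intro!: mult_right_mono mult_left_mono)
  qed
 qed simp
 have hi: "((%y. \<bar>det (matrix (cone_map_deriv ep h v y))\<bar>) has_integral (LINT y|lborel. indicator S y * ?d y)) S"
 proof (rule has_integral_eq)
  have "((%y. indicator S y * ?d y) has_integral (LINT y|lborel. indicator S y * ?d y)) UNIV"
   by (rule has_integral_integral_lborel[OF int])
  moreover have "(%y. indicator S y * ?d y) = (%y. if y : S then ?d y else 0)"
   by (auto simp: indicator_def)
  ultimately show "(?d has_integral (LINT y|lborel. indicator S y * ?d y)) S"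
   by (simp only: has_integral_restrict_UNIV)
 qed (use det in auto)
 have "?T ` S : lmeasurable & measure lebesgue (?T ` S) = (LINT y|lborel. indicator S y * ?d y)"
  by (subst has_measure_differentiable_image[OF _ der inj]) (use hi in auto)
 then have "emeasure lborel ?C = ennreal (LINT y|lborel. indicator S y * ?d y)"
  unfolding img using emeasure_eq_measure2[of ?C lebesgue] by (simp add: emeasure_completion main_part_sets)
 also have "... = (NN y. ennreal (indicator S y * ?d y) \<partial>lborel)"
  by (rule nn_integral_eq_integral[symmetric, OF int]) (use h in \<open>auto simp: indicator_def S_def\<close>)
 \<comment> \<open>The factor 3 of the Jacobian is the one in the definition of surface measure by
   cones, so what remains is an integral over the sphere.\<close>
 also have "... = (NN y. ennreal h * (3 * (ennreal (ep\<^sup>2 * max 0 (v \<bullet> sgn y)) * indicator B (sgn y) * indicator (ball 0 1 - {0}) y)) \<partial>lborel)"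
 proof (rule nn_integral_cong)
  fix y
  have "ennreal (3 * h * ep\<^sup>2 * q) = ennreal h * (3 * ennreal (ep\<^sup>2 * q))" if "0 <= q" for q
   using that h by (simp add: ennreal_mult mult.assoc mult.left_commute)
  then show "ennreal (indicator S y * ?d y) = ennreal h * (3 * (ennreal (ep\<^sup>2 * max 0 (v \<bullet> sgn y)) * indicator B (sgn y) * indicator (ball 0 1 - {0}) y))"
   using h by (auto simp: indicator_def S_def max_def)
 qed
 also have "... = ennreal h * (3 * (NN y. ennreal (ep\<^sup>2 * max 0 (v \<bullet> sgn y)) * indicator B (sgn y) * indicator (ball 0 1 - {0}) y \<partial>lborel))"
 proof -
  have [measurable]: "ball (0::real^3) 1 - {0} : sets borel" by simp
  have [measurable]: "(%y. ennreal (ep\<^sup>2 * max 0 (v \<bullet> sgn y)) * indicator B (sgn y) * indicator (ball 0 1 - {0}) y) : bm borel"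
   by measurable
  show ?thesis
  proof -
   let ?G = "%y. ennreal (ep\<^sup>2 * max 0 (v \<bullet> sgn y)) * indicator B (sgn y) * indicator (ball 0 1 - {0}) y"
   have G: "?G : bm lborel" by measurable
   have "(%y. 3 * ?G y) : bm lborel" by (rule borel_measurable_times_ennreal[OF borel_measurable_const G])
   from nn_integral_cmult[OF this, of "ennreal h"] nn_integral_cmult[OF G, of 3] show ?thesis by simp
  qed
 qed
 also have "... = ennreal h * (NN nu. ennreal (ep\<^sup>2 * max 0 (v \<bullet> nu)) * indicator B nu \<partial>sphere_measure)"
 proof -
  have "(%nu. ennreal (ep\<^sup>2 * max 0 (v \<bullet> nu)) * indicator B nu) : bm borel" by measurable
  from nn_integral_sphere[OF this] show ?thesis by simp
 qed
 finally show ?thesis .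
qed


section \<open>Lebesgue measure in cylinder coordinates\<close>

text \<open>Uniqueness of Lebesgue measure, applied to \<open>M\<close> divided by \<open>c\<close>.
  The case \<open>c = 0\<close> is separate because of this division; it occurs for sets of unit
  vectors on which the kernel vanishes.\<close>

lemma emeasure_eq_scaled_lborel:
 fixes c :: ennreal
 assumes sets: "sets M = sets (borel :: real measure)" and c: "c < \<infinity>"
  and box: "!!a b. a < b ==> emeasure M {a<..<b} = ennreal (b - a) * c"
  and A: "A : sets borel"
 shows "emeasure M A = emeasure lborel A * c"
proof (cases "c = 0")
 case True
 have "emeasure M (\<Union>n::nat. {- real n<..<real n}) = 0"
 proof (rule emeasure_UN_eq_0)
  fix n :: nat
  show "emeasure M {- real n<..<real n} = 0"
   using box[of "- real n" "real n"] True by (cases "n = 0") auto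
 qed (auto simp: sets)
 moreover have "(\<Union>n::nat. {- real n<..<real n}) = UNIV"
 proof (intro set_eqI iffI UNIV_I)
  fix x :: real
  obtain n :: nat where "\<bar>x\<bar> < real n" using reals_Archimedean2 by blast
  then show "x : (\<Union>n::nat. {- real n<..<real n})" by (auto simp: abs_less_iff intro!: exI[of _ n])
 qed
 ultimately have "emeasure M UNIV = 0" by simp
 moreover have "UNIV : sets M" by (simp add: sets)
 ultimately have "emeasure M A = 0" using emeasure_eq_0 by blast
 then show ?thesis using True by simp
next
 case False
 have "lborel = scale_measure (inverse c) M"
 proof (rule lborel_eqI)
  fix l u :: real assume "!!b. b : Basis ==> l \<bullet> b <= u \<bullet> b"
  then have "l <= u" by simp
  show "emeasure (scale_measure (inverse c) M) (box l u) = ennreal (\<Prod>b\<in>Basis. (u - l) \<bullet> b)"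
  proof (cases "l = u")
   case False
   with \<open>l <= u\<close> have "emeasure M {l<..<u} = ennreal (u - l) * c" using box by simp
   moreover obtain r where "c = ennreal r" "0 < r" using \<open>c \<noteq> 0\<close> c by (cases c) (auto simp: ennreal_eq_0_iff not_le)
   then have "inverse c * c = 1" by (simp add: inverse_ennreal ennreal_mult[symmetric])
   ultimately have "inverse c * emeasure M {l<..<u} = ennreal (u - l)"
    by (metis mult.assoc mult.commute mult_1_right)
   then show ?thesis by (simp add: box_real)
  qed simp
 qed (simp add: sets)
 then have "emeasure lborel A = inverse c * emeasure M A" by (metis emeasure_scale_measure)
 moreover obtain r where "c = ennreal r" "0 < r" using False c by (cases c) (auto simp: ennreal_eq_0_iff not_le)
 then have "c * inverse c = 1" by (simp add: inverse_ennreal ennreal_mult[symmetric])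
 ultimately show ?thesis by (metis mult.assoc mult.commute mult_1)
qed

lemma nn_integral_distr_density_lborel:
 assumes [measurable]: "\<Psi> : measurable borel M" "Measurable.pred borel P" "G : bm M"
 shows "(NN x. G x \<partial>distr (density lborel (indicator {p. P p})) M \<Psi>)
  = (NN p. indicator {p. P p} p * G (\<Psi> p) \<partial>lborel)"
 by (subst nn_integral_distr) (simp_all add: nn_integral_density)

text \<open>Sliding the starting point along the direction of flight changes only the time of entry,
  neither its existence nor its place.\<close>

lemma disc_root_translate:
 fixes p v :: "real^3"
 shows "disc ep (p + a *. v) (- v) = disc ep p (- v)"
  and "v \<noteq> 0 ==> root ep (p + a *. v) (- v) = root ep p (- v) + a"
  and "v \<noteq> 0 ==> cyl_norm ep (p + a *. v) (- v) = cyl_norm ep p (- v)"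
proof -
 show d: "disc ep (p + a *. v) (- v) = disc ep p (- v)"
  by (simp add: disc_def inner_simps inner_commute power2_eq_square algebra_simps)
 show r: "root ep (p + a *. v) (- v) = root ep p (- v) + a" if "v \<noteq> 0"
  unfolding root_def d using that by (simp add: inner_simps field_simps)
 show "cyl_norm ep (p + a *. v) (- v) = cyl_norm ep p (- v)" if "v \<noteq> 0"
  unfolding cyl_norm_def r[OF that] by (simp add: algebra_simps)
qed

lemma emeasure_lborel_translate:
 fixes c :: "real^3"
 assumes [measurable]: "Measurable.pred borel P"
 shows "emeasure lborel {p. P p} = emeasure lborel {p. P (p + c)}"
proof -
 have "emeasure lborel {p. P p} = emeasure (distr lborel borel ((+) c)) {p. P p}"
  by (simp add: lborel_distr_plus)
 also have "... = emeasure lborel {p. P (p + c)}"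
  by (subst emeasure_distr) (auto simp: vimage_def add.commute)
 finally show ?thesis .
qed

text \<open>The map from \<open>(s, nu)\<close> to \<open>ep *. nu + s *. v\<close> with
  \<open>0 < v \<bullet> nu\<close> parametrises the open cylinder of radius \<open>ep\<close> with
  axis \<open>v\<close>, and Lebesgue measure becomes \<open>ds\<close> times the hard-sphere kernel
  on the sphere. The two measures are compared on rectangles: in the time variable by translation
  invariance, in the unit vector by \<open>emeasure_cylinder_piece\<close>.\<close>

lemma cylinder_nn_integral:
 fixes v :: "real^3"
 assumes ep: "0 < ep" and F[measurable]: "F : bm (borel \<Otimes>\<^sub>M borel)"
 shows "(NN s. NN nu. F (s, nu) * ennreal (ep\<^sup>2 * max 0 (v \<bullet> nu)) \<partial>sphere_measure \<partial>lborel)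
  = (NN p. (if 0 < disc ep p (- v) then F (root ep p (- v), cyl_norm ep p (- v)) else 0) \<partial>lborel)"
proof -
 define k where "k nu = ennreal (ep\<^sup>2 * max 0 (v \<bullet> nu))" for nu
 have [measurable]: "k : bm borel" unfolding k_def by measurable
 define \<sigma> where "\<sigma> = distr sphere_measure borel (%nu. nu)"
 have id: "(%nu. nu) : measurable sphere_measure borel"
  by (simp add: measurable_cong_sets[OF sets_sphere_measure refl] measurable_restrict_space1)
 have int\<sigma>: "(NN nu. G nu \<partial>\<sigma>) = (NN nu. G nu \<partial>sphere_measure)" if [measurable]: "G : bm borel" for G
  unfolding \<sigma>_def by (simp add: nn_integral_distr[OF id])
 define D where "D = density \<sigma> k"
 have [measurable_cong]: "sets \<sigma> = sets borel" "sets D = sets borel" by (simp_all add: \<sigma>_def D_def)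
 have D: "emeasure D B = (NN nu. k nu * indicator B nu \<partial>sphere_measure)" if [measurable]: "B : sets borel" for B
  unfolding D_def by (subst emeasure_density) (simp_all add: int\<sigma>)
 have kfin: "(NN nu. k nu * indicator B nu \<partial>sphere_measure) < \<infinity>" for B
 proof -
  have "(NN nu. k nu * indicator B nu \<partial>sphere_measure) <= (NN nu. ennreal (ep\<^sup>2 * norm v) \<partial>sphere_measure)"
  proof (intro nn_integral_mono)
   fix nu assume "nu : space sphere_measure"
   then have "v \<bullet> nu <= norm v" using norm_cauchy_schwarz[of v nu] by (simp add: space_sphere_measure)
   then show "k nu * indicator B nu <= ennreal (ep\<^sup>2 * norm v)"
    by (auto simp: k_def indicator_def intro!: ennreal_leI mult_left_mono)
  qed
  also have "... < \<infinity>" using finite_sphere by (simp add: ennreal_mult_less_top)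
  finally show ?thesis .
 qed
 interpret D: finite_measure D
  by standard (use D[of UNIV] kfin[of UNIV] in \<open>simp add: sets_eq_imp_space_eq[OF \<open>sets D = sets borel\<close>]\<close>)
 define \<Psi> where "\<Psi> p = (root ep p (- v), cyl_norm ep p (- v))" for p
 have [measurable]: "\<Psi> : measurable borel (borel \<Otimes>\<^sub>M borel)" unfolding \<Psi>_def by measurable
 define N where "N = distr (density lborel (indicator {p. 0 < disc ep p (- v)})) (borel \<Otimes>\<^sub>M borel) \<Psi>"
 have N: "emeasure N (A \<times> B) = emeasure lborel {p. 0 < disc ep p (- v) & root ep p (- v) : A & cyl_norm ep p (- v) : B}"
  if [measurable]: "A : sets borel" "B : sets borel" for A B
 proof -
  have "emeasure N (A \<times> B) = (NN x. indicator (A \<times> B) x \<partial>N)"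
   by (rule nn_integral_indicator[symmetric]) (simp add: N_def)
  also have "... = (NN p. indicator {p. 0 < disc ep p (- v)} p * indicator (A \<times> B) (\<Psi> p) \<partial>lborel)"
   unfolding N_def by (rule nn_integral_distr_density_lborel) measurable
  also have "... = (NN p. indicator {p. 0 < disc ep p (- v) & root ep p (- v) : A & cyl_norm ep p (- v) : B} p \<partial>lborel)"
   by (intro nn_integral_cong) (auto simp: indicator_def \<Psi>_def)
  finally show ?thesis by simp
 qed
 have NAB: "emeasure N (A \<times> B) = emeasure lborel A * emeasure D B"
  if A[measurable]: "A : sets borel" and [measurable]: "B : sets borel" for A B
 proof -
  define M where "M = distr (density lborel (indicator {p. 0 < disc ep p (- v) & cyl_norm ep p (- v) : B})) borel (%p. root ep p (- v))"
  have M: "emeasure M A = emeasure N (A \<times> B)" if [measurable]: "A : sets borel" for A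
  proof -
   have "emeasure M A = (NN x. indicator A x \<partial>M)"
    by (rule nn_integral_indicator[symmetric]) (simp add: M_def)
   also have "... = (NN p. indicator {p. 0 < disc ep p (- v) & cyl_norm ep p (- v) : B} p * indicator A (root ep p (- v)) \<partial>lborel)"
    unfolding M_def by (rule nn_integral_distr_density_lborel) measurable
   also have "... = (NN p. indicator {p. 0 < disc ep p (- v) & root ep p (- v) : A & cyl_norm ep p (- v) : B} p \<partial>lborel)"
    by (intro nn_integral_cong) (auto simp: indicator_def)
   finally show ?thesis by (simp add: N)
  qed
  have "emeasure M A = emeasure lborel A * emeasure D B"
  proof (rule emeasure_eq_scaled_lborel)
   show "emeasure D B < \<infinity>" using kfin by (simp add: D)
   fix a b :: real assume ab: "a < b"
   have "emeasure M {a<..<b} = emeasure lborel {p. 0 < disc ep p (- v) & root ep p (- v) : {a<..<b} & cyl_norm ep p (- v) : B}"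
    by (simp add: M N)
   \<comment> \<open>Sliding \<open>p\<close> by \<open>a *. v\<close> moves the time interval to
     one that starts at 0, for which the measure is known.\<close>
   also have "... = emeasure lborel {p. 0 < disc ep (p + a *. v) (- v) & root ep (p + a *. v) (- v) : {a<..<b} & cyl_norm ep (p + a *. v) (- v) : B}"
    by (rule emeasure_lborel_translate) measurable
   also have "{p. 0 < disc ep (p + a *. v) (- v) & root ep (p + a *. v) (- v) : {a<..<b} & cyl_norm ep (p + a *. v) (- v) : B}
    = {p. 0 < disc ep p (- v) & root ep p (- v) : {0<..<b - a} & cyl_norm ep p (- v) : B}"
    using disc_pos_nonzero[of ep _ "- v"] by (auto simp: disc_root_translate)
   also have "emeasure lborel ... = ennreal (b - a) * emeasure D B"
    using ab by (subst emeasure_cylinder_piece[OF ep]) (simp_all add: D k_def)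
   finally show "emeasure M {a<..<b} = ennreal (b - a) * emeasure D B" .
  qed (simp_all add: M_def)
  then show ?thesis by (simp add: M)
 qed
 have eq: "lborel \<Otimes>\<^sub>M D = N"
 proof (rule pair_measure_eqI)
  show "sigma_finite_measure D" by unfold_locales
  show "sets (lborel \<Otimes>\<^sub>M D) = sets N"
   unfolding N_def by simp (intro sets_pair_measure_cong, simp_all add: \<open>sets D = sets borel\<close>)
  fix A :: "real set" and B assume "A : sets lborel" "B : sets D"
  then show "emeasure lborel A * emeasure D B = emeasure N (A \<times> B)"
   using NAB by (simp add: \<open>sets D = sets borel\<close>)
 qed (rule lborel.sigma_finite_measure_axioms)
 have "(NN s. NN nu. F (s, nu) * k nu \<partial>sphere_measure \<partial>lborel) = (NN s. NN nu. F (s, nu) \<partial>D \<partial>lborel)"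
  unfolding D_def by (intro nn_integral_cong) (simp add: nn_integral_density int\<sigma> mult.commute)
 also have "... = (NN x. F x \<partial>(lborel \<Otimes>\<^sub>M D))"
  by (rule D.nn_integral_fst) measurable
 also have "... = (NN p. indicator {p. 0 < disc ep p (- v)} p * F (\<Psi> p) \<partial>lborel)"
  unfolding eq N_def by (rule nn_integral_distr_density_lborel) measurable
 also have "... = (NN p. (if 0 < disc ep p (- v) then F (root ep p (- v), cyl_norm ep p (- v)) else 0) \<partial>lborel)"
  by (intro nn_integral_cong) (auto simp: \<Psi>_def)
 finally show ?thesis unfolding k_def .
qed

section \<open>The lattice and the distance on the torus\<close>

lemma lattice_zero[simp]: "0 : lattice" by (simp add: lattice_def)
lemma lattice_add: "k : lattice ==> l : lattice ==> k + l : lattice" by (simp add: lattice_def)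
lemma lattice_diff: "k : lattice ==> l : lattice ==> k - l : lattice" by (simp add: lattice_def)
lemma lattice_minus: "k : lattice ==> - k : lattice" by (simp add: lattice_def)

lemma countable_lattice: "countable lattice"
proof -
 have "lattice \<subseteq> range (%f :: 3 => int. \<chi> i. real_of_int (f i))"
 proof
  fix k assume k: "k : lattice"
  have "k = (\<chi> i. real_of_int \<lfloor>k $ i\<rfloor>)"
   using k by (auto simp: vec_eq_iff lattice_def elim!: Ints_cases)
  then show "k : range (%f :: 3 => int. \<chi> i. real_of_int (f i))"
   by (rule image_eqI[where x = "%i. \<lfloor>k $ i\<rfloor>"]) simp
 qed
 then show ?thesis by (rule countable_subset) simp
qed

lemma lattice_norm_ge_1:
 assumes "k : lattice" "k \<noteq> 0"
 shows "1 <= norm k"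
proof -
 obtain i where i: "k $ i \<noteq> 0" using assms(2) by (auto simp: vec_eq_iff)
 have "k $ i : \<int>" using assms(1) by (simp add: lattice_def)
 then have "1 <= \<bar>k $ i\<bar>" using i by (rule Ints_nonzero_abs_ge1)
 then show ?thesis using component_le_norm_cart[of k i] by linarith
qed

lemma bdd_below_torus: "bdd_below ((%k. norm (x - y - k)) ` lattice)"
 by (rule bdd_belowI[of _ 0]) auto

lemma torus_dist_le: "k : lattice ==> torus_dist x y <= norm (x - y - k)"
 unfolding torus_dist_def by (intro cINF_lower bdd_below_torus)

lemma torus_dist_nonneg: "0 <= torus_dist x y"
 unfolding torus_dist_def by (intro cINF_greatest) (auto intro: lattice_zero)

lemma torus_dist_less_iff: "torus_dist x y < c \<longleftrightarrow> (\<exists>k\<in>lattice. norm (x - y - k) < c)"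
 unfolding torus_dist_def by (subst cINF_less_iff[OF _ bdd_below_torus]) (auto intro: lattice_zero)

text \<open>Distinct lattice vectors are at distance at least 1, so a translate within distance 1/2
  is a nearest one.\<close>

lemma torus_dist_eq_norm:
 assumes "k : lattice" "norm (x - y - k) <= 1 / 2"
 shows "torus_dist x y = norm (x - y - k)"
proof (rule antisym[OF torus_dist_le[OF assms(1)]])
 show "norm (x - y - k) <= torus_dist x y"
  unfolding torus_dist_def
 proof (rule cINF_greatest)
  fix l assume l: "l : lattice"
  show "norm (x - y - k) <= norm (x - y - l)"
  proof (cases "l = k")
   case False
   then have "1 <= norm (k - l)" using l assms(1) by (intro lattice_norm_ge_1 lattice_diff) auto
   moreover have "norm (k - l) <= norm (x - y - l) + norm (x - y - k)"
    using norm_triangle_ineq4[of "x - y - l" "x - y - k"] by (simp add: algebra_simps)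
   ultimately show ?thesis using assms(2) by linarith
  qed simp
 qed (use assms in auto)
qed

lemma torus_dist_attained:
 assumes "torus_dist x y < 1 / 2"
 obtains k where "k : lattice" "torus_dist x y = norm (x - y - k)"
proof -
 from assms obtain k where k: "k : lattice" "norm (x - y - k) < 1 / 2"
  unfolding torus_dist_less_iff by blast
 then show ?thesis using torus_dist_eq_norm[of k x y] that by auto
qed

lemma torus_dist_eq_0_iff: "torus_dist x y = 0 \<longleftrightarrow> x - y : lattice"
proof
 assume "torus_dist x y = 0"
 then obtain k where "k : lattice" "torus_dist x y = norm (x - y - k)"
  using torus_dist_attained[of x y] by auto
 then show "x - y : lattice" using \<open>torus_dist x y = 0\<close> by simp
next
 assume "x - y : lattice"
 then show "torus_dist x y = 0" using torus_dist_le[of "x - y" x y] torus_dist_nonneg[of x y] by simp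
qed

lemma torus_dist_lipschitz: "\<bar>torus_dist x y - torus_dist x' y'\<bar> <= norm ((x - y) - (x' - y'))"
proof -
 have "torus_dist x y <= torus_dist x' y' + norm ((x - y) - (x' - y'))" for x y x' y'
 proof -
  have "torus_dist x y - norm ((x - y) - (x' - y')) <= norm (x' - y' - k)" if "k : lattice" for k
  proof -
   have "(x - y) - (x' - y') + (x' - y' - k) = x - y - k" by simp
   then have "norm (x - y - k) <= norm ((x - y) - (x' - y')) + norm (x' - y' - k)"
    using norm_triangle_ineq[of "(x - y) - (x' - y')" "x' - y' - k"] by (simp only:)
   then show ?thesis using torus_dist_le[OF that, of x y] by linarith
  qed
  then have "torus_dist x y - norm ((x - y) - (x' - y')) <= torus_dist x' y'"
   unfolding torus_dist_def[of x' y'] by (intro cINF_greatest) (auto intro: lattice_zero)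
  then show ?thesis by simp
 qed
 from this[of x y x' y'] this[of x' y' x y] show ?thesis by (auto simp: norm_minus_commute abs_le_iff)
qed

lemma torus_dist_continuous: "continuous_on UNIV (%z :: phase. torus_dist (fst z) (snd z))"
proof (rule continuous_on_iff[THEN iffD2], intro ballI allI impI)
 fix z :: phase and e :: real assume "0 < e"
 show "\<exists>d>0. \<forall>z'\<in>UNIV. dist z' z < d --> dist (torus_dist (fst z') (snd z')) (torus_dist (fst z) (snd z)) < e"
 proof (intro exI[of _ "e / 2"] conjI ballI impI)
  fix z' assume z': "dist z' z < e / 2"
  have "dist (torus_dist (fst z') (snd z')) (torus_dist (fst z) (snd z)) <= norm ((fst z' - snd z') - (fst z - snd z))"
   unfolding dist_real_def by (rule torus_dist_lipschitz)
  also have "... <= dist (fst z') (fst z) + dist (snd z') (snd z)"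
   using norm_triangle_ineq4[of "fst z' - fst z" "snd z' - snd z"] by (simp add: dist_norm algebra_simps)
  also have "... <= dist z' z + dist z' z" by (intro add_mono dist_fst_le dist_snd_le)
  finally show "dist (torus_dist (fst z') (snd z')) (torus_dist (fst z) (snd z)) < e" using z' by simp
 qed (use \<open>0 < e\<close> in simp)
qed

lemma continuous_on_torus_dist[continuous_intros]:
 assumes "continuous_on A f" "continuous_on A g"
 shows "continuous_on A (%x. torus_dist (f x) (g x))"
 using continuous_on_compose2[OF torus_dist_continuous continuous_on_Pair[OF assms]] by simp

lemma measurable_torus_dist[measurable (raw)]:
 assumes [measurable]: "f : bm M" "g : bm M"
 shows "(%x. torus_dist (f x) (g x)) : bm M"
 by (rule borel_measurable_continuous_Pair[OF assms torus_dist_continuous])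

section \<open>Integration over the torus\<close>

lemma cell_borel[measurable]: "cell : sets borel"
proof -
 have eq: "cell = (\<Inter>i\<in>UNIV. {x. 0 <= x $ i} \<inter> {x. x $ i < 1})" by (auto simp: cell_def)
 have "{x :: real^3. 0 <= x $ i} \<inter> {x. x $ i < 1} : sets borel" for i
  by (intro sets.Int borel_closed borel_open closed_Collect_le open_Collect_less continuous_intros)
 then show ?thesis unfolding eq by (intro sets.finite_INT) auto
qed

lemma lattice_cell_unique: "\<exists>!k. k : lattice & x - k : cell"
proof (rule ex1I)
 show "(\<chi> i. real_of_int \<lfloor>x $ i\<rfloor>) : lattice & x - (\<chi> i. real_of_int \<lfloor>x $ i\<rfloor>) : cell"
  by (auto simp: lattice_def cell_def) linarith+
 fix k assume k: "k : lattice & x - k : cell"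
 have "k $ i = real_of_int \<lfloor>x $ i\<rfloor>" for i
 proof -
  have "k $ i : \<int>" "0 <= x $ i - k $ i" "x $ i - k $ i < 1" using k by (auto simp: lattice_def cell_def)
  then show ?thesis by (auto elim!: Ints_cases simp: floor_eq_iff intro!: arg_cong[of _ _ real_of_int]) linarith+
 qed
 then show "k = (\<chi> i. real_of_int \<lfloor>x $ i\<rfloor>)" by (simp add: vec_eq_iff)
qed

lemma space_torus_vol: "space torus_vol = cell"
 by (simp add: torus_vol_def space_restrict_space)

lemma measurable_torus_volI: "f : measurable borel M ==> f : measurable torus_vol M"
 unfolding torus_vol_def by (intro measurable_restrict_space1) simp

lemma nn_integral_torus_vol:
 "F : bm borel ==> (NN x. F x \<partial>torus_vol) = (NN x. F x * indicator cell x \<partial>lborel)"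
 unfolding torus_vol_def by (subst nn_integral_restrict_space) (auto simp: mult.commute)

lemma nn_integral_lborel_shift:
 fixes F :: "real^3 => ennreal"
 assumes [measurable]: "F : bm borel"
 shows "(NN x. F (x + c) \<partial>lborel) = (NN x. F x \<partial>lborel)"
proof -
 have "(NN x. F x \<partial>lborel) = (NN x. F x \<partial>distr lborel borel ((+) c))" by (simp add: lborel_distr_plus)
 also have "... = (NN x. F (x + c) \<partial>lborel)" by (subst nn_integral_distr) (simp_all add: add.commute)
 finally show ?thesis by simp
qed

text \<open>Insert the partition of unity formed by the translates of \<open>cell\<close>, exchange
  sum and integral, and translate each term back to \<open>cell\<close>.\<close>

lemma nn_integral_periodize:
 assumes [measurable]: "F : bm borel"
 shows "(NN x. F x \<partial>lborel) = (NN x. (NN k. F (x + k) \<partial>count_space lattice) \<partial>torus_vol)"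
proof -
 have one: "(NN k. indicator cell (x - k) \<partial>count_space lattice) = 1" for x
 proof -
  obtain k0 where k0: "k0 : lattice" "x - k0 : cell" "!!k. k : lattice ==> x - k : cell ==> k = k0"
   using lattice_cell_unique[of x] by auto
  have "(NN k. indicator cell (x - k) \<partial>count_space lattice) = (NN k. indicator {k0} k \<partial>count_space lattice)"
  proof (rule nn_integral_cong)
   fix k assume "k : space (count_space lattice)"
   then have "x - k : cell \<longleftrightarrow> k = k0" using k0(2) k0(3)[of k] by auto
   then show "indicator cell (x - k) = indicator {k0} k" by (simp add: indicator_def)
  qed
  also have "... = 1" using k0(1) by (simp add: nn_integral_indicator)
  finally show ?thesis .
 qed
 have "(NN x. F x \<partial>lborel) = (NN x. (NN k. F x * indicator cell (x - k) \<partial>count_space lattice) \<partial>lborel)"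
  by (subst nn_integral_cmult) (simp_all add: one)
 also have "... = (NN k. (NN x. F x * indicator cell (x - k) \<partial>lborel) \<partial>count_space lattice)"
  by (rule nn_integral_count_space_nn_integral[OF countable_lattice]) measurable
 also have "... = (NN k. (NN x. F (x + k) * indicator cell x \<partial>lborel) \<partial>count_space lattice)"
 proof (rule nn_integral_cong)
  fix k :: "real^3"
  show "(NN x. F x * indicator cell (x - k) \<partial>lborel) = (NN x. F (x + k) * indicator cell x \<partial>lborel)"
   using nn_integral_lborel_shift[of "%x. F x * indicator cell (x - k)" k] by simp
 qed
 also have "... = (NN k. (NN x. F (x + k) \<partial>torus_vol) \<partial>count_space lattice)"
  by (simp add: nn_integral_torus_vol)
 also have "... = (NN x. (NN k. F (x + k) \<partial>count_space lattice) \<partial>torus_vol)"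
  by (rule nn_integral_count_space_nn_integral[symmetric, OF countable_lattice]) (rule measurable_torus_volI, measurable)
 finally show ?thesis .
qed


section \<open>Integration over phase space\<close>

lemma lborel_phase: "(lborel :: phase measure) = lborel \<Otimes>\<^sub>M lborel"
 by (rule lborel_prod[symmetric])

lemma sigma_finite_torus_vol: "sigma_finite_measure torus_vol"
 unfolding torus_vol_def
 by (rule sigma_finite_measure_restrict_space) (simp_all add: lborel.sigma_finite_measure_axioms)

interpretation torus_vol: sigma_finite_measure torus_vol by (rule sigma_finite_torus_vol)

interpretation torus_lborel: pair_sigma_finite torus_vol "lborel :: (real^3) measure" ..

lemma borel_measurable_nn_integral_count_space:
 fixes f :: "'i => 'a => ennreal"
 assumes I: "countable I" and f: "!!i. i : I ==> f i : bm M"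
 shows "(%x. NN i. f i x \<partial>count_space I) : bm M"
proof -
 interpret count: sigma_finite_measure "count_space I"
  by (rule sigma_finite_measure_count_space_countable[OF I])
 have "(%(x, i). f i x) : bm (M \<Otimes>\<^sub>M count_space I)"
  unfolding case_prod_beta'
  by (rule measurable_compose_countable'[where f = "%i p. f i (fst p)" and g = snd and I = I])
   (use f I in \<open>auto intro: measurable_compose[OF measurable_fst]\<close>)
 then show ?thesis by (rule count.borel_measurable_nn_integral)
qed

lemma measurable_phase_volI: "f : measurable borel M ==> f : measurable phase_vol M"
proof -
 assume f: "f : measurable borel M"
 have "fst : measurable (torus_vol \<Otimes>\<^sub>M (lborel :: (real^3) measure)) borel"
  using measurable_compose[OF measurable_fst measurable_torus_volI[of "%x. x" borel]] by simp
 moreover have "snd : measurable (torus_vol \<Otimes>\<^sub>M (lborel :: (real^3) measure)) borel"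
  using measurable_snd[of torus_vol "lborel :: (real^3) measure"] by simp
 ultimately have "(%z. (fst z, snd z)) : measurable (torus_vol \<Otimes>\<^sub>M (lborel :: (real^3) measure)) (borel \<Otimes>\<^sub>M borel)"
  by (rule measurable_Pair)
 then have "(%z. z) : measurable phase_vol borel" by (simp add: phase_vol_def borel_prod)
 from measurable_compose[OF this f] show "f : measurable phase_vol M" by simp
qed

lemma measurable_borel_pair: "f : measurable (borel \<Otimes>\<^sub>M borel) M ==> f : measurable borel M"
 for f :: "('a::second_countable_topology \<times> 'b::second_countable_topology) => 'c"
 by (simp add: borel_prod)

lemma space_phase_vol: "space phase_vol = cell \<times> UNIV"
 by (simp add: phase_vol_def space_pair_measure space_torus_vol)

lemma nn_integral_phase_vol:
 assumes F: "F : bm borel"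
 shows "(NN z. F z \<partial>phase_vol) = (NN w. NN x. F (x, w) \<partial>torus_vol \<partial>lborel)"
 unfolding phase_vol_def
 by (rule torus_lborel.nn_integral_snd[symmetric]) (use measurable_phase_volI[OF F] in \<open>simp add: phase_vol_def\<close>)

lemma nn_integral_lborel_phase:
 fixes F :: "phase => ennreal"
 assumes F: "F : bm borel"
 shows "(NN z. F z \<partial>lborel) = (NN w. NN x. F (x, w) \<partial>lborel \<partial>lborel)"
 unfolding lborel_phase
 by (rule lborel_pair.nn_integral_snd[symmetric]) (use F in \<open>simp add: lborel_prod\<close>)

lemma nn_integral_periodize_phase:
 fixes F :: "phase => ennreal"
 assumes F[measurable]: "F : bm borel"
 shows "(NN z. F z \<partial>lborel) = (NN z. (NN k. F (fst z + k, snd z) \<partial>count_space lattice) \<partial>phase_vol)"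
proof -
 have [measurable]: "F : bm (borel \<Otimes>\<^sub>M borel)" by (simp add: borel_prod)
 have m: "(%z. (NN k. F (fst z + k, snd z) \<partial>count_space lattice)) : bm borel"
  by (rule borel_measurable_nn_integral_count_space[OF countable_lattice]) (rule measurable_borel_pair, measurable)
 have "(NN z. F z \<partial>lborel) = (NN w. (NN x. NN k. F (x + k, w) \<partial>count_space lattice \<partial>torus_vol) \<partial>lborel)"
  unfolding nn_integral_lborel_phase[OF F]
  by (intro nn_integral_cong nn_integral_periodize) measurable
 also have "... = (NN z. (NN k. F (fst z + k, snd z) \<partial>count_space lattice) \<partial>phase_vol)"
  unfolding nn_integral_phase_vol[OF m] by simp
 finally show ?thesis .
qed


section \<open>Unfolding the positions of finitely many particles\<close>

lemma nn_integral_PiE_lessThan_Suc: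
 assumes "countable L"
 shows "(NN l. H l \<partial>count_space (PiE {..<Suc n} (%_. L)))
  = (NN l. NN m. H (l(n := m)) \<partial>count_space L \<partial>count_space (PiE {..<n} (%_. L)))"
proof -
 interpret product_sigma_finite "%_::nat. count_space L"
  by (intro product_sigma_finite.intro sigma_finite_measure_count_space_countable assms)
 have PiM: "count_space (PiE {..<n} (%_. L)) = PiM {..<n} (%_. count_space L)" for n :: nat
  by (rule count_space_PiM_finite[symmetric]) (use assms in auto)
 show ?thesis
  unfolding PiM unfolding lessThan_Suc
  by (rule product_nn_integral_insert) (simp_all add: PiM[of "Suc n", unfolded lessThan_Suc, symmetric])
qed

text \<open>\<open>l k\<close> is the lattice translate chosen for particle \<open>k\<close>. The
  restriction keeps the result in the space of the product measure.\<close>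

definition shift :: "nat => (nat => real^3) => (nat => phase) => nat => phase" where
 "shift n l et = (\<lambda>k\<in>{..<n}. (fst (et k) + l k, snd (et k)))"

lemma shift_upd: "shift (Suc n) (l(n := m)) (et(n := y)) = (shift n l et)(n := (fst y + m, snd y))"
 by (auto simp: shift_def fun_eq_iff restrict_def)

lemma space_shift: "shift n l et : space (PiM {..<n} (%_. borel))"
 by (simp add: space_PiM shift_def)

lemma measurable_shift[measurable]:
 "shift n l : measurable (PiM {..<n} (%_. borel)) (PiM {..<n} (%_. borel))"
 unfolding shift_def
proof (rule measurable_restrict)
 fix k assume "k : {..<n}"
 then have c: "(%et. et k) : measurable (PiM {..<n} (%_. borel :: phase measure)) borel"
  by (rule measurable_component_singleton)
 have "(%z :: phase. (fst z + l k, snd z)) : bm borel"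
  unfolding borel_prod[symmetric] by measurable
 from measurable_compose[OF c this]
 show "(%et. (fst (et k) + l k, snd (et k) :: real^3)) : bm (PiM {..<n} (%_. borel))" .
qed

lemma sets_PiM_borel: "(!!i. i : I ==> sets (M i) = sets borel) ==> sets (PiM I M) = sets (PiM I (%_. borel))"
 by (rule sets_PiM_cong) auto

lemma measurable_borel_to_phase_vol_PiM:
 assumes "F : bm (PiM I (%_. borel))"
 shows "F : bm (PiM I (%_. density phase_vol g))"
proof -
 have "(%et. \<lambda>i\<in>I. et i) : measurable (PiM I (%_. density phase_vol g)) (PiM I (%_. borel))"
 proof (rule measurable_restrict)
  fix i assume i: "i : I"
  have "(%z. z) : measurable (density phase_vol g) borel" using measurable_phase_volI[of "%z. z" borel] by simp
  from measurable_compose[OF measurable_component_singleton[OF i] this]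
  show "(%et. et i) : measurable (PiM I (%_. density phase_vol g)) borel" .
 qed
 from measurable_compose[OF this assms]
 show ?thesis
  by (rule measurable_cong[THEN iffD1, rotated]) (auto simp: space_PiM PiE_restrict)
qed

text \<open>Unfolding all positions at once: initial data on the torus together with lattice shifts are initial data in space.\<close>

lemma nn_integral_PiM_periodize:
 fixes g :: "phase => real" and F :: "(nat => phase) => ennreal"
 assumes g[measurable]: "g : bm borel" and per: "!!x v k. k : lattice ==> g (x + k, v) = g (x, v)"
  and fin: "sigma_finite_measure (density phase_vol (%z. ennreal (g z)))"
  and F: "F : bm (PiM {..<n} (%_. borel))"
 shows "(NN et. F et * (\<Prod>k<n. ennreal (g (et k))) \<partial>PiM {..<n} (%_. lborel)) =
  (NN et. NN l. F (shift n l et) \<partial>count_space (PiE {..<n} (%_. lattice)) \<partial>PiM {..<n} (%_. density phase_vol (%z. ennreal (g z))))"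
  (is "?L n F = ?R n F")
 using F
proof (induction n arbitrary: F)
 case 0
 have "shift 0 (%x. undefined) (%x. undefined) = (%x. undefined)" by (simp add: shift_def fun_eq_iff)
 then show ?case by (simp add: PiM_empty nn_integral_count_space_finite)
next
 case (Suc n)
 let ?G = "density phase_vol (%z. ennreal (g z))"
 let ?P = "PiM {..<n} (%_. borel :: phase measure)"
 interpret G: sigma_finite_measure ?G by (rule fin)
 interpret PG: product_sigma_finite "%_::nat. ?G" by standard
 interpret PL: product_sigma_finite "%_::nat. lborel :: phase measure" by standard
 have idG: "(%z. z) : measurable ?G borel" using measurable_phase_volI[of "%z. z" borel] by simp
 note F = Suc.prems[unfolded lessThan_Suc]
 have upd: "(%(et, y). F (et(n := y))) : bm (?P \<Otimes>\<^sub>M borel)"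
  using measurable_compose[OF measurable_add_dim F] by (simp add: case_prod_beta' fun_upd_def)
 \<comment> \<open>The last particle is integrated out over the whole space; \<open>K\<close> is the
   function of the remaining ones to which the induction hypothesis applies.\<close>
 define K where "K et = (NN y. F (et(n := y)) * ennreal (g y) \<partial>lborel)" for et
 have Km: "K : bm ?P"
  unfolding K_def
 proof (rule lborel.borel_measurable_nn_integral)
  have "(%(et, y). F (et(n := y)) * ennreal (g y)) : bm (?P \<Otimes>\<^sub>M borel)"
   using borel_measurable_times_ennreal[OF upd, of "%(et, y). ennreal (g y)"] by (simp add: case_prod_beta')
  then show "(%(et, y). F (et(n := y)) * ennreal (g y)) : bm (?P \<Otimes>\<^sub>M lborel)"
   by (simp add: measurable_cong_sets[OF sets_pair_measure_cong[OF refl sets_lborel] refl])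
 qed
 have mPL: "H : bm (PiM I (%_. lborel))" if "H : bm (PiM I (%_. borel))" for H :: "(nat => phase) => ennreal" and I
 proof -
  have "sets (PiM I (%_. lborel :: phase measure)) = sets (PiM I (%_. borel))"
   by (rule sets_PiM_borel) simp
  from measurable_cong_sets[OF this refl] that show ?thesis by blast
 qed
 have Kshift: "K \<zeta> = (NN y. NN m. F (\<zeta>(n := (fst y + m, snd y))) \<partial>count_space lattice \<partial>?G)" if \<zeta>: "\<zeta> : space ?P" for \<zeta>
 proof -
  have Fz[measurable]: "(%y. F (\<zeta>(n := y))) : bm borel"
   using measurable_Pair2[OF upd \<zeta>] by simp
  have Fzm[measurable]: "(%y. F (\<zeta>(n := (fst y + m, snd y)))) : bm borel" for m
   by (rule measurable_compose[OF _ Fz]) (rule measurable_borel_pair, measurable)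
  have "K \<zeta> = (NN y. (NN m. F (\<zeta>(n := (fst y + m, snd y))) * ennreal (g (fst y + m, snd y)) \<partial>count_space lattice) \<partial>phase_vol)"
   unfolding K_def by (rule nn_integral_periodize_phase) measurable
  also have "... = (NN y. ennreal (g y) * (NN m. F (\<zeta>(n := (fst y + m, snd y))) \<partial>count_space lattice) \<partial>phase_vol)"
  proof (rule nn_integral_cong)
   fix y :: phase
   have "(NN m. F (\<zeta>(n := (fst y + m, snd y))) * ennreal (g (fst y + m, snd y)) \<partial>count_space lattice)
    = (NN m. ennreal (g y) * F (\<zeta>(n := (fst y + m, snd y))) \<partial>count_space lattice)"
    using per[of _ "fst y" "snd y"] by (intro nn_integral_cong) (simp add: mult.commute)
   also have "... = ennreal (g y) * (NN m. F (\<zeta>(n := (fst y + m, snd y))) \<partial>count_space lattice)"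
    by (rule nn_integral_cmult) simp
   finally show "(NN m. F (\<zeta>(n := (fst y + m, snd y))) * ennreal (g (fst y + m, snd y)) \<partial>count_space lattice)
    = ennreal (g y) * (NN m. F (\<zeta>(n := (fst y + m, snd y))) \<partial>count_space lattice)" .
  qed
  also have "... = (NN y. NN m. F (\<zeta>(n := (fst y + m, snd y))) \<partial>count_space lattice \<partial>?G)"
   by (rule nn_integral_density[symmetric])
    (auto intro!: measurable_phase_volI borel_measurable_nn_integral_count_space countable_lattice)
  finally show ?thesis .
 qed
 have "?L (Suc n) F = (NN et. NN y. F (et(n := y)) * (\<Prod>k\<in>insert n {..<n}. ennreal (g ((et(n := y)) k))) \<partial>lborel \<partial>PiM {..<n} (%_. lborel))"
  unfolding lessThan_Suc
 proof (rule PL.product_nn_integral_insert)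
  have "(%et. ennreal (g (et k))) : bm (PiM (insert n {..<n}) (%_. borel))" if "k : insert n {..<n}" for k
   using measurable_compose[OF measurable_component_singleton[OF that, of "%_. borel :: phase measure"], of "%z. ennreal (g z)" borel] by simp
  then show "(%et. F et * (\<Prod>k\<in>insert n {..<n}. ennreal (g (et k)))) : bm (PiM (insert n {..<n}) (%_. lborel))"
   by (intro mPL borel_measurable_times_ennreal F borel_measurable_prod_ennreal)
 qed auto
 also have "... = (NN et. K et * (\<Prod>k<n. ennreal (g (et k))) \<partial>PiM {..<n} (%_. lborel))"
 proof (rule nn_integral_cong)
  fix et assume "et : space (PiM {..<n} (%_. lborel :: phase measure))"
  then have et: "et : space ?P" by (simp add: space_PiM)
  have Fz[measurable]: "(%y. F (et(n := y))) : bm borel"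
   using measurable_Pair2[OF upd et] by simp
  have "(NN y. F (et(n := y)) * (\<Prod>k\<in>insert n {..<n}. ennreal (g ((et(n := y)) k))) \<partial>lborel)
   = (NN y. (F (et(n := y)) * ennreal (g y)) * (\<Prod>k<n. ennreal (g (et k))) \<partial>lborel)"
   by (intro nn_integral_cong) (simp add: mult.assoc)
  then show "(NN y. F (et(n := y)) * (\<Prod>k\<in>insert n {..<n}. ennreal (g ((et(n := y)) k))) \<partial>lborel) = K et * (\<Prod>k<n. ennreal (g (et k)))"
   unfolding K_def by (simp add: nn_integral_multc)
 qed
 also have "... = ?R n K" by (rule Suc.IH[OF Km])
 also have "... = (NN et. NN l. NN y. NN m. F ((shift n l et)(n := (fst y + m, snd y))) \<partial>count_space lattice \<partial>?G \<partial>count_space (PiE {..<n} (%_. lattice)) \<partial>PiM {..<n} (%_. ?G))"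
 proof (rule nn_integral_cong)
  fix et
  have "K (shift n l et) = (NN y. NN m. F ((shift n l et)(n := (fst y + m, snd y))) \<partial>count_space lattice \<partial>?G)" for l
   by (rule Kshift) (rule space_shift)
  then show "(NN l. K (shift n l et) \<partial>count_space (PiE {..<n} (%_. lattice)))
   = (NN l. NN y. NN m. F ((shift n l et)(n := (fst y + m, snd y))) \<partial>count_space lattice \<partial>?G \<partial>count_space (PiE {..<n} (%_. lattice)))"
   by simp
 qed
 also have "... = (NN et. NN y. NN l. NN m. F ((shift n l et)(n := (fst y + m, snd y))) \<partial>count_space lattice \<partial>count_space (PiE {..<n} (%_. lattice)) \<partial>?G \<partial>PiM {..<n} (%_. ?G))"
 proof (rule nn_integral_cong)
  fix et assume "et : space (PiM {..<n} (%_. ?G))"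
  note sp = space_shift[of n _ et]
  have Fzm: "(%y. F ((shift n l et)(n := (fst y + m, snd y)))) : bm borel" for l m
   by (rule measurable_compose[OF _ measurable_Pair2[OF upd sp[of l]], of "%y. (fst y + m, snd y)" borel, simplified])
    (rule measurable_borel_pair, measurable)
  show "(NN l. NN y. NN m. F ((shift n l et)(n := (fst y + m, snd y))) \<partial>count_space lattice \<partial>?G \<partial>count_space (PiE {..<n} (%_. lattice)))
   = (NN y. NN l. NN m. F ((shift n l et)(n := (fst y + m, snd y))) \<partial>count_space lattice \<partial>count_space (PiE {..<n} (%_. lattice)) \<partial>?G)"
   by (rule nn_integral_count_space_nn_integral[symmetric])
    (auto intro!: countable_PiE countable_lattice borel_measurable_nn_integral_count_space measurable_phase_volI Fzm)
 qed
 also have "... = (NN et. NN y. NN l. F (shift (Suc n) l (et(n := y))) \<partial>count_space (PiE {..<Suc n} (%_. lattice)) \<partial>?G \<partial>PiM {..<n} (%_. ?G))"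
  by (simp only: nn_integral_PiE_lessThan_Suc[OF countable_lattice] shift_upd)
 also have "... = ?R (Suc n) F"
  unfolding lessThan_Suc
 proof (rule PG.product_nn_integral_insert[symmetric])
  show "(%et. NN l. F (shift (Suc n) l et) \<partial>count_space (insert n {..<n} \<rightarrow>\<^sub>E lattice)) : bm (PiM (insert n {..<n}) (%_. ?G))"
   using measurable_compose[OF measurable_shift Suc.prems]
   by (intro borel_measurable_nn_integral_count_space countable_PiE measurable_borel_to_phase_vol_PiM)
    (auto simp: countable_lattice lessThan_Suc)
 qed auto
 finally show ?case .
qed

section \<open>Contacts\<close>

lemma contact_cong:
 assumes "a < s" and "!!r. r : {a<..s} ==> x r = x' r" "!!r. r : {a<..s} ==> y r = y' r"
 shows "contact ep x y s \<longleftrightarrow> contact ep x' y' s"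
proof -
 have "\<forall>\<^sub>F r in at_left s. r : {a<..<s}"
  using eventually_at_left_real[OF assms(1)] .
 then have "(\<forall>\<^sub>F r in at_left s. ep < torus_dist (x r) (y r)) \<longleftrightarrow> (\<forall>\<^sub>F r in at_left s. ep < torus_dist (x' r) (y' r))"
  by (intro eventually_cong[rotated]) (use assms in auto)
 then show ?thesis unfolding contact_def using assms by auto
qed

text \<open>\<open>z\<close> and \<open>b\<close> are the states at time \<open>a\<close>, not at
  time 0: after each collision the flight restarts from the current states.\<close>

definition free_contact :: "real => real => phase => phase => real => bool" where
 "free_contact ep a z b s \<longleftrightarrow>
  contact ep (%r. fst z + (r - a) *. snd z) (%r. fst b + (r - a) *. snd b) s"

text \<open>Entry of the relative position into the ball of radius \<open>ep\<close> about the
  lattice point \<open>l\<close>. The case \<open>disc = 0\<close> is included because a grazing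
  entry is also an arrival from a larger distance.\<close>

definition touches :: "real => real => phase => phase => real^3 => real => bool" where
 "touches ep a z b l s \<longleftrightarrow> (let p = fst b - fst z - l; u = snd b - snd z in
  u \<noteq> 0 & 0 <= disc ep p u & s - a = root ep p u)"

text \<open>Two candidates for the normal differ by a lattice vector of length at most
  \<open>2 * ep < 1\<close>, hence by zero.\<close>

lemma torus_normal_iff:
 assumes "0 < ep" "ep < 1 / 2" "l : lattice" "norm (y - x - l) = ep"
 shows "torus_normal ep x y nu \<longleftrightarrow> nu = (y - x - l) /\<^sub>R ep"
proof
 assume nu: "torus_normal ep x y nu"
 define k where "k = y - x - ep *. nu"
 have k: "k : lattice" and n: "norm nu = 1" using nu by (auto simp: torus_normal_def k_def)
 have "norm (k - l) = norm ((y - x - l) - ep *. nu)" by (simp add: k_def algebra_simps)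
 also have "... <= ep + ep"
  using norm_triangle_ineq4[of "y - x - l" "ep *. nu"] assms n by simp
 finally have "norm (k - l) < 1" using assms by simp
 then have "k = l" using lattice_norm_ge_1[OF lattice_diff[OF k assms(3)]] by auto
 then have "ep *. nu = y - x - l" by (simp add: k_def algebra_simps)
 then have "nu = (1 / ep) *. (y - x - l)" using assms(1) by (metis divide_self less_irrefl scaleR_one scaleR_scaleR times_divide_eq_left mult_1)
 then show "nu = (y - x - l) /\<^sub>R ep" by (simp add: divide_inverse)
qed (use assms in \<open>auto simp: torus_normal_def\<close>)

lemma torus_normal_unique:
 assumes "0 < ep" "ep < 1 / 2" "torus_normal ep x y nu" "torus_normal ep x y nu'"
 shows "nu = nu'"
proof -
 have "y - x - ep *. nu : lattice" "norm (y - x - (y - x - ep *. nu)) = ep"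
  using assms by (auto simp: torus_normal_def)
 from torus_normal_iff[OF assms(1,2) this] assms(3,4) show ?thesis by simp
qed

text \<open>Arrival from a larger distance is equivalent to entry for one lattice translate. If the
  nearest translate were moving outward at time \<open>s\<close>, it would have been closer than
  \<open>ep\<close> just before; if the relative velocity vanished, the distance would be constant.
  Conversely, near \<open>s\<close> the torus distance is the norm of the entering translate, whose
  square is strictly convex in time.\<close>

lemma free_contact_iff:
 assumes ep: "0 < ep" "ep < 1 / 2" and s: "0 <= a" "a < s"
 shows "free_contact ep a z b s \<longleftrightarrow> (\<exists>l\<in>lattice. touches ep a z b l s)"
proof -
 define u where "u = snd b - snd z"
 define q where "q l r = (fst b - fst z - l) + (r - a) *. u" for l r
 let ?x = "%r. fst z + (r - a) *. snd z" and ?y = "%r. fst b + (r - a) *. snd b"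
 have dist: "norm (?x r - ?y r - k) = norm (q (- k) r)" for r k
  by (subst norm_minus_cancel[symmetric]) (simp add: q_def u_def algebra_simps)
 have q: "q l r = q l s - (s - r) *. u" for l r by (simp add: q_def algebra_simps)
 have nq: "(norm (q l r))\<^sup>2 = (norm (q l s))\<^sup>2 - 2 * ((s - r) * (q l s \<bullet> u)) + (s - r)\<^sup>2 * (u \<bullet> u)" for l r
  unfolding q[of l r] power2_norm_eq_inner
  by (simp add: inner_simps inner_commute power2_eq_square algebra_simps)
 have touch: "touches ep a z b l s \<longleftrightarrow> u \<noteq> 0 & norm (q l s) = ep & q l s \<bullet> u <= 0" for l
  using root_iff[of u ep "fst b - fst z - l" "s - a"] ep
  unfolding touches_def Let_def u_def[symmetric] q_def by auto
 show ?thesis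
 proof
  assume fc: "free_contact ep a z b s"
  then have d: "torus_dist (?x s) (?y s) = ep"
   and ev: "\<forall>\<^sub>F r in at_left s. ep < torus_dist (?x r) (?y r)"
   by (auto simp: free_contact_def contact_def)
  obtain k where k0: "k : lattice" "torus_dist (?x s) (?y s) = norm (?x s - ?y s - k)"
   by (rule torus_dist_attained[of "?x s" "?y s"]) (use d ep in auto)
  then have k: "k : lattice" "norm (q (- k) s) = ep" using d dist[of s k] by simp_all
  have ev': "\<forall>\<^sub>F r in at_left s. ep < norm (q (- k) r)"
   using ev
  proof (rule eventually_mono)
   fix r assume "ep < torus_dist (?x r) (?y r)"
   then show "ep < norm (q (- k) r)" using torus_dist_le[OF k(1), of "?x r" "?y r"] dist[of r k] by simp
  qed
  have "u \<noteq> 0"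
  proof
   assume "u = 0"
   then have "\<forall>\<^sub>F r in at_left s. False" using ev' k(2) by (simp add: q_def)
   then show False by simp
  qed
  moreover have "q (- k) s \<bullet> u <= 0"
  proof (rule ccontr)
   assume neg: "\<not> q (- k) s \<bullet> u <= 0"
   \<comment> \<open>Within \<open>\<delta>\<close> before \<open>s\<close> the linear term of the
     squared distance dominates the quadratic one.\<close>
   define \<delta> where "\<delta> = (q (- k) s \<bullet> u) / (u \<bullet> u)"
   have \<delta>: "0 < \<delta>" using neg \<open>u \<noteq> 0\<close> by (simp add: \<delta>_def)
   have "\<forall>\<^sub>F r in at_left s. r : {s - \<delta><..<s}"
    by (rule eventually_at_left_real) (use \<delta> in simp)
   with ev' have "\<forall>\<^sub>F r in at_left s. False"
   proof eventually_elim
    case (elim r)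
    have "(s - r) * (u \<bullet> u) < q (- k) s \<bullet> u"
     using elim \<open>u \<noteq> 0\<close> by (simp add: \<delta>_def field_simps)
    then have "(s - r) * ((s - r) * (u \<bullet> u)) < (s - r) * (q (- k) s \<bullet> u)" using elim by simp
    moreover have "0 < (s - r) * (q (- k) s \<bullet> u)" using elim neg by simp
    ultimately have "(norm (q (- k) r))\<^sup>2 < (norm (q (- k) s))\<^sup>2"
     unfolding nq[of "- k" r] power2_eq_square[of "s - r"] mult.assoc by linarith
    then have "norm (q (- k) r) < norm (q (- k) s)" by (rule power2_less_imp_less) simp
    then show False using elim k(2) by simp
   qed
   then show False by simp
  qed
  ultimately have "touches ep a z b (- k) s" using k by (simp add: touch)
  then show "\<exists>l\<in>lattice. touches ep a z b l s" using lattice_minus[OF k(1)] by blast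
 next
  assume "\<exists>l\<in>lattice. touches ep a z b l s"
  then obtain l where l: "l : lattice" "u \<noteq> 0" "norm (q l s) = ep" "q l s \<bullet> u <= 0"
   by (auto simp: touch)
  have ml: "- l : lattice" using l by (simp add: lattice_minus)
  have eq: "torus_dist (?x r) (?y r) = norm (q l r)" if "norm (q l r) <= 1 / 2" for r
   using torus_dist_eq_norm[OF ml, of "?x r" "?y r"] dist[of r "- l"] that by simp
  have "((%r. norm (q l r)) \<longlongrightarrow> norm (q l s)) (at_left s)"
   unfolding q_def by (intro tendsto_intros)
  then have "\<forall>\<^sub>F r in at_left s. norm (q l r) < 1 / 2"
   using l ep by (intro order_tendstoD) auto
  moreover have "\<forall>\<^sub>F r in at_left s. r : {a<..<s}" by (rule eventually_at_left_real) fact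
  ultimately have "\<forall>\<^sub>F r in at_left s. ep < torus_dist (?x r) (?y r)"
  proof eventually_elim
   case (elim r)
   have "0 < (s - r)\<^sup>2 * (u \<bullet> u)" using elim l by simp
   moreover have "(s - r) * (q l s \<bullet> u) <= 0" using elim l by (simp add: mult_nonneg_nonpos)
   ultimately have "(norm (q l s))\<^sup>2 < (norm (q l r))\<^sup>2" unfolding nq[of l r] by linarith
   then have "norm (q l s) < norm (q l r)" by (rule power2_less_imp_less) simp
   then show ?case using eq[of r] elim l by simp
  qed
  then show "free_contact ep a z b s"
   unfolding free_contact_def contact_def using eq[of s] l ep s by simp
 qed
qed

lemma touches_normal:
 assumes ep: "0 < ep" "ep < 1 / 2" and "l : lattice" "touches ep a z b l s"
 shows "torus_normal ep (fst z + (s - a) *. snd z) (fst b + (s - a) *. snd b) nu \<longleftrightarrow>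
  nu = (fst b - fst z - l + (s - a) *. (snd b - snd z)) /\<^sub>R ep"
proof -
 have eq: "fst b + (s - a) *. snd b - (fst z + (s - a) *. snd z) - l = fst b - fst z - l + (s - a) *. (snd b - snd z)"
  by (simp add: algebra_simps)
 have "norm (fst b - fst z - l + (s - a) *. (snd b - snd z)) = ep"
  using root_props(1)[of "snd b - snd z" ep "fst b - fst z - l"] assms by (simp add: touches_def Let_def)
 then show ?thesis using torus_normal_iff[OF ep assms(3)] eq by metis
qed

section \<open>Piecewise free motion\<close>

text \<open>\<open>C\<close> is the set of times at which the velocity may jump. Using the intervals
  \<open>{p<..q}\<close> means that a jump at \<open>p\<close> is already contained in
  \<open>v p\<close>, which is right continuity.\<close>

definition motion :: "real => real => real set => (real => real^3) => (real => real^3) => bool" where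
 "motion a t C x v \<longleftrightarrow> (\<forall>s\<in>{a..t}. x s = x a + integral {a..s} v) \<and>
  (\<forall>p q. a <= p & p <= q & q <= t --> C \<inter> {p<..q} = {} --> v q = v p)"

lemma motion_pos: "motion a t C x v ==> s : {a..t} ==> x s = x a + integral {a..s} v"
 unfolding motion_def by blast

lemma motion_vel: "motion a t C x v ==> a <= p ==> p <= q ==> q <= t ==> C \<inter> {p<..q} = {} ==> v q = v p"
 unfolding motion_def by blast

text \<open>A jump at \<open>r\<close> itself is permitted: the position at \<open>r\<close> still
  belongs to the free flight because one point does not change the integral, while the velocity is
  known only before \<open>r\<close>.\<close>

lemma motion_free:
 assumes m: "motion a t C x v" and r: "a <= r" "r <= t" and C: "C \<inter> {a<..<r} = {}"
 shows "s : {a..r} ==> x s = x a + (s - a) *. v a" and "s : {a..<r} ==> v s = v a"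
proof -
 show v: "v s = v a" if "s : {a..<r}" for s
 proof -
  have "C \<inter> {a<..s} = {}" using C that by auto
  then show ?thesis using motion_vel[OF m, of a s] that r by simp
 qed
 show "x s = x a + (s - a) *. v a" if s: "s : {a..r}"
 proof -
  have "((%_. v a) has_integral (s - a) *. v a) {a..s}"
   using has_integral_const_real[of "v a" a s] s by simp
  moreover have "v q = v a" if "q : {a..s} - {s}" for q using v[of q] that s by simp
  ultimately have "(v has_integral (s - a) *. v a) {a..s}"
   using has_integral_spike_finite[of "{s}" "{a..s}" v "%_. v a"] by blast
  then have "integral {a..s} v = (s - a) *. v a" by (rule integral_unique)
  then show ?thesis using motion_pos[OF m, of s] s r by simp
 qed
qed

lemma piecewise_constant_integrable:
 fixes v :: "real => real^3"
 assumes "finite (C \<inter> {a<..t})" and "!!p q. a <= p ==> p <= q ==> q <= t ==> C \<inter> {p<..q} = {} ==> v q = v p"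
 shows "v integrable_on {a..t}"
 using assms
proof (induction "card (C \<inter> {a<..t})" arbitrary: a rule: less_induct)
 case (less a)
 show ?case
 proof (cases "C \<inter> {a<..t} = {}")
  case True
  have "v s = v a" if "s : {a..t}" for s
   using less.prems(2)[of a s] True that by fastforce
  then show ?thesis using integrable_eq[OF integrable_const_ivl[of "v a" a t], of v] by metis
 next
  case False
  define r where "r = Min (C \<inter> {a<..t})"
  have r: "r : C" "a < r" "r <= t" using Min_in[OF less.prems(1) False] by (auto simp: r_def)
  have noC: "C \<inter> {a<..s} = {}" if "s < r" for s
   using Min_le[OF less.prems(1)] r that by (fastforce simp: r_def)
  have "v s = v a" if "s : {a..r} - {r}" for s
   using less.prems(2)[of a s] noC[of s] that r by auto
  then have "v integrable_on {a..r}"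
   using integrable_spike_finite[of "{r}" "{a..r}" v "%_. v a"] integrable_const_ivl[of "v a" a r] by blast
  moreover have "v integrable_on {r..t}"
  proof (rule less.hyps)
   have "C \<inter> {r<..t} \<subset> C \<inter> {a<..t}" using r by auto
   then show "card (C \<inter> {r<..t}) < card (C \<inter> {a<..t})" by (rule psubset_card_mono[OF less.prems(1)])
   show "finite (C \<inter> {r<..t})" by (rule finite_subset[OF _ less.prems(1)]) (use r in auto)
   show "v q = v p" if "r <= p" "p <= q" "q <= t" "C \<inter> {p<..q} = {}" for p q
    using less.prems(2)[of p q] that r by auto
  qed
  ultimately show ?thesis
   using r Henstock_Kurzweil_Integration.integrable_combine[where a = a and b = t and c = r and f = v] by simp
 qed
qed

text \<open>Finiteness of the jump set makes the velocity integrable, so that the integral can be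
  split at \<open>r\<close>.\<close>

lemma motion_restrict:
 assumes m: "motion a t C x v" and fin: "finite (C \<inter> {a<..t})" and r: "a <= r" "r <= t"
 shows "motion r t C x v"
 unfolding motion_def
proof (intro conjI ballI allI impI)
 fix s assume s: "s : {r..t}"
 have "v integrable_on {a..t}"
  by (rule piecewise_constant_integrable[OF fin]) (rule motion_vel[OF m])
 then have "v integrable_on {a..s}" by (rule integrable_on_subinterval) (use s in auto)
 then have "integral {a..r} v + integral {r..s} v = integral {a..s} v"
  using s r by (intro Henstock_Kurzweil_Integration.integral_combine) auto
 moreover have "x s = x a + integral {a..s} v" "x r = x a + integral {a..r} v"
  using motion_pos[OF m, of s] motion_pos[OF m, of r] s r by auto
 ultimately show "x s = x r + integral {r..s} v" by (simp add: add.assoc)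
next
 fix p q assume "r <= p & p <= q & q <= t" "C \<inter> {p<..q} = {}"
 then show "v q = v p" using motion_vel[OF m, of p q] r by simp
qed

text \<open>Puts a free flight on \<open>{a..<r}\<close> in front of a motion that starts at time
  \<open>r\<close>.\<close>

lemma motion_glue:
 assumes m: "motion r t C x v" and fin: "finite (C \<inter> {r<..t})" and r: "a <= r" "r <= t"
  and xr: "x r = x0 + (r - a) *. v0" and jump: "r : C' \<or> v r = v0"
  and C': "!!s. s : {r<..t} ==> s : C' \<longleftrightarrow> s : C"
  and x': "!!s. x' s = (if s < r then x0 + (s - a) *. v0 else x s)" "!!s. v' s = (if s < r then v0 else v s)"
  and ar: "a < r"
 shows "motion a t C' x' v'"
 unfolding motion_def
proof (intro conjI ballI allI impI)
 have const: "(v' has_integral (s - a) *. v0) {a..s}" if "s : {a..r}" for s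
 proof -
  have "((%_. v0) has_integral (s - a) *. v0) {a..s}"
   using has_integral_const_real[of v0 a s] that by simp
  then show ?thesis
   using has_integral_spike_finite[of "{s}" "{a..s}" v' "%_. v0"] x'(2) that by auto
 qed
 fix s assume s: "s : {a..t}"
 have x'a: "x' a = x0" using ar by (simp add: x')
 show "x' s = x' a + integral {a..s} v'"
 proof (cases "s < r")
  case True
  then show ?thesis using integral_unique[OF const[of s]] s x'a by (simp add: x')
 next
  case False
  have "v integrable_on {r..t}"
   by (rule piecewise_constant_integrable[OF fin]) (rule motion_vel[OF m])
  then have "v integrable_on {r..s}" by (rule integrable_on_subinterval) (use s in auto)
  then have "(v has_integral integral {r..s} v) {r..s}" by (rule integrable_integral)
  then have "(v' has_integral integral {r..s} v) {r..s}"
   by (rule has_integral_eq[rotated]) (use x' in auto)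
  with const[of r] have "(v' has_integral (r - a) *. v0 + integral {r..s} v) {a..s}"
   using False r by (intro has_integral_combine[of a r s]) auto
  then have "integral {a..s} v' = (r - a) *. v0 + integral {r..s} v" by (rule integral_unique)
  moreover have "x s = x r + integral {r..s} v" using motion_pos[OF m, of s] s False by simp
  moreover have "x' s = x s" using False by (simp add: x')
  ultimately show ?thesis using x'a xr by simp
 qed
next
 fix p q assume pq: "a <= p & p <= q & q <= t" and C'pq: "C' \<inter> {p<..q} = {}"
 have vC: "v q = v p'" if "r <= p'" "p <= p'" "p' <= q" for p'
 proof -
  have "C \<inter> {p'<..q} = {}"
  proof (rule equals0I)
   fix s assume s: "s : C \<inter> {p'<..q}"
   then have "s : C'" using C'[of s] that pq by auto
   then show False using s that C'pq by auto
  qed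
  then show ?thesis using motion_vel[OF m, of p' q] that pq by simp
 qed
 show "v' q = v' p"
 proof (cases "q < r")
  case False
  show ?thesis
  proof (cases "p < r")
   case True
   then have "r \<notin> C'" using C'pq False by auto
   then show ?thesis using vC[of r] jump True False by (simp add: x')
  qed (use vC[of p] False pq in \<open>simp add: x'\<close>)
 qed (use pq in \<open>simp add: x'\<close>)
qed

section \<open>Collision histories of the particle system\<close>

text \<open>
 A labelled history records the colliding background particle along with each collision.  The
 state after a collision is stored at the time of the collision.
\<close>

definition after_tagged :: "real => phase => phase => real^3 => real => phase" where
 "after_tagged a z b nu r =
  (fst z + (r - a) *. snd z, snd z - (nu \<bullet> (snd z - snd b)) *. nu)"

definition after_background :: "nat => nat => real => phase => (nat => phase) => real^3 => real => nat => phase" where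
 "after_background N j a z b nu r = (\<lambda>i\<in>{..<N}. (fst (b i) + (r - a) *. snd (b i),
  if i = j then snd (b j) + (nu \<bullet> (snd z - snd (b j))) *. nu else snd (b i)))"

text \<open>In the second rule \<open>(j, r)\<close> must be the only contact on
  \<open>{a<..r}\<close>, so it is the first one and not simultaneous with another. The interval is
  open at \<open>a\<close>, so the pair that has just collided there is not counted again.
  Exceptional initial data admit no derivation at all.\<close>

inductive lhist :: "nat => real => real => real => phase => (nat => phase) => (nat \<times> collision) list => bool"
 for N ep t where
 nil: "(!!j s. j < N ==> s : {a<..t} ==> \<not> free_contact ep a z (b j) s) ==> lhist N ep t a z b []"
| step: "j < N ==> a < r ==> r <= t ==> free_contact ep a z (b j) r ==>
  (!!i s. i < N ==> s : {a<..r} ==> free_contact ep a z (b i) s ==> i = j & s = r) ==>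
  torus_normal ep (fst z + (r - a) *. snd z) (fst (b j) + (r - a) *. snd (b j)) nu ==>
  lhist N ep t r (after_tagged a z (b j) nu r) (after_background N j a z b nu r) L ==>
  lhist N ep t a z b ((j, r, nu, snd (b j)) # L)"

lemma lhist_unique:
 assumes ep: "0 < ep" "ep < 1 / 2"
 shows "lhist N ep t a z b L ==> lhist N ep t a z b L' ==> L' = L"
proof (induction arbitrary: L' rule: lhist.induct)
 case (nil a z b)
 from nil(2) show ?case
 proof cases
  case (step j r nu L)
  then show ?thesis using nil(1)[of j r] by auto
 qed auto
next
 case (step j a r z b nu L)
 from step.prems show ?case
 proof cases
  case nil
  then show ?thesis using step.hyps(1-4) by auto
 next
  case (step j' r' nu' L'')
  have "j' = j & r' = r"
  proof (cases "r' <= r")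
   case True
   then show ?thesis using \<open>!!i s. i < N ==> s : {a<..r} ==> free_contact ep a z (b i) s ==> i = j & s = r\<close>[of j' r'] step by auto
  next
   case False
   then show ?thesis using step(6)[of j r] \<open>j < N\<close> \<open>a < r\<close> \<open>free_contact ep a z (b j) r\<close> by auto
  qed
  then have jr: "j' = j" "r' = r" by auto
  have "nu' = nu"
   using torus_normal_unique[OF ep _ \<open>torus_normal ep (fst z + (r - a) *. snd z) (fst (b j) + (r - a) *. snd (b j)) nu\<close>] step jr by auto
  then show ?thesis using \<open>!!L'. _ L' ==> L' = L\<close>[of L''] step jr by auto
 qed
qed

lemma lhist_times:
 "lhist N ep t a z b L ==> sorted_wrt (<) (map (fst \<circ> snd) L) & (\<forall>c\<in>set L. a < fst (snd c) & fst (snd c) <= t & norm (fst (snd (snd c))) = 1)"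
 by (induction rule: lhist.induct) (force simp: torus_normal_def)+

section \<open>Equivalence of trajectories and labelled histories\<close>

definition contact_times :: "real => (real => real^3) => (nat => real => real^3) => nat => real set" where
 "contact_times ep x y j = {s. contact ep x (y j) s}"

definition collision_rule where
 "collision_rule ep x v y w s \<longleftrightarrow>
  (\<exists>nu v' w'. torus_normal ep (x s) (y s) nu & (v \<longlongrightarrow> v') (at_left s) & (w \<longlongrightarrow> w') (at_left s) \<and>
    v s = v' - (nu \<bullet> (v' - w')) *. nu & w s = w' + (nu \<bullet> (v' - w')) *. (nu :: real^3))"

text \<open>The dynamics with an arbitrary starting time \<open>a\<close>. This generality permits
  induction over collisions, each of which restarts the dynamics.\<close>

definition evolution where
 "evolution N ep t a z b x v y w \<longleftrightarrow>
  (x a, v a) = z & (\<forall>j<N. (y j a, w j a) = b j) \<and>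
  finite ((\<Union>j<N. contact_times ep x y j) \<inter> {a<..t}) \<and>
  (\<forall>s\<in>{a<..t}. \<forall>i<N. \<forall>j<N. s : contact_times ep x y i & s : contact_times ep x y j --> i = j) \<and>
  motion a t (\<Union>j<N. contact_times ep x y j) x v \<and>
  (\<forall>j<N. motion a t (contact_times ep x y j) (y j) (w j)) \<and>
  (\<forall>s\<in>{a<..t}. \<forall>j<N. s : contact_times ep x y j --> collision_rule ep x v (y j) (w j) s)"

lemma rayleigh_evolution_iff:
 "rayleigh_evolution N ep t om x v y w \<longleftrightarrow> evolution N ep t 0 (fst om) (snd om) x v y w"
proof -
 have fin: "{s : {0<..t}. \<exists>j<N. contact ep x (y j) s} = (\<Union>j<N. contact_times ep x y j) \<inter> {0<..t}"
  by (auto simp: contact_times_def)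
 have mot: "(\<forall>s\<in>{0..t}. x s = x 0 + integral {0..s} v & (\<forall>j<N. y j s = y j 0 + integral {0..s} (w j))) \<and>
  (\<forall>a b. 0 <= a & a <= b & b <= t \<longrightarrow>
    ((\<forall>j<N. \<forall>s\<in>{a<..b}. \<not> contact ep x (y j) s) --> v b = v a) \<and>
    (\<forall>j<N. (\<forall>s\<in>{a<..b}. \<not> contact ep x (y j) s) --> w j b = w j a)) \<longleftrightarrow>
  motion 0 t (\<Union>j<N. contact_times ep x y j) x v & (\<forall>j<N. motion 0 t (contact_times ep x y j) (y j) (w j))"
 proof -
  have "(\<forall>j<N. \<forall>s\<in>{a<..b}. \<not> contact ep x (y j) s) \<longleftrightarrow> (\<Union>j<N. contact_times ep x y j) \<inter> {a<..b} = {}"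
   "(\<forall>s\<in>{a<..b}. \<not> contact ep x (y j) s) \<longleftrightarrow> contact_times ep x y j \<inter> {a<..b} = {}" for a b j
   by (auto simp: contact_times_def)
  then show ?thesis unfolding motion_def by (simp only:) blast
 qed
 have mot': "(\<forall>s\<in>{0..t}. x s = x 0 + integral {0..s} v & (\<forall>j<N. y j s = y j 0 + integral {0..s} (w j))) \<and>
  (\<forall>a b. 0 <= a & a <= b & b <= t \<longrightarrow>
    ((\<forall>j<N. \<forall>s\<in>{a<..b}. \<not> contact ep x (y j) s) --> v b = v a) \<and>
    (\<forall>j<N. (\<forall>s\<in>{a<..b}. \<not> contact ep x (y j) s) --> w j b = w j a)) & R \<longleftrightarrow>
  motion 0 t (\<Union>j<N. contact_times ep x y j) x v & (\<forall>j<N. motion 0 t (contact_times ep x y j) (y j) (w j)) & R" for R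
  using mot by blast
 have mem: "s : contact_times ep x y j \<longleftrightarrow> contact ep x (y j) s" for s j by (simp add: contact_times_def)
 show ?thesis
  unfolding rayleigh_evolution_def evolution_def fin collision_rule_def mot' mem ..
qed

definition lhist_of where
 "lhist_of N ep t a x y w L \<longleftrightarrow> sorted_wrt (<) (map (fst \<circ> snd) L) \<and>
  set L = {(j, s, nu, w'). s : {a<..t} & j < N & contact ep x (y j) s & torus_normal ep (x s) (y j s) nu \<and>
    (w j \<longlongrightarrow> w') (at_left s)}"

lemma left_limit_const:
 fixes v :: "real => real^3"
 assumes "a < r" "!!s. s : {a<..<r} ==> v s = c"
 shows "(v \<longlongrightarrow> l) (at_left r) \<longleftrightarrow> l = c"
proof -
 have "\<forall>\<^sub>F s in at_left r. s : {a<..<r}" using assms(1) by (rule eventually_at_left_real)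
 then have "\<forall>\<^sub>F s in at_left r. v s = c" by (rule eventually_mono) (rule assms(2))
 then have lim: "(v \<longlongrightarrow> c) (at_left r)" by (rule tendsto_eventually)
 show ?thesis using tendsto_unique[OF trivial_limit_at_left_real _ lim] lim by blast
qed

lemma left_limit_cong:
 fixes v :: "real => real^3"
 assumes "r < s" "!!q. r <= q ==> v q = v' q"
 shows "(v \<longlongrightarrow> l) (at_left s) \<longleftrightarrow> (v' \<longlongrightarrow> l) (at_left s)"
proof (rule tendsto_cong)
 have "\<forall>\<^sub>F q in at_left s. q : {r<..<s}" using assms(1) by (rule eventually_at_left_real)
 then show "\<forall>\<^sub>F q in at_left s. v q = v' q" by (rule eventually_mono) (use assms(2) in simp)
qed

lemma free_motion: "motion a t C (%s. x0 + (s - a) *. v0) (%_. v0)"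
 unfolding motion_def
proof (intro conjI ballI)
 fix s assume "s : {a..t}"
 then have "a <= s" by simp
 have "((%_. v0) has_integral (s - a) *. v0) {a..s}"
  using has_integral_const_real[of v0 a s] \<open>a <= s\<close> by simp
 then have "integral {a..s} (%_. v0) = (s - a) *. v0" by (rule integral_unique)
 then show "x0 + (s - a) *. v0 = x0 + (a - a) *. v0 + integral {a..s} (%_. v0)" unfolding \<open>integral {a..s} _ = _\<close> by simp
qed simp

lemma evolution_free:
 assumes ev: "evolution N ep t a z b x v y w" and r: "a <= r" "r <= t"
  and noK: "(\<Union>j<N. contact_times ep x y j) \<inter> {a<..<r} = {}"
 shows "s : {a..r} ==> x s = fst z + (s - a) *. snd z"
  and "s : {a..<r} ==> v s = snd z"
  and "j < N ==> s : {a..r} ==> y j s = fst (b j) + (s - a) *. snd (b j)"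
  and "j < N ==> s : {a..<r} ==> w j s = snd (b j)"
  and "j < N ==> s : {a<..r} ==> contact ep x (y j) s \<longleftrightarrow> free_contact ep a z (b j) s"
proof -
 have m: "motion a t (\<Union>j<N. contact_times ep x y j) x v" and z: "x a = fst z" "v a = snd z"
  using ev unfolding evolution_def by auto
 have mj: "motion a t (contact_times ep x y j) (y j) (w j)" and bj: "y j a = fst (b j)" "w j a = snd (b j)"
  if "j < N" for j
  using ev that unfolding evolution_def by (metis, metis fst_conv, metis snd_conv)
 have noC: "contact_times ep x y j \<inter> {a<..<r} = {}" if "j < N" for j
  using noK that by blast
 show x: "x s = fst z + (s - a) *. snd z" if "s : {a..r}" for s
  using motion_free(1)[OF m r noK that] z by simp
 show "v s = snd z" if "s : {a..<r}"
  using motion_free(2)[OF m r noK that] z by simp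
 show y: "y j s = fst (b j) + (s - a) *. snd (b j)" if "j < N" "s : {a..r}" for j s
  using motion_free(1)[OF mj[OF that(1)] r noC[OF that(1)] that(2)] bj[OF that(1)] by simp
 show "w j s = snd (b j)" if "j < N" "s : {a..<r}"
  using motion_free(2)[OF mj[OF that(1)] r noC[OF that(1)] that(2)] bj[OF that(1)] by simp
 show "contact ep x (y j) s \<longleftrightarrow> free_contact ep a z (b j) s" if j: "j < N" and s: "s : {a<..r}"
  unfolding free_contact_def
 proof (rule contact_cong)
  show "a < s" using s by simp
  fix q assume "q : {a<..s}"
  then have q: "q : {a..r}" using s by simp
  show "x q = fst z + (q - a) *. snd z" by (rule x[OF q])
  show "y j q = fst (b j) + (q - a) *. snd (b j)" by (rule y[OF j q])
 qed
qed

text \<open>Induction on the number of remaining contact times: up to the first of them all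
  particles fly freely, and the collision rule determines the states from which the rest of the
  evolution starts.\<close>

lemma evolution_imp_lhist:
 assumes ep: "0 < ep" "ep < 1 / 2"
 shows "a <= t ==> evolution N ep t a z b x v y w ==>
  \<exists>L. lhist N ep t a z b L & lhist_of N ep t a x y w L"
proof (induction "card ((\<Union>j<N. contact_times ep x y j) \<inter> {a<..t})" arbitrary: a z b rule: less_induct)
 case (less a z b)
 define K where "K = (\<Union>j<N. contact_times ep x y j)"
 note ev = less.prems(2)
 have fin: "finite (K \<inter> {a<..t})" using ev unfolding evolution_def K_def by blast
 show ?case
 proof (cases "K \<inter> {a<..t} = {}")
  case True
  have noK: "(\<Union>j<N. contact_times ep x y j) \<inter> {a<..<t} = {}" using True unfolding K_def by auto
  have none: "\<not> contact ep x (y j) s" if "j < N" "s : {a<..t}" for j s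
   using True that unfolding K_def contact_times_def by auto
  have "lhist N ep t a z b []"
   using none evolution_free(5)[OF ev less.prems(1) order_refl noK] by (intro lhist.nil) blast
  moreover have "lhist_of N ep t a x y w []"
   unfolding lhist_of_def using none by auto
  ultimately show ?thesis by blast
 next
  case False
  define r where "r = Min (K \<inter> {a<..t})"
  have r: "r : K" "a < r" "r <= t" using Min_in[OF fin False] by (auto simp: r_def)
  have noK: "K \<inter> {a<..<r} = {}"
   using Min_le[OF fin] r by (fastforce simp: r_def)
  from r obtain j where j: "j < N" "contact ep x (y j) r" by (auto simp: K_def contact_times_def)
  note free = evolution_free[OF ev less_imp_le[OF r(2)] r(3) noK[unfolded K_def]]
  have uni: "i = j" if "i < N" "contact ep x (y i) r" for i
  proof -
   have "r : {a<..t}" "r : contact_times ep x y i" "r : contact_times ep x y j"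
    using r that j by (auto simp: contact_times_def)
   then show ?thesis using ev that(1) j(1) unfolding evolution_def by blast
  qed
  have contact_r: "contact ep x (y i) s \<longleftrightarrow> i = j & s = r" if "i < N" "s : {a<..r}" for i s
  proof
   assume c: "contact ep x (y i) s"
   then have "s : K" using that by (auto simp: K_def contact_times_def)
   then have "s = r" using noK that by fastforce
   then show "i = j & s = r" using uni c that by auto
  qed (use j in auto)
  have "r : {a<..t}" "r : contact_times ep x y j" using r j by (auto simp: contact_times_def)
  then have "collision_rule ep x v (y j) (w j) r" using ev j(1) unfolding evolution_def by blast
  then obtain nu v' w' where nu: "torus_normal ep (x r) (y j r) nu"
   and lim: "(v \<longlongrightarrow> v') (at_left r)" "(w j \<longlongrightarrow> w') (at_left r)"
   and vr: "v r = v' - (nu \<bullet> (v' - w')) *. nu" and wr: "w j r = w' + (nu \<bullet> (v' - w')) *. nu"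
   unfolding collision_rule_def by blast
  have limv: "(v \<longlongrightarrow> l) (at_left r) \<longleftrightarrow> l = snd z" for l
   by (rule left_limit_const[OF r(2)]) (rule free(2), simp)
  have limw: "(w j \<longlongrightarrow> l) (at_left r) \<longleftrightarrow> l = snd (b j)" for l
   by (rule left_limit_const[OF r(2)]) (rule free(4)[OF j(1)], simp)
  have v'w': "v' = snd z" "w' = snd (b j)" using lim limv limw by auto
  define z' where "z' = after_tagged a z (b j) nu r"
  define b' where "b' = after_background N j a z b nu r"
  have sub: "K \<inter> {r<..t} \<subseteq> K \<inter> {a<..t}" using r by auto
  have ev': "evolution N ep t r z' b' x v y w"
   unfolding evolution_def K_def[symmetric]
  proof (intro conjI allI impI ballI)
   show "(x r, v r) = z'"
    using free(1)[of r] r vr v'w' by (simp add: z'_def after_tagged_def)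
   show "finite (K \<inter> {r<..t})" by (rule finite_subset[OF sub fin])
   show "motion r t K x v"
    by (rule motion_restrict[OF _ fin]) (use ev r in \<open>auto simp: evolution_def K_def\<close>)
   fix i assume i: "i < N"
   have Ci: "contact_times ep x y i \<subseteq> K" using i by (auto simp: K_def)
   have mi: "motion a t (contact_times ep x y i) (y i) (w i)" and bi: "(y i a, w i a) = b i"
    using ev i unfolding evolution_def by blast+
   show "motion r t (contact_times ep x y i) (y i) (w i)"
    by (rule motion_restrict[OF mi]) (use r finite_subset[OF _ fin, of "contact_times ep x y i \<inter> {a<..t}"] Ci in auto)
   show "(y i r, w i r) = b' i"
   proof (cases "i = j")
    case True
    then show ?thesis using free(3)[OF i, of r] r wr v'w' i by (simp add: b'_def after_background_def)
   next
    case False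
    have "contact_times ep x y i \<inter> {a<..r} = {}"
     using contact_r[OF i] False by (auto simp: contact_times_def)
    then have "w i r = w i a" using motion_vel[OF mi, of a r] r by simp
    then have "w i r = snd (b i)" using bi by (metis snd_conv)
    then show ?thesis using free(3)[OF i, of r] r i False by (simp add: b'_def after_background_def)
   qed
  next
   fix s i k assume "s : {r<..t}" "i < N" "k < N" "s : contact_times ep x y i & s : contact_times ep x y k"
   moreover from this have "s : {a<..t}" using r by simp
   ultimately show "i = k" using ev unfolding evolution_def by blast
  next
   fix s i assume "s : {r<..t}" "i < N" "s : contact_times ep x y i"
   moreover from this have "s : {a<..t}" using r by simp
   ultimately show "collision_rule ep x v (y i) (w i) s" using ev unfolding evolution_def by blast
  qed
  have "K \<inter> {r<..t} \<subset> K \<inter> {a<..t}" using r by auto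
  then have "card (K \<inter> {r<..t}) < card (K \<inter> {a<..t})" by (rule psubset_card_mono[OF fin])
  from less.hyps[OF this[unfolded K_def] r(3) ev'] obtain L
   where L: "lhist N ep t r z' b' L" and Lof: "lhist_of N ep t r x y w L" by blast
  have "lhist N ep t a z b ((j, r, nu, snd (b j)) # L)"
  proof (rule lhist.step[OF j(1) r(2,3)])
   show "free_contact ep a z (b j) r" using free(5)[OF j(1), of r] r j by simp
   show "i = j & s = r" if "i < N" "s : {a<..r}" "free_contact ep a z (b i) s" for i s
    using contact_r[OF that(1,2)] free(5)[OF that(1,2)] that(3) by blast
   show "torus_normal ep (fst z + (r - a) *. snd z) (fst (b j) + (r - a) *. snd (b j)) nu"
    using nu free(1)[of r] free(3)[OF j(1), of r] r by simp
   show "lhist N ep t r (after_tagged a z (b j) nu r) (after_background N j a z b nu r) L"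
    using L by (simp add: z'_def b'_def)
  qed
  moreover have "lhist_of N ep t a x y w ((j, r, nu, snd (b j)) # L)"
   unfolding lhist_of_def
  proof
   have setL: "set L = {(j, s, nu, w'). s : {r<..t} & j < N & contact ep x (y j) s & torus_normal ep (x s) (y j s) nu \<and>
    (w j \<longlongrightarrow> w') (at_left s)}" and sortL: "sorted_wrt (<) (map (fst \<circ> snd) L)"
    using conjunct2[OF Lof[unfolded lhist_of_def]] conjunct1[OF Lof[unfolded lhist_of_def]] by this
   have tail: "\<forall>c\<in>set L. r < fst (snd c)" unfolding setL by auto
   show "sorted_wrt (<) (map (fst \<circ> snd) ((j, r, nu, snd (b j)) # L))"
    using sortL tail by simp
   have iff: "i < N & s : {a<..t} & contact ep x (y i) s & torus_normal ep (x s) (y i s) \<mu> & (w i \<longlongrightarrow> l) (at_left s) \<longleftrightarrow>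
     (i, s, \<mu>, l) = (j, r, nu, snd (b j)) \<or>
     i < N & s : {r<..t} & contact ep x (y i) s & torus_normal ep (x s) (y i s) \<mu> & (w i \<longlongrightarrow> l) (at_left s)" for i s \<mu> l
   proof (cases "s : {a<..r}")
    case True
    have \<mu>: "torus_normal ep (x r) (y j r) \<mu> \<longleftrightarrow> \<mu> = nu" using torus_normal_unique[OF ep nu] nu by blast
    show ?thesis
    proof (cases "i = j & s = r")
     case T: True
     then show ?thesis using j r(2,3) by (simp add: \<mu> limw)
    next
     case F: False
     then show ?thesis using contact_r[OF _ True, of i] True by auto
    qed
   next
    case False
    then show ?thesis using r by auto
   qed
   show "set ((j, r, nu, snd (b j)) # L) = {(j, s, nu, w'). s : {a<..t} & j < N & contact ep x (y j) s & torus_normal ep (x s) (y j s) nu \<and>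
    (w j \<longlongrightarrow> w') (at_left s)}"
   proof (rule set_eqI)
    fix c :: "nat \<times> collision"
    obtain i s \<mu> l where c: "c = (i, s, \<mu>, l)" by (metis prod.exhaust)
    show "c : set ((j, r, nu, snd (b j)) # L) \<longleftrightarrow> c : {(j, s, nu, w'). s : {a<..t} & j < N & contact ep x (y j) s & torus_normal ep (x s) (y j s) nu \<and>
    (w j \<longlongrightarrow> w') (at_left s)}"
     unfolding c list.set insert_iff setL mem_Collect_eq case_prod_conv using iff[of i s \<mu> l] by blast
   qed
  qed
  ultimately show ?thesis by blast
 qed
qed

text \<open>The free flight before the first collision is glued to the trajectories of the remaining
  history. Contacts after the gluing time are unaffected, since a contact depends only on times
  shortly before it.\<close>

lemma lhist_imp_evolution:
 assumes ep: "0 < ep" "ep < 1 / 2"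
 shows "lhist N ep t a z b L ==> a <= t ==>
  \<exists>x v y w. evolution N ep t a z b x v y w & lhist_of N ep t a x y w L"
proof (induction rule: lhist.induct)
 case (nil a z b)
 let ?x = "%s. fst z + (s - a) *. snd z" and ?v = "%_. snd z"
 let ?y = "%j s. fst (b j) + (s - a) *. snd (b j)" and ?w = "%j _. snd (b j)"
 have none: "\<not> contact ep ?x (?y j) s" if "j < N" "s : {a<..t}" for j s
  using nil(1)[OF that] by (simp add: free_contact_def)
 then have K: "(\<Union>j<N. contact_times ep ?x ?y j) \<inter> {a<..t} = {}"
  unfolding contact_times_def by blast
 have "evolution N ep t a z b ?x ?v ?y ?w"
  unfolding evolution_def K
 proof (intro conjI allI impI ballI free_motion)
  fix s i k assume "s : {a<..t}" "i < N" "s : contact_times ep ?x ?y i & s : contact_times ep ?x ?y k"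
  then show "i = k" using K by blast
 next
  fix s i assume "s : {a<..t}" "i < N" "s : contact_times ep ?x ?y i"
  then have False using K by blast
  then show "collision_rule ep ?x ?v (?y i) (?w i) s" ..
 qed auto
 moreover have "lhist_of N ep t a ?x ?y ?w []"
  unfolding lhist_of_def using none by auto
 ultimately show ?case by blast
next
 case (step j a r z b nu L)
 from step.IH[OF step.hyps(3)] obtain x v y w
  where ev: "evolution N ep t r (after_tagged a z (b j) nu r) (after_background N j a z b nu r) x v y w"
   and Lof: "lhist_of N ep t r x y w L" by blast
 note j = step.hyps(1) and r = step.hyps(2,3) and only = step.hyps(5) and nu = step.hyps(6)
 define x' where "x' s = (if s < r then fst z + (s - a) *. snd z else x s)" for s
 define v' where "v' s = (if s < r then snd z else v s)" for s
 define y' where "y' i s = (if s < r then fst (b i) + (s - a) *. snd (b i) else y i s)" for i s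
 define w' where "w' i s = (if s < r then snd (b i) else w i s)" for i s
 have xr: "x r = fst z + (r - a) *. snd z" and vr: "v r = snd z - (nu \<bullet> (snd z - snd (b j))) *. nu"
  using ev unfolding evolution_def after_tagged_def by auto
 have yr: "y i r = fst (b i) + (r - a) *. snd (b i)"
  and wr: "w i r = (if i = j then snd (b j) + (nu \<bullet> (snd z - snd (b j))) *. nu else snd (b i))" if "i < N" for i
 proof -
  have "(y i r, w i r) = after_background N j a z b nu r i" using ev that unfolding evolution_def by blast
  then show "y i r = fst (b i) + (r - a) *. snd (b i)"
   "w i r = (if i = j then snd (b j) + (nu \<bullet> (snd z - snd (b j))) *. nu else snd (b i))"
   using that by (simp_all add: after_background_def)
 qed
 have C1: "contact ep x' (y' i) s \<longleftrightarrow> contact ep x (y i) s" if "r < s" for i s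
  by (rule contact_cong[OF that]) (auto simp: x'_def y'_def)
 have C2: "contact ep x' (y' i) s \<longleftrightarrow> free_contact ep a z (b i) s" if i: "i < N" and s: "s : {a<..r}" for i s
  unfolding free_contact_def
 proof (rule contact_cong[of a])
  show "a < s" using s by simp
  fix q assume "q : {a<..s}"
  then have "q < r \<or> q = r" using s by auto
  then show "x' q = fst z + (q - a) *. snd z" "y' i q = fst (b i) + (q - a) *. snd (b i)"
   using xr yr[OF i] by (auto simp: x'_def y'_def)
 qed
 have C3: "contact ep x' (y' i) s \<longleftrightarrow> i = j & s = r" if i: "i < N" and s: "s : {a<..r}" for i s
  using C2[OF i s] only[OF i s] step.hyps(4) by blast
 define K where "K = (\<Union>j<N. contact_times ep x y j)"
 define K' where "K' = (\<Union>j<N. contact_times ep x' y' j)"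
 have K'1: "s : K' \<longleftrightarrow> s : K" if "r < s" for s
  using C1[OF that] by (simp add: K_def K'_def contact_times_def)
 have K'2: "s : K' \<longleftrightarrow> s = r" if "s : {a<..r}" for s
  using C3[OF _ that] j by (auto simp: K'_def contact_times_def)
 have finK: "finite (K \<inter> {r<..t})" using ev unfolding evolution_def K_def by blast
 have K': "K' \<inter> {a<..t} \<subseteq> insert r (K \<inter> {r<..t})"
 proof
  fix s assume s: "s : K' \<inter> {a<..t}"
  then show "s : insert r (K \<inter> {r<..t})" using K'1[of s] K'2[of s] by (cases "r < s") auto
 qed
 have lim_r: "(v' \<longlongrightarrow> l) (at_left r) \<longleftrightarrow> l = snd z" "(w' i \<longlongrightarrow> l) (at_left r) \<longleftrightarrow> l = snd (b i)" for i l
  by (rule left_limit_const[OF r(1)], simp add: v'_def w'_def)+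
 have lim_s: "(v' \<longlongrightarrow> l) (at_left s) \<longleftrightarrow> (v \<longlongrightarrow> l) (at_left s)"
  "(w' i \<longlongrightarrow> l) (at_left s) \<longleftrightarrow> (w i \<longlongrightarrow> l) (at_left s)" if "r < s" for i l s
  by (rule left_limit_cong[OF that], simp add: v'_def w'_def)+
 have "evolution N ep t a z b x' v' y' w'"
  unfolding evolution_def K'_def[symmetric]
 proof (intro conjI allI impI ballI)
  show "(x' a, v' a) = z" using r by (simp add: x'_def v'_def)
  show "finite (K' \<inter> {a<..t})" using K' finK by (rule finite_subset[rotated, OF finite.insertI, rotated])
  have "motion r t K x v" using ev unfolding evolution_def K_def by blast
  then show "motion a t K' x' v'"
   by (rule motion_glue[where r = r and ?x0.0 = "fst z" and ?v0.0 = "snd z" and x = x and v = v])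
    (use finK r xr K'1 K'2[of r] in \<open>auto simp: x'_def v'_def\<close>)
  fix i assume i: "i < N"
  show "(y' i a, w' i a) = b i" using r by (simp add: y'_def w'_def)
  have "motion r t (contact_times ep x y i) (y i) (w i)" using ev i unfolding evolution_def by blast
  then show "motion a t (contact_times ep x' y' i) (y' i) (w' i)"
  proof (rule motion_glue[where r = r and ?x0.0 = "fst (b i)" and ?v0.0 = "snd (b i)"])
   show "finite (contact_times ep x y i \<inter> {r<..t})"
    by (rule finite_subset[OF _ finK]) (use i in \<open>auto simp: K_def\<close>)
   show "r : contact_times ep x' y' i \<or> w i r = snd (b i)"
    using C3[OF i, of r] wr[OF i] r by (auto simp: contact_times_def)
   show "s : contact_times ep x' y' i \<longleftrightarrow> s : contact_times ep x y i" if "s : {r<..t}" for s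
    using C1[of s i] that by (simp add: contact_times_def)
  qed (use r yr[OF i] in \<open>auto simp: y'_def w'_def\<close>)
 next
  fix s i k assume s: "s : {a<..t}" and ik: "i < N" "k < N"
   and c: "s : contact_times ep x' y' i & s : contact_times ep x' y' k"
  show "i = k"
  proof (cases "r < s")
   case True
   then have "s : contact_times ep x y i & s : contact_times ep x y k" "s : {r<..t}"
    using c C1[OF True] s by (auto simp: contact_times_def)
   then show ?thesis using ev ik unfolding evolution_def by blast
  next
   case False
   then show ?thesis using c s C3[OF ik(1), of s] C3[OF ik(2), of s] by (auto simp: contact_times_def)
  qed
 next
  fix s i assume s: "s : {a<..t}" and i: "i < N" and c: "s : contact_times ep x' y' i"
  show "collision_rule ep x' v' (y' i) (w' i) s"
  proof (cases "r < s")
   case True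
   then have "s : contact_times ep x y i" "s : {r<..t}"
    using c C1[OF True] s by (auto simp: contact_times_def)
   then have "collision_rule ep x v (y i) (w i) s" using ev i unfolding evolution_def by blast
   then show ?thesis using True
    unfolding collision_rule_def lim_s[OF True] by (simp add: x'_def v'_def y'_def w'_def)
  next
   case False
   then have eq: "i = j" "s = r" using c s C3[OF i, of s] by (auto simp: contact_times_def)
   show ?thesis
    unfolding collision_rule_def eq lim_r
    using nu xr yr[OF j] vr wr[OF j]
    by (intro exI[of _ nu] exI[of _ "snd z"] exI[of _ "snd (b j)"]) (simp add: x'_def v'_def y'_def w'_def)
  qed
 qed
 moreover have "lhist_of N ep t a x' y' w' ((j, r, nu, snd (b j)) # L)"
  unfolding lhist_of_def
 proof
  have setL: "set L = {(j, s, nu, w'). s : {r<..t} & j < N & contact ep x (y j) s & torus_normal ep (x s) (y j s) nu \<and>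
   (w j \<longlongrightarrow> w') (at_left s)}" and sortL: "sorted_wrt (<) (map (fst \<circ> snd) L)"
    using conjunct2[OF Lof[unfolded lhist_of_def]] conjunct1[OF Lof[unfolded lhist_of_def]] by this
  have tail: "\<forall>c\<in>set L. r < fst (snd c)" unfolding setL by auto
   show "sorted_wrt (<) (map (fst \<circ> snd) ((j, r, nu, snd (b j)) # L))"
   using sortL tail by simp
  have nu': "torus_normal ep (x' r) (y' j r) nu" using nu xr yr[OF j] by (simp add: x'_def y'_def)
  have iff: "i < N & s : {a<..t} & contact ep x' (y' i) s & torus_normal ep (x' s) (y' i s) \<mu> & (w' i \<longlongrightarrow> l) (at_left s) \<longleftrightarrow>
    (i, s, \<mu>, l) = (j, r, nu, snd (b j)) \<or>
    i < N & s : {r<..t} & contact ep x (y i) s & torus_normal ep (x s) (y i s) \<mu> & (w i \<longlongrightarrow> l) (at_left s)" for i s \<mu> l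
  proof (cases "s : {a<..r}")
   case True
   have \<mu>: "torus_normal ep (x' r) (y' j r) \<mu> \<longleftrightarrow> \<mu> = nu" using torus_normal_unique[OF ep nu'] nu' by blast
   show ?thesis
   proof (cases "i = j & s = r")
    case T: True
    then show ?thesis using j r C3[OF j, of r] by (simp add: \<mu> lim_r)
   next
    case F: False
    then show ?thesis using C3[OF _ True, of i] True by auto
   qed
  next
   case False
   show ?thesis
   proof (cases "r < s")
    case True
    then show ?thesis using r C1[OF True] lim_s(2)[OF True] by (simp add: x'_def y'_def)
   qed (use False r in auto)
  qed
  show "set ((j, r, nu, snd (b j)) # L) = {(j, s, nu, l). s : {a<..t} & j < N & contact ep x' (y' j) s & torus_normal ep (x' s) (y' j s) nu \<and>
   (w' j \<longlongrightarrow> l) (at_left s)}"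
  proof (rule set_eqI)
   fix c :: "nat \<times> collision"
   obtain i s \<mu> l where c: "c = (i, s, \<mu>, l)" by (metis prod.exhaust)
   show "c : set ((j, r, nu, snd (b j)) # L) \<longleftrightarrow> c : {(j, s, nu, l). s : {a<..t} & j < N & contact ep x' (y' j) s & torus_normal ep (x' s) (y' j s) nu \<and>
   (w' j \<longlongrightarrow> l) (at_left s)}"
    unfolding c list.set insert_iff setL mem_Collect_eq case_prod_conv using iff[of i s \<mu> l] by blast
  qed
 qed
 ultimately show ?case by blast
qed

text \<open>\<open>is_history\<close> prescribes the set of records; strict ordering by time makes
  the list recoverable from it.\<close>

lemma sorted_key_set_unique:
 fixes f :: "'a => 'b :: linorder"
 shows "sorted_wrt (<) (map f xs) ==> sorted_wrt (<) (map f ys) ==> set xs = set ys ==> xs = ys"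
proof (induction xs arbitrary: ys)
 case (Cons x xs)
 from Cons.prems(3) obtain y ys' where ys: "ys = y # ys'" by (cases ys) auto
 have x: "\<forall>q\<in>set xs. f x < f q" and y: "\<forall>q\<in>set ys'. f y < f q"
  using Cons.prems ys by auto
 have "x = y"
 proof (rule ccontr)
  assume "x \<noteq> y"
  then have "x : set ys'" "y : set xs" using Cons.prems(3) ys by auto
  then have "f x < f y" "f y < f x" using x y by auto
  then show False by simp
 qed
 moreover have "x \<notin> set xs" "y \<notin> set ys'" using x y by auto
 then have "set xs = set ys'" using Cons.prems(3) ys \<open>x = y\<close> by auto
 then have "xs = ys'" using Cons.IH[of ys'] Cons.prems ys by auto
 ultimately show ?case using ys by simp
qed simp

lemma is_history_iff:
 assumes ep: "0 < ep" "ep < 1 / 2" and t: "0 <= t"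
 shows "is_history N ep t om \<Phi> \<longleftrightarrow> fst \<Phi> = fst om & (\<exists>L. lhist N ep t 0 (fst om) (snd om) L & snd \<Phi> = map snd L)"
proof -
 have key: "sorted_wrt (<) (map fst (snd \<Phi>)) & set (snd \<Phi>) = {(s, nu, w'). s : {0<..t} \<and>
     (\<exists>j<N. contact ep x (y j) s & torus_normal ep (x s) (y j s) nu & (w j \<longlongrightarrow> w') (at_left s))}
   \<longleftrightarrow> snd \<Phi> = map snd L" if "lhist_of N ep t 0 x y w L" for x y w L
 proof -
  have L: "sorted_wrt (<) (map fst (map snd L))" using that by (simp add: lhist_of_def)
  have setL: "set (map snd L) = {(s, nu, w'). s : {0<..t} \<and>
     (\<exists>j<N. contact ep x (y j) s & torus_normal ep (x s) (y j s) nu & (w j \<longlongrightarrow> w') (at_left s))}"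
  proof (rule set_eqI)
   fix c :: collision
   obtain s \<mu> l where c: "c = (s, \<mu>, l)" by (metis prod.exhaust)
   have "c : set (map snd L) \<longleftrightarrow> (\<exists>j. (j, c) : set L)" by force
   then show "c : set (map snd L) \<longleftrightarrow> c : {(s, nu, w'). s : {0<..t} \<and>
     (\<exists>j<N. contact ep x (y j) s & torus_normal ep (x s) (y j s) nu & (w j \<longlongrightarrow> w') (at_left s))}"
    unfolding c conjunct2[OF that[unfolded lhist_of_def]] mem_Collect_eq case_prod_conv by blast
  qed
  show ?thesis
   by (rule iffI, erule conjE, rule sorted_key_set_unique[OF _ L], assumption, erule trans, rule setL[symmetric], simp only: L setL simp_thms)
 qed
 show ?thesis
 proof
  assume "is_history N ep t om \<Phi>"
  then obtain x v y w where ev: "evolution N ep t 0 (fst om) (snd om) x v y w" and f: "fst \<Phi> = fst om"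
   and S: "sorted_wrt (<) (map fst (snd \<Phi>)) & set (snd \<Phi>) = {(s, nu, w'). s : {0<..t} \<and>
     (\<exists>j<N. contact ep x (y j) s & torus_normal ep (x s) (y j s) nu & (w j \<longlongrightarrow> w') (at_left s))}"
   unfolding is_history_def rayleigh_evolution_iff by blast
  from evolution_imp_lhist[OF ep t ev] obtain L
   where "lhist N ep t 0 (fst om) (snd om) L" "lhist_of N ep t 0 x y w L" by blast
  then show "fst \<Phi> = fst om & (\<exists>L. lhist N ep t 0 (fst om) (snd om) L & snd \<Phi> = map snd L)"
   using f key S by blast
 next
  assume "fst \<Phi> = fst om & (\<exists>L. lhist N ep t 0 (fst om) (snd om) L & snd \<Phi> = map snd L)"
  then obtain L where f: "fst \<Phi> = fst om" and L: "lhist N ep t 0 (fst om) (snd om) L" "snd \<Phi> = map snd L" by blast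
  from lhist_imp_evolution[OF ep L(1) t] obtain x v y w
   where "evolution N ep t 0 (fst om) (snd om) x v y w" "lhist_of N ep t 0 x y w L" by blast
  then show "is_history N ep t om \<Phi>"
   unfolding is_history_def rayleigh_evolution_iff using f L(2) key by blast
 qed
qed

lemma history_eq:
 assumes ep: "0 < ep" "ep < 1 / 2" "0 <= t"
 shows "lhist N ep t 0 (fst om) (snd om) L ==> history N ep t om = (fst om, map snd L)"
  and "(!!L. \<not> lhist N ep t 0 (fst om) (snd om) L) ==> history N ep t om = (fst om, [])"
proof -
 assume L: "lhist N ep t 0 (fst om) (snd om) L"
 have "is_history N ep t om \<Phi> \<longleftrightarrow> \<Phi> = (fst om, map snd L)" for \<Phi>
  unfolding is_history_iff[OF ep] using lhist_unique[OF ep(1,2) L] L by (metis prod.collapse fst_conv snd_conv)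
 then have "is_history N ep t om = (%\<Phi>. \<Phi> = (fst om, map snd L))" by blast
 then show "history N ep t om = (fst om, map snd L)" unfolding history_def by simp
next
 assume "!!L. \<not> lhist N ep t 0 (fst om) (snd om) L"
 then have "\<not> is_history N ep t om \<Phi>" for \<Phi>
  unfolding is_history_iff[OF ep] by blast
 then show "history N ep t om = (fst om, [])" unfolding history_def by auto
qed

section \<open>Measurability of the history\<close>

lemma measurable_fst_borel[measurable (raw)]:
 fixes f :: "'a => 'b::second_countable_topology \<times> 'c::second_countable_topology"
 assumes "f : bm M"
 shows "(%x. fst (f x)) : bm M"
 using measurable_compose[OF assms borel_measurable_continuous_onI[OF continuous_on_fst[OF continuous_on_id]]] by simp

lemma measurable_snd_borel[measurable (raw)]:
 fixes f :: "'a => 'b::second_countable_topology \<times> 'c::second_countable_topology"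
 assumes "f : bm M"
 shows "(%x. snd (f x)) : bm M"
 using measurable_compose[OF assms borel_measurable_continuous_onI[OF continuous_on_snd[OF continuous_on_id]]] by simp

lemma measurable_Pair_borel[measurable (raw)]:
 fixes f :: "'a => 'b::second_countable_topology" and g :: "'a => 'c::second_countable_topology"
 assumes [measurable]: "f : bm M" "g : bm M"
 shows "(%x. (f x, g x)) : bm M"
 unfolding borel_prod[symmetric] by measurable

lemma pred_countable_ball:
 assumes "countable X" "!!i. i : X ==> Measurable.pred M (P i)"
 shows "Measurable.pred M (%x. \<forall>i\<in>X. P i x)" "Measurable.pred M (%x. \<exists>i\<in>X. P i x)"
proof -
 have ex: "Measurable.pred M (%x. \<exists>i\<in>X. Q i x)" if "!!i. i : X ==> Measurable.pred M (Q i)" for Q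
 proof -
  have "{x : space M. \<exists>i\<in>X. Q i x} = (\<Union>i\<in>X. {x : space M. Q i x})" by auto
  also have "... : sets M" by (rule sets.countable_UN'[OF assms(1)]) (use that in \<open>auto simp: pred_def\<close>)
  finally show ?thesis by (simp add: pred_def)
 qed
 show "Measurable.pred M (%x. \<exists>i\<in>X. P i x)" by (rule ex[OF assms(2)])
 have "Measurable.pred M (%x. \<not> (\<exists>i\<in>X. \<not> P i x))"
  by (intro pred_intros_logic(2) ex) (use assms(2) in \<open>auto intro: pred_intros_logic\<close>)
 then show "Measurable.pred M (%x. \<forall>i\<in>X. P i x)" by simp
qed

lemma pred_conj: "Measurable.pred M P ==> Measurable.pred M Q ==> Measurable.pred M (%x. P x & Q x)"
 by measurable

lemma pred_imp: "Measurable.pred M P ==> Measurable.pred M Q ==> Measurable.pred M (%x. P x --> Q x)"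
 by measurable

text \<open>\<open>touches\<close> is split into a condition and a time. A quantifier over contact
  times thereby becomes one over the countable lattice, which preserves measurability.\<close>

definition touch_ok :: "real => phase => phase => real^3 => bool" where
 "touch_ok ep z b l \<longleftrightarrow> snd b - snd z \<noteq> 0 & 0 <= disc ep (fst b - fst z - l) (snd b - snd z)"

definition touch_time :: "real => phase => phase => real^3 => real" where
 "touch_time ep z b l = root ep (fst b - fst z - l) (snd b - snd z)"

definition touch_normal :: "real => phase => phase => real^3 => real^3" where
 "touch_normal ep z b l = cyl_norm ep (fst b - fst z - l) (snd b - snd z)"

lemma touches_iff: "touches ep a z b l s \<longleftrightarrow> touch_ok ep z b l & s = a + touch_time ep z b l"
 by (auto simp: touches_def touch_ok_def touch_time_def Let_def)

lemma measurable_touch[measurable (raw)]: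
 assumes [measurable]: "f : bm M" "g : bm M"
 shows "Measurable.pred M (%x. touch_ok ep (f x) (g x) l)"
  and "(%x. touch_time ep (f x) (g x) l) : bm M"
  and "(%x. touch_normal ep (f x) (g x) l) : bm M"
 unfolding touch_ok_def touch_time_def touch_normal_def by measurable

text \<open>Each entry of \<open>P\<close> prescribes the label of one collision and a set for its
  record. Such events satisfy a recursion over \<open>P\<close> and suffice to describe the
  history.\<close>

definition lhist_in where
 "lhist_in N ep t P a z b \<longleftrightarrow> (\<exists>L. lhist N ep t a z b L & list_all2 (%p c. fst c = fst p & snd c : snd p) P L)"

lemma lhist_in_Nil:
 assumes ep: "0 < ep" "ep < 1 / 2" and a: "0 <= a"
 shows "lhist_in N ep t [] a z b \<longleftrightarrow> (\<forall>j\<in>{..<N}. \<forall>l\<in>lattice. \<not> (touch_ok ep z (b j) l \<and>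
  0 < touch_time ep z (b j) l & a + touch_time ep z (b j) l <= t))"
proof -
 have "lhist_in N ep t [] a z b \<longleftrightarrow> lhist N ep t a z b []" by (simp add: lhist_in_def)
 also have "... \<longleftrightarrow> (\<forall>j<N. \<forall>s\<in>{a<..t}. \<not> free_contact ep a z (b j) s)"
  by (auto intro: lhist.nil elim: lhist.cases)
 also have "... \<longleftrightarrow> (\<forall>j<N. \<forall>s\<in>{a<..t}. \<forall>l\<in>lattice. \<not> (touch_ok ep z (b j) l & s = a + touch_time ep z (b j) l))"
  using free_contact_iff[OF ep a] unfolding touches_iff by (meson greaterThanAtMost_iff)
 also have "... \<longleftrightarrow> (\<forall>j\<in>{..<N}. \<forall>l\<in>lattice. \<not> (touch_ok ep z (b j) l \<and>
  0 < touch_time ep z (b j) l & a + touch_time ep z (b j) l <= t))"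
  by (auto simp: Ball_def) (metis less_add_same_cancel1)
 finally show ?thesis .
qed

inductive_cases lhist_ConsE: "lhist N ep t a z b (c # L)"

text \<open>Unfolds the first collision. The choice of the lattice translate determines its time and
  normal, and minimality of this time among all positive entry times replaces the condition on
  intermediate contacts.\<close>

lemma lhist_in_Cons:
 assumes ep: "0 < ep" "ep < 1 / 2" and a: "0 <= a"
 shows "lhist_in N ep t (p # P) a z b \<longleftrightarrow> (let j = fst p in j < N & (\<exists>l\<in>lattice.
  let h = touch_time ep z (b j) l; nu = touch_normal ep z (b j) l in
  touch_ok ep z (b j) l & 0 < h & a + h <= t \<and>
  (\<forall>i\<in>{..<N}. \<forall>l'\<in>lattice. touch_ok ep z (b i) l' & 0 < touch_time ep z (b i) l' & touch_time ep z (b i) l' <= h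
    --> i = j & touch_time ep z (b i) l' = h) \<and>
  (a + h, nu, snd (b j)) : snd p \<and>
  lhist_in N ep t P (a + h) (after_tagged a z (b j) nu (a + h)) (after_background N j a z b nu (a + h))))"
  (is "?L \<longleftrightarrow> ?R")
proof
 assume ?L
 then obtain c L where L: "lhist N ep t a z b (c # L)" "fst c = fst p" "snd c : snd p"
  and P: "list_all2 (%p c. fst c = fst p & snd c : snd p) P L"
  unfolding lhist_in_def list_all2_Cons1 by blast
 from L(1) have "\<exists>j r nu. c = (j, r, nu, snd (b j)) & j < N & a < r & r <= t & free_contact ep a z (b j) r \<and>
  (\<forall>i s. i < N --> a < s & s <= r --> free_contact ep a z (b i) s --> i = j & s = r) \<and>
  torus_normal ep (fst z + (r - a) *. snd z) (fst (b j) + (r - a) *. snd (b j)) nu \<and>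
  lhist N ep t r (after_tagged a z (b j) nu r) (after_background N j a z b nu r) L"
  by (rule lhist_ConsE) blast
 then obtain j r nu where c: "c = (j, r, nu, snd (b j))" and j: "j < N" and r: "a < r" "r <= t"
  and fc: "free_contact ep a z (b j) r"
  and only: "\<forall>i s. i < N --> a < s & s <= r --> free_contact ep a z (b i) s --> i = j & s = r"
  and nu: "torus_normal ep (fst z + (r - a) *. snd z) (fst (b j) + (r - a) *. snd (b j)) nu"
  and L': "lhist N ep t r (after_tagged a z (b j) nu r) (after_background N j a z b nu r) L"
  by blast
 from fc obtain l where l: "l : lattice" "touches ep a z (b j) l r"
  unfolding free_contact_iff[OF ep a r(1)] by blast
 then have ok: "touch_ok ep z (b j) l" and h: "r = a + touch_time ep z (b j) l" by (simp_all add: touches_iff)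
 have nu': "nu = touch_normal ep z (b j) l"
  using touches_normal[OF ep l] nu h by (simp add: touch_normal_def cyl_norm_def touch_time_def)
 have first: "i = j & touch_time ep z (b i) l' = touch_time ep z (b j) l"
  if "i < N" "l' : lattice" "touch_ok ep z (b i) l'" "0 < touch_time ep z (b i) l'"
   "touch_time ep z (b i) l' <= touch_time ep z (b j) l" for i l'
 proof -
  let ?s = "a + touch_time ep z (b i) l'"
  have "a < ?s & ?s <= r" using that h by simp
  moreover from this have "free_contact ep a z (b i) ?s"
   using that by (subst free_contact_iff[OF ep a]) (auto simp: touches_iff)
  ultimately have "i = j & ?s = r" using only that(1) by blast
  then show ?thesis using h by auto
 qed
 have jp: "fst p = j" using L(2) c by simp
 show ?R
  unfolding Let_def jp
 proof (intro conjI bexI[OF _ l(1)])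
  show "\<forall>i\<in>{..<N}. \<forall>l'\<in>lattice. touch_ok ep z (b i) l' & 0 < touch_time ep z (b i) l' \<and>
    touch_time ep z (b i) l' <= touch_time ep z (b j) l --> i = j & touch_time ep z (b i) l' = touch_time ep z (b j) l"
   using first by blast
  show "lhist_in N ep t P (a + touch_time ep z (b j) l)
    (after_tagged a z (b j) (touch_normal ep z (b j) l) (a + touch_time ep z (b j) l))
    (after_background N j a z b (touch_normal ep z (b j) l) (a + touch_time ep z (b j) l))"
   using L' P unfolding lhist_in_def h[symmetric] nu'[symmetric] by blast
  show "(a + touch_time ep z (b j) l, touch_normal ep z (b j) l, snd (b j)) : snd p"
   using L(3) c h nu' by simp
  show "0 < touch_time ep z (b j) l" "a + touch_time ep z (b j) l <= t" using r h by simp_all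
 qed (fact j ok)+
next
 assume ?R
 then obtain l where j: "fst p < N" and l: "l : lattice"
  and ok: "touch_ok ep z (b (fst p)) l" and h: "0 < touch_time ep z (b (fst p)) l" "a + touch_time ep z (b (fst p)) l <= t"
  and first: "!!i l'. i < N ==> l' : lattice ==> touch_ok ep z (b i) l' ==> 0 < touch_time ep z (b i) l' ==>
   touch_time ep z (b i) l' <= touch_time ep z (b (fst p)) l ==> i = fst p & touch_time ep z (b i) l' = touch_time ep z (b (fst p)) l"
  and mem: "(a + touch_time ep z (b (fst p)) l, touch_normal ep z (b (fst p)) l, snd (b (fst p))) : snd p"
  and rest: "lhist_in N ep t P (a + touch_time ep z (b (fst p)) l)
   (after_tagged a z (b (fst p)) (touch_normal ep z (b (fst p)) l) (a + touch_time ep z (b (fst p)) l))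
   (after_background N (fst p) a z b (touch_normal ep z (b (fst p)) l) (a + touch_time ep z (b (fst p)) l))"
  unfolding Let_def by auto
 define j r nu where "j = fst p" and "r = a + touch_time ep z (b j) l" and "nu = touch_normal ep z (b j) l"
 from rest obtain L where L: "lhist N ep t r (after_tagged a z (b j) nu r) (after_background N j a z b nu r) L"
  "list_all2 (%p c. fst c = fst p & snd c : snd p) P L"
  unfolding lhist_in_def j_def r_def nu_def by blast
 have touches: "touches ep a z (b j) l r" using ok by (simp add: touches_iff j_def r_def)
 have ar: "a < r" using h by (simp add: r_def j_def)
 have "lhist N ep t a z b ((j, r, nu, snd (b j)) # L)"
 proof (rule lhist.step[OF _ ar])
  show "free_contact ep a z (b j) r"
   unfolding free_contact_iff[OF ep a ar] using l touches by blast
  show "torus_normal ep (fst z + (r - a) *. snd z) (fst (b j) + (r - a) *. snd (b j)) nu"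
   unfolding touches_normal[OF ep l touches] by (simp add: nu_def r_def touch_normal_def cyl_norm_def touch_time_def)
  fix i s assume i: "i < N" "s : {a<..r}" "free_contact ep a z (b i) s"
  then obtain l' where l': "l' : lattice" "touches ep a z (b i) l' s"
   using free_contact_iff[OF ep a, of s z "b i"] by auto
  then show "i = j & s = r"
   using first[OF i(1) l'(1)] i(2) by (auto simp: touches_iff j_def r_def)
 qed (use j h L in \<open>simp_all add: j_def r_def\<close>)
 then show ?L
  unfolding lhist_in_def using mem L(2) by (intro exI conjI) (auto simp: j_def r_def nu_def)
qed

abbreviation state_space :: "nat => (real \<times> phase \<times> (nat => phase)) measure" where
 "state_space N \<equiv> borel \<Otimes>\<^sub>M (borel \<Otimes>\<^sub>M PiM {..<N} (%_. borel))"

text \<open>\<open>0 <= fst s\<close> is carried along because the recursion for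
  \<open>lhist_in\<close> is available only from nonnegative starting times: contacts are by
  definition at positive times.\<close>

lemma measurable_lhist_in:
 assumes ep: "0 < ep" "ep < 1 / 2" and P: "\<forall>p\<in>set P. snd p : sets borel"
 shows "Measurable.pred (state_space N) (%s. 0 <= fst s & lhist_in N ep t P (fst s) (fst (snd s)) (snd (snd s)))"
 using P
proof (induction P)
 case Nil
 have comp[measurable]: "(%s. snd (snd s) j) : bm (state_space N)" if "j : {..<N}" for j
  using that by measurable
 have "Measurable.pred (state_space N) (%s. 0 <= fst s & (\<forall>j\<in>{..<N}. \<forall>l\<in>lattice. \<not> (touch_ok ep (fst (snd s)) (snd (snd s) j) l \<and>
  0 < touch_time ep (fst (snd s)) (snd (snd s) j) l & fst s + touch_time ep (fst (snd s)) (snd (snd s) j) l <= t)))"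
  by (intro pred_intros_logic pred_countable_ball countable_lattice countable_finite[OF finite_lessThan]) measurable
 then show ?case
  by (rule measurable_cong[THEN iffD1, rotated]) (use lhist_in_Nil[OF ep] in auto)
next
 case (Cons p P)
 have comp[measurable]: "(%s. snd (snd s) j) : bm (state_space N)" if "j : {..<N}" for j
  using that by measurable
 have [measurable]: "snd p : sets borel" using Cons.prems by simp
 define j where "j = fst p"
 show ?case
 proof (cases "j < N")
  case False
  have "(%s. 0 <= fst s & lhist_in N ep t (p # P) (fst s) (fst (snd s)) (snd (snd s))) = (%s. False)"
   using lhist_in_Cons[OF ep] False by (auto simp: fun_eq_iff j_def Let_def)
  then show ?thesis by simp
 next
  case True
  have j[measurable]: "(%s. snd (snd s) j) : bm (state_space N)" using comp True by simp
  \<comment> \<open>The state right after a collision through the translate \<open>l\<close>; the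
    event for the remaining collisions is pulled back along this map.\<close>
  define T where "T l s = (let a = fst s; z = fst (snd s); b = snd (snd s);
   r = a + touch_time ep z (b j) l; nu = touch_normal ep z (b j) l in
   (r, after_tagged a z (b j) nu r, after_background N j a z b nu r))" for l s
  have T[measurable]: "T l : measurable (state_space N) (state_space N)" for l
  proof -
   have "(%s. after_background N j (fst s) (fst (snd s)) (snd (snd s)) (touch_normal ep (fst (snd s)) (snd (snd s) j) l)
    (fst s + touch_time ep (fst (snd s)) (snd (snd s) j) l)) : measurable (state_space N) (PiM {..<N} (%_. borel))"
    unfolding after_background_def
   proof (rule measurable_restrict)
    fix i assume [measurable]: "i : {..<N}"
    show "(%s. (fst (snd (snd s) i) + (fst s + touch_time ep (fst (snd s)) (snd (snd s) j) l - fst s) *. snd (snd (snd s) i),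
     if i = j then snd (snd (snd s) j) + (touch_normal ep (fst (snd s)) (snd (snd s) j) l \<bullet> (snd (fst (snd s)) - snd (snd (snd s) j))) *. touch_normal ep (fst (snd s)) (snd (snd s) j) l
     else snd (snd (snd s) i))) : bm (state_space N)"
     by measurable
   qed
   then show ?thesis unfolding T_def Let_def after_tagged_def by measurable
  qed
  have IH: "Measurable.pred (state_space N) (%s. 0 <= fst (T l s) & lhist_in N ep t P (fst (T l s)) (fst (snd (T l s))) (snd (snd (T l s))))" for l
   using measurable_compose[OF T Cons.IH] Cons.prems by simp
  define TP where "TP l s \<longleftrightarrow> 0 <= fst (T l s) & lhist_in N ep t P (fst (T l s)) (fst (snd (T l s))) (snd (snd (T l s)))" for l s
  have "Measurable.pred (state_space N) (%s. 0 <= fst s & (\<exists>l\<in>lattice.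
   touch_ok ep (fst (snd s)) (snd (snd s) j) l & 0 < touch_time ep (fst (snd s)) (snd (snd s) j) l \<and>
   fst s + touch_time ep (fst (snd s)) (snd (snd s) j) l <= t \<and>
   (\<forall>i\<in>{..<N}. \<forall>l'\<in>lattice. touch_ok ep (fst (snd s)) (snd (snd s) i) l' & 0 < touch_time ep (fst (snd s)) (snd (snd s) i) l' \<and>
     touch_time ep (fst (snd s)) (snd (snd s) i) l' <= touch_time ep (fst (snd s)) (snd (snd s) j) l
     --> i = j & touch_time ep (fst (snd s)) (snd (snd s) i) l' = touch_time ep (fst (snd s)) (snd (snd s) j) l) \<and>
   (fst s + touch_time ep (fst (snd s)) (snd (snd s) j) l, touch_normal ep (fst (snd s)) (snd (snd s) j) l, snd (snd (snd s) j)) : snd p \<and>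
   TP l s))"
  proof (intro pred_conj pred_imp pred_countable_ball countable_lattice countable_finite[OF finite_lessThan])
   fix l :: "real^3"
   show "Measurable.pred (state_space N) (TP l)" by (unfold TP_def, rule IH)
  qed measurable
  then show ?thesis
   unfolding TP_def
  proof (rule measurable_cong[THEN iffD1, rotated])
   fix s
   show "(0 <= fst s & (\<exists>l\<in>lattice.
   touch_ok ep (fst (snd s)) (snd (snd s) j) l & 0 < touch_time ep (fst (snd s)) (snd (snd s) j) l \<and>
   fst s + touch_time ep (fst (snd s)) (snd (snd s) j) l <= t \<and>
   (\<forall>i\<in>{..<N}. \<forall>l'\<in>lattice. touch_ok ep (fst (snd s)) (snd (snd s) i) l' & 0 < touch_time ep (fst (snd s)) (snd (snd s) i) l' \<and>
     touch_time ep (fst (snd s)) (snd (snd s) i) l' <= touch_time ep (fst (snd s)) (snd (snd s) j) l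
     --> i = j & touch_time ep (fst (snd s)) (snd (snd s) i) l' = touch_time ep (fst (snd s)) (snd (snd s) j) l) \<and>
   (fst s + touch_time ep (fst (snd s)) (snd (snd s) j) l, touch_normal ep (fst (snd s)) (snd (snd s) j) l, snd (snd (snd s) j)) : snd p \<and>
   0 <= fst (T l s) & lhist_in N ep t P (fst (T l s)) (fst (snd (T l s))) (snd (snd (T l s))))) \<longleftrightarrow>
   (0 <= fst s & lhist_in N ep t (p # P) (fst s) (fst (snd s)) (snd (snd s)))"
   proof (cases "0 <= fst s")
    case a: True
    have "0 <= fst (T l s)" if "0 < touch_time ep (fst (snd s)) (snd (snd s) j) l" for l
     using a that by (simp add: T_def Let_def)
    then have absorb: "(\<exists>l\<in>lattice. A l & 0 < touch_time ep (fst (snd s)) (snd (snd s) j) l & B l & C l & D l & 0 <= fst s + touch_time ep (fst (snd s)) (snd (snd s) j) l & E l) \<longleftrightarrow>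
      (\<exists>l\<in>lattice. A l & 0 < touch_time ep (fst (snd s)) (snd (snd s) j) l & B l & C l & D l & E l)" for A B C D E
     using a by (metis add_nonneg_nonneg less_imp_le)
    have eqs: "fst (T l s) = fst s + touch_time ep (fst (snd s)) (snd (snd s) j) l"
     "fst (snd (T l s)) = after_tagged (fst s) (fst (snd s)) (snd (snd s) j) (touch_normal ep (fst (snd s)) (snd (snd s) j) l)
      (fst s + touch_time ep (fst (snd s)) (snd (snd s) j) l)"
     "snd (snd (T l s)) = after_background N j (fst s) (fst (snd s)) (snd (snd s)) (touch_normal ep (fst (snd s)) (snd (snd s) j) l)
      (fst s + touch_time ep (fst (snd s)) (snd (snd s) j) l)" for l
     by (simp_all add: T_def Let_def)
    show ?thesis
     unfolding lhist_in_Cons[OF ep a] j_def[symmetric] Let_def eqs unfolding absorb using a True by (simp only: simp_thms)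
   qed simp
  qed
 qed
qed


section \<open>The history as a measurable map into trees\<close>

lemma collision_vol_measurableI:
 assumes f: "f : bm R"
  and sp: "!!x. x : space R ==> fst (f x) : {0..T} & norm (fst (snd (f x))) = 1"
 shows "f : measurable R (collision_vol T)"
proof -
 note [measurable] = f
 have "(%x. fst (f x)) : measurable R (restrict_space lborel {0..T})"
  by (rule measurable_restrict_space2) (use sp in \<open>auto intro: measurable_fst_borel[OF f]\<close>)
 moreover have "(%x. fst (snd (f x))) : measurable R sphere_measure"
  unfolding measurable_cong_sets[OF refl sets_sphere_measure]
  by (rule measurable_restrict_space2) (use sp in auto)
 moreover have "(%x. snd (snd (f x))) : measurable R lborel" by simp
 ultimately have "(%x. (fst (f x), fst (snd (f x)), snd (snd (f x)))) : measurable R (collision_vol T)"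
  unfolding collision_vol_def by (intro measurable_Pair)
 then show ?thesis by simp
qed

lemma tree_vol_measurableI:
 assumes G: "G : measurable R (tree_coords_vol T m)"
  and H: "!!om. om : space R ==> H om = (fst (G om), map (snd (G om)) [0..<m])"
  and trees: "!!om. om : space R ==> H om : collision_trees T"
 shows "H : measurable R (tree_vol T)"
proof (rule measurableI)
 show "H om : space (tree_vol T)" if "om : space R" for om
  using trees[OF that] by (simp add: space_tree_vol)
 fix S assume "S : sets (tree_vol T)"
 then have S: "tree_component T m S : sets (tree_coords_vol T m)" by (simp add: sets_tree_vol)
 have "H -` S \<inter> space R = G -` tree_component T m S \<inter> space R"
  using H measurable_space[OF G] by (auto simp: tree_component_def case_prod_beta')
 then show "H -` S \<inter> space R : sets R" using measurable_sets[OF G S] by simp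
qed

lemma lhist_in_single:
 assumes ep: "0 < ep" "ep < 1 / 2" and L: "lhist N ep t a z b L" and i: "i < length L"
 shows "snd (L ! i) : B \<longleftrightarrow> lhist_in N ep t ((map (%c. (fst c, UNIV)) L)[i := (fst (L ! i), B)]) a z b"
proof -
 let ?P = "(map (%c. (fst c, UNIV)) L)[i := (fst (L ! i), B)]"
 have "lhist_in N ep t ?P a z b \<longleftrightarrow> list_all2 (%p c. fst c = fst p & snd c : snd p) ?P L"
  using lhist_unique[OF ep L] L unfolding lhist_in_def by blast
 also have "... \<longleftrightarrow> snd (L ! i) : B"
  unfolding list_all2_conv_all_nth using i by (auto simp: nth_list_update)
 finally show ?thesis by simp
qed

definition the_lhist where "the_lhist N ep t om = (THE L. lhist N ep t 0 (fst om) (snd om) L)"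

lemma the_lhist_eq:
 assumes "0 < ep" "ep < 1 / 2" "lhist N ep t 0 (fst om) (snd om) L"
 shows "the_lhist N ep t om = L"
 unfolding the_lhist_def using assms lhist_unique[OF assms(1-3)] by blast

text \<open>The sequence of colliding labels takes countably many values. On each of these events
  the number of collisions is fixed and every coordinate of the tree is measurable; elsewhere the
  history is the default tree without collisions. It is thus measurable even before completion of
  the initial law.\<close>

lemma history_measurable:
 assumes ep: "0 < ep" "ep < 1 / 2" and t: "0 <= t" "t <= T"
  and z: "(%om. fst om) : measurable R phase_vol"
  and b: "!!j. j < N ==> (%om. snd om j) : bm R"
  and ext: "!!om. om : space R ==> snd om : extensional {..<N}"
 shows "history N ep t : measurable R (tree_vol T)"
  and "{om : space R. \<exists>L. lhist N ep t 0 (fst om) (snd om) L & map fst L = js} : sets R"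
proof -
 define J where "J om = (0 :: real, fst om, snd om)" for om :: "phase \<times> (nat => phase)"
 have J: "J : measurable R (state_space N)"
 proof -
  have zb: "(%om. fst om) : bm R"
   using measurable_compose[OF z measurable_phase_volI[of "%x. x" borel]] by simp
  have "(%om. \<lambda>i\<in>{..<N}. snd om i) : measurable R (PiM {..<N} (%_. borel))"
   by (rule measurable_restrict) (use b in auto)
  then have "(%om. snd om) : measurable R (PiM {..<N} (%_. borel))"
   by (rule measurable_cong[THEN iffD1, rotated]) (use ext in \<open>simp add: extensional_restrict\<close>)
  with zb show ?thesis unfolding J_def by measurable
 qed
 have Q: "{om : space R. lhist_in N ep t P 0 (fst om) (snd om)} : sets R" if "\<forall>p\<in>set P. snd p : sets borel" for P
 proof -
  have "Measurable.pred R (%om. 0 <= fst (J om) & lhist_in N ep t P (fst (J om)) (fst (snd (J om))) (snd (snd (J om))))"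
   by (rule measurable_compose[OF J measurable_lhist_in[OF ep that]])
  then show ?thesis by (simp add: J_def pred_def)
 qed
 define D where "D js = {om : space R. \<exists>L. lhist N ep t 0 (fst om) (snd om) L & map fst L = js}" for js
 have D: "D js : sets R" for js
 proof -
  have "D js = {om : space R. lhist_in N ep t (map (%j. (j, UNIV)) js) 0 (fst om) (snd om)}"
   unfolding D_def lhist_in_def by (auto simp: list_all2_conv_all_nth list_eq_iff_nth_eq)
  then show ?thesis using Q[of "map (%j. (j, UNIV)) js"] by auto
 qed
 then show "{om : space R. \<exists>L. lhist N ep t 0 (fst om) (snd om) L & map fst L = js} : sets R"
  unfolding D_def .
 have cell: "fst (fst om) : cell" if "om : space R" for om
  using measurable_space[OF z that] by (auto simp: space_phase_vol)
 have cont: "history N ep t : measurable (restrict_space R (D js)) (tree_vol T)" for js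
 proof (rule tree_vol_measurableI)
  let ?m = "length js"
  let ?C = "%om. \<lambda>i\<in>{..<?m}. snd (the_lhist N ep t om ! i)"
  have sp: "om : space R" "om : D js" if "om : space (restrict_space R (D js))" for om
   using that by (auto simp: space_restrict_space)
  have L: "\<exists>L. lhist N ep t 0 (fst om) (snd om) L & map fst L = js & the_lhist N ep t om = L" if "om : D js" for om
   using that the_lhist_eq[OF ep] unfolding D_def by blast
  show "(%om. (fst om, ?C om)) : measurable (restrict_space R (D js)) (tree_coords_vol T ?m)"
   unfolding tree_coords_vol_def
  proof (rule measurable_Pair[OF measurable_restrict_space1[OF z]], rule measurable_restrict)
   fix i assume i: "i : {..<?m}"
   show "(%om. snd (the_lhist N ep t om ! i)) : measurable (restrict_space R (D js)) (collision_vol T)"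
   proof (rule collision_vol_measurableI)
    show "(%om. snd (the_lhist N ep t om ! i)) : bm (restrict_space R (D js))"
    proof (rule measurableI)
     fix B :: "collision set" assume B: "B : sets borel"
     \<comment> \<open>Only the record with index \<open>i\<close> is constrained; all other slots
       are filled with \<open>UNIV\<close>.\<close>
     let ?P = "(map (%j. (j, UNIV)) js)[i := (js ! i, B)]"
     have "(%om. snd (the_lhist N ep t om ! i)) -` B \<inter> space (restrict_space R (D js))
      = D js \<inter> {om : space R. lhist_in N ep t ?P 0 (fst om) (snd om)}"
     proof (rule set_eqI)
      fix om
      show "om : (%om. snd (the_lhist N ep t om ! i)) -` B \<inter> space (restrict_space R (D js)) \<longleftrightarrow>
       om : D js \<inter> {om : space R. lhist_in N ep t ?P 0 (fst om) (snd om)}"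
      proof (cases "om : D js")
       case True
       then obtain L where L': "lhist N ep t 0 (fst om) (snd om) L" "map fst L = js" "the_lhist N ep t om = L"
        using L by blast
       have "(map (%c. (fst c, UNIV)) L)[i := (fst (L ! i), B)] = ?P"
        using L'(2) i by (auto simp: comp_def)
       then show ?thesis
        using lhist_in_single[OF ep L'(1), of i B] L'(2,3) i True by (auto simp: space_restrict_space D_def)
      qed (simp add: space_restrict_space)
     qed
     moreover have "\<forall>p\<in>set ?P. snd p : sets borel"
      using B by (auto dest!: set_update_subset_insert[THEN subsetD])
     ultimately show "(%om. snd (the_lhist N ep t om ! i)) -` B \<inter> space (restrict_space R (D js)) : sets (restrict_space R (D js))"
      using D Q[of ?P] by (auto simp: sets_restrict_space_iff)
    qed simp
    fix om assume "om : space (restrict_space R (D js))"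
    then obtain L where L': "lhist N ep t 0 (fst om) (snd om) L" "map fst L = js" "the_lhist N ep t om = L"
     using L sp by blast
    then have "L ! i : set L" using i by auto
    then show "fst (snd (the_lhist N ep t om ! i)) : {0..T} & norm (fst (snd (snd (the_lhist N ep t om ! i)))) = 1"
     using lhist_times[OF L'(1)] L'(3) t by fastforce
   qed
  qed
  fix om assume "om : space (restrict_space R (D js))"
  then obtain L where L': "lhist N ep t 0 (fst om) (snd om) L" "map fst L = js" "the_lhist N ep t om = L"
   and om: "om : space R"
   using L sp by blast
  have h: "history N ep t om = (fst om, map snd L)" by (rule history_eq(1)[OF ep t(1) L'(1)])
  show "history N ep t om = (fst (fst om, ?C om), map (snd (fst om, ?C om)) [0..<?m])"
  proof -
   have len: "length js = length L" using L'(2) by (metis length_map)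
   have "map snd L = map (\<lambda>i\<in>{..<?m}. snd (L ! i)) [0..<?m]"
    by (rule nth_equalityI) (simp_all add: len)
   then show ?thesis unfolding h L'(3) by simp
  qed
  show "history N ep t om : collision_trees T"
  proof -
   have "sorted_wrt (<) (map fst (map snd L))" using lhist_times[OF L'(1)] by simp
   moreover have "\<forall>c\<in>set (map snd L). fst c : {0..T} & norm (fst (snd c)) = 1"
    using lhist_times[OF L'(1)] t by fastforce
   ultimately show ?thesis
    unfolding h using cell[OF om] by (cases "fst om") (auto simp: collision_trees_def)
  qed
 qed
 have rest: "history N ep t : measurable (restrict_space R (space R - (\<Union>js. D js))) (tree_vol T)"
 proof (rule tree_vol_measurableI)
  show "(%om. (fst om, %_. undefined)) : measurable (restrict_space R (space R - (\<Union>js. D js))) (tree_coords_vol T 0)"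
   unfolding tree_coords_vol_def
   by (intro measurable_Pair measurable_restrict_space1 z) (simp add: PiM_empty)
  fix om assume om: "om : space (restrict_space R (space R - (\<Union>js. D js)))"
  then have "\<not> lhist N ep t 0 (fst om) (snd om) L" for L
   by (auto simp: space_restrict_space D_def)
  then have h: "history N ep t om = (fst om, [])" by (rule history_eq(2)[OF ep t(1)])
  then show "history N ep t om = (fst (fst om, %_. undefined), map (snd (fst om, %_. undefined)) [0..<0])" by simp
  show "history N ep t om : collision_trees T"
   unfolding h using cell[of om] om by (cases "fst om") (auto simp: collision_trees_def space_restrict_space)
 qed
 have "countable (insert (space R - (\<Union>js. D js)) (range D))" by simp
 then show "history N ep t : measurable R (tree_vol T)"
  by (rule measurable_piecewise_restrict) (use cont rest D in auto)
qed

section \<open>Trees in coordinates\<close>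

definition deflect :: "real^3 => collision => real^3" where
 "deflect v c = v - (fst (snd c) \<bullet> (v - snd (snd c))) *. fst (snd c)"

text \<open>Start of piece \<open>m\<close> of the root trajectory: time 0 for piece 0, and the time
  of collision \<open>m\<close> for piece \<open>Suc m\<close>, collisions being counted from 0.
  \<open>vel z c m\<close> is the velocity on this piece and \<open>pos z c m\<close> the position
  at its start.\<close>

primrec tau :: "(nat => collision) => nat => real" where
 "tau c 0 = 0"
| "tau c (Suc m) = fst (c m)"

primrec vel :: "phase => (nat => collision) => nat => real^3" where
 "vel z c 0 = snd z"
| "vel z c (Suc m) = deflect (vel z c m) (c m)"

primrec pos :: "phase => (nat => collision) => nat => real^3" where
 "pos z c 0 = fst z"
| "pos z c (Suc m) = pos z c m + (tau c (Suc m) - tau c m) *. vel z c m"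

lemma coords_cong:
 assumes "!!i. i < m ==> c i = c' i"
 shows "tau c m = tau c' m" "vel z c m = vel z c' m" "pos z c m = pos z c' m"
 using assms
proof (induction m)
 case (Suc m)
 {
  case 1 then show ?case by simp
 next
  case 2 then show ?case using Suc.IH(2) by simp
 next
  case 3
  have "tau c m = tau c' m" using 3 by (cases m) auto
  then show ?case using Suc.IH(2,3) 3 by simp
 }
qed simp_all

text \<open>A first collision at time 0 is allowed, as it is in \<open>collision_trees\<close>; this
  is the reason for the mixture of strict and non-strict inequalities in
  \<open>ord_Suc\<close>.\<close>

definition ord :: "nat => (nat => collision) => bool" where
 "ord n c \<longleftrightarrow> 0 <= tau c n & (\<forall>j<n. \<forall>i<j. fst (c i) < fst (c j)) & (\<forall>i<n. 0 <= fst (c i))"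

lemma ord_Suc: "ord (Suc n) c \<longleftrightarrow> ord n c & tau c n <= fst (c n) & (0 < n --> tau c n < fst (c n))"
proof
 assume *: "ord (Suc n) c"
 then have "ord n c" by (cases n) (auto simp: ord_def less_Suc_eq)
 moreover have "0 < n --> tau c n < fst (c n)"
  using * by (cases n) (auto simp: ord_def)
 moreover have "n = 0 --> tau c n <= fst (c n)" using * by (auto simp: ord_def)
 ultimately show "ord n c & tau c n <= fst (c n) & (0 < n --> tau c n < fst (c n))" by auto
next
 assume *: "ord n c & tau c n <= fst (c n) & (0 < n --> tau c n < fst (c n))"
 have "fst (c i) < fst (c n)" if "i < n" for i
 proof -
  have "fst (c i) <= fst (c (n - 1))"
   using * that by (cases "i = n - 1") (auto simp: ord_def intro!: less_imp_le)
  moreover have "tau c n = fst (c (n - 1))" using that by (cases n) auto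
  ultimately show ?thesis using * that by auto
 qed
 moreover have "0 <= fst (c n)" using * by (auto simp: ord_def)
 ultimately show "ord (Suc n) c" using * by (auto simp: ord_def less_Suc_eq)
qed

lemma ord_mono: "ord n c ==> m <= n ==> ord m c"
 by (induction n) (auto simp: ord_Suc le_Suc_eq)

lemma ord_tau_le: "ord n c ==> m <= n ==> tau c m <= tau c n"
proof (induction n)
 case (Suc n)
 then show ?case by (cases "m = Suc n") (auto simp: ord_Suc le_Suc_eq intro: order_trans)
qed simp

lemma ord_nonneg: "ord n c ==> 0 <= tau c n"
 by (simp add: ord_def)

lemma fold_vel:
 "fold (%(r, nu, w) v. v - (nu \<bullet> (v - w)) *. nu) (map c [0..<m]) (snd z) = vel z c m"
 by (induction m) (auto simp: deflect_def case_prod_beta')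

lemma filter_upt_prefix:
 assumes "m <= n" "!!i. i < m ==> P i" "!!i. m <= i ==> i < n ==> \<not> P i"
 shows "filter P [0..<n] = [0..<m]"
proof -
 have "[0..<n] = [0..<m] @ [m..<n]" using assms(1) upt_add_eq_append[of 0 m "n - m"] by simp
 moreover have "filter P [0..<m] = [0..<m]" "filter P [m..<n] = []"
  using assms by (auto simp: filter_empty_conv filter_id_conv)
 ultimately show ?thesis by simp
qed

lemma ord_less: "ord n c ==> i < j ==> j < n ==> fst (c i) < fst (c j)"
 by (simp add: ord_def)

lemma root_vel_coords:
 assumes o: "ord n c" and m: "m <= n" and s: "tau c m <= s" "m < n ==> s < fst (c m)"
 shows "root_vel (z, map c [0..<n]) s = vel z c m"
proof -
 have "filter (%i. fst (c i) <= s) [0..<n] = [0..<m]"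
 proof (rule filter_upt_prefix[OF m])
  fix i assume i: "i < m"
  have "fst (c i) <= tau c m" using ord_tau_le[OF ord_mono[OF o m], of "Suc i"] i by simp
  then show "fst (c i) <= s" using s by simp
 next
  fix i assume i: "m <= i" "i < n"
  have "fst (c m) <= fst (c i)" using ord_less[OF o, of m i] i by (cases "m = i") auto
  then show "\<not> fst (c i) <= s" using s i by simp
 qed
 then show ?thesis by (simp add: root_vel_def filter_map comp_def fold_vel)
qed

lemma root_vel_left_coords:
 assumes o: "ord (Suc n) c"
 shows "root_vel_left (z, map c [0..<Suc n]) (fst (c n)) = vel z c n"
proof -
 have "filter (%i. fst (c i) < fst (c n)) [0..<Suc n] = [0..<n]"
  by (rule filter_upt_prefix) (use ord_less[OF o, of _ n] in \<open>auto simp: less_Suc_eq\<close>)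
 then show ?thesis by (simp add: root_vel_left_def filter_map comp_def fold_vel del: upt_Suc)
qed

text \<open>In contrast to \<open>root_vel_coords\<close> the end of a piece is included: the
  position is continuous there. The integral of the velocity is assembled piece by piece.\<close>

lemma root_pos_coords:
 assumes o: "ord n c" and m: "m <= n" and s: "tau c m <= s" "m < n ==> s <= fst (c m)"
 shows "root_pos (z, map c [0..<n]) s = pos z c m + (s - tau c m) *. vel z c m"
proof -
 let ?V = "root_vel (z, map c [0..<n])"
 have "(?V has_integral (pos z c m + (s - tau c m) *. vel z c m - fst z)) {0..s}"
  using m s
 proof (induction m arbitrary: s)
  case 0
  have "((%_. vel z c 0) has_integral (s - 0) *. vel z c 0) {0..s}"
   using has_integral_const_real[of "vel z c 0" 0 s] 0 by simp
  moreover have "?V q = vel z c 0" if "q : {0..s} - {s}" for q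
  proof (rule root_vel_coords[OF o])
   show "tau c 0 <= q" "0 <= n" using that by simp_all
   assume "0 < n"
   from 0(3)[OF this] that show "q < fst (c 0)" by simp
  qed
  ultimately have "(?V has_integral (s - 0) *. vel z c 0) {0..s}"
   using has_integral_spike_finite[of "{s}" "{0..s}" ?V "%_. vel z c 0"] by blast
  then show ?case by simp
 next
  case (Suc m)
  have tm: "tau c m <= tau c (Suc m)" using ord_tau_le[OF ord_mono[OF o Suc.prems(1)], of m] by simp
  have tm0: "0 <= tau c (Suc m)" using ord_nonneg[OF ord_mono[OF o Suc.prems(1)]] .
  have 1: "(?V has_integral (pos z c (Suc m) - fst z)) {0..tau c (Suc m)}"
   using Suc.IH[of "tau c (Suc m)"] Suc.prems tm by simp
  have "((%_. vel z c (Suc m)) has_integral (s - tau c (Suc m)) *. vel z c (Suc m)) {tau c (Suc m)..s}"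
   using has_integral_const_real[of "vel z c (Suc m)" "tau c (Suc m)" s] Suc.prems(2) by (simp del: tau.simps vel.simps)
  moreover have "?V q = vel z c (Suc m)" if "q : {tau c (Suc m)..s} - {s}" for q
  proof (rule root_vel_coords[OF o Suc.prems(1)])
   show "tau c (Suc m) <= q" using that by (simp del: tau.simps)
   assume "Suc m < n"
   from Suc.prems(3)[OF this] that show "q < fst (c (Suc m))" by (simp del: tau.simps)
  qed
  ultimately have 2: "(?V has_integral (s - tau c (Suc m)) *. vel z c (Suc m)) {tau c (Suc m)..s}"
   using has_integral_spike_finite[of "{s}" "{tau c (Suc m)..s}" ?V "%_. vel z c (Suc m)"] by blast
  have "(?V has_integral (pos z c (Suc m) - fst z) + (s - tau c (Suc m)) *. vel z c (Suc m)) {0..s}"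
   by (rule has_integral_combine[OF tm0 Suc.prems(2) 1 2])
  then show ?case by (simp only: add_diff_eq diff_add_eq)
 qed
 then have "integral {0..s} ?V = pos z c m + (s - tau c m) *. vel z c m - fst z" by (rule integral_unique)
 then show ?thesis by (simp add: root_pos_def)
qed

definition rate :: "(phase => real) => real => real^3 => real^3 => real" where
 "rate g s x v = (LINT nu|sphere_measure. LINT w|lborel. g (x - s *. w, w) * max 0 ((v - w) \<bullet> nu))"

text \<open>Defined for all \<open>s\<close> along the straight extension of piece \<open>m\<close>,
  which makes it continuous on the whole line.\<close>

definition seg_rate :: "(phase => real) => phase => (nat => collision) => nat => real => real" where
 "seg_rate g z c m s = rate g s (pos z c m + (s - tau c m) *. vel z c m) (vel z c m)"

definition seg_loss :: "(phase => real) => phase => (nat => collision) => nat => real => real" where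
 "seg_loss g z c m t = (LINT s:{tau c m..t}|lborel. seg_rate g z c m s)"

definition gain :: "(phase => real) => phase => (nat => collision) => nat => real" where
 "gain g z c m = g (pos z c (Suc m) - fst (c m) *. snd (snd (c m)), snd (snd (c m))) *
  max 0 ((vel z c m - snd (snd (c m))) \<bullet> fst (snd (c m)))"

text \<open>The idealised density at the time of the last collision, without the survival factor
  after that time; it does not depend on \<open>t\<close>.\<close>

primrec dens :: "(phase => real) => (phase => real) => phase => (nat => collision) => nat => real" where
 "dens f g z c 0 = f z"
| "dens f g z c (Suc n) = dens f g z c n * exp (- seg_loss g z c n (tau c (Suc n))) * gain g z c n"

lemma loss_rate_coords:
 assumes "ord n c" "tau c n <= s"
 shows "loss_rate g s (z, map c [0..<n]) = seg_rate g z c n s"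
 using root_vel_coords[OF assms(1) order_refl assms(2)] root_pos_coords[OF assms(1) order_refl assms(2)]
 by (simp add: loss_rate_def seg_rate_def rate_def transported_def)

lemma seg_loss_coords:
 assumes "ord n c"
 shows "(LINT s:{tau c n..t}|lborel. loss_rate g s (z, map c [0..<n])) = seg_loss g z c n t"
 unfolding seg_loss_def
 by (rule set_lebesgue_integral_cong) (use loss_rate_coords[OF assms] in auto)

lemma idealised_coords:
 assumes "ord n c" "0 <= t"
 shows "idealised f g t (z, map c [0..<n]) =
  (if tau c n <= t then exp (- seg_loss g z c n t) * dens f g z c n else 0)"
 using assms
proof (induction n arbitrary: t)
 case 0
 then show ?case using seg_loss_coords[of 0 c t g z] by (simp add: idealised.simps ord_def)
next
 case (Suc n)
 have o: "ord n c" and tn: "tau c n <= fst (c n)" "0 <= fst (c n)"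
  using Suc.prems(1) ord_nonneg[OF Suc.prems(1)] unfolding ord_Suc by auto
 obtain \<tau> nu w where cn: "c n = (\<tau>, nu, w)" by (cases "c n") auto
 have IH: "idealised f g \<tau> (z, map c [0..<n]) = exp (- seg_loss g z c n \<tau>) * dens f g z c n"
  using Suc.IH[OF o, of \<tau>] tn cn by simp
 have pos: "root_pos (z, map c [0..<Suc n]) \<tau> = pos z c (Suc n)"
  using root_pos_coords[OF Suc.prems(1) order_refl, of \<tau> z] cn by simp
 have vel: "root_vel_left (z, map c [0..<Suc n]) \<tau> = vel z c n"
  using root_vel_left_coords[OF Suc.prems(1), of z] cn by simp
 have loss: "(LINT \<sigma>:{\<tau>..t}|lborel. loss_rate g \<sigma> (z, map c [0..<Suc n])) = seg_loss g z c (Suc n) t"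
  using seg_loss_coords[OF Suc.prems(1), of t g z] cn by simp
 have "last (map c [0..<Suc n]) = (\<tau>, nu, w)" "butlast (map c [0..<Suc n]) = map c [0..<n]" "map c [0..<Suc n] \<noteq> []"
  by (simp_all add: cn)
 then have "idealised f g t (z, map c [0..<Suc n]) = (if \<tau> <= t then 1 else 0) * exp (- seg_loss g z c (Suc n) t) *
   (exp (- seg_loss g z c n \<tau>) * dens f g z c n) * transported g \<tau> (pos z c (Suc n), w) * max 0 ((vel z c n - w) \<bullet> nu)"
  unfolding idealised.simps[of f g t z "map c [0..<Suc n]"] by (simp only: Let_def case_prod_conv if_False IH pos vel loss)
 then show ?case by (simp add: cn gain_def transported_def)
qed

section \<open>The collision rate\<close>

text \<open>
 The envelope \<open>gb\<close> dominates the background density uniformly in position; only its second moment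
 and the Hoelder bound of the density enter.
\<close>

locale rayleigh =
 fixes f g :: "phase => real" and gb :: "real^3 => real" and M \<alpha> T :: real
 assumes f_meas[measurable]: "f : bm borel" and f_nonneg: "!!z. 0 <= f z"
  and f_int: "(NN z. ennreal (f z) \<partial>phase_vol) = 1"
  and f_moment: "(NN z. ennreal (f z * (1 + norm (snd z))) \<partial>phase_vol) < \<infinity>"
  and g_meas[measurable]: "g : bm borel" and g_nonneg: "!!z. 0 <= g z"
  and g_periodic: "!!x v k. k : lattice ==> g (x + k, v) = g (x, v)"
  and g_int: "(NN z. ennreal (g z) \<partial>phase_vol) = 1"
  and gb_meas[measurable]: "gb : bm borel" and gb_nonneg: "!!w. 0 <= gb w"
  and gb_moment: "(NN w. ennreal (gb w * (1 + norm w)\<^sup>2) \<partial>lborel) < \<infinity>"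
  and g_le_gb: "AE w in lborel. \<forall>x. g (x, w) <= gb w"
  and M_pos: "0 < M" and \<alpha>_pos: "0 < \<alpha>"
  and g_holder: "AE w in lborel. \<forall>x y. \<bar>g (x, w) - g (y, w)\<bar> <= M * norm (x - y) powr \<alpha>"
  and T_pos: "0 < T"
begin

definition Cg :: real where "Cg = (LINT w|lborel. gb w * (1 + norm w)\<^sup>2)"

definition area :: real where "area = measure sphere_measure (space sphere_measure)"

lemma gb_integrable: "integrable lborel (%w. gb w * (1 + norm w)\<^sup>2)"
 using gb_moment gb_nonneg by (intro integrableI_nonneg) auto

lemma Cg_nonneg: "0 <= Cg"
 unfolding Cg_def by (rule integral_nonneg_AE) (use gb_nonneg in auto)

lemma area_nonneg: "0 <= area" by (simp add: area_def)

lemma emeasure_sphere: "emeasure sphere_measure (space sphere_measure) = ennreal area"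
 unfolding area_def by (rule sphere_measure.emeasure_eq_measure)

lemma nn_integral_gb: "(NN w. ennreal (gb w * (1 + norm w)\<^sup>2) \<partial>lborel) = ennreal Cg"
 unfolding Cg_def by (rule nn_integral_eq_integral[OF gb_integrable]) (use gb_nonneg in auto)

lemma max_inner_le:
 fixes u nu :: "real^3"
 assumes "norm nu = 1"
 shows "max 0 (u \<bullet> nu) <= norm u"
 using norm_cauchy_schwarz[of u nu] assms by simp

text \<open>The weight \<open>(1 + norm w) ^ 2\<close> absorbs the relative speed and one further
  power of \<open>norm w\<close>. That further power appears when the kernel is multiplied by the
  speed after a collision.\<close>

lemma kernel_weight:
 fixes v w nu :: "real^3"
 assumes "norm nu = 1"
 shows "max 0 ((v - w) \<bullet> nu) <= (1 + norm v) * (1 + norm w)\<^sup>2"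
  and "max 0 ((v - w) \<bullet> nu) * norm w <= (1 + norm v) * (1 + norm w)\<^sup>2"
proof -
 have 1: "max 0 ((v - w) \<bullet> nu) <= norm v + norm w"
  using max_inner_le[OF assms, of "v - w"] norm_triangle_ineq4[of v w] by linarith
 have v: "0 <= norm v" and w: "0 <= norm w" by simp_all
 have 2: "norm v + norm w <= (1 + norm v) * (1 + norm w)" using v w by (simp add: algebra_simps)
 have 3: "(1 + norm v) * (1 + norm w) * q <= (1 + norm v) * (1 + norm w)\<^sup>2" if "q <= 1 + norm w" for q
  using that by (simp add: power2_eq_square mult.assoc mult_left_mono)
 show "max 0 ((v - w) \<bullet> nu) <= (1 + norm v) * (1 + norm w)\<^sup>2"
  using 1 2 3[of 1] by simp
 have "max 0 ((v - w) \<bullet> nu) * norm w <= (1 + norm v) * (1 + norm w) * norm w"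
  using 1 2 by (intro mult_right_mono) auto
 then show "max 0 ((v - w) \<bullet> nu) * norm w <= (1 + norm v) * (1 + norm w)\<^sup>2"
  using 3[of "norm w"] by simp
qed

lemma AE_sphere_lborel:
 assumes "AE w in lborel. P w"
 shows "AE p in sphere_measure \<Otimes>\<^sub>M lborel. P (snd p)"
proof -
 from assms obtain Z where Z: "Z : null_sets lborel" "{w. \<not> P w} \<subseteq> Z"
  by (auto simp: eventually_ae_filter)
 have "space sphere_measure \<times> Z : null_sets (sphere_measure \<Otimes>\<^sub>M lborel)"
  using Z by (intro lborel.times_in_null_sets2) auto
 then show ?thesis
  by (rule AE_I') (use Z in \<open>auto simp: space_pair_measure\<close>)
qed

interpretation sl: pair_sigma_finite sphere_measure "lborel :: (real^3) measure"
 by (intro pair_sigma_finite.intro sphere_measure.sigma_finite_measure_axioms lborel.sigma_finite_measure_axioms)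

lemma id_sphere: "(%nu. nu) : measurable sphere_measure borel"
 by (simp add: measurable_cong_sets[OF sets_sphere_measure refl] measurable_restrict_space1)

lemma snd_sl: "snd : measurable (sphere_measure \<Otimes>\<^sub>M lborel) (borel :: (real^3) measure)"
 using measurable_snd[of sphere_measure "lborel :: (real^3) measure"] by simp

lemma fst_sl: "fst : measurable (sphere_measure \<Otimes>\<^sub>M (lborel :: (real^3) measure)) borel"
 using measurable_compose[OF measurable_fst[of sphere_measure "lborel :: (real^3) measure"] id_sphere] by simp

lemma measurable_sl:
 assumes "F : bm (borel :: ((real^3) \<times> (real^3)) measure)"
 shows "F : bm (sphere_measure \<Otimes>\<^sub>M lborel)"
 using measurable_compose[OF measurable_Pair_borel[OF fst_sl snd_sl] assms] by simp

definition kern :: "real => real^3 => real^3 => (real^3) \<times> (real^3) => real" where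
 "kern s x v p = g (x - s *. snd p, snd p) * max 0 ((v - snd p) \<bullet> fst p)"

lemma kern_Pair: "kern s x v (nu, w) = g (x - s *. w, w) * max 0 ((v - w) \<bullet> nu)"
 by (simp add: kern_def)

lemma kern_nonneg: "0 <= kern s x v p" by (simp add: kern_def g_nonneg)

lemma kern_measurable: "kern s x v : bm (sphere_measure \<Otimes>\<^sub>M lborel)"
 unfolding kern_def by (rule measurable_sl) measurable

text \<open>The exceptional null set is the same for all times and positions, so the bound can serve
  for dominated convergence along moving arguments.\<close>

lemma kern_bound: "AE p in sphere_measure \<Otimes>\<^sub>M lborel. \<forall>s x. kern s x v p <= (1 + norm v) * (gb (snd p) * (1 + norm (snd p))\<^sup>2)"
proof -
 have sp: "AE p in sphere_measure \<Otimes>\<^sub>M (lborel :: (real^3) measure). norm (fst p) = 1"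
  by (rule AE_I2) (auto simp: space_pair_measure space_sphere_measure)
 from AE_sphere_lborel[OF g_le_gb] sp show ?thesis
 proof eventually_elim
  case (elim p)
  show ?case
  proof (intro allI)
   fix s x
   have "kern s x v p <= gb (snd p) * ((1 + norm v) * (1 + norm (snd p))\<^sup>2)"
    unfolding kern_def using elim kernel_weight(1)[of "fst p" v "snd p"]
    by (intro mult_mono) (auto simp: gb_nonneg)
   then show "kern s x v p <= (1 + norm v) * (gb (snd p) * (1 + norm (snd p))\<^sup>2)" by (simp add: mult_ac)
  qed
 qed
qed

lemma bound_integrable: "integrable (sphere_measure \<Otimes>\<^sub>M lborel) (%p. c * (gb (snd p) * (1 + norm (snd p))\<^sup>2))"
 and bound_nn_integral: "(NN p. ennreal (gb (snd p) * (1 + norm (snd p))\<^sup>2) \<partial>(sphere_measure \<Otimes>\<^sub>M lborel)) = ennreal (area * Cg)"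
proof -
 have m: "(%p. gb (snd p) * (1 + norm (snd p))\<^sup>2) : bm (sphere_measure \<Otimes>\<^sub>M lborel)"
  by (rule measurable_sl) measurable
 then have m': "(%p. ennreal (gb (snd p) * (1 + norm (snd p))\<^sup>2)) : bm (sphere_measure \<Otimes>\<^sub>M lborel)"
  by (rule measurable_compose) simp
 have "(NN p. ennreal (gb (snd p) * (1 + norm (snd p))\<^sup>2) \<partial>(sphere_measure \<Otimes>\<^sub>M lborel)) =
   (NN nu. NN w. ennreal (gb w * (1 + norm w)\<^sup>2) \<partial>lborel \<partial>sphere_measure)"
  using lborel.nn_integral_fst[OF m'] by simp
 also have "... = ennreal (area * Cg)"
  using area_nonneg Cg_nonneg by (simp add: nn_integral_gb emeasure_sphere ennreal_mult mult.commute)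
 finally show *: "(NN p. ennreal (gb (snd p) * (1 + norm (snd p))\<^sup>2) \<partial>(sphere_measure \<Otimes>\<^sub>M lborel)) = ennreal (area * Cg)" .
 have "integrable (sphere_measure \<Otimes>\<^sub>M lborel) (%p. gb (snd p) * (1 + norm (snd p))\<^sup>2)"
  using m * gb_nonneg by (intro integrableI_nonneg) auto
 then show "integrable (sphere_measure \<Otimes>\<^sub>M lborel) (%p. c * (gb (snd p) * (1 + norm (snd p))\<^sup>2))" by simp
qed

lemma kern_integrable: "integrable (sphere_measure \<Otimes>\<^sub>M lborel) (kern s x v)"
 by (rule Bochner_Integration.integrable_bound[OF bound_integrable[of "1 + norm v"] kern_measurable])
  (use kern_bound[of v] in \<open>eventually_elim, simp add: kern_nonneg gb_nonneg\<close>)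

lemma rate_eq: "rate g s x v = (LINT p|(sphere_measure \<Otimes>\<^sub>M lborel). kern s x v p)"
 unfolding rate_def using sl.integral_fst'[OF kern_integrable[of s x v]] by (simp add: kern_Pair)

lemma rate_nonneg: "0 <= rate g s x v"
 unfolding rate_eq by (rule integral_nonneg_AE) (simp add: kern_nonneg)

lemma ennreal_rate: "ennreal (rate g s x v) = (NN nu. NN w. ennreal (kern s x v (nu, w)) \<partial>lborel \<partial>sphere_measure)"
 unfolding rate_eq
proof -
 have "(%p. ennreal (kern s x v p)) : bm (sphere_measure \<Otimes>\<^sub>M lborel)"
  by (rule measurable_compose[OF kern_measurable]) simp
 from lborel.nn_integral_fst[OF this] nn_integral_eq_integral[OF kern_integrable[of s x v]]
 show "ennreal (LINT p|(sphere_measure \<Otimes>\<^sub>M lborel). kern s x v p) = (NN nu. NN w. ennreal (kern s x v (nu, w)) \<partial>lborel \<partial>sphere_measure)"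
  by (simp add: kern_nonneg)
qed

definition Cr :: real where "Cr = area * Cg"

lemma Cr_nonneg: "0 <= Cr" by (simp add: Cr_def area_nonneg Cg_nonneg)

lemma rate_le: "rate g s x v <= Cr * (1 + norm v)"
proof -
 have "rate g s x v <= (LINT p|(sphere_measure \<Otimes>\<^sub>M lborel). (1 + norm v) * (gb (snd p) * (1 + norm (snd p))\<^sup>2))"
  unfolding rate_eq
  by (rule integral_mono_AE[OF kern_integrable bound_integrable]) (use kern_bound[of v] in \<open>eventually_elim, simp\<close>)
 also have "... = (1 + norm v) * (area * Cg)"
 proof -
  have m: "(%p. gb (snd p) * (1 + norm (snd p))\<^sup>2) : bm (sphere_measure \<Otimes>\<^sub>M lborel)"
   by (rule measurable_sl) measurable
  have "(LINT p|(sphere_measure \<Otimes>\<^sub>M lborel). gb (snd p) * (1 + norm (snd p))\<^sup>2) = enn2real (ennreal (area * Cg))"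
   unfolding bound_nn_integral[symmetric] by (rule integral_eq_nn_integral[OF m]) (simp add: gb_nonneg)
  then show ?thesis using area_nonneg Cg_nonneg by simp
 qed
 finally show ?thesis by (simp add: Cr_def mult.commute)
qed

text \<open>The Hoelder bound gives pointwise convergence of the integrand, the envelope its
  domination.\<close>

lemma rate_tendsto:
 assumes "s \<longlonglongrightarrow> s0" "x \<longlonglongrightarrow> x0"
 shows "(%n. rate g (s n) (x n) v) \<longlonglongrightarrow> rate g s0 x0 v"
 unfolding rate_eq
proof (rule integral_dominated_convergence[OF kern_measurable kern_measurable bound_integrable[of "1 + norm v"]])
 show "AE p in sphere_measure \<Otimes>\<^sub>M lborel. (%n. kern (s n) (x n) v p) \<longlonglongrightarrow> kern s0 x0 v p"
  using AE_sphere_lborel[OF g_holder]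
 proof eventually_elim
  case (elim p)
  have "(%n. norm ((x n - s n *. snd p) - (x0 - s0 *. snd p))) \<longlonglongrightarrow> norm ((x0 - s0 *. snd p) - (x0 - s0 *. snd p))"
   by (intro tendsto_intros assms)
  then have "(%n. norm ((x n - s n *. snd p) - (x0 - s0 *. snd p)) powr \<alpha>) \<longlonglongrightarrow> 0"
   using \<alpha>_pos by (intro tendsto_zero_powrI[where b = \<alpha>]) auto
  then have "(%n. M * norm ((x n - s n *. snd p) - (x0 - s0 *. snd p)) powr \<alpha>) \<longlonglongrightarrow> 0"
   using tendsto_mult_right_zero by blast
  then have "(%n. g (x n - s n *. snd p, snd p) - g (x0 - s0 *. snd p, snd p)) \<longlonglongrightarrow> 0"
   by (rule Lim_null_comparison[rotated]) (use elim in auto)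
  then have "(%n. g (x n - s n *. snd p, snd p)) \<longlonglongrightarrow> g (x0 - s0 *. snd p, snd p)"
   by (simp add: LIM_zero_iff)
  then show ?case unfolding kern_def by (intro tendsto_mult tendsto_const)
 qed
 show "AE p in sphere_measure \<Otimes>\<^sub>M lborel. norm (kern (s n) (x n) v p) <= (1 + norm v) * (gb (snd p) * (1 + norm (snd p))\<^sup>2)" for n
  using kern_bound[of v] by eventually_elim (simp add: kern_nonneg)
qed

lemma seg_rate_continuous: "continuous_on UNIV (seg_rate g z c m)"
 unfolding continuous_on_sequentially
proof (intro allI ballI impI)
 fix s :: "nat => real" and s0 assume "(\<forall>n. s n : UNIV) & s \<longlonglongrightarrow> s0"
 then have s: "s \<longlonglongrightarrow> s0" by simp
 show "(seg_rate g z c m \<circ> s) \<longlonglongrightarrow> seg_rate g z c m s0"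
  unfolding comp_def seg_rate_def by (intro rate_tendsto tendsto_intros s)
qed

lemma seg_rate_nonneg: "0 <= seg_rate g z c m s" by (simp add: seg_rate_def rate_nonneg)

lemma seg_rate_le: "seg_rate g z c m s <= Cr * (1 + norm (vel z c m))" by (simp add: seg_rate_def rate_le)

end

text \<open>The integrand is the derivative of \<open>- exp (- A s) * exp (- l * s)\<close>. The
  value \<open>l = 0\<close> serves the balance of masses, \<open>l = 2 * Cr\<close> the weighted
  bound on the number of collisions.\<close>

lemma nn_integral_survival:
 fixes L :: "real => real"
 assumes L: "continuous_on UNIV L" "!!s. 0 <= L s" and ab: "a <= b" and l: "0 <= l"
 defines "A \<equiv> %s. LINT r:{a..s}|lborel. L r"
 shows "(NN s. ennreal ((L s + l) * exp (- A s) * exp (- l * s)) * indicator {a..b} s \<partial>lborel)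
  = ennreal (exp (- l * a) - exp (- A b) * exp (- l * b))"
proof -
 have A: "A s = integral {a..s} L" for s
  unfolding A_def by (rule set_borel_integral_eq_integral(2)[OF borel_integrable_atLeastAtMost'])
   (use L(1) continuous_on_subset in blast)
 let ?F = "%s. - exp (- A s) * exp (- l * s)"
 have der: "DERIV ?F s :> (L s + l) * exp (- A s) * exp (- l * s)" if "a < s" "s < b" for s
 proof -
  have "((%u. integral {a..u} L) has_real_derivative L s) (at s within {a..b})"
   by (rule integral_has_real_derivative) (use L(1) that continuous_on_subset in auto)
  then have "((%u. integral {a..u} L) has_real_derivative L s) (at s)"
   using that by (simp add: at_within_Icc_at)
  then have "(A has_real_derivative L s) (at s)" unfolding A .
  then show ?thesis by (auto intro!: derivative_eq_intros simp: algebra_simps)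
 qed
 have cont: "continuous_on {a..b} ?F"
 proof -
  have "continuous_on {a..b} A"
   unfolding A by (rule indefinite_integral_continuous_1, rule integrable_continuous_real)
    (use L(1) continuous_on_subset in blast)
  then show ?thesis by (intro continuous_intros)
 qed
 have "((%s. (L s + l) * exp (- A s) * exp (- l * s)) has_integral (?F b - ?F a)) {a..b}"
  by (rule fundamental_theorem_of_calculus_interior[OF ab cont])
   (use der in \<open>auto simp: has_real_derivative_iff_has_vector_derivative[symmetric]\<close>)
 moreover have "A a = 0" by (simp add: A)
 ultimately have hi: "((%s. (L s + l) * exp (- A s) * exp (- l * s)) has_integral (exp (- l * a) - exp (- A b) * exp (- l * b))) {a..b}"
  by simp
 have "(NN s. ennreal (((L s + l) * exp (- A s) * exp (- l * s)) * indicator {a..b} s) \<partial>lborel)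
  = ennreal (exp (- l * a) - exp (- A b) * exp (- l * b))"
 proof (rule nn_integral_has_integral_lborel)
  have [measurable]: "L : bm borel" using L(1) by (rule borel_measurable_continuous_onI)
  have "continuous_on {a..b} (%s. (L s + l) * exp (- A s) * exp (- l * s))"
   unfolding A by (intro continuous_intros indefinite_integral_continuous_1 integrable_continuous_real)
    (use L(1) continuous_on_subset in blast)+
  then have "(%s. indicator {a..b} s *. ((L s + l) * exp (- A s) * exp (- l * s))) : bm borel"
   by (rule borel_measurable_continuous_on_indicator[rotated]) simp
  then show "(%s. ((L s + l) * exp (- A s) * exp (- l * s)) * indicator {a..b} s) : bm borel"
   by (simp add: mult.commute)
  show "((%s. (L s + l) * exp (- A s) * exp (- l * s) * indicator {a..b} s) has_integral (exp (- l * a) - exp (- A b) * exp (- l * b))) UNIV"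
  proof -
   have "(%s. (L s + l) * exp (- A s) * exp (- l * s) * indicator {a..b} s)
    = (%s. if s : {a..b} then (L s + l) * exp (- A s) * exp (- l * s) else 0)"
    by (auto simp: indicator_def)
   then show ?thesis using hi by (simp only: has_integral_restrict_UNIV)
  qed
 qed (use L(2) l in auto)
 moreover have "ennreal (((L s + l) * exp (- A s) * exp (- l * s)) * indicator {a..b} s)
   = ennreal ((L s + l) * exp (- A s) * exp (- l * s)) * indicator {a..b} s" for s
  by (auto simp: indicator_def)
 ultimately show ?thesis by (simp only:)
qed

section \<open>Total mass of the idealised distribution\<close>

lemma measurable_coords:
 assumes Z: "Z : bm R" and C: "!!i. i < m ==> (%om. C om i) : bm R"
 shows measurable_tau: "(%om. tau (C om) m) : bm R"
  and measurable_vel: "(%om. vel (Z om) (C om) m) : bm R"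
  and measurable_pos: "(%om. pos (Z om) (C om) m) : bm R"
proof -
 have tau: "(%om. tau (C om) k) : bm R" if "k <= m" for k
  using that C by (cases k) auto
 then show "(%om. tau (C om) m) : bm R" by simp
 have vel: "(%om. vel (Z om) (C om) k) : bm R" if "k <= m" for k
  using that
 proof (induction k)
  case (Suc k)
  have [measurable]: "(%om. C om k) : bm R" using C Suc.prems by simp
  have [measurable]: "(%om. vel (Z om) (C om) k) : bm R" using Suc by simp
  show ?case by (simp add: deflect_def)
 qed (use Z in simp)
 then show "(%om. vel (Z om) (C om) m) : bm R" by simp
 have "(%om. pos (Z om) (C om) k) : bm R" if "k <= m" for k
  using that
 proof (induction k)
  case (Suc k)
  have [measurable]: "(%om. pos (Z om) (C om) k) : bm R" "(%om. vel (Z om) (C om) k) : bm R"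
   "(%om. tau (C om) k) : bm R" "(%om. tau (C om) (Suc k)) : bm R"
   using Suc vel[of k] tau[of k] tau[of "Suc k"] by simp_all
  show ?case unfolding pos.simps by measurable
 qed (use Z in simp)
 then show "(%om. pos (Z om) (C om) m) : bm R" by simp
qed

lemma pred_ord:
 assumes C: "!!i. i < m ==> (%om. C om i) : bm R"
 shows "Measurable.pred R (%om. ord m (C om))"
 using C
proof (induction m)
 case 0
 then show ?case by (simp add: ord_def)
next
 case (Suc m)
 have [measurable]: "(%om. C om m) : bm R" using Suc.prems by simp
 have [measurable]: "(%om. tau (C om) m) : bm R"
  using Suc.prems by (cases m) auto
 have [measurable]: "Measurable.pred R (%om. ord m (C om))" using Suc by simp
 show ?case unfolding ord_Suc by measurable
qed

section \<open>Integrals over collisions and over the last collision of a tree\<close>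

lemma sigma_finite_collision_vol: "sigma_finite_measure (collision_vol T)"
proof -
 interpret A: sigma_finite_measure "restrict_space lborel {0..T}"
  by (rule sigma_finite_measure_restrict_space) (simp_all add: lborel.sigma_finite_measure_axioms)
 interpret B: pair_sigma_finite sphere_measure "lborel :: (real^3) measure"
  by (intro pair_sigma_finite.intro sphere_measure.sigma_finite_measure_axioms lborel.sigma_finite_measure_axioms)
 interpret C: pair_sigma_finite "restrict_space lborel {0..T}" "sphere_measure \<Otimes>\<^sub>M (lborel :: (real^3) measure)"
  by (intro pair_sigma_finite.intro A.sigma_finite_measure_axioms B.sigma_finite_measure_axioms)
 show ?thesis unfolding collision_vol_def by (rule C.sigma_finite_measure_axioms)
qed

lemma id_collision_vol: "(%c. c) : measurable (collision_vol T) borel"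
proof -
 have t: "(%t. t) : measurable (restrict_space lborel {0..T}) (borel :: real measure)"
  by (rule measurable_restrict_space1) simp
 have nu: "(%nu. nu) : measurable sphere_measure (borel :: (real^3) measure)"
  by (simp add: measurable_cong_sets[OF sets_sphere_measure refl] measurable_restrict_space1)
 have "(%c. (fst c, fst (snd c), snd (snd c))) : bm (collision_vol T)"
  unfolding collision_vol_def
 proof (intro measurable_Pair_borel)
  show "fst : bm (restrict_space lborel {0..T} \<Otimes>\<^sub>M sphere_measure \<Otimes>\<^sub>M (lborel :: (real^3) measure))"
   using measurable_compose[OF measurable_fst[of "restrict_space lborel {0..T}" "sphere_measure \<Otimes>\<^sub>M (lborel :: (real^3) measure)"] t] by simp
  have s: "snd : measurable (restrict_space lborel {0..T} \<Otimes>\<^sub>M sphere_measure \<Otimes>\<^sub>M lborel) (sphere_measure \<Otimes>\<^sub>M (lborel :: (real^3) measure))"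
   by (rule measurable_snd)
  show "(%c. fst (snd c)) : bm (restrict_space lborel {0..T} \<Otimes>\<^sub>M sphere_measure \<Otimes>\<^sub>M (lborel :: (real^3) measure))"
   using measurable_compose[OF measurable_compose[OF s measurable_fst] nu] by simp
  show "(%c. snd (snd c)) : bm (restrict_space lborel {0..T} \<Otimes>\<^sub>M sphere_measure \<Otimes>\<^sub>M (lborel :: (real^3) measure))"
   using measurable_compose[OF s measurable_snd] by simp
 qed
 then show ?thesis by simp
qed

lemma collision_vol_measurable: "F : measurable borel M ==> F : measurable (collision_vol T) M"
 using measurable_compose[OF id_collision_vol] by blast

lemma nn_integral_collision_vol:
 assumes F: "F : bm borel"
 shows "(NN c. F c \<partial>collision_vol T) =
  (NN t. (NN nu. NN w. F (t, nu, w) \<partial>lborel \<partial>sphere_measure) * indicator {0..T} t \<partial>lborel)"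
proof -
 let ?R = "restrict_space lborel {0..T}"
 let ?S = "sphere_measure \<Otimes>\<^sub>M (lborel :: (real^3) measure)"
 interpret B: pair_sigma_finite sphere_measure "lborel :: (real^3) measure"
  by (intro pair_sigma_finite.intro sphere_measure.sigma_finite_measure_axioms lborel.sigma_finite_measure_axioms)
 have Fm: "F : bm (?R \<Otimes>\<^sub>M ?S)"
  using collision_vol_measurable[OF F] by (simp add: collision_vol_def)
 have "(NN c. F c \<partial>collision_vol T) = (NN t. NN p. F (t, p) \<partial>?S \<partial>?R)"
  unfolding collision_vol_def by (rule B.nn_integral_fst[OF Fm, symmetric])
 also have "... = (NN t. NN nu. NN w. F (t, nu, w) \<partial>lborel \<partial>sphere_measure \<partial>?R)"
 proof (rule nn_integral_cong)
  fix t assume "t : space ?R"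
  then have "(%p. F (t, p)) : bm ?S" by (rule measurable_Pair2[OF Fm])
  from lborel.nn_integral_fst[OF this]
  show "(NN p. F (t, p) \<partial>?S) = (NN nu. NN w. F (t, nu, w) \<partial>lborel \<partial>sphere_measure)" by simp
 qed
 also have "... = (NN t. (NN nu. NN w. F (t, nu, w) \<partial>lborel \<partial>sphere_measure) * indicator {0..T} t \<partial>lborel)"
  by (subst nn_integral_restrict_space) simp_all
 finally show ?thesis .
qed

lemma tree_coords_components:
 shows "(%zc. fst zc) : bm (tree_coords_vol T n)"
  and "i < n ==> (%zc. snd zc i) : bm (tree_coords_vol T n)"
proof -
 show "(%zc. fst zc) : bm (tree_coords_vol T n)"
  unfolding tree_coords_vol_def
  using measurable_compose[OF measurable_fst measurable_phase_volI[of "%x. x" borel]] by simp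
 assume "i < n"
 then have "(%c. c i) : measurable (PiM {..<n} (%_. collision_vol T)) (collision_vol T)"
  by (intro measurable_component_singleton) simp
 then show "(%zc. snd zc i) : bm (tree_coords_vol T n)"
  unfolding tree_coords_vol_def
  using measurable_compose[OF measurable_compose[OF measurable_snd[of phase_vol "PiM {..<n} (%_. collision_vol T)"] \<open>(%c. c i) : _\<close>] id_collision_vol] by simp
qed

lemma measurable_tree_upd:
 "(%(zc, x). (fst zc, (snd zc)(n := x))) : measurable (tree_coords_vol T n \<Otimes>\<^sub>M collision_vol T) (tree_coords_vol T (Suc n))"
 unfolding tree_coords_vol_def case_prod_beta'
proof (rule measurable_Pair)
 show "(%x. fst (fst x)) : measurable ((phase_vol \<Otimes>\<^sub>M PiM {..<n} (%_. collision_vol T)) \<Otimes>\<^sub>M collision_vol T) phase_vol"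
  by measurable
 show "(%x. (snd (fst x))(n := snd x)) : measurable ((phase_vol \<Otimes>\<^sub>M PiM {..<n} (%_. collision_vol T)) \<Otimes>\<^sub>M collision_vol T) (PiM {..<Suc n} (%_. collision_vol T))"
  unfolding lessThan_Suc by (rule measurable_fun_upd[where J = "{..<n}"]) auto
qed

lemma nn_integral_tree_coords_Suc:
 assumes F: "F : bm (tree_coords_vol T (Suc n))"
 shows "(NN zc. F zc \<partial>tree_coords_vol T (Suc n)) =
  (NN zc. NN x. F (fst zc, (snd zc)(n := x)) \<partial>collision_vol T \<partial>tree_coords_vol T n)"
proof -
 interpret P: product_sigma_finite "%_::nat. collision_vol T"
  by (intro product_sigma_finite.intro sigma_finite_collision_vol)
 interpret C: sigma_finite_measure "collision_vol T" by (rule sigma_finite_collision_vol)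
 interpret PS: sigma_finite_measure "PiM {..<Suc n} (%_. collision_vol T)" by (rule P.sigma_finite) simp
 interpret Pn: sigma_finite_measure "PiM {..<n} (%_. collision_vol T)" by (rule P.sigma_finite) simp
 have upd: "(%zc. NN x. F (fst zc, (snd zc)(n := x)) \<partial>collision_vol T) : bm (tree_coords_vol T n)"
  by (rule sigma_finite_measure.borel_measurable_nn_integral[OF sigma_finite_collision_vol]) (use measurable_compose[OF measurable_tree_upd F] in \<open>simp add: case_prod_beta'\<close>)
 have "(NN zc. F zc \<partial>tree_coords_vol T (Suc n)) = (NN z. NN c. F (z, c) \<partial>PiM {..<Suc n} (%_. collision_vol T) \<partial>phase_vol)"
  using PS.nn_integral_fst[of F phase_vol] F by (simp add: tree_coords_vol_def)
 also have "... = (NN z. NN c. NN x. F (z, c(n := x)) \<partial>collision_vol T \<partial>PiM {..<n} (%_. collision_vol T) \<partial>phase_vol)"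
  unfolding lessThan_Suc
 proof (intro nn_integral_cong P.product_nn_integral_insert)
  fix z assume "z : space phase_vol"
  then show "(%c. F (z, c)) : bm (PiM (insert n {..<n}) (%_. collision_vol T))"
   using measurable_Pair2[of F phase_vol "PiM {..<Suc n} (%_. collision_vol T)" borel z] F
   by (simp add: tree_coords_vol_def lessThan_Suc)
 qed auto
 also have "... = (NN zc. NN x. F (fst zc, (snd zc)(n := x)) \<partial>collision_vol T \<partial>tree_coords_vol T n)"
  using Pn.nn_integral_fst[of "%zc. NN x. F (fst zc, (snd zc)(n := x)) \<partial>collision_vol T" phase_vol] upd
  by (simp add: tree_coords_vol_def)
 finally show ?thesis .
qed

text \<open>Quantities of piece \<open>n\<close> involve only the collisions before it, so the
  record with index \<open>n\<close> can be integrated out with everything else fixed.\<close>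

lemma coords_upd[simp]:
 "tau (c(n := x)) n = tau c n" "vel z (c(n := x)) n = vel z c n" "pos z (c(n := x)) n = pos z c n"
 "ord n (c(n := x)) = ord n c"
proof -
 show 1: "tau (c(n := x)) n = tau c n" "vel z (c(n := x)) n = vel z c n" "pos z (c(n := x)) n = pos z c n"
  by (rule coords_cong; simp)+
 show "ord n (c(n := x)) = ord n c" unfolding ord_def 1 by auto
qed

lemma seg_upd[simp]:
 "seg_rate g z (c(n := x)) n = seg_rate g z c n" "seg_loss g z (c(n := x)) n = seg_loss g z c n"
 by (auto simp: seg_rate_def seg_loss_def fun_eq_iff)

lemma dens_cong: "(!!i. i < n ==> c i = c' i) ==> dens f g z c n = dens f g z c' n"
proof (induction n)
 case (Suc n)
 have e: "tau c n = tau c' n" "vel z c n = vel z c' n" "pos z c n = pos z c' n" "pos z c (Suc n) = pos z c' (Suc n)"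
  "dens f g z c n = dens f g z c' n" "c n = c' n"
  using Suc coords_cong(1,2,3)[of n c c'] coords_cong(3)[of "Suc n" c c'] by (simp_all del: pos.simps)
 then show ?case
  by (simp add: seg_loss_def seg_rate_def gain_def del: pos.simps)
qed simp

lemma dens_upd[simp]: "dens f g z (c(n := x)) n = dens f g z c n"
 by (rule dens_cong) simp


context rayleigh
begin

interpretation sl: pair_sigma_finite sphere_measure "lborel :: (real^3) measure"
 by (intro pair_sigma_finite.intro sphere_measure.sigma_finite_measure_axioms lborel.sigma_finite_measure_axioms)

lemma rate_measurable:
 assumes s: "s : bm R" and x: "x : bm R" and v: "v : bm R"
 shows "(%om. rate g (s om) (x om) (v om)) : bm R"
 unfolding rate_eq
proof (rule sl.borel_measurable_lebesgue_integral)
 let ?Q = "R \<Otimes>\<^sub>M (sphere_measure \<Otimes>\<^sub>M (lborel :: (real^3) measure))"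
 have f: "(%q. fst q) : measurable ?Q R" by (rule measurable_fst)
 have p: "(%q. snd q) : bm ?Q"
  using measurable_compose[OF measurable_snd measurable_sl[of "%p. p"]] measurable_compose[OF measurable_snd measurable_Pair_borel[OF fst_sl snd_sl]] by simp
 have [measurable]: "(%q. s (fst q)) : bm ?Q" "(%q. x (fst q)) : bm ?Q" "(%q. v (fst q)) : bm ?Q"
  using measurable_compose[OF f] s x v by auto
 note [measurable] = p
 show "(%(om, p). kern (s om) (x om) (v om) p) : bm ?Q"
  unfolding kern_def case_prod_beta' by measurable
qed

lemma seg_rate_measurable:
 assumes Z: "Z : bm R" and C: "!!i. i < m ==> (%om. C om i) : bm R" and s: "s : bm R"
 shows "(%om. seg_rate g (Z om) (C om) m (s om)) : bm R"
 unfolding seg_rate_def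
proof (rule rate_measurable)
 note [measurable] = measurable_coords[of Z R m C, OF Z C] s
 show "s : bm R" by (rule s)
 show "(%om. vel (Z om) (C om) m) : bm R" by measurable
 show "(%om. pos (Z om) (C om) m + (s om - tau (C om) m) *. vel (Z om) (C om) m) : bm R" by measurable
qed

lemma seg_loss_measurable:
 assumes Z: "Z : bm R" and C: "!!i. i < m ==> (%om. C om i) : bm R" and t: "t : bm R"
 shows "(%om. seg_loss g (Z om) (C om) m (t om)) : bm R"
 unfolding seg_loss_def set_lebesgue_integral_def
proof (rule lborel.borel_measurable_lebesgue_integral)
 let ?Q = "R \<Otimes>\<^sub>M (lborel :: real measure)"
 have f: "(%q. fst q) : measurable ?Q R" by (rule measurable_fst)
 have s[measurable]: "(%q. snd q) : bm ?Q" using measurable_snd[of R "lborel :: real measure"] by simp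
 have [measurable]: "(%q. t (fst q)) : bm ?Q" by (rule measurable_compose[OF f t])
 have [measurable]: "(%q. tau (C (fst q)) m) : bm ?Q"
  by (rule measurable_compose[OF f measurable_tau[OF Z C]])
 have [measurable]: "(%q. seg_rate g (Z (fst q)) (C (fst q)) m (snd q)) : bm ?Q"
  by (rule seg_rate_measurable) (use measurable_compose[OF f] Z C s in auto)
 have "(%q. (if tau (C (fst q)) m <= snd q & snd q <= t (fst q) then 1 else 0) *. seg_rate g (Z (fst q)) (C (fst q)) m (snd q)) : bm ?Q"
  by measurable
 then show "(%(om, s). indicat_real {tau (C om) m..t om} s *. seg_rate g (Z om) (C om) m s) : bm ?Q"
  by (simp add: indicator_def case_prod_beta' of_bool_def)
qed

lemma dens_measurable:
 assumes Z: "Z : bm R" and C: "!!i. i < n ==> (%om. C om i) : bm R"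
 shows "(%om. dens f g (Z om) (C om) n) : bm R"
 using C
proof (induction n)
 case 0
 then show ?case using measurable_compose[OF Z f_meas] by simp
next
 case (Suc n)
 have [measurable]: "(%om. C om n) : bm R" using Suc.prems by simp
 have [measurable]: "(%om. dens f g (Z om) (C om) n) : bm R" using Suc by simp
 have [measurable]: "(%om. seg_loss g (Z om) (C om) n (fst (C om n))) : bm R"
  by (rule seg_loss_measurable[OF Z]) (use Suc.prems in auto)
 have [measurable]: "(%om. pos (Z om) (C om) (Suc n)) : bm R" by (rule measurable_pos[OF Z Suc.prems])
 have [measurable]: "(%om. vel (Z om) (C om) n) : bm R" by (rule measurable_vel[OF Z]) (use Suc.prems in auto)
 have "(%om. gain g (Z om) (C om) n) : bm R" unfolding gain_def by measurable
 then show ?case by simp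
qed

lemma gain_nonneg: "0 <= gain g z c n" by (simp add: gain_def g_nonneg)

lemma dens_nonneg: "0 <= dens f g z c n"
 by (induction n) (auto simp: f_nonneg gain_nonneg)

lemma gain_upd: "gain g z (c(n := x)) n =
  kern (fst x) (pos z c n + (fst x - tau c n) *. vel z c n) (vel z c n) (snd x)"
 by (simp add: gain_def kern_def)

lemma dens_Suc_upd: "dens f g z (c(n := x)) (Suc n) = dens f g z c n * exp (- seg_loss g z c n (fst x)) *
  kern (fst x) (pos z c n + (fst x - tau c n) *. vel z c n) (vel z c n) (snd x)"
 by (simp add: gain_upd)

lemma kern_measurable_time:
 "(%x. kern (fst x) (a + (fst x - b) *. v) v (snd x)) : bm (borel :: collision measure)"
 unfolding kern_def by measurable

lemma seg_loss_measurable_time: "(%s. seg_loss g z c n s) : bm borel"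
 using seg_loss_measurable[of "%_. z" borel n "%_. c" "%s. s"] by simp

lemma seg_loss_nonneg: "0 <= seg_loss g z c n t"
 unfolding seg_loss_def set_lebesgue_integral_def
 by (rule integral_nonneg_AE) (simp add: seg_rate_nonneg)

text \<open>Integrates out the last collision against a test function: \<open>\<Omega> = 1\<close>
  leads to the loss rate, a velocity weight to the moment bound.\<close>

lemma next_collision_integral:
 assumes o: "ord n c" and t: "t <= T" and \<Omega>[measurable]: "\<Omega> : bm borel" and \<Omega>_nonneg: "!!x. 0 <= \<Omega> x"
 shows "(NN x. (if ord (Suc n) (c(n := x)) & fst x <= t then ennreal (dens f g z (c(n := x)) (Suc n) * \<Omega> x) else 0) \<partial>collision_vol T)
  = (NN s. ennreal (dens f g z c n * exp (- seg_loss g z c n s)) *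
    (NN nu. NN w. ennreal (kern s (pos z c n + (s - tau c n) *. vel z c n) (vel z c n) (nu, w) * \<Omega> (s, nu, w)) \<partial>lborel \<partial>sphere_measure)
    * indicator {tau c n..t} s \<partial>lborel)"
proof -
 let ?k = "%x. kern (fst x) (pos z c n + (fst x - tau c n) *. vel z c n) (vel z c n) (snd x)"
 let ?d = "%s. dens f g z c n * exp (- seg_loss g z c n s)"
 note [measurable] = kern_measurable_time seg_loss_measurable_time
 let ?F = "%x. if (tau c n <= fst x & (0 < n --> tau c n < fst x)) & fst x <= t then ennreal (?d (fst x) * ?k x * \<Omega> x) else 0"
 have F: "?F : bm borel" by measurable
 have d: "0 <= ?d s" for s by (simp add: dens_nonneg)
 have "(NN x. (if ord (Suc n) (c(n := x)) & fst x <= t then ennreal (dens f g z (c(n := x)) (Suc n) * \<Omega> x) else 0) \<partial>collision_vol T)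
  = (NN x. ?F x \<partial>collision_vol T)"
  unfolding dens_Suc_upd ord_Suc using o by (intro nn_integral_cong) simp
 also have "... = (NN s. (NN nu. NN w. ?F (s, nu, w) \<partial>lborel \<partial>sphere_measure) * indicator {0..T} s \<partial>lborel)"
  by (rule nn_integral_collision_vol[OF F])
 also have "... = (NN s. ennreal (?d s) *
    (NN nu. NN w. ennreal (kern s (pos z c n + (s - tau c n) *. vel z c n) (vel z c n) (nu, w) * \<Omega> (s, nu, w)) \<partial>lborel \<partial>sphere_measure)
    * indicator {tau c n..t} s \<partial>lborel)"
 proof (rule nn_integral_cong_AE)
  \<comment> \<open>At the start of the piece \<open>ord_Suc\<close> asks for a strict or a
    non-strict inequality according to \<open>n\<close>; removing one point makes both
    agree.\<close>
  have "AE s in lborel. s \<noteq> tau c n" by (rule AE_lborel_singleton)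
  then show "AE s in lborel. (NN nu. NN w. ?F (s, nu, w) \<partial>lborel \<partial>sphere_measure) * indicator {0..T} s =
   ennreal (?d s) * (NN nu. NN w. ennreal (kern s (pos z c n + (s - tau c n) *. vel z c n) (vel z c n) (nu, w) * \<Omega> (s, nu, w)) \<partial>lborel \<partial>sphere_measure)
    * indicator {tau c n..t} s"
  proof eventually_elim
   case (elim s)
   show ?case
   proof (cases "s : {tau c n..t}")
    case True
    have s: "s : {0..T}" "tau c n < s" using True elim t ord_nonneg[OF o] by auto
    let ?K = "%nu w. ennreal (kern s (pos z c n + (s - tau c n) *. vel z c n) (vel z c n) (nu, w) * \<Omega> (s, nu, w))"
    have Km: "(%p. ennreal (kern s (pos z c n + (s - tau c n) *. vel z c n) (vel z c n) p * \<Omega> (s, p))) : bm (sphere_measure \<Otimes>\<^sub>M lborel)"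
     unfolding kern_def by (rule measurable_sl) measurable
    have Kw: "(%w. ?K nu w) : bm lborel" for nu
     unfolding kern_Pair by measurable
    have "(NN nu. NN w. ?F (s, nu, w) \<partial>lborel \<partial>sphere_measure) = (NN nu. NN w. ennreal (?d s) * ?K nu w \<partial>lborel \<partial>sphere_measure)"
     using True s d[of s] by (intro nn_integral_cong) (simp add: ennreal_mult[symmetric] kern_nonneg \<Omega>_nonneg mult.assoc)
    also have "... = (NN nu. ennreal (?d s) * (NN w. ?K nu w \<partial>lborel) \<partial>sphere_measure)"
     by (intro nn_integral_cong nn_integral_cmult Kw)
    also have "... = ennreal (?d s) * (NN nu. NN w. ?K nu w \<partial>lborel \<partial>sphere_measure)"
     using lborel.borel_measurable_nn_integral_fst[OF Km] by (intro nn_integral_cmult) simp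
    finally show ?thesis using True s by simp
   next
    case False
    then have "?F (s, nu, w) = 0" for nu w by auto
    then show ?thesis using False by simp
   qed
  qed
 qed
 finally show ?thesis .
qed

definition alive :: "nat => real => phase \<times> (nat => collision) => bool" where
 "alive n t zc \<longleftrightarrow> ord n (snd zc) & tau (snd zc) n <= t"

text \<open>To be read as the probability of at least \<open>n\<close> collisions up to time
  \<open>t\<close> in the idealised process; \<open>mass n t\<close> is that of exactly
  \<open>n\<close>.\<close>

definition jumps :: "nat => real => ennreal" where
 "jumps n t = (NN zc. (if alive n t zc then ennreal (dens f g (fst zc) (snd zc) n) else 0) \<partial>tree_coords_vol T n)"

definition mass :: "nat => real => ennreal" where
 "mass n t = (NN zc. (if alive n t zc then ennreal (exp (- seg_loss g (fst zc) (snd zc) n t) * dens f g (fst zc) (snd zc) n) else 0) \<partial>tree_coords_vol T n)"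

lemma coords_measurable[measurable]:
 "(%zc. dens f g (fst zc) (snd zc) n) : bm (tree_coords_vol T n)"
 "Measurable.pred (tree_coords_vol T n) (alive n t)"
 "(%zc. seg_loss g (fst zc) (snd zc) n t) : bm (tree_coords_vol T n)"
 "(%zc. vel (fst zc) (snd zc) n) : bm (tree_coords_vol T n)"
 "(%zc. tau (snd zc) n) : bm (tree_coords_vol T n)"
proof -
 note c = tree_coords_components(1)[of T n] tree_coords_components(2)[of _ n T]
 show "(%zc. dens f g (fst zc) (snd zc) n) : bm (tree_coords_vol T n)" by (rule dens_measurable[OF c])
 show 1: "(%zc. tau (snd zc) n) : bm (tree_coords_vol T n)" by (rule measurable_tau[OF c])
 show "(%zc. vel (fst zc) (snd zc) n) : bm (tree_coords_vol T n)" by (rule measurable_vel[OF c])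
 show "(%zc. seg_loss g (fst zc) (snd zc) n t) : bm (tree_coords_vol T n)"
  by (rule seg_loss_measurable[OF c]) simp_all
 have "Measurable.pred (tree_coords_vol T n) (%zc. ord n (snd zc))" by (rule pred_ord[OF c(2)])
 then show "Measurable.pred (tree_coords_vol T n) (alive n t)"
  unfolding alive_def[abs_def] using 1 by measurable
qed

text \<open>At least \<open>n\<close> collisions means at least \<open>Suc n\<close> or exactly
  \<open>n\<close>: by \<open>nn_integral_survival\<close>, the density of the next collision time
  integrates to one minus the survival probability.\<close>

lemma jumps_Suc:
 assumes t: "0 <= t" "t <= T"
 shows "jumps (Suc n) t + mass n t = jumps n t"
proof -
 have inner: "(NN x. (if alive (Suc n) t (z, c(n := x)) then ennreal (dens f g z (c(n := x)) (Suc n)) else 0) \<partial>collision_vol T)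
   = (if alive n t (z, c) then ennreal (dens f g z c n * (1 - exp (- seg_loss g z c n t))) else 0)" for z c
 proof (cases "alive n t (z, c)")
  case False
  then have "\<not> alive (Suc n) t (z, c(n := x))" for x by (auto simp: alive_def ord_Suc)
  then show ?thesis using False by simp
 next
  case True
  then have o: "ord n c" "tau c n <= t" by (auto simp: alive_def)
  let ?A = "%s. seg_loss g z c n s" and ?L = "seg_rate g z c n"
  have "(NN x. (if alive (Suc n) t (z, c(n := x)) then ennreal (dens f g z (c(n := x)) (Suc n)) else 0) \<partial>collision_vol T)
   = (NN s. ennreal (dens f g z c n * exp (- ?A s)) * ennreal (?L s) * indicator {tau c n..t} s \<partial>lborel)"
   using next_collision_integral[OF o(1) t(2), of "%_. 1" z, unfolded mult_1_right]
   by (simp add: alive_def ennreal_rate[symmetric] seg_rate_def)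
  also have "... = (NN s. ennreal (dens f g z c n) * (ennreal ((?L s + 0) * exp (- ?A s) * exp (- 0 * s)) * indicator {tau c n..t} s) \<partial>lborel)"
   by (intro nn_integral_cong) (simp add: ennreal_mult dens_nonneg seg_rate_nonneg mult_ac)
  also have "... = ennreal (dens f g z c n) * ennreal (exp (- 0 * tau c n) - exp (- ?A t) * exp (- 0 * t))"
  proof (subst nn_integral_cmult)
   have "?L : bm borel" by (rule borel_measurable_continuous_onI[OF seg_rate_continuous])
   then show "(%s. ennreal ((?L s + 0) * exp (- ?A s) * exp (- 0 * s)) * indicator {tau c n..t} s) : bm lborel"
    using seg_loss_measurable_time[of z c n] by simp
   show "ennreal (dens f g z c n) * (NN s. ennreal ((?L s + 0) * exp (- ?A s) * exp (- 0 * s)) * indicator {tau c n..t} s \<partial>lborel)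
    = ennreal (dens f g z c n) * ennreal (exp (- 0 * tau c n) - exp (- ?A t) * exp (- 0 * t))"
    unfolding seg_loss_def
    by (subst nn_integral_survival[OF seg_rate_continuous seg_rate_nonneg o(2)]) simp_all
  qed
  finally show ?thesis using True seg_loss_nonneg[of z c n t] by (simp add: ennreal_mult dens_nonneg)
 qed
 have "jumps (Suc n) t = (NN zc. (if alive n t zc then ennreal (dens f g (fst zc) (snd zc) n * (1 - exp (- seg_loss g (fst zc) (snd zc) n t))) else 0) \<partial>tree_coords_vol T n)"
 proof -
  have "jumps (Suc n) t = (NN zc. NN x. (if alive (Suc n) t (fst zc, (snd zc)(n := x)) then ennreal (dens f g (fst zc) ((snd zc)(n := x)) (Suc n)) else 0) \<partial>collision_vol T \<partial>tree_coords_vol T n)"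
   unfolding jumps_def by (subst nn_integral_tree_coords_Suc) (measurable, simp only: fst_conv snd_conv)
  then show ?thesis by (simp only: inner prod.collapse)
 qed
 then have "jumps (Suc n) t + mass n t = (NN zc. (if alive n t zc then ennreal (dens f g (fst zc) (snd zc) n * (1 - exp (- seg_loss g (fst zc) (snd zc) n t))) else 0)
   + (if alive n t zc then ennreal (exp (- seg_loss g (fst zc) (snd zc) n t) * dens f g (fst zc) (snd zc) n) else 0) \<partial>tree_coords_vol T n)"
  unfolding mass_def by (simp add: nn_integral_add)
 also have "... = jumps n t"
  unfolding jumps_def
 proof (rule nn_integral_cong)
  fix zc
  define d where "d = dens f g (fst zc) (snd zc) n"
  define e where "e = exp (- seg_loss g (fst zc) (snd zc) n t)"
  have "0 <= d" "0 <= e" "e <= 1" by (simp_all add: d_def e_def dens_nonneg seg_loss_nonneg)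
  then have "ennreal (d * (1 - e)) + ennreal (e * d) = ennreal (d * (1 - e) + e * d)"
   by (intro ennreal_plus[symmetric]) auto
  also have "d * (1 - e) + e * d = d" by (simp add: algebra_simps)
  finally show "(if alive n t zc then ennreal (dens f g (fst zc) (snd zc) n * (1 - exp (- seg_loss g (fst zc) (snd zc) n t))) else 0)
   + (if alive n t zc then ennreal (exp (- seg_loss g (fst zc) (snd zc) n t) * dens f g (fst zc) (snd zc) n) else 0)
   = (if alive n t zc then ennreal (dens f g (fst zc) (snd zc) n) else 0)"
   by (simp add: d_def[symmetric] e_def[symmetric])
 qed
 finally show ?thesis .
qed

end


section \<open>A weighted bound for the number of collisions\<close>

context rayleigh
begin

text \<open>The component of \<open>v\<close> along the normal is exchanged for that of the incoming
  velocity; projections do not increase norms.\<close>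

lemma norm_deflect_le:
 assumes "norm (fst (snd x)) = 1"
 shows "norm (deflect v x) <= norm v + norm (snd (snd x))"
proof -
 define nu w where "nu = fst (snd x)" and "w = snd (snd x)"
 have n: "nu \<bullet> nu = 1" using assms by (simp add: nu_def norm_eq_1)
 have "(norm (v - (nu \<bullet> v) *. nu))\<^sup>2 = (norm v)\<^sup>2 - (nu \<bullet> v)\<^sup>2"
  unfolding power2_norm_eq_inner by (simp add: inner_simps n inner_commute power2_eq_square)
 then have "(norm (v - (nu \<bullet> v) *. nu))\<^sup>2 <= (norm v)\<^sup>2" by simp
 then have 1: "norm (v - (nu \<bullet> v) *. nu) <= norm v" by (rule power2_le_imp_le) simp
 have 2: "norm ((nu \<bullet> w) *. nu) <= norm w"
  using Cauchy_Schwarz_ineq2[of nu w] assms by (simp add: nu_def)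
 have "deflect v x = (v - (nu \<bullet> v) *. nu) + (nu \<bullet> w) *. nu"
  by (simp add: deflect_def nu_def[symmetric] w_def[symmetric] inner_diff_right scaleR_diff_left)
 then show ?thesis using norm_triangle_ineq[of "v - (nu \<bullet> v) *. nu" "(nu \<bullet> w) *. nu"] 1 2 by (simp add: w_def)
qed

text \<open>After a collision \<open>1 + norm v\<close> has grown by at most the incoming speed; its
  integral against the kernel is at most \<open>Cr * (1 + norm v)\<close> by the second part of
  \<open>kernel_weight\<close>.\<close>

lemma nn_integral_kern_weight:
 "(NN nu. NN w. ennreal (kern s x v (nu, w) * ((1 + norm (deflect v (s, nu, w))) * q)) \<partial>lborel \<partial>sphere_measure)
  <= ennreal ((rate g s x v + Cr) * (1 + norm v) * q)" if q: "0 <= q"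
proof -
 let ?b = "%p. (1 + norm v) * q * (gb (snd p) * (1 + norm (snd p))\<^sup>2)"
 have m: "(%p. ennreal (kern s x v p * ((1 + norm (deflect v (s, p))) * q))) : bm (sphere_measure \<Otimes>\<^sub>M lborel)"
  unfolding kern_def deflect_def by (rule measurable_sl) measurable
 have "(NN nu. NN w. ennreal (kern s x v (nu, w) * ((1 + norm (deflect v (s, nu, w))) * q)) \<partial>lborel \<partial>sphere_measure)
  = (NN p. ennreal (kern s x v p * ((1 + norm (deflect v (s, p))) * q)) \<partial>(sphere_measure \<Otimes>\<^sub>M lborel))"
  using lborel.nn_integral_fst[OF m] by simp
 also have "... <= (NN p. ennreal ((1 + norm v) * q * kern s x v p + ?b p) \<partial>(sphere_measure \<Otimes>\<^sub>M lborel))"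
 proof (rule nn_integral_mono_AE)
  have sp: "AE p in sphere_measure \<Otimes>\<^sub>M (lborel :: (real^3) measure). norm (fst p) = 1"
   by (rule AE_I2) (auto simp: space_pair_measure space_sphere_measure)
  from AE_sphere_lborel[OF g_le_gb] sp
  show "AE p in sphere_measure \<Otimes>\<^sub>M lborel. ennreal (kern s x v p * ((1 + norm (deflect v (s, p))) * q)) <= ennreal ((1 + norm v) * q * kern s x v p + ?b p)"
  proof eventually_elim
   case (elim p)
   have d: "1 + norm (deflect v (s, p)) <= (1 + norm v) + norm (snd p)"
    using norm_deflect_le[of "(s, p)" v] elim by simp
   have "kern s x v p * norm (snd p) = g (x - s *. snd p, snd p) * (max 0 ((v - snd p) \<bullet> fst p) * norm (snd p))"
    by (simp add: kern_def)
   also have "... <= gb (snd p) * ((1 + norm v) * (1 + norm (snd p))\<^sup>2)"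
    by (rule mult_mono[OF spec[OF elim(1)] kernel_weight(2)[OF elim(2)] gb_nonneg]) simp
   finally have k: "kern s x v p * norm (snd p) <= gb (snd p) * ((1 + norm v) * (1 + norm (snd p))\<^sup>2)" .
   have "kern s x v p * (1 + norm (deflect v (s, p))) <= kern s x v p * ((1 + norm v) + norm (snd p))"
    using d by (intro mult_left_mono) (auto simp: kern_nonneg)
   also have "... <= (1 + norm v) * kern s x v p + gb (snd p) * ((1 + norm v) * (1 + norm (snd p))\<^sup>2)"
    using k by (simp add: algebra_simps)
   finally have "kern s x v p * (1 + norm (deflect v (s, p))) * q <= ((1 + norm v) * kern s x v p + gb (snd p) * ((1 + norm v) * (1 + norm (snd p))\<^sup>2)) * q"
    using q by (rule mult_right_mono)
   then show ?case by (intro ennreal_leI) (simp add: algebra_simps)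
  qed
 qed
 also have "... = ennreal ((1 + norm v) * q * rate g s x v + (1 + norm v) * q * Cr)"
 proof -
  have "(LINT p|(sphere_measure \<Otimes>\<^sub>M lborel). gb (snd p) * (1 + norm (snd p))\<^sup>2) = Cr"
  proof -
   have m: "(%p. gb (snd p) * (1 + norm (snd p))\<^sup>2) : bm (sphere_measure \<Otimes>\<^sub>M lborel)"
    by (rule measurable_sl) measurable
   have "(LINT p|(sphere_measure \<Otimes>\<^sub>M lborel). gb (snd p) * (1 + norm (snd p))\<^sup>2) = enn2real (ennreal (area * Cg))"
    unfolding bound_nn_integral[symmetric] by (rule integral_eq_nn_integral[OF m]) (simp add: gb_nonneg)
   then show ?thesis using Cr_nonneg by (simp add: Cr_def)
  qed
  then have "(LINT p|(sphere_measure \<Otimes>\<^sub>M lborel). (1 + norm v) * q * kern s x v p + ?b p) = (1 + norm v) * q * rate g s x v + (1 + norm v) * q * Cr"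
   using kern_integrable[of s x v] bound_integrable[of "(1 + norm v) * q"] by (simp add: rate_eq)
  moreover have "integrable (sphere_measure \<Otimes>\<^sub>M lborel) (%p. (1 + norm v) * q * kern s x v p + ?b p)"
   using kern_integrable[of s x v] bound_integrable[of "(1 + norm v) * q"] by simp
  ultimately show ?thesis
   using q by (subst nn_integral_eq_integral) (auto simp: kern_nonneg gb_nonneg)
 qed
 also have "... = ennreal ((rate g s x v + Cr) * (1 + norm v) * q)" by (simp add: algebra_simps)
 finally show ?thesis .
qed

text \<open>A Lyapunov functional. Of the exponential rate \<open>2 * Cr\<close>, one
  \<open>Cr\<close> pays for the growth of \<open>1 + norm v\<close> at collisions, the other for
  the number of collisions.\<close>

definition weighted :: "nat => ennreal" where
 "weighted n = (NN zc. (if alive n T zc then ennreal (dens f g (fst zc) (snd zc) n *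
  ((1 + norm (vel (fst zc) (snd zc) n)) * exp (- (2 * Cr) * tau (snd zc) n))) else 0) \<partial>tree_coords_vol T n)"

text \<open>For a fixed tree with \<open>n\<close> collisions the two summands are bounded by
  integrals over the next collision time with rates \<open>rate + Cr\<close> and \<open>Cr\<close>.
  Their sum contains \<open>rate + 2 * Cr\<close>, which turns the integrand into an exact
  derivative; its integral is at most the weight at the start of the piece.\<close>

lemma weighted_step: "weighted (Suc n) + ennreal (exp (- (2 * Cr) * T)) * jumps (Suc n) T <= weighted n"
proof -
 let ?l = "2 * Cr"
 have inner: "(NN x. (if alive (Suc n) T (z, c(n := x)) then ennreal (dens f g z (c(n := x)) (Suc n) *
   ((1 + norm (vel z (c(n := x)) (Suc n))) * exp (- ?l * tau (c(n := x)) (Suc n)))) else 0) \<partial>collision_vol T)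
  + ennreal (exp (- ?l * T)) * (NN x. (if alive (Suc n) T (z, c(n := x)) then ennreal (dens f g z (c(n := x)) (Suc n)) else 0) \<partial>collision_vol T)
  <= (if alive n T (z, c) then ennreal (dens f g z c n * ((1 + norm (vel z c n)) * exp (- ?l * tau c n))) else 0)" for z c
 proof (cases "alive n T (z, c)")
  case False
  then have "\<not> alive (Suc n) T (z, c(n := x))" for x by (auto simp: alive_def ord_Suc)
  then show ?thesis using False by simp
 next
  case True
  then have o: "ord n c" "tau c n <= T" by (auto simp: alive_def)
  define d V where "d = dens f g z c n" and "V = vel z c n"
  have d: "0 <= d" by (simp add: d_def dens_nonneg)
  let ?A = "%s. seg_loss g z c n s" and ?L = "seg_rate g z c n"
  let ?x = "%s. pos z c n + (s - tau c n) *. V"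
  let ?I = "%s. indicator {tau c n..T} s :: ennreal"
  have [measurable]: "?L : bm borel" by (rule borel_measurable_continuous_onI[OF seg_rate_continuous])
  note [measurable] = seg_loss_measurable_time[of z c n]
  have 1: "(NN x. (if alive (Suc n) T (z, c(n := x)) then ennreal (dens f g z (c(n := x)) (Suc n) *
    ((1 + norm (vel z (c(n := x)) (Suc n))) * exp (- ?l * tau (c(n := x)) (Suc n)))) else 0) \<partial>collision_vol T)
   <= (NN s. ennreal (d * exp (- ?A s)) * ennreal ((?L s + Cr) * (1 + norm V) * exp (- ?l * s)) * ?I s \<partial>lborel)"
  proof -
   have "(NN x. (if alive (Suc n) T (z, c(n := x)) then ennreal (dens f g z (c(n := x)) (Suc n) *
    ((1 + norm (vel z (c(n := x)) (Suc n))) * exp (- ?l * tau (c(n := x)) (Suc n)))) else 0) \<partial>collision_vol T)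
    = (NN x. (if ord (Suc n) (c(n := x)) & fst x <= T then ennreal (dens f g z (c(n := x)) (Suc n) * ((1 + norm (deflect V x)) * exp (- ?l * fst x))) else 0) \<partial>collision_vol T)"
    by (intro nn_integral_cong) (simp add: alive_def V_def del: dens.simps)
   also have "... = (NN s. ennreal (d * exp (- ?A s)) *
     (NN nu. NN w. ennreal (kern s (?x s) V (nu, w) * ((1 + norm (deflect V (s, nu, w))) * exp (- ?l * s))) \<partial>lborel \<partial>sphere_measure) * ?I s \<partial>lborel)"
    unfolding d_def V_def
    by (subst next_collision_integral[OF o(1) order_refl]) (simp_all add: deflect_def)
   also have "... <= (NN s. ennreal (d * exp (- ?A s)) * ennreal ((?L s + Cr) * (1 + norm V) * exp (- ?l * s)) * ?I s \<partial>lborel)"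
    unfolding seg_rate_def V_def
    by (intro nn_integral_mono mult_right_mono mult_left_mono nn_integral_kern_weight) auto
   finally show ?thesis .
  qed
  have 2: "ennreal (exp (- ?l * T)) * (NN x. (if alive (Suc n) T (z, c(n := x)) then ennreal (dens f g z (c(n := x)) (Suc n)) else 0) \<partial>collision_vol T)
   <= (NN s. ennreal (d * exp (- ?A s)) * ennreal (Cr * (1 + norm V) * exp (- ?l * s)) * ?I s \<partial>lborel)"
  proof -
   have "(NN x. (if alive (Suc n) T (z, c(n := x)) then ennreal (dens f g z (c(n := x)) (Suc n)) else 0) \<partial>collision_vol T)
    = (NN s. ennreal (d * exp (- ?A s)) * ennreal (?L s) * ?I s \<partial>lborel)"
    using next_collision_integral[OF o(1) order_refl, of "%_. 1" z, unfolded mult_1_right]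
    by (simp add: alive_def ennreal_rate[symmetric] seg_rate_def d_def del: dens.simps)
   then have "ennreal (exp (- ?l * T)) * (NN x. (if alive (Suc n) T (z, c(n := x)) then ennreal (dens f g z (c(n := x)) (Suc n)) else 0) \<partial>collision_vol T)
    = (NN s. ennreal (exp (- ?l * T)) * (ennreal (d * exp (- ?A s)) * ennreal (?L s) * ?I s) \<partial>lborel)"
    by (simp add: nn_integral_cmult)
   also have "... <= (NN s. ennreal (d * exp (- ?A s)) * ennreal (Cr * (1 + norm V) * exp (- ?l * s)) * ?I s \<partial>lborel)"
   proof (rule nn_integral_mono)
    \<comment> \<open>On the time interval \<open>exp (- 2 * Cr * T)\<close> is at most
      \<open>exp (- 2 * Cr * s)\<close>, and the rate is at most
      \<open>Cr * (1 + norm V)\<close>.\<close>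
    fix s
    have "exp (- ?l * T) * ?L s <= exp (- ?l * s) * (Cr * (1 + norm V))" if "s <= T"
     using that Cr_nonneg seg_rate_le[of z c n s] by (intro mult_mono) (auto simp: seg_rate_nonneg V_def mult_left_mono)
    then have "ennreal (exp (- ?l * T)) * ennreal (?L s) <= ennreal (Cr * (1 + norm V) * exp (- ?l * s))" if "s <= T"
     using that by (simp add: ennreal_mult[symmetric] seg_rate_nonneg mult_ac ennreal_leI)
    then show "ennreal (exp (- ?l * T)) * (ennreal (d * exp (- ?A s)) * ennreal (?L s) * ?I s)
      <= ennreal (d * exp (- ?A s)) * ennreal (Cr * (1 + norm V) * exp (- ?l * s)) * ?I s"
     by (auto simp: indicator_def mult.left_commute intro!: mult_left_mono)
   qed
   finally show ?thesis .
  qed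
  have "(NN s. ennreal (d * exp (- ?A s)) * ennreal ((?L s + Cr) * (1 + norm V) * exp (- ?l * s)) * ?I s \<partial>lborel)
   + (NN s. ennreal (d * exp (- ?A s)) * ennreal (Cr * (1 + norm V) * exp (- ?l * s)) * ?I s \<partial>lborel)
   = (NN s. ennreal (d * (1 + norm V)) * (ennreal ((?L s + ?l) * exp (- ?A s) * exp (- ?l * s)) * ?I s) \<partial>lborel)"
  proof (subst nn_integral_add[symmetric])
   show "(NN s. ennreal (d * exp (- ?A s)) * ennreal ((?L s + Cr) * (1 + norm V) * exp (- ?l * s)) * ?I s
     + ennreal (d * exp (- ?A s)) * ennreal (Cr * (1 + norm V) * exp (- ?l * s)) * ?I s \<partial>lborel)
    = (NN s. ennreal (d * (1 + norm V)) * (ennreal ((?L s + ?l) * exp (- ?A s) * exp (- ?l * s)) * ?I s) \<partial>lborel)"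
   proof (rule nn_integral_cong)
    fix s
    have L: "0 <= ?L s" by (rule seg_rate_nonneg)
    have "ennreal (d * exp (- ?A s)) * ennreal ((?L s + Cr) * (1 + norm V) * exp (- ?l * s))
     + ennreal (d * exp (- ?A s)) * ennreal (Cr * (1 + norm V) * exp (- ?l * s))
     = ennreal (d * exp (- ?A s) * ((?L s + Cr) * (1 + norm V) * exp (- ?l * s)) + d * exp (- ?A s) * (Cr * (1 + norm V) * exp (- ?l * s)))"
     using d L Cr_nonneg by (subst ennreal_plus) (auto simp: ennreal_mult)
    also have "... = ennreal (d * (1 + norm V)) * ennreal ((?L s + ?l) * exp (- ?A s) * exp (- ?l * s))"
     using d L Cr_nonneg by (subst ennreal_mult[symmetric]) (auto intro!: arg_cong[of _ _ ennreal] simp: algebra_simps)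
    finally show "ennreal (d * exp (- ?A s)) * ennreal ((?L s + Cr) * (1 + norm V) * exp (- ?l * s)) * ?I s
     + ennreal (d * exp (- ?A s)) * ennreal (Cr * (1 + norm V) * exp (- ?l * s)) * ?I s
     = ennreal (d * (1 + norm V)) * (ennreal ((?L s + ?l) * exp (- ?A s) * exp (- ?l * s)) * ?I s)"
     by (simp add: distrib_right[symmetric] mult.assoc[symmetric])
   qed
  qed simp_all
  also have "... = ennreal (d * (1 + norm V)) * ennreal (exp (- ?l * tau c n) - exp (- ?A T) * exp (- ?l * T))"
  proof (subst nn_integral_cmult)
   show "ennreal (d * (1 + norm V)) * (NN s. ennreal ((?L s + ?l) * exp (- ?A s) * exp (- ?l * s)) * ?I s \<partial>lborel)
    = ennreal (d * (1 + norm V)) * ennreal (exp (- ?l * tau c n) - exp (- ?A T) * exp (- ?l * T))"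
    unfolding seg_loss_def using Cr_nonneg
    by (subst nn_integral_survival[OF seg_rate_continuous seg_rate_nonneg o(2)]) simp_all
  qed simp
  also have "... <= ennreal (d * (1 + norm V)) * ennreal (exp (- ?l * tau c n))"
   by (intro mult_left_mono ennreal_leI) auto
  finally have 3: "(NN s. ennreal (d * exp (- ?A s)) * ennreal ((?L s + Cr) * (1 + norm V) * exp (- ?l * s)) * ?I s \<partial>lborel)
   + (NN s. ennreal (d * exp (- ?A s)) * ennreal (Cr * (1 + norm V) * exp (- ?l * s)) * ?I s \<partial>lborel)
   <= ennreal (d * (1 + norm V)) * ennreal (exp (- ?l * tau c n))" .
  have "ennreal (d * (1 + norm V)) * ennreal (exp (- ?l * tau c n)) = ennreal (d * ((1 + norm V) * exp (- ?l * tau c n)))"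
   using d by (simp add: ennreal_mult[symmetric] mult.assoc)
  then show ?thesis using order_trans[OF add_mono[OF 1 2] 3] True by (simp add: d_def V_def)
 qed
 let ?w = "%n zc. if alive n T zc then ennreal (dens f g (fst zc) (snd zc) n *
  ((1 + norm (vel (fst zc) (snd zc) n)) * exp (- ?l * tau (snd zc) n))) else 0"
 let ?j = "%n zc. if alive n T zc then ennreal (dens f g (fst zc) (snd zc) n) else 0"
 have wm: "?w n : bm (tree_coords_vol T n)" for n by measurable
 have jm: "?j n : bm (tree_coords_vol T n)" for n by measurable
 have sm: "(%zc. NN x. F (fst zc, (snd zc)(n := x)) \<partial>collision_vol T) : bm (tree_coords_vol T n)"
  if "F : bm (tree_coords_vol T (Suc n))" for F
  by (rule sigma_finite_measure.borel_measurable_nn_integral[OF sigma_finite_collision_vol])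
   (use measurable_compose[OF measurable_tree_upd that] in \<open>simp add: case_prod_beta'\<close>)
 have "weighted (Suc n) + ennreal (exp (- ?l * T)) * jumps (Suc n) T
  = (NN zc. (NN x. ?w (Suc n) (fst zc, (snd zc)(n := x)) \<partial>collision_vol T)
   + ennreal (exp (- ?l * T)) * (NN x. ?j (Suc n) (fst zc, (snd zc)(n := x)) \<partial>collision_vol T) \<partial>tree_coords_vol T n)"
  unfolding weighted_def jumps_def nn_integral_tree_coords_Suc[OF wm] nn_integral_tree_coords_Suc[OF jm]
  using sm[OF wm] sm[OF jm] by (subst nn_integral_cmult[symmetric]) (auto simp: nn_integral_add[symmetric] simp del: dens.simps vel.simps tau.simps)
 also have "... <= weighted n"
  unfolding weighted_def
 proof (rule nn_integral_mono)
  fix zc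
  show "(NN x. ?w (Suc n) (fst zc, (snd zc)(n := x)) \<partial>collision_vol T)
   + ennreal (exp (- ?l * T)) * (NN x. ?j (Suc n) (fst zc, (snd zc)(n := x)) \<partial>collision_vol T) <= ?w n zc"
   using inner[of "fst zc" "snd zc"] by (simp only: fst_conv snd_conv prod.collapse)
 qed
 finally show ?thesis .
qed

end


section \<open>Finite expected number of collisions and total mass one\<close>

context rayleigh
begin

text \<open>Telescoping of \<open>weighted_step\<close>, followed by cancellation of the exponential
  factor.\<close>

lemma jumps_le_weighted_0: "(\<Sum>n<k. jumps (Suc n) T) <= ennreal (exp (2 * Cr * T)) * weighted 0"
proof -
 have "weighted k + ennreal (exp (- (2 * Cr) * T)) * (\<Sum>n<k. jumps (Suc n) T) <= weighted 0"
 proof (induction k)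
  case (Suc k)
  have "weighted (Suc k) + ennreal (exp (- (2 * Cr) * T)) * (\<Sum>n<Suc k. jumps (Suc n) T)
   = (weighted (Suc k) + ennreal (exp (- (2 * Cr) * T)) * jumps (Suc k) T) + ennreal (exp (- (2 * Cr) * T)) * (\<Sum>n<k. jumps (Suc n) T)"
   by (simp add: distrib_left add_ac)
  also have "... <= weighted k + ennreal (exp (- (2 * Cr) * T)) * (\<Sum>n<k. jumps (Suc n) T)"
   by (rule add_right_mono[OF weighted_step])
  finally show ?case using Suc by (rule order_trans)
 qed simp
 then have "ennreal (exp (- (2 * Cr) * T)) * (\<Sum>n<k. jumps (Suc n) T) <= weighted 0"
  by (rule order_trans[rotated]) simp
 then have "ennreal (exp (2 * Cr * T)) * (ennreal (exp (- (2 * Cr) * T)) * (\<Sum>n<k. jumps (Suc n) T)) <= ennreal (exp (2 * Cr * T)) * weighted 0"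
  by (rule mult_left_mono) simp
 moreover have "ennreal (exp (2 * Cr * T)) * ennreal (exp (- (2 * Cr) * T)) = 1"
  by (subst ennreal_mult[symmetric]) (simp_all add: exp_add[symmetric])
 ultimately show ?thesis by (simp add: mult.assoc[symmetric])
qed

lemma nn_integral_tree_coords_0:
 assumes F: "F : bm borel"
 shows "(NN zc. F (fst zc) \<partial>tree_coords_vol T 0) = (NN z. F z \<partial>phase_vol)"
proof -
 interpret P: sigma_finite_measure "PiM {..<0::nat} (%_. collision_vol T)"
  by (simp add: PiM_empty sigma_finite_measure_count_space_countable)
 have "(%zc. F (fst zc)) : bm (phase_vol \<Otimes>\<^sub>M PiM {..<0::nat} (%_. collision_vol T))"
  by (rule measurable_compose[OF measurable_fst measurable_phase_volI[OF F]])
 from P.nn_integral_fst[OF this] show ?thesis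
  unfolding tree_coords_vol_def by (simp add: PiM_empty)
qed

lemma weighted_0: "weighted 0 < \<infinity>"
proof -
 have "weighted 0 <= (NN zc. ennreal (f (fst zc) * (1 + norm (snd (fst zc)))) \<partial>tree_coords_vol T 0)"
  unfolding weighted_def by (intro nn_integral_mono) auto
 also have "... = (NN z. ennreal (f z * (1 + norm (snd z))) \<partial>phase_vol)"
  by (rule nn_integral_tree_coords_0) measurable
 also have "... < \<infinity>" by (rule f_moment)
 finally show ?thesis .
qed

lemma jumps_0: "0 <= t ==> jumps 0 t = 1"
proof -
 assume "0 <= t"
 then have "jumps 0 t = (NN zc. ennreal (f (fst zc)) \<partial>tree_coords_vol T 0)"
  unfolding jumps_def by (intro nn_integral_cong) (simp add: alive_def ord_def)
 also have "... = 1" using f_int by (subst nn_integral_tree_coords_0) simp_all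
 finally show ?thesis .
qed

text \<open>The sum over \<open>n\<close> of the probabilities of at least \<open>n\<close>
  collisions is one plus the expected number of collisions. It also provides the majorant for all
  later sums over \<open>n\<close>.\<close>

lemma suminf_jumps: "(\<Sum>n. jumps n T) < \<infinity>"
proof -
 have "(\<Sum>n<k. jumps n T) <= 1 + ennreal (exp (2 * Cr * T)) * weighted 0" for k
 proof (cases k)
  case (Suc k')
  then show ?thesis
   using jumps_le_weighted_0[of k'] T_pos by (simp add: sum.lessThan_Suc_shift jumps_0 del: sum.lessThan_Suc)
 qed simp
 then have "(\<Sum>n. jumps n T) <= 1 + ennreal (exp (2 * Cr * T)) * weighted 0"
  by (intro suminf_le_const) auto
 also have "... < \<infinity>" using weighted_0 by (simp add: ennreal_mult_less_top)
 finally show ?thesis .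
qed

lemma jumps_mono: "t <= T ==> jumps n t <= jumps n T"
 unfolding jumps_def by (intro nn_integral_mono) (auto simp: alive_def)

text \<open>By telescoping, the partial sums differ from 1 by \<open>jumps n t\<close>, which tends
  to 0 as the term of a convergent series.\<close>

lemma mass_total:
 assumes t: "0 <= t" "t <= T"
 shows "(\<Sum>n. mass n t) = 1"
proof -
 have part: "(\<Sum>k<n. mass k t) + jumps n t = 1" for n
 proof (induction n)
  case 0
  then show ?case using t by (simp add: jumps_0)
 next
  case (Suc n)
  have "(\<Sum>k<Suc n. mass k t) + jumps (Suc n) t = (\<Sum>k<n. mass k t) + (jumps (Suc n) t + mass n t)"
   by (simp add: add_ac)
  then show ?case using Suc jumps_Suc[OF t, of n] by simp
 qed
 have "(%n. jumps n T) \<longlonglongrightarrow> 0"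
 proof -
  have fin: "jumps n T < \<infinity>" for n
  proof -
   have "jumps n T <= (\<Sum>n. jumps n T)"
    using sum_le_suminf[of "%n. jumps n T" "{n}"] by simp
   then show ?thesis using suminf_jumps by (rule order_le_less_trans)
  qed
  have "summable (%n. enn2real (jumps n T))"
  proof (rule summable_suminf_not_top)
   show "(\<Sum>n. ennreal (enn2real (jumps n T))) \<noteq> top"
    using suminf_jumps fin by (simp add: ennreal_enn2real_if less_top[symmetric])
  qed simp
  then have "(%n. enn2real (jumps n T)) \<longlonglongrightarrow> 0" by (rule summable_LIMSEQ_zero)
  then have "(%n. ennreal (enn2real (jumps n T))) \<longlonglongrightarrow> ennreal 0" by (rule tendsto_ennrealI)
  then show ?thesis using fin by (simp add: ennreal_enn2real_if less_top[symmetric])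
 qed
 then have "(%n. jumps n t) \<longlonglongrightarrow> 0"
  by (rule tendsto_sandwich[OF _ _ tendsto_const, rotated 2]) (use jumps_mono[OF t(2)] in auto)
 moreover have "(%n. \<Sum>k<n. mass k t) \<longlonglongrightarrow> (\<Sum>n. mass n t)"
  by (rule summable_LIMSEQ) simp
 ultimately have "(%n. (\<Sum>k<n. mass k t) + jumps n t) \<longlonglongrightarrow> (\<Sum>n. mass n t) + 0"
  by (intro tendsto_add)
 then show ?thesis unfolding part using LIMSEQ_unique[OF tendsto_const] by fastforce
qed

end

section \<open>Trees without recollisions\<close>

text \<open>The tagged trajectory of a tree, written with \<open>min\<close> and \<open>max\<close> to make it continuous by construction.\<close>

primrec traj :: "phase => (nat => collision) => nat => real => real^3" where
 "traj z c 0 s = fst z + s *. snd z"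
| "traj z c (Suc n) s = traj z c n (min s (fst (c n))) + max 0 (s - fst (c n)) *. vel z c (Suc n)"

text \<open>Lifted path of the background particle of collision \<open>k\<close>: incoming velocity
  before the collision, outgoing velocity after it, and no second collision. At
  \<open>ep = 0\<close> it is the path of a point particle.\<close>

definition bpath :: "real => phase => (nat => collision) => nat => real => real^3" where
 "bpath ep z c k s = (case c k of (r, nu, w) => pos z c (Suc k) + ep *. nu + min 0 (s - r) *. w
  + max 0 (s - r) *. (w + (nu \<bullet> (vel z c k - w)) *. nu))"

text \<open>The pull-back of a collision record to time 0 along the incoming free flight.\<close>

definition bstart :: "real => phase => (nat => collision) => nat => phase" where
 "bstart ep z c k = (case c k of (r, nu, w) => (pos z c (Suc k) + ep *. nu - r *. w, w))"

text \<open>Quantification over rational times and integers keeps the condition measurable. A strict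
  inequality at rational times would not extend to all times; a lower bound that grows linearly away
  from the collision time does, and is strict everywhere else.\<close>

definition good :: "real => real => nat => phase => (nat => collision) => bool" where
 "good T ep n z c \<longleftrightarrow> ord n c & (0 < n --> 0 < fst (c 0)) & (\<forall>k<n. norm (fst (snd (c k))) = 1) \<and>
  (\<exists>m::nat. \<forall>k<n. \<forall>s\<in>\<rat> \<inter> {0..T}. ep + \<bar>s - fst (c k)\<bar> / real (Suc m) <= torus_dist (traj z c n s) (bpath ep z c k s))"

text \<open>By continuity the inequality extends from rational to all times, but only in its
  non-strict form. It is therefore used with a radius larger than the particle diameter.\<close>

definition nohit :: "real => nat => phase => (nat => collision) => real => phase => bool" where
 "nohit ep n z c t b \<longleftrightarrow> (\<forall>s\<in>\<rat> \<inter> {0..t}. ep <= torus_dist (traj z c n s) (fst b + s *. snd b))"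

lemma traj_continuous: "continuous_on UNIV (traj z c n)"
proof (induction n)
 case (Suc n)
 have "continuous_on UNIV (%s. traj z c n (min s (fst (c n))))"
  by (rule continuous_on_compose2[OF Suc]) (auto intro!: continuous_intros)
 then show ?case by (simp del: vel.simps) (intro continuous_intros)
qed (simp, intro continuous_intros)

lemma bpath_continuous: "continuous_on UNIV (bpath ep z c k)"
 unfolding bpath_def by (cases "c k") (simp del: pos.simps, intro continuous_intros)

lemma traj_piece:
 assumes "ord n c" "m <= n" "tau c m <= s" "m < n ==> s <= fst (c m)"
 shows "traj z c n s = pos z c m + (s - tau c m) *. vel z c m"
 using assms
proof (induction n arbitrary: m s)
 case (Suc n)
 have o: "ord n c" and tn: "tau c n <= fst (c n)" using Suc.prems(1) by (auto simp: ord_Suc)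
 have end_n: "traj z c n (fst (c n)) = pos z c (Suc n)"
  using Suc.IH[OF o order_refl tn] by simp
 show ?case
 proof (cases "m = Suc n")
  case True
  then have "fst (c n) <= s" using Suc.prems by simp
  then show ?thesis using end_n True by (simp add: min_absorb2 del: pos.simps vel.simps)
 next
  case False
  then have m: "m <= n" "m < Suc n" using Suc.prems by auto
  have "s <= fst (c n)"
  proof (cases "m = n")
   case False
   then have "fst (c m) < fst (c n)" using ord_less[OF Suc.prems(1), of m n] m by auto
   then show ?thesis using Suc.prems(4)[OF m(2)] by simp
  qed (use Suc.prems m in auto)
  then show ?thesis using Suc.IH[OF o m(1) Suc.prems(3)] Suc.prems(4) m by (simp add: min_absorb1)
 qed
qed simp

text \<open>The rationals of the open interval are dense in the closed one, and the set where the
  inequality holds is closed.\<close>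

lemma rational_le_imp_real_le:
 fixes h k :: "real => real"
 assumes "continuous_on UNIV h" "continuous_on UNIV k" "!!s. s : \<rat> \<inter> {0..T} ==> k s <= h s" "0 < T" "s : {0..T}"
 shows "k s <= h s"
proof -
 have "closed {s. k s <= h s}" using assms(1,2) by (intro closed_Collect_le) auto
 moreover have "{0<..<T} \<inter> \<rat> \<subseteq> {s. k s <= h s}" using assms(3) by auto
 ultimately have "closure ({0<..<T} \<inter> \<rat>) \<subseteq> {s. k s <= h s}" by (rule closure_minimal[rotated])
 moreover have "closure ({0<..<T} \<inter> \<rat>) = closure {0<..<T}"
  by (rule closure_open_Int_superset) (auto simp: Rats_closure_real)
 ultimately show ?thesis using assms(4,5) by (auto simp: closure_greaterThanLessThan)
qed

lemma torus_dist_shift: "l : lattice ==> torus_dist x (y - l) = torus_dist x y"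
proof -
 have le: "torus_dist x (y - l) <= torus_dist x y" if l: "l : lattice" for y l
 proof -
  have "torus_dist x (y - l) <= norm (x - y - k)" if "k : lattice" for k
   using torus_dist_le[OF lattice_add[OF that l], of x "y - l"] by (simp add: algebra_simps)
  then show ?thesis unfolding torus_dist_def[of x y] by (intro cINF_greatest) (auto intro: lattice_zero)
 qed
 assume "l : lattice"
 then show ?thesis using le[of l y] le[of "- l" "y - l"] lattice_minus[of l] by (intro antisym) auto
qed

lemma good_dist:
 assumes "good T ep n z c" "0 < T" "k < n" "s : {0..T}"
 shows "ep <= torus_dist (traj z c n s) (bpath ep z c k s)"
  and "s \<noteq> fst (c k) ==> ep < torus_dist (traj z c n s) (bpath ep z c k s)"
proof -
 from assms(1) obtain m :: nat where m: "\<forall>k<n. \<forall>s\<in>\<rat> \<inter> {0..T}. ep + \<bar>s - fst (c k)\<bar> / real (Suc m) <= torus_dist (traj z c n s) (bpath ep z c k s)"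
  unfolding good_def by blast
 have *: "ep + \<bar>s - fst (c k)\<bar> / real (Suc m) <= torus_dist (traj z c n s) (bpath ep z c k s)"
  by (rule rational_le_imp_real_le[OF _ _ _ assms(2,4)])
   (use m assms(3) in \<open>auto intro!: continuous_intros traj_continuous bpath_continuous\<close>)
 have "0 <= \<bar>s - fst (c k)\<bar> / real (Suc m)" by simp
 with * show "ep <= torus_dist (traj z c n s) (bpath ep z c k s)" by linarith
 show "ep < torus_dist (traj z c n s) (bpath ep z c k s)" if "s \<noteq> fst (c k)"
 proof -
  have "0 < \<bar>s - fst (c k)\<bar> / real (Suc m)" using that by simp
  with * show ?thesis by linarith
 qed
qed

lemma nohit_dist:
 assumes "nohit ep n z c t b" "s : {0<..t}"
 shows "ep <= torus_dist (traj z c n s) (fst b + s *. snd b)"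
 by (rule rational_le_imp_real_le[where T = t])
  (use assms in \<open>auto simp: nohit_def intro!: continuous_intros traj_continuous\<close>)

text \<open>Background states at time \<open>tau c k\<close>. \<open>J\<close> assigns labels to
  collisions; particles whose collision has happened are on their \<open>bpath\<close>, displaced by
  their lattice translate, and all others still fly freely from their initial data.\<close>

definition stage :: "nat => (nat => nat) => real => phase => (nat => collision) => (nat => phase) => (nat => real^3) => nat => nat => phase" where
 "stage N J ep z c et l k = (\<lambda>i\<in>{..<N}.
  if i : J ` {..<k} then (let m = inv_into {..<k} J i in
    (bpath ep z c m (tau c k) - l m, snd (snd (c m)) + (fst (snd (c m)) \<bullet> (vel z c m - snd (snd (c m)))) *. fst (snd (c m))))
  else (fst (et i) + tau c k *. snd (et i), snd (et i)))"

text \<open>If the labelled particles start at the pull-back of the tree, the prescribed collisions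
  occur and no others. The induction proceeds from the last piece to the first because a derivation
  of \<open>lhist\<close> is built up from its end.\<close>

lemma good_lhist:
 assumes good: "good T ep n z c" and T: "0 < T" and ep: "0 < ep" "ep < 1 / 2" "ep < ep'" and t: "tau c n <= t" "t <= T"
  and J: "inj_on J {..<n}" "J ` {..<n} \<subseteq> {..<N}" and et: "et : extensional {..<N}"
  and l: "!!k. k < n ==> l k : lattice"
  and hit: "!!k. k < n ==> et (J k) = (fst (bstart ep z c k) - l k, snd (bstart ep z c k))"
  and nohit: "!!j. j < N ==> j \<notin> J ` {..<n} ==> nohit ep' n z c t (et j)"
 shows "lhist N ep t 0 z et (map (%k. (J k, c k)) [0..<n])"
proof -
 have o: "ord n c" and c0: "0 < n ==> 0 < fst (c 0)" and nu1: "!!k. k < n ==> norm (fst (snd (c k))) = 1"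
  using good by (auto simp: good_def)
 define b where "b = stage N J ep z c et l"
 have inv: "inv_into {..<k} J (J m) = m" if "m < k" "k <= n" for m k
  by (rule inv_into_f_f) (use that J(1) in \<open>auto intro: inj_on_subset\<close>)
 have inJ: "J m : J ` {..<k} \<longleftrightarrow> m < k" if "m < n" "k <= n" for m k
 proof
  assume "J m : J ` {..<k}"
  then obtain x where x: "x < k" "J m = J x" by auto
  then have "m = x" using inj_onD[OF J(1) x(2)] that by simp
  then show "m < k" using x by simp
 qed simp
 have JN: "J m < N" if "m < n" for m using J(2) that by auto
 have tau_mono: "tau c i <= tau c j" if "i <= j" "j <= n" for i j
  using ord_tau_le[OF ord_mono[OF o that(2)] that(1)] .
 have tau_strict: "tau c i < tau c (Suc i)" if "i < n" for i
  using ord_mono[OF o, of "Suc i"] that c0 by (cases i) (auto simp: ord_Suc)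
 have tau0: "0 <= tau c k" if "k <= n" for k using ord_nonneg[OF ord_mono[OF o that]] .
 have fc: "fst (c m) = tau c (Suc m)" for m by simp
 \<comment> \<open>Straight flight from the state at stage \<open>k\<close> agrees with
   \<open>bpath\<close> in three situations: the collision is over (\<open>post\<close>), it is
   still to come (\<open>pre\<close>), or the particle never collides
   (\<open>other\<close>).\<close>
 have post: "fst (b k (J m)) + (s - tau c k) *. snd (b k (J m)) = bpath ep z c m s - l m"
  if "m < k" "k <= n" "tau c k <= s" for m k s
 proof -
  have "fst (c m) <= tau c k" using tau_mono[of "Suc m" k] that by simp
  then show ?thesis
   using that inv[of m k] inJ[of m k] JN[of m]
   by (cases "c m") (simp add: b_def stage_def Let_def bpath_def min_absorb1 max_absorb2 algebra_simps del: pos.simps)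
 qed
 have pre: "fst (b k (J m)) + (s - tau c k) *. snd (b k (J m)) = bpath ep z c m s - l m"
  if "k <= m" "m < n" "s <= fst (c m)" for m k s
  using that inJ[of m k] JN[of m] hit[of m]
  by (cases "c m") (simp add: b_def stage_def bstart_def bpath_def min_absorb2 max_absorb1 algebra_simps del: pos.simps)
 have other: "fst (b k i) + (s - tau c k) *. snd (b k i) = fst (et i) + s *. snd (et i)"
  if "i < N" "i \<notin> J ` {..<n}" "k <= n" for i k s
 proof -
  have "i \<notin> J ` {..<k}" using that by auto
  then show ?thesis using that by (simp add: b_def stage_def algebra_simps)
 qed
 have tr: "pos z c k + (s - tau c k) *. vel z c k = traj z c n s" if "k <= n" "tau c k <= s" "k < n ==> s <= fst (c k)" for k s
  using traj_piece[OF o that] by simp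
 \<comment> \<open>A labelled particle is farther away than \<open>ep\<close> except at its own
   collision time, an unlabelled one is at distance at least \<open>ep' > ep\<close>. A contact
   during piece \<open>k\<close> can therefore only be the collision that ends it.\<close>
 have only: "\<exists>m. i = J m & k = m & m < n & s = fst (c m)"
  if k: "k <= n" and s: "tau c k < s" "s <= t" "k < n ==> s <= fst (c k)" and i: "i < N"
   and contact: "free_contact ep (tau c k) (pos z c k, vel z c k) (b k i) s" for k s i
 proof -
  have s0: "0 < s" using s tau0[OF k] by simp
  then have sT: "s : {0..T}" "s : {0<..t}" using s t by auto
  have d: "torus_dist (traj z c n s) (fst (b k i) + (s - tau c k) *. snd (b k i)) = ep"
   using contact tr[OF k less_imp_le[OF s(1)] s(3)] by (simp add: free_contact_def contact_def)
  have "i : J ` {..<n}"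
  proof (rule ccontr)
   assume ni: "i \<notin> J ` {..<n}"
   show False using nohit_dist[OF nohit[OF i ni] sT(2)] d other[OF i ni k] ep(3) by simp
  qed
  then obtain m where m: "m < n" "i = J m" by auto
  have path: "fst (b k i) + (s - tau c k) *. snd (b k i) = bpath ep z c m s - l m"
  proof (cases "m < k")
   case True
   then show ?thesis using post[OF True k] s m by simp
  next
   case False
   then have "fst (c k) <= fst (c m)" using tau_mono[of "Suc k" "Suc m"] m by simp
   then have "s <= fst (c m)" using s(3) False m by force
   then show ?thesis using pre[of k m s] False m by simp
  qed
  then have "torus_dist (traj z c n s) (bpath ep z c m s) = ep"
   using d torus_dist_shift[OF l[OF m(1)]] by simp
  then have sm: "s = fst (c m)" using good_dist(2)[OF good T m(1) sT(1)] by force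
  have "\<not> m < k" using tau_mono[of "Suc m" k] s(1) sm k by auto
  moreover have "\<not> k < m"
  proof
   assume "k < m"
   then have "fst (c k) < fst (c m)" using ord_less[OF o] m by simp
   then show False using s(3) sm \<open>k < m\<close> m by simp
  qed
  ultimately have "m = k" by simp
  then show ?thesis using m sm by blast
 qed
 have main: "lhist N ep t (tau c k) (pos z c k, vel z c k) (b k) (map (%k. (J k, c k)) [k..<n])" if "k <= n" for k
  using that
 proof (induction "n - k" arbitrary: k)
  case 0
  then have k: "k = n" by simp
  have "lhist N ep t (tau c n) (pos z c n, vel z c n) (b n) []"
  proof (rule lhist.nil)
   fix j s assume "j < N" "s : {tau c n<..t}"
   then show "\<not> free_contact ep (tau c n) (pos z c n, vel z c n) (b n j) s"
    using only[of n s j] by auto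
  qed
  then show ?case using k by simp
 next
  case (Suc d)
  then have k: "k < n" by simp
  obtain r nu w where ck: "c k = (r, nu, w)" by (cases "c k") auto
  have rt: "tau c k < r" "r <= t" using tau_strict[OF k] tau_mono[of "Suc k" n] k t ck by simp_all
  have rT: "r : {0..T}" using rt t tau0[of k] k by simp
  have wk: "snd (b k (J k)) = w" using inJ[of k k] k JN[OF k] hit[OF k] by (simp add: b_def stage_def bstart_def ck)
  have path: "fst (b k (J k)) + (s - tau c k) *. w = bpath ep z c k s - l k" if "s <= r" for s
   using pre[of k k s] k that ck wk by simp
  have bp: "bpath ep z c k r = pos z c (Suc k) + ep *. nu" by (simp add: bpath_def ck del: pos.simps)
  have nnu: "norm nu = 1" using nu1[OF k] ck by simp
  have pk: "pos z c k + (r - tau c k) *. vel z c k = pos z c (Suc k)" by (simp add: ck)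
  have normal: "torus_normal ep (pos z c k + (r - tau c k) *. vel z c k) (fst (b k (J k)) + (r - tau c k) *. snd (b k (J k))) nu"
   unfolding wk path[OF order_refl] pk bp torus_normal_def
   using nnu lattice_minus[OF l[OF k]] by simp
  have contact: "free_contact ep (tau c k) (pos z c k, vel z c k) (b k (J k)) r"
   unfolding free_contact_def contact_def fst_conv snd_conv wk
  proof (intro conjI)
   show "0 < r" using rt tau0[of k] k by simp
   have "norm (pos z c (Suc k) - (pos z c (Suc k) + ep *. nu - l k) - l k) = ep" using nnu ep by simp
   then show "torus_dist (pos z c k + (r - tau c k) *. vel z c k) (fst (b k (J k)) + (r - tau c k) *. w) = ep"
    unfolding path[OF order_refl] pk bp
    using torus_dist_eq_norm[OF l[OF k], of "pos z c (Suc k)" "pos z c (Suc k) + ep *. nu - l k"] ep by simp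
   have "\<forall>\<^sub>F s in at_left r. s : {tau c k<..<r}" by (rule eventually_at_left_real[OF rt(1)])
   then show "\<forall>\<^sub>F s in at_left r. ep < torus_dist (pos z c k + (s - tau c k) *. vel z c k) (fst (b k (J k)) + (s - tau c k) *. w)"
   proof (rule eventually_mono)
    fix s assume s: "s : {tau c k<..<r}"
    have "ep < torus_dist (traj z c n s) (bpath ep z c k s)"
     by (rule good_dist(2)[OF good T k]) (use s rT tau0[of k] k ck in auto)
    then show "ep < torus_dist (pos z c k + (s - tau c k) *. vel z c k) (fst (b k (J k)) + (s - tau c k) *. w)"
     using tr[of k s] path[of s] s k ck torus_dist_shift[OF l[OF k]] by simp
   qed
  qed
  have after_b: "after_background N (J k) (tau c k) (pos z c k, vel z c k) (b k) nu r = b (Suc k)"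
  proof (rule ext)
   fix i
   show "after_background N (J k) (tau c k) (pos z c k, vel z c k) (b k) nu r i = b (Suc k) i"
   proof (cases "i < N")
    case False
    then show ?thesis by (simp add: after_background_def b_def stage_def)
   next
    case True
    have r: "tau c (Suc k) = r" by (simp add: ck)
    consider (old) m where "m < k" "i = J m" | (new) "i = J k" | (none) "i \<notin> J ` {..<Suc k}"
    proof (cases "i : J ` {..<Suc k}")
     case True
     then obtain m where "m < Suc k" "i = J m" by auto
     then show ?thesis using old[of m] new by (cases "m = k") (auto simp: less_Suc_eq)
    qed (rule none)
    then show ?thesis
    proof cases
     case old
     then have ne: "J m \<noteq> J k" using J(1) k by (auto simp: inj_on_def)
     have m: "m < n" using old k by simp
     have "fst (b k (J m)) + (r - tau c k) *. snd (b k (J m)) = bpath ep z c m r - l m"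
      using post[OF old(1), of r] k rt by simp
     moreover have "snd (b k (J m)) = snd (b (Suc k) (J m))" "fst (b (Suc k) (J m)) = bpath ep z c m r - l m"
      using inJ[OF m, of k] inJ[OF m, of "Suc k"] inv[of m k] inv[of m "Suc k"] old k JN[OF m] r
      by (simp_all add: b_def stage_def Let_def del: tau.simps)
     ultimately show ?thesis
      using ne old True JN[OF m] by (simp add: after_background_def prod_eq_iff)
    next
     case new
     have "b (Suc k) (J k) = (bpath ep z c k r - l k, w + (nu \<bullet> (vel z c k - w)) *. nu)"
      using inJ[OF k, of "Suc k"] inv[of k "Suc k"] k JN[OF k] r by (simp add: b_def stage_def Let_def ck del: tau.simps)
     then show ?thesis
      using new JN[OF k] path[OF order_refl] wk by (simp add: after_background_def)
    next
     case none
     then have "i \<notin> J ` {..<k}" "i \<noteq> J k" by auto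
     then show ?thesis using none True r
      by (simp add: after_background_def b_def stage_def algebra_simps del: tau.simps)
    qed
   qed
  qed
  have after_t: "after_tagged (tau c k) (pos z c k, vel z c k) (b k (J k)) nu r = (pos z c (Suc k), vel z c (Suc k))"
   by (simp add: after_tagged_def wk ck deflect_def)
  have IH: "lhist N ep t r (pos z c (Suc k), vel z c (Suc k)) (b (Suc k)) (map (%k. (J k, c k)) [Suc k..<n])"
   using Suc.hyps(1)[of "Suc k"] Suc.hyps(2) k by (simp add: ck)
  have "lhist N ep t (tau c k) (pos z c k, vel z c k) (b k) ((J k, r, nu, snd (b k (J k))) # map (%k. (J k, c k)) [Suc k..<n])"
  proof (rule lhist.step)
   show "J k < N" "tau c k < r" "r <= t" using JN[OF k] rt by auto
   show "free_contact ep (tau c k) (pos z c k, vel z c k) (b k (J k)) r" by (rule contact)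
  next
   fix i s assume i: "i < N" and s: "s : {tau c k<..r}" and c': "free_contact ep (tau c k) (pos z c k, vel z c k) (b k i) s"
   have "s <= t" "s <= fst (c k)" "tau c k < s" using s rt ck by auto
   then show "i = J k & s = r" using only[of k s i] i c' k ck by auto
  next
   show "torus_normal ep (fst (pos z c k, vel z c k) + (r - tau c k) *. snd (pos z c k, vel z c k))
    (fst (b k (J k)) + (r - tau c k) *. snd (b k (J k))) nu" using normal by simp
   show "lhist N ep t r (after_tagged (tau c k) (pos z c k, vel z c k) (b k (J k)) nu r)
    (after_background N (J k) (tau c k) (pos z c k, vel z c k) (b k) nu r) (map (%k. (J k, c k)) [Suc k..<n])"
    unfolding after_b after_t by (rule IH)
  qed
  then show ?case using k wk ck by (simp add: upt_conv_Cons)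
 qed
 have "b 0 = et"
 proof (rule ext)
  fix i show "b 0 i = et i"
   using et by (cases "i < N") (auto simp: b_def stage_def extensional_def)
 qed
 then show ?thesis using main[of 0] by simp
qed

section \<open>From initial data to trees\<close>

text \<open>\<open>b\<close> is the state at time 0; it is first moved freely to time
  \<open>a\<close>, where the current piece of the tagged flight starts.\<close>

definition next_col :: "real => real^3 => real^3 => real => phase => collision" where
 "next_col ep x v a b = (a + root ep (fst b + a *. snd b - x) (snd b - v), cyl_norm ep (fst b + a *. snd b - x) (snd b - v), snd b)"

definition hits :: "real => real => real^3 => real^3 => real => phase => bool" where
 "hits T ep x v a b \<longleftrightarrow> 0 < disc ep (fst b + a *. snd b - x) (snd b - v) \<and>
  root ep (fst b + a *. snd b - x) (snd b - v) : {0<..T - a}"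

text \<open>Change of variables between the initial state of a background particle and its collision
  record, with Jacobian \<open>ep ^ 2\<close> times the hard-sphere kernel. For a fixed background
  velocity \<open>w\<close> it is the cylinder formula with relative velocity \<open>v - w\<close>,
  up to a shift of time by \<open>a\<close> and a translation of position by
  \<open>a *. w - x\<close>.\<close>

lemma collision_step:
 fixes H :: "collision => ennreal"
 assumes ep: "0 < ep" and a: "0 <= a" and H[measurable]: "H : bm borel"
 shows "(NN q. H q * (ennreal (ep\<^sup>2 * max 0 ((v - snd (snd q)) \<bullet> fst (snd q))) * indicator {a<..} (fst q)) \<partial>collision_vol T) =
  (NN b. (if hits T ep x v a b then H (next_col ep x v a b) else 0) \<partial>lborel)"
proof -
 have Hm: "(%y. H (f y, g y, h y)) : bm R" if [measurable]: "f : bm R" "g : bm R" "h : bm R"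
  for f :: "'d => real" and g h :: "'d => real^3" and R
  by (rule measurable_compose[OF _ H]) measurable
 interpret W: pair_sigma_finite sphere_measure "lborel :: (real^3) measure"
  by (intro pair_sigma_finite.intro sphere_measure.sigma_finite_measure_axioms lborel.sigma_finite_measure_axioms)
 define A where "A t nu w = H (t, nu, w) * (ennreal (ep\<^sup>2 * max 0 ((v - w) \<bullet> nu)) * indicator ({a<..} \<inter> {0..T}) t)" for t nu w
 have ms[measurable]: "(%x. x) : bm sphere_measure"
  by (simp add: measurable_cong_sets[OF sets_sphere_measure refl] measurable_restrict_space1)
 have Am: "(%y. A (f y) (g y) (h y)) : bm R" if [measurable]: "f : bm R" "g : bm R" "h : bm R"
  for f :: "'d => real" and g h :: "'d => real^3" and R
  unfolding A_def by (intro borel_measurable_times_ennreal Hm) measurable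
 have "(NN q. H q * (ennreal (ep\<^sup>2 * max 0 ((v - snd (snd q)) \<bullet> fst (snd q))) * indicator {a<..} (fst q)) \<partial>collision_vol T)
  = (NN t. (NN nu. NN w. H (t, nu, w) * (ennreal (ep\<^sup>2 * max 0 ((v - w) \<bullet> nu)) * indicator {a<..} t) \<partial>lborel \<partial>sphere_measure) * indicator {0..T} t \<partial>lborel)"
 proof -
  have [measurable]: "(%q :: collision. indicator {a<..} (fst q) :: ennreal) : bm borel"
   by (rule measurable_compose[of fst _ borel]) measurable
  show ?thesis by (subst nn_integral_collision_vol) (measurable, auto intro!: open_Collect_less continuous_intros)
 qed
 also have "... = (NN t. NN w. NN nu. A t nu w \<partial>sphere_measure \<partial>lborel \<partial>lborel)"
 proof (rule nn_integral_cong)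
  fix t
  have "(NN nu. NN w. H (t, nu, w) * (ennreal (ep\<^sup>2 * max 0 ((v - w) \<bullet> nu)) * indicator {a<..} t) \<partial>lborel \<partial>sphere_measure) * indicator {0..T} t
   = (NN nu. NN w. A t nu w \<partial>lborel \<partial>sphere_measure)"
   by (cases "t : {0..T}") (auto simp: A_def indicator_def)
  also have "... = (NN w. NN nu. A t nu w \<partial>sphere_measure \<partial>lborel)"
   by (rule W.Fubini'[symmetric]) (simp add: case_prod_beta', rule Am, measurable)
  finally show "(NN nu. NN w. H (t, nu, w) * (ennreal (ep\<^sup>2 * max 0 ((v - w) \<bullet> nu)) * indicator {a<..} t) \<partial>lborel \<partial>sphere_measure) * indicator {0..T} t
   = (NN w. NN nu. A t nu w \<partial>sphere_measure \<partial>lborel)" .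
 qed
 also have "... = (NN w. NN t. NN nu. A t nu w \<partial>sphere_measure \<partial>lborel \<partial>lborel)"
 proof (rule lborel_pair.Fubini'[symmetric])
  have "(%(tw, nu). A (fst tw) nu (snd tw)) : bm ((lborel \<Otimes>\<^sub>M lborel) \<Otimes>\<^sub>M sphere_measure)"
   unfolding case_prod_beta'
   by (rule Am)
    (use measurable_compose[OF measurable_fst[of "(lborel :: real measure) \<Otimes>\<^sub>M (lborel :: (real^3) measure)" sphere_measure] measurable_fst]
     measurable_compose[OF measurable_fst[of "(lborel :: real measure) \<Otimes>\<^sub>M (lborel :: (real^3) measure)" sphere_measure] measurable_snd]
     measurable_compose[OF measurable_snd[of "(lborel :: real measure) \<Otimes>\<^sub>M (lborel :: (real^3) measure)" sphere_measure] ms] in simp_all)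
  from sphere_measure.borel_measurable_nn_integral[OF this]
  show "(%(t, w). NN nu. A t nu w \<partial>sphere_measure) : bm (lborel \<Otimes>\<^sub>M lborel)" by (simp add: case_prod_beta')
 qed
 also have "... = (NN w. NN y. (if hits T ep x v a (y, w) then H (next_col ep x v a (y, w)) else 0) \<partial>lborel \<partial>lborel)"
 proof (rule nn_integral_cong)
  fix w :: "real^3"
  let ?F = "%(s, nu). H (a + s, nu, w) * indicator {0<..T - a} s"
  let ?P = "%p. if 0 < disc ep p (- (v - w)) then ?F (root ep p (- (v - w)), cyl_norm ep p (- (v - w))) else 0"
  have Fm: "?F : bm (borel \<Otimes>\<^sub>M borel)"
   unfolding case_prod_beta' by (intro borel_measurable_times_ennreal Hm) measurable
  have Pm: "?P : bm borel"
   unfolding case_prod_conv by (intro measurable_If borel_measurable_times_ennreal Hm) measurable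
  have "(%(t, nu). A t nu w) : bm (borel \<Otimes>\<^sub>M sphere_measure)"
   unfolding case_prod_beta'
   by (rule Am) (use measurable_fst[of "borel :: real measure" sphere_measure] measurable_compose[OF measurable_snd[of "borel :: real measure" sphere_measure] ms] in simp_all)
  then have "(%t. NN nu. A t nu w \<partial>sphere_measure) : bm borel"
   using sphere_measure.borel_measurable_nn_integral[of "%t nu. A t nu w" borel] by simp
  then have "(NN t. NN nu. A t nu w \<partial>sphere_measure \<partial>lborel) = (NN s. NN nu. A (a + s) nu w \<partial>sphere_measure \<partial>lborel)"
   using nn_integral_real_affine[of "%t. NN nu. A t nu w \<partial>sphere_measure" 1 a] by simp
  also have "... = (NN s. NN nu. ?F (s, nu) * ennreal (ep\<^sup>2 * max 0 ((v - w) \<bullet> nu)) \<partial>sphere_measure \<partial>lborel)"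
   using a by (intro nn_integral_cong) (auto simp: A_def indicator_def)
  also have "... = (NN p. ?P p \<partial>lborel)" by (rule cylinder_nn_integral[OF ep Fm])
  also have "... = (NN y. ?P (y + (a *. w - x)) \<partial>lborel)" by (rule nn_integral_lborel_shift[OF Pm, symmetric])
  also have "... = (NN y. (if hits T ep x v a (y, w) then H (next_col ep x v a (y, w)) else 0) \<partial>lborel)"
   by (intro nn_integral_cong) (auto simp: hits_def next_col_def add_diff_eq indicator_def)
  finally show "(NN t. NN nu. A t nu w \<partial>sphere_measure \<partial>lborel) = (NN y. (if hits T ep x v a (y, w) then H (next_col ep x v a (y, w)) else 0) \<partial>lborel)" .
 qed
 also have "... = (NN b. (if hits T ep x v a b then H (next_col ep x v a b) else 0) \<partial>lborel)"
  unfolding hits_def next_col_def by (rule nn_integral_lborel_phase[symmetric]) (intro measurable_If Hm; measurable)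
 finally show ?thesis .
qed

text \<open>The records produced when the particles \<open>0, ..., n - 1\<close> with initial data
  \<open>et\<close> hit the tagged particle in this order; \<open>chain\<close> says that they
  really do.\<close>

primrec unfold_col :: "real => phase => (nat => phase) => nat => nat => collision" where
 "unfold_col ep z et 0 = (%_. undefined)"
| "unfold_col ep z et (Suc n) = (let c = unfold_col ep z et n in c(n := next_col ep (pos z c n) (vel z c n) (tau c n) (et n)))"

primrec chain :: "real => real => phase => (nat => phase) => nat => bool" where
 "chain T ep z et 0 \<longleftrightarrow> True"
| "chain T ep z et (Suc n) \<longleftrightarrow> chain T ep z et n & (let c = unfold_col ep z et n in hits T ep (pos z c n) (vel z c n) (tau c n) (et n))"

lemma unfold_col_cong: "(!!i. i < n ==> et i = et' i) ==> unfold_col ep z et n = unfold_col ep z et' n"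
 by (induction n) (auto simp: Let_def)

lemma chain_cong: "(!!i. i < n ==> et i = et' i) ==> chain T ep z et n = chain T ep z et' n"
proof (induction n)
 case (Suc n)
 have "unfold_col ep z et n = unfold_col ep z et' n" by (rule unfold_col_cong) (use Suc.prems in auto)
 then show ?case using Suc by (simp add: Let_def)
qed simp

text \<open>The last property makes \<open>bstart\<close> a left inverse of the reconstruction, so
  that on chains the initial data are recovered from the tree.\<close>

lemma unfold_col_props:
 assumes "0 < ep" "chain T ep z et n"
 shows "unfold_col ep z et n : {..<n} \<rightarrow>\<^sub>E {0..T} \<times> sphere 0 1 \<times> UNIV"
  and "k < n ==> tau (unfold_col ep z et n) k < fst (unfold_col ep z et n k)"
  and "k < n ==> bstart ep z (unfold_col ep z et n) k = et k"
proof -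
 have "unfold_col ep z et n : ({..<n} \<rightarrow>\<^sub>E {0..T} \<times> sphere 0 1 \<times> UNIV) \<and>
  (\<forall>k<n. tau (unfold_col ep z et n) k < fst (unfold_col ep z et n k) & bstart ep z (unfold_col ep z et n) k = et k)"
  using assms(2)
 proof (induction n)
  case (Suc n)
  define c where "c = unfold_col ep z et n"
  define q where "q = next_col ep (pos z c n) (vel z c n) (tau c n) (et n)"
  define c' where "c' = unfold_col ep z et (Suc n)"
  have c': "c' = c(n := q)" by (simp add: c'_def c_def q_def Let_def)
  have IH: "c : {..<n} \<rightarrow>\<^sub>E {0..T} \<times> sphere 0 1 \<times> UNIV" "!!k. k < n ==> tau c k < fst (c k)" "!!k. k < n ==> bstart ep z c k = et k"
   using Suc by (auto simp: c_def)
  have same: "tau c' m = tau c m" "vel z c' m = vel z c m" "pos z c' m = pos z c m" if "m <= n" for m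
   using that coords_cong[of m c' c] by (auto simp: c')
  have h: "hits T ep (pos z c n) (vel z c n) (tau c n) (et n)" using Suc.prems by (simp add: c_def Let_def)
  obtain y w where yw: "et n = (y, w)" by (cases "et n")
  define p where "p = y + tau c n *. w - pos z c n"
  define r where "r = root ep p (w - vel z c n)"
  define nu where "nu = cyl_norm ep p (w - vel z c n)"
  have d: "0 < disc ep p (- (vel z c n - w))" and r: "0 < r" "tau c n + r <= T"
   using h by (auto simp: hits_def yw p_def r_def)
  have q: "q = (tau c n + r, nu, w)" by (simp add: q_def next_col_def yw p_def r_def nu_def)
  note cyl = cyl_norm_props[OF assms(1) d]
  have nu: "norm nu = 1" and eq: "ep *. nu + r *. (vel z c n - w) = p"
   using cyl by (simp_all add: nu_def r_def)
  have tau0: "0 <= tau c n" using PiE_mem[OF IH(1), of "n - 1"] by (cases n) (auto simp: mem_Times_iff)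
  have "bstart ep z c' n = et n"
  proof -
   have "pos z c n + r *. vel z c n + ep *. nu - (tau c n + r) *. w = pos z c n + p - tau c n *. w"
    unfolding eq[symmetric] by (simp add: algebra_simps)
   then have "pos z c n + r *. vel z c n + ep *. nu - (tau c n + r) *. w = y" by (simp add: p_def)
   then show ?thesis using same[of n] by (simp add: bstart_def c' q yw)
  qed
  moreover have "bstart ep z c' k = et k" if "k < n" for k
   using IH(3)[OF that] that same(3)[of "Suc k"] by (simp add: bstart_def c' del: pos.simps)
  moreover have "tau c' k < fst (c' k)" if "k < Suc n" for k
   using that IH(2)[of k] same(1)[of k] r by (cases "k = n") (auto simp: c' q)
  moreover have "c' : {..<Suc n} \<rightarrow>\<^sub>E {0..T} \<times> sphere 0 1 \<times> UNIV"
   using IH(1) r tau0 nu by (auto simp: c' q PiE_iff extensional_def less_Suc_eq)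
  ultimately show ?case unfolding c'_def[symmetric] by (auto simp: less_Suc_eq)
 qed auto
 then show "unfold_col ep z et n : {..<n} \<rightarrow>\<^sub>E {0..T} \<times> sphere 0 1 \<times> UNIV"
  "k < n ==> tau (unfold_col ep z et n) k < fst (unfold_col ep z et n k)"
  "k < n ==> bstart ep z (unfold_col ep z et n) k = et k" by auto
qed


section \<open>Iterated change of variables\<close>

lemma measurable_nat_updates:
 fixes G :: "'s => nat => 'c::topological_space" and h :: "'s => 'c"
 assumes "!!i. i < n ==> (%om. G om i) : bm R" "h : bm R" "i < Suc n"
 shows "(%om. ((G om)(n := h om)) i) : bm R"
 using assms by (cases "i = n") auto

lemma measurable_next_col:
 assumes [measurable]: "x : bm R" "v : bm R" "a : bm R" "b : bm R"
 shows "(%om. next_col ep (x om) (v om) (a om) (b om)) : bm R"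
  and "Measurable.pred R (%om. hits T ep (x om) (v om) (a om) (b om))"
 unfolding next_col_def hits_def greaterThanAtMost_iff by measurable

lemma measurable_unfold_col:
 assumes Z: "Z : bm R" and E: "!!i. i < n ==> (%om. E om i) : bm R"
 shows "i < n ==> (%om. unfold_col ep (Z om) (E om) n i) : bm R"
  and "Measurable.pred R (%om. chain T ep (Z om) (E om) n)"
proof -
 have "(\<forall>i<n. (%om. unfold_col ep (Z om) (E om) n i) : bm R) & Measurable.pred R (%om. chain T ep (Z om) (E om) n)"
  using E
 proof (induction n)
  case (Suc n)
  then have IH: "!!i. i < n ==> (%om. unfold_col ep (Z om) (E om) n i) : bm R"
   "Measurable.pred R (%om. chain T ep (Z om) (E om) n)" by auto
  note m = measurable_next_col[OF measurable_pos[OF Z IH(1)] measurable_vel[OF Z IH(1)] measurable_tau[OF Z IH(1)] Suc.prems[of n]]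
  show ?case
  proof (intro conjI allI impI)
   fix i assume "i < Suc n"
   then show "(%om. unfold_col ep (Z om) (E om) (Suc n) i) : bm R"
    unfolding unfold_col.simps Let_def by (intro measurable_nat_updates IH(1) m(1)) auto
  next
   show "Measurable.pred R (%om. chain T ep (Z om) (E om) (Suc n))"
    unfolding chain.simps Let_def by (intro pred_conj IH(2) m(2)) auto
  qed
 qed simp
 then show "i < n ==> (%om. unfold_col ep (Z om) (E om) n i) : bm R"
  "Measurable.pred R (%om. chain T ep (Z om) (E om) n)" by auto
qed

text \<open>The Jacobian factor of collision \<open>k\<close>; the indicator enforces the order of
  the collision times.\<close>

definition weight :: "real => phase => (nat => collision) => nat => ennreal" where
 "weight ep z c k = ennreal (ep\<^sup>2 * max 0 ((vel z c k - snd (snd (c k))) \<bullet> fst (snd (c k)))) * indicator {tau c k<..} (fst (c k))"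

lemma unfold_col_extensional: "unfold_col ep z et n : extensional {..<n}"
 by (induction n) (auto simp: Let_def extensional_def)

lemma PiM_component: "k < n ==> (%et. et k) : bm (PiM {..<n} (%_. borel))"
 by (rule measurable_component_singleton) simp

lemma measurable_PiM_unfold_col:
 fixes F :: "(nat => collision) => ennreal"
 assumes F: "F : bm (PiM {..<n} (%_. borel))"
  and Z: "Z : bm R" and E: "!!i. i < n ==> (%om. E om i) : bm R"
 shows "(%om. if chain T ep (Z om) (E om) n then F (unfold_col ep (Z om) (E om) n) else 0) : bm R"
proof (rule measurable_If)
 have "(%om. \<lambda>i\<in>{..<n}. unfold_col ep (Z om) (E om) n i) : measurable R (PiM {..<n} (%_. borel))"
  by (rule measurable_restrict) (simp add: measurable_unfold_col[OF Z E])
 then have "(%om. unfold_col ep (Z om) (E om) n) : measurable R (PiM {..<n} (%_. borel))"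
  by (simp add: extensional_restrict[OF unfold_col_extensional])
 then show "(%om. F (unfold_col ep (Z om) (E om) n)) : bm R"
  by (rule measurable_compose) (rule F)
 show "{x : space R. chain T ep (Z x) (E x) n} : sets R"
  using measurable_unfold_col(2)[OF Z E] by (simp add: pred_def)
qed simp

lemma measurable_weight:
 assumes Z: "Z : bm R" and C: "!!i. i <= k ==> (%om. C om i) : bm R"
 shows "(%om. weight ep (Z om) (C om) k) : bm R"
proof -
 have [measurable]: "(%om. vel (Z om) (C om) k) : bm R" "(%om. tau (C om) k) : bm R" "(%om. C om k) : bm R"
  using measurable_vel[OF Z C] measurable_tau[OF Z C] C by auto
 have "(%om. if tau (C om) k < fst (C om k) then 1 else 0 :: ennreal) : bm R" by measurable
 then have [measurable]: "(%om. indicator {tau (C om) k<..} (fst (C om k)) :: ennreal) : bm R"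
  by (simp add: indicator_def)
 show ?thesis unfolding weight_def by measurable
qed

lemma measurable_PiM_borel_collision:
 assumes "F : measurable (PiM {..<n} (%_. borel)) M"
 shows "F : measurable (PiM {..<n} (%_. collision_vol T)) M"
proof -
 have "(%et. \<lambda>i\<in>{..<n}. et i) : measurable (PiM {..<n} (%_. collision_vol T)) (PiM {..<n} (%_. borel))"
  by (rule measurable_restrict) (rule measurable_compose[OF measurable_component_singleton[of _ _ "%_. collision_vol T"] id_collision_vol])
 from measurable_compose[OF this assms]
 show ?thesis
  by (rule measurable_cong[THEN iffD1, rotated]) (auto simp: space_PiM PiE_restrict)
qed

text \<open>Position and velocity of the tagged particle at a collision depend only on the earlier
  records. The change of variables is therefore triangular, and its Jacobian is the product of those
  in \<open>collision_step\<close>.\<close>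

lemma collision_chain:
 fixes F :: "(nat => collision) => ennreal"
 assumes ep: "0 < ep" and F: "F : bm (PiM {..<n} (%_. borel))"
 shows "(NN c. F c * (\<Prod>k<n. weight ep z c k) \<partial>PiM {..<n} (%_. collision_vol T)) =
  (NN et. (if chain T ep z et n then F (unfold_col ep z et n) else 0) \<partial>PiM {..<n} (%_. lborel))"
 using F
proof (induction n arbitrary: F)
 case 0
 then show ?case by (simp add: PiM_empty nn_integral_count_space_finite)
next
 case (Suc n)
 interpret P: product_sigma_finite "%_::nat. collision_vol T"
  by (intro product_sigma_finite.intro sigma_finite_collision_vol)
 interpret PL: product_sigma_finite "%_::nat. lborel :: phase measure" by standard
 let ?B = "PiM {..<n} (%_. borel :: collision measure)"
 let ?W = "%c q. ennreal (ep\<^sup>2 * max 0 ((vel z c n - snd (snd q)) \<bullet> fst (snd q))) * indicator {tau c n<..} (fst q)"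
 note F = Suc.prems[unfolded lessThan_Suc]
 have upd: "(%(et, y). F (et(n := y))) : bm (?B \<Otimes>\<^sub>M borel)"
  using measurable_compose[OF measurable_add_dim F] by (simp add: case_prod_beta' fun_upd_def)
 have idb: "(%_. z) : bm R" for R by simp
 have comp: "(%etq. fst etq i) : bm (?B \<Otimes>\<^sub>M collision_vol T)" if "i < n" for i
  using measurable_compose[OF measurable_fst[of ?B "collision_vol T"] PiM_component[OF that]] .
 have sndm: "(%etq. snd etq) : bm (?B \<Otimes>\<^sub>M collision_vol T)"
  using measurable_compose[OF measurable_snd[of ?B "collision_vol T"] id_collision_vol] .
 define K where "K c = (NN q. F (c(n := q)) * ?W c q \<partial>collision_vol T)" for c
 have W_upd: "weight ep z (c(n := q)) n = ?W c q" for c q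
  using coords_cong[of n "c(n := q)" c] by (simp add: weight_def)
 have w_upd: "weight ep z (c(n := q)) k = weight ep z c k" if "k < n" for c q k
  using coords_cong[of k "c(n := q)" c] that by (simp add: weight_def)
 have Km: "K : bm ?B"
  unfolding K_def
 proof (rule sigma_finite_measure.borel_measurable_nn_integral[OF sigma_finite_collision_vol])
  have "(%etq. F ((fst etq)(n := snd etq))) : bm (?B \<Otimes>\<^sub>M collision_vol T)"
   using measurable_compose[OF measurable_Pair[OF measurable_fst[of ?B "collision_vol T"] sndm] upd] by simp
  moreover have "(%etq. weight ep z ((fst etq)(n := snd etq)) n) : bm (?B \<Otimes>\<^sub>M collision_vol T)"
   by (rule measurable_weight[OF idb]) (rule measurable_nat_updates[OF comp sndm], auto)
  ultimately show "(%(c, q). F (c(n := q)) * ?W c q) : bm (?B \<Otimes>\<^sub>M collision_vol T)"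
   unfolding W_upd case_prod_beta' by (rule borel_measurable_times_ennreal)
 qed
 have "(NN c. F c * (\<Prod>k<Suc n. weight ep z c k) \<partial>PiM {..<Suc n} (%_. collision_vol T))
  = (NN c. NN q. F (c(n := q)) * (\<Prod>k\<in>insert n {..<n}. weight ep z (c(n := q)) k) \<partial>collision_vol T \<partial>PiM {..<n} (%_. collision_vol T))"
  unfolding lessThan_Suc
 proof (rule P.product_nn_integral_insert)
  have "(%c. weight ep z c k) : bm (PiM {..<Suc n} (%_. borel))" if "k < Suc n" for k
   by (rule measurable_weight[OF idb]) (rule PiM_component, use that in simp)
  then have "(%c. F c * (\<Prod>k\<in>{..<Suc n}. weight ep z c k)) : bm (PiM {..<Suc n} (%_. borel))"
   by (intro borel_measurable_times_ennreal Suc.prems borel_measurable_prod_ennreal) simp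
  from measurable_PiM_borel_collision[OF this]
  show "(%c. F c * (\<Prod>k\<in>insert n {..<n}. weight ep z c k)) : bm (PiM (insert n {..<n}) (%_. collision_vol T))"
   unfolding lessThan_Suc .
 qed auto
 also have "... = (NN c. K c * (\<Prod>k<n. weight ep z c k) \<partial>PiM {..<n} (%_. collision_vol T))"
 proof (rule nn_integral_cong)
  fix c assume "c : space (PiM {..<n} (%_. collision_vol T))"
  then have c: "c : space ?B" by (auto simp: space_PiM)
  have "(NN q. F (c(n := q)) * (\<Prod>k\<in>insert n {..<n}. weight ep z (c(n := q)) k) \<partial>collision_vol T)
   = (NN q. F (c(n := q)) * ?W c q * (\<Prod>k<n. weight ep z c k) \<partial>collision_vol T)"
   by (intro nn_integral_cong) (simp add: W_upd w_upd mult.assoc)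
  also have "... = K c * (\<Prod>k<n. weight ep z c k)"
   unfolding K_def
  proof (rule nn_integral_multc)
   have "(%q. F (c(n := q))) : bm (collision_vol T)"
    using collision_vol_measurable[OF measurable_Pair2[OF upd c]] by simp
   moreover have "(%q. weight ep z (c(n := q)) n) : bm (collision_vol T)"
    by (rule measurable_weight[OF idb]) (rule measurable_nat_updates, use id_collision_vol in auto)
   ultimately show "(%q. F (c(n := q)) * ?W c q) : bm (collision_vol T)"
    unfolding W_upd by (rule borel_measurable_times_ennreal)
  qed
  finally show "(NN q. F (c(n := q)) * (\<Prod>k\<in>insert n {..<n}. weight ep z (c(n := q)) k) \<partial>collision_vol T) = K c * (\<Prod>k<n. weight ep z c k)" .
 qed
 also have "... = (NN et. (if chain T ep z et n then K (unfold_col ep z et n) else 0) \<partial>PiM {..<n} (%_. lborel))"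
  by (rule Suc.IH[OF Km])
 also have "... = (NN et. NN b. (if chain T ep z (et(n := b)) (Suc n) then F (unfold_col ep z (et(n := b)) (Suc n)) else 0) \<partial>lborel \<partial>PiM {..<n} (%_. lborel))"
 proof (rule nn_integral_cong)
  fix et
  define c where "c = unfold_col ep z et n"
  have cb: "unfold_col ep z (et(n := b)) n = c" "chain T ep z (et(n := b)) n = chain T ep z et n" for b
   unfolding c_def by (rule unfold_col_cong, simp) (rule chain_cong, simp)
  show "(if chain T ep z et n then K (unfold_col ep z et n) else 0) = (NN b. (if chain T ep z (et(n := b)) (Suc n) then F (unfold_col ep z (et(n := b)) (Suc n)) else 0) \<partial>lborel)"
  proof (cases "chain T ep z et n")
   case True
   have c: "c : {..<n} \<rightarrow>\<^sub>E {0..T} \<times> sphere 0 1 \<times> UNIV" using unfold_col_props(1)[OF ep True] by (simp add: c_def)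
   have "c : space ?B" using c by (auto simp: space_PiM PiE_iff)
   then have Hc: "(%q. F (c(n := q))) : bm borel" using measurable_Pair2[OF upd] by simp
   have tau0: "0 <= tau c n" using PiE_mem[OF c, of "n - 1"] by (cases n) (auto simp: mem_Times_iff)
   have Kc: "K c = (NN b. (if hits T ep (pos z c n) (vel z c n) (tau c n) b then F (c(n := next_col ep (pos z c n) (vel z c n) (tau c n) b)) else 0) \<partial>lborel)"
    unfolding K_def by (rule collision_step[OF ep tau0 Hc])
   have *: "chain T ep z (et(n := b)) (Suc n) = hits T ep (pos z c n) (vel z c n) (tau c n) b"
    "unfold_col ep z (et(n := b)) (Suc n) = c(n := next_col ep (pos z c n) (vel z c n) (tau c n) b)" for b
    using True by (simp_all add: cb Let_def)
   show ?thesis unfolding * c_def[symmetric] if_P[OF True] by (rule Kc)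
  qed (simp add: cb Let_def)
 qed
 also have "... = (NN et. (if chain T ep z et (Suc n) then F (unfold_col ep z et (Suc n)) else 0) \<partial>PiM {..<Suc n} (%_. lborel))"
  unfolding lessThan_Suc
 proof (rule PL.product_nn_integral_insert[symmetric])
  have "sets (PiM {..<Suc n} (%_. lborel :: phase measure)) = sets (PiM {..<Suc n} (%_. borel))"
   by (rule sets_PiM_borel) simp
  moreover have "(%et. if chain T ep z et (Suc n) then F (unfold_col ep z et (Suc n)) else 0) : bm (PiM {..<Suc n} (%_. borel))"
   by (rule measurable_PiM_unfold_col[OF Suc.prems idb]) (rule PiM_component)
  ultimately show "(%et. if chain T ep z et (Suc n) then F (unfold_col ep z et (Suc n)) else 0) : bm (PiM (insert n {..<n}) (%_. lborel))"
   unfolding lessThan_Suc using measurable_cong_sets by blast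
 qed auto
 finally show ?case .
qed

section \<open>Measurability of the conditions on trees\<close>

lemma measurable_traj:
 assumes Z: "Z : bm R" and C: "!!i. i < n ==> (%om. C om i) : bm R" and s: "s : bm R"
 shows "(%om. traj (Z om) (C om) n (s om)) : bm R"
 using C s
proof (induction n arbitrary: s)
 case 0
 then show ?case using Z by simp
next
 case (Suc n)
 note [measurable] = Suc.prems(2)
 have [measurable]: "(%om. C om n) : bm R" "(%om. vel (Z om) (C om) (Suc n)) : bm R"
  using Suc.prems(1)[of n] measurable_vel[OF Z Suc.prems(1)] by (simp_all del: vel.simps)
 have [measurable]: "(%om. traj (Z om) (C om) n (min (s om) (fst (C om n)))) : bm R"
  by (rule Suc.IH) (use Suc.prems(1) in auto)
 show ?case unfolding traj.simps by measurable
qed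

lemma measurable_torus_dist_comp:
 assumes [measurable]: "x : bm R" "y : bm R"
 shows "(%om. torus_dist (x om) (y om)) : bm R"
proof -
 have "(%om. (INF k\<in>lattice. norm (x om - y om - k))) : bm R"
  by (rule borel_measurable_cINF) (auto intro!: countable_lattice bdd_belowI[of _ 0] lattice_zero)
 then show ?thesis by (simp add: torus_dist_def)
qed

lemma pred_nohit:
 assumes Z: "Z : bm R" and C: "!!i. i < n ==> (%om. C om i) : bm R" and b[measurable]: "b : bm R"
 shows "Measurable.pred R (%om. nohit ep n (Z om) (C om) t (b om))"
 unfolding nohit_def
proof (rule pred_countable_ball)
 fix s :: real
 have [measurable]: "(%om. torus_dist (traj (Z om) (C om) n s) (fst (b om) + s *. snd (b om))) : bm R"
  by (rule measurable_torus_dist_comp[OF measurable_traj[OF Z C]]) measurable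
 show "Measurable.pred R (%om. ep <= torus_dist (traj (Z om) (C om) n s) (fst (b om) + s *. snd (b om)))" by measurable
qed (auto intro: countable_Int1 countable_rat)

lemma pred_good:
 assumes Z: "Z : bm R" and C: "!!i. i < n ==> (%om. C om i) : bm R"
 shows "Measurable.pred R (%om. good T ep n (Z om) (C om))"
 unfolding good_def
proof (intro pred_conj)
 show "Measurable.pred R (%om. ord n (C om))" by (rule pred_ord[OF C])
 show "Measurable.pred R (%om. 0 < n --> 0 < fst (C om 0))"
  by (cases "0 < n") (use C[of 0] in \<open>auto intro!: borel_measurable_less[unfolded pred_def[symmetric]]\<close>)
 show "Measurable.pred R (%om. \<forall>k<n. norm (fst (snd (C om k))) = 1)"
 proof -
  have "Measurable.pred R (%om. norm (fst (snd (C om k))) = 1)" if "k : {..<n}" for k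
  proof -
   have [measurable]: "(%om. C om k) : bm R" using C that by simp
   show ?thesis by measurable
  qed
  then have "Measurable.pred R (%om. \<forall>k\<in>{..<n}. norm (fst (snd (C om k))) = 1)" by (intro pred_countable_ball) auto
  then show ?thesis unfolding Ball_def lessThan_iff .
 qed
 have "Measurable.pred R (%om. \<exists>m\<in>(UNIV :: nat set). \<forall>k\<in>{..<n}. \<forall>s\<in>\<rat> \<inter> {0..T}. ep + \<bar>s - fst (C om k)\<bar> / real (Suc m) <= torus_dist (traj (Z om) (C om) n s) (bpath ep (Z om) (C om) k s))"
 proof (intro pred_countable_ball)
  fix m k :: nat and s :: real assume k: "k : {..<n}"
  then have C': "(%om. C om i) : bm R" if "i < Suc k" for i using that C by simp
  note [measurable] = C'[OF lessI]
  have [measurable]: "(%om. pos (Z om) (C om) (Suc k)) : bm R" by (rule measurable_pos[OF Z C'])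
  have [measurable]: "(%om. vel (Z om) (C om) k) : bm R" by (rule measurable_vel[OF Z C']) simp
  have b: "(%om. bpath ep (Z om) (C om) k s) : bm R"
   unfolding bpath_def case_prod_beta' by measurable
  have [measurable]: "(%om. torus_dist (traj (Z om) (C om) n s) (bpath ep (Z om) (C om) k s)) : bm R"
   by (rule measurable_torus_dist_comp[OF measurable_traj[OF Z C] b]) simp_all
  show "Measurable.pred R (%om. ep + \<bar>s - fst (C om k)\<bar> / real (Suc m) <= torus_dist (traj (Z om) (C om) n s) (bpath ep (Z om) (C om) k s))" by measurable
 qed (auto intro: countable_Int1 countable_rat)
 then show "Measurable.pred R (%om. \<exists>m. \<forall>k<n. \<forall>s\<in>\<rat> \<inter> {0..T}. ep + \<bar>s - fst (C om k)\<bar> / real (Suc m) <= torus_dist (traj (Z om) (C om) n s) (bpath ep (Z om) (C om) k s))"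
  unfolding bex_UNIV Ball_def lessThan_iff .
qed

lemma measurable_bstart:
 assumes Z: "Z : bm R" and C: "!!i. i <= k ==> (%om. C om i) : bm R"
 shows "(%om. bstart ep (Z om) (C om) k) : bm R"
proof -
 note [measurable] = C[OF order_refl]
 have [measurable]: "(%om. pos (Z om) (C om) (Suc k)) : bm R" by (rule measurable_pos[OF Z C]) simp
 show ?thesis unfolding bstart_def case_prod_beta' by measurable
qed

lemma nn_integral_count_space_at_most_one:
 fixes h :: "'i => ennreal"
 assumes le: "!!l. l : A ==> h l <= B" and one: "!!l l'. l : A ==> l' : A ==> h l \<noteq> 0 ==> h l' \<noteq> 0 ==> l = l'"
 shows "(NN l. h l \<partial>count_space A) <= B"
proof (cases "\<exists>l\<in>A. h l \<noteq> 0")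
 case True
 then obtain l0 where l0: "l0 : A" "h l0 \<noteq> 0" by blast
 have "(NN l. h l \<partial>count_space A) = (NN l. h l0 * indicator {l0} l \<partial>count_space A)"
  by (rule nn_integral_cong) (use one[OF _ l0(1) _ l0(2)] in \<open>auto simp: indicator_def\<close>)
 also have "... = h l0" using l0 by (subst nn_integral_cmult_indicator) auto
 finally show ?thesis using le[OF l0(1)] by simp
next
 case False
 then have "(NN l. h l \<partial>count_space A) = (NN l. 0 \<partial>count_space A)" by (intro nn_integral_cong) auto
 then show ?thesis by simp
qed

lemma lhist_unfold_unique:
 assumes ep: "0 < ep" "ep < 1 / 2" "ep < ep'" and T: "0 < T" "t <= T"
  and J: "inj_on J {..<n}" "J ` {..<n} \<subseteq> {..<N}" and et: "et : extensional {..<N}"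
  and l: "!!k. k < n ==> l k : lattice"
  and c: "c = unfold_col ep z (shift n l (%k. et (J k))) n" and chain: "chain T ep z (shift n l (%k. et (J k))) n"
  and good: "good T ep n z c" "tau c n <= t"
  and nohit: "!!j. j < N ==> j \<notin> J ` {..<n} ==> nohit ep' n z c t (et j)"
 shows "lhist N ep t 0 z et (map (%k. (J k, c k)) [0..<n])"
proof (rule good_lhist[OF good(1) T(1) ep good(2) T(2) J et l])
 fix k assume "k < n"
 then show "et (J k) = (fst (bstart ep z c k) - l k, snd (bstart ep z c k))"
  using unfold_col_props(3)[OF ep(1) chain, of k] by (simp add: c shift_def)
qed (use nohit in auto)

section \<open>Lower bound for the law of the history\<close>

context rayleigh
begin

abbreviation G :: "phase measure" where "G \<equiv> density phase_vol (%z. ennreal (g z))"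

lemma prob_G: "prob_space G"
proof (rule prob_spaceI)
 have "(%z. ennreal (g z)) : bm phase_vol" by (rule measurable_phase_volI) measurable
 then have "emeasure G (space G) = (NN z. ennreal (g z) * indicator (space phase_vol) z \<partial>phase_vol)"
  by (subst emeasure_density) auto
 also have "... = (NN z. ennreal (g z) \<partial>phase_vol)" by (intro nn_integral_cong) simp
 finally show "emeasure G (space G) = 1" using g_int by simp
qed

lemma G_borel: "F : measurable borel MM ==> F : measurable G MM"
 using measurable_phase_volI by simp

text \<open>The probability that one random background particle stays off the whole tagged
  trajectory up to time \<open>t\<close>.\<close>

definition clear :: "real => nat => real => phase => (nat => collision) => ennreal" where
 "clear ep n t z c = (NN b. (if nohit ep n z c t b then 1 else 0) \<partial>G)"

lemma clear_measurable:
 assumes Z: "Z : bm R" and C: "!!i. i < n ==> (%om. C om i) : bm R"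
 shows "(%om. clear ep n t (Z om) (C om)) : bm R"
proof -
 interpret G: prob_space G by (rule prob_G)
 have "Measurable.pred (R \<Otimes>\<^sub>M G) (%omb. nohit ep n (Z (fst omb)) (C (fst omb)) t (snd omb))"
 proof (rule pred_nohit)
  show "snd : bm (R \<Otimes>\<^sub>M G)" using measurable_compose[OF measurable_snd[of R G] G_borel[of "%x. x" borel]] by simp
 qed (use measurable_compose[OF measurable_fst[of R G] Z] measurable_compose[OF measurable_fst[of R G] C] in auto)
 then have "(%(om, b). if nohit ep n (Z om) (C om) t b then 1 else 0 :: ennreal) : bm (R \<Otimes>\<^sub>M G)"
  unfolding case_prod_beta' by measurable
 from G.borel_measurable_nn_integral[OF this] show ?thesis by (simp add: clear_def)
qed

text \<open>Fixed tagged data and fixed labels. By independence each of the \<open>N - n\<close>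
  unlabelled particles contributes a factor \<open>clear\<close>. The labelled ones are integrated
  over the torus and summed over lattice translates, which is an integral over the whole space,
  where \<open>collision_chain\<close> turns initial data into collisions.\<close>

lemma history_lower_fixed_particles:
 assumes ep: "0 < ep" "ep < 1 / 2" "ep < ep'" and t: "0 <= t" "t <= T"
  and J: "inj_on J {..<n}" "J ` {..<n} \<subseteq> {..<N}"
  and B: "Measurable.pred (PiM {..<n} (%_. borel)) B"
  and E: "E : sets (PiM {..<N} (%_. G))"
  and hyp: "!!et c. et : space (PiM {..<N} (%_. G)) ==> B c ==> lhist N ep t 0 z et (map (%k. (J k, c k)) [0..<n]) ==> et : E"
 shows "(NN c. (if good T ep n z c & tau c n <= t & B c then clear ep' n t z c ^ (N - n) else 0) *
   (\<Prod>k<n. ennreal (g (bstart ep z c k))) * (\<Prod>k<n. weight ep z c k) \<partial>PiM {..<n} (%_. collision_vol T)) <= emeasure (PiM {..<N} (%_. G)) E"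
proof -
 interpret G: prob_space G by (rule prob_G)
 interpret PG: product_sigma_finite "%_::nat. G" by standard
 define I where "I = J ` {..<n}"
 define R where "R = {..<N} - I"
 define Q where "Q c \<longleftrightarrow> good T ep n z c & tau c n <= t & B c" for c
 let ?q = "%c. if Q c then 1 else 0 :: ennreal"
 let ?Q = "%c. if Q c then clear ep' n t z c ^ (N - n) else 0"
 have N: "{..<N} = I \<union> R" "I \<inter> R = {}" "finite I" "finite R" using J by (auto simp: I_def R_def)
 have "card I = n" using J by (simp add: I_def card_image)
 then have cR: "card R = N - n" using J by (simp add: R_def card_Diff_subset I_def)
 define l_set where "l_set = PiE {..<n} (%_. lattice)"
 have cl: "countable l_set" unfolding l_set_def by (rule countable_PiE) (auto intro: countable_lattice)
 define sh where "sh l et = shift n l (%k. et (J k))" for l and et :: "nat => phase"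
 have zm: "(%_. z) : bm MM" for MM by simp
 have Qm: "?q : bm (PiM {..<n} (%_. borel))" "Measurable.pred (PiM {..<n} (%_. borel)) Q"
 proof -
  have [measurable]: "(%c. tau c n) : bm (PiM {..<n} (%_. borel))" by (rule measurable_tau[OF zm PiM_component])
  show Q: "Measurable.pred (PiM {..<n} (%_. borel)) Q"
   unfolding Q_def by (intro pred_conj B pred_good[OF zm PiM_component]) measurable
  then show "?q : bm (PiM {..<n} (%_. borel))" by measurable
 qed
 have QQm: "?Q : bm (PiM {..<n} (%_. borel))"
 proof -
  have [measurable]: "clear ep' n t z : bm (PiM {..<n} (%_. borel))"
   using clear_measurable[where C = "%c. c" and Z = "%_. z" and n = n] PiM_component by simp
  show ?thesis using Qm(2) by measurable
 qed
 \<comment> \<open>An indicator: with the translates \<open>l\<close>, the labelled particles hit in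
   order along a good tree in \<open>B\<close>, and all others miss this tree.\<close>
 define h where "h l et = (if chain T ep z (sh l et) n then ?q (unfold_col ep z (sh l et) n) else 0) *
  (\<Prod>j\<in>R. if nohit ep' n z (unfold_col ep z (sh l et) n) t (et j) then 1 else 0)" for l et
 have comp: "(%om. om j) : bm (PiM A (%_. G))" if "j : A" for A j
  using measurable_compose[OF measurable_component_singleton[OF that, of "%_. G"] G_borel[of "%x. x" borel]] by simp
 have shm: "(%om. sh l (Y om) k) : bm MM" if "!!j. j : I ==> (%om. Y om j) : bm MM" "k < n" for l Y MM k
 proof -
  have [measurable]: "(%om. Y om (J k)) : bm MM" using that by (auto simp: I_def)
  show ?thesis unfolding sh_def shift_def using that by (simp, measurable)
 qed
 have hm: "h l : bm (PiM {..<N} (%_. G))" for l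
  unfolding h_def
 proof (intro borel_measurable_times_ennreal borel_measurable_prod_ennreal)
  have s: "(%om. sh l om k) : bm (PiM {..<N} (%_. G))" if "k < n" for k
   using shm[of "%om. om", OF comp] that N(1) by blast
  show "(%om. if chain T ep z (sh l om) n then ?q (unfold_col ep z (sh l om) n) else 0) : bm (PiM {..<N} (%_. G))"
   by (rule measurable_PiM_unfold_col[OF Qm(1) zm s])
  fix j assume "j : R"
  then have "j : {..<N}" using N(1) by blast
  then have j: "(%om. om j) : bm (PiM {..<N} (%_. G))" by (rule comp)
  have "Measurable.pred (PiM {..<N} (%_. G)) (%om. nohit ep' n z (unfold_col ep z (sh l om) n) t (om j))"
   by (rule pred_nohit[OF zm _ j]) (rule measurable_unfold_col(1)[OF zm s])
  then show "(%om. if nohit ep' n z (unfold_col ep z (sh l om) n) t (om j) then 1 else 0 :: ennreal) : bm (PiM {..<N} (%_. G))"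
   by measurable
 qed
 have h_le: "h l et <= 1" for l et
 proof -
  have "(\<Prod>j\<in>R. if nohit ep' n z (unfold_col ep z (sh l et) n) t (et j) then 1 else 0 :: ennreal) <= 1" by (rule prod_le_1) auto
  then show ?thesis by (auto simp: h_def)
 qed
 have h_hist: "chain T ep z (sh l et) n & B (unfold_col ep z (sh l et) n) & lhist N ep t 0 z et (map (%k. (J k, unfold_col ep z (sh l et) n k)) [0..<n])"
  if "h l et \<noteq> 0" "l : l_set" "et : space (PiM {..<N} (%_. G))" for l et
 proof -
  have ch: "chain T ep z (sh l et) n" and Q: "Q (unfold_col ep z (sh l et) n)"
   and nh: "!!j. j : R ==> nohit ep' n z (unfold_col ep z (sh l et) n) t (et j)"
   using that(1) N(4) by (auto simp: h_def split: if_splits)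
  have ext: "et : extensional {..<N}" using that(3) unfolding space_PiM PiE_def by (rule IntD2)
  define c where "c = unfold_col ep z (sh l et) n"
  have gd: "good T ep n z c" "tau c n <= t" and Bc: "B c" using Q unfolding Q_def c_def by blast+
  have "lhist N ep t 0 z et (map (%k. (J k, unfold_col ep z (sh l et) n k)) [0..<n])"
   unfolding c_def[symmetric]
  proof (rule lhist_unfold_unique[OF ep T_pos t(2) J ext _ c_def[unfolded sh_def] ch[unfolded sh_def] gd])
   show "l k : lattice" if "k < n" for k using PiE_mem[OF \<open>l : l_set\<close>[unfolded l_set_def], of k] that by simp
   show "nohit ep' n z c t (et j)" if "j < N" "j \<notin> J ` {..<n}" for j
    using nh[of j] that unfolding c_def R_def I_def by blast
  qed
  then show ?thesis using ch Bc unfolding c_def by blast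
 qed
 \<comment> \<open>At most one \<open>l\<close> contributes: two choices would give two labelled
   histories, which coincide by uniqueness; their pull-backs to time 0 then coincide as well, and so
   do the translates.\<close>
 have h_E: "(NN l. h l et \<partial>count_space l_set) <= indicator E et" if et: "et : space (PiM {..<N} (%_. G))" for et
 proof (rule nn_integral_count_space_at_most_one)
  fix l assume l: "l : l_set"
  show "h l et <= indicator E et"
  proof (cases "h l et = 0")
   case False
   then show ?thesis using hyp[OF et] h_hist[OF False l et] h_le by (auto simp: indicator_def)
  qed simp
 next
  fix l l' assume l: "l : l_set" "l' : l_set" "h l et \<noteq> 0" "h l' et \<noteq> 0"
  define c where "c = unfold_col ep z (sh l et) n"
  define c' where "c' = unfold_col ep z (sh l' et) n"
  note H = h_hist[OF l(3,1) et] h_hist[OF l(4,2) et]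
  have eq: "map (%k. (J k, c k)) [0..<n] = map (%k. (J k, c' k)) [0..<n]"
   unfolding c_def c'_def using lhist_unique[OF ep(1,2)] H by blast
  have cc: "c k = c' k" if "k < n" for k
   using arg_cong[OF eq, of "%L. L ! k"] that by simp
  have "l k = l' k" if "k < n" for k
  proof -
   have "bstart ep z c k = bstart ep z c' k"
    using coords_cong(3)[of "Suc k" c c' z] cc that by (simp add: bstart_def del: pos.simps)
   then have "sh l et k = sh l' et k"
    using unfold_col_props(3)[OF ep(1) conjunct1[OF H(1)] that] unfold_col_props(3)[OF ep(1) conjunct1[OF H(2)] that]
    unfolding c_def c'_def by simp
   then show ?thesis using that by (simp add: sh_def shift_def)
  qed
  then show "l = l'" using l(1,2) unfolding l_set_def by (intro PiE_ext[of l _ _ l']) auto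
 qed
 have "(NN et. NN l. h l et \<partial>count_space l_set \<partial>PiM {..<N} (%_. G)) <= (NN et. indicator E et \<partial>PiM {..<N} (%_. G))"
  by (rule nn_integral_mono) (rule h_E)
 also have "... = emeasure (PiM {..<N} (%_. G)) E" using E by (rule nn_integral_indicator)
 finally have lower: "(NN et. NN l. h l et \<partial>count_space l_set \<partial>PiM {..<N} (%_. G)) <= emeasure (PiM {..<N} (%_. G)) E" .
 define F where "F \<zeta> = (if chain T ep z \<zeta> n then ?Q (unfold_col ep z \<zeta> n) else 0)" for \<zeta>
 have Fm: "F : bm (PiM {..<n} (%_. borel))"
  unfolding F_def by (rule measurable_PiM_unfold_col[OF QQm zm PiM_component])
 have "(NN et. NN l. h l et \<partial>count_space l_set \<partial>PiM {..<N} (%_. G)) = (NN l. NN et. h l et \<partial>PiM {..<N} (%_. G) \<partial>count_space l_set)"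
  by (rule nn_integral_count_space_nn_integral[OF cl hm])
 also have "... = (NN l. NN x. F (sh l x) \<partial>PiM I (%_. G) \<partial>count_space l_set)"
 proof (rule nn_integral_cong)
  fix l
  have "(NN et. h l et \<partial>PiM {..<N} (%_. G)) = (NN x. NN y. h l (merge I R (x, y)) \<partial>PiM R (%_. G) \<partial>PiM I (%_. G))"
   unfolding N(1) by (rule PG.product_nn_integral_fold[OF N(2-4)]) (use hm N(1) in simp)
  also have "... = (NN x. F (sh l x) \<partial>PiM I (%_. G))"
  proof (rule nn_integral_cong)
   fix x
   have shx: "sh l (merge I R (x, y)) = sh l x" for y
    unfolding sh_def shift_def by (rule restrict_ext) (auto simp: merge_def I_def)
   let ?c = "unfold_col ep z (sh l x) n"
   have "(NN y. h l (merge I R (x, y)) \<partial>PiM R (%_. G))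
    = (NN y. (if chain T ep z (sh l x) n then ?q ?c else 0) * (\<Prod>j\<in>R. if nohit ep' n z ?c t (y j) then 1 else 0) \<partial>PiM R (%_. G))"
   proof (rule nn_integral_cong)
    fix y
    have "merge I R (x, y) j = y j" if "j : R" for j using that N(2) by (auto simp: merge_def)
    then show "h l (merge I R (x, y)) = (if chain T ep z (sh l x) n then ?q ?c else 0) * (\<Prod>j\<in>R. if nohit ep' n z ?c t (y j) then 1 else 0)"
     unfolding h_def shx by (auto intro!: arg_cong2[where f = "(*)"] prod.cong)
   qed
   also have "... = (if chain T ep z (sh l x) n then ?q ?c else 0) * (NN y. (\<Prod>j\<in>R. if nohit ep' n z ?c t (y j) then 1 else 0) \<partial>PiM R (%_. G))"
   proof (rule nn_integral_cmult, rule borel_measurable_prod_ennreal)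
    fix j assume "j : R"
    then have "Measurable.pred (PiM R (%_. G)) (%y. nohit ep' n z ?c t (y j))" by (intro pred_nohit comp) simp_all
    then show "(%y. if nohit ep' n z ?c t (y j) then 1 else 0 :: ennreal) : bm (PiM R (%_. G))" by measurable
   qed
   \<comment> \<open>With the tree fixed, the conditions on the unlabelled particles involve one
     independent coordinate each.\<close>
   also have "(NN y. (\<Prod>j\<in>R. if nohit ep' n z ?c t (y j) then 1 else 0) \<partial>PiM R (%_. G)) = (\<Prod>j\<in>R. clear ep' n t z ?c)"
    unfolding clear_def
   proof (rule PG.product_nn_integral_prod[OF N(4)])
    have "Measurable.pred G (%b. nohit ep' n z ?c t b)" by (intro pred_nohit G_borel) simp_all
    then show "(%b. if nohit ep' n z ?c t b then 1 else 0 :: ennreal) : bm G" by measurable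
   qed
   also have "... = clear ep' n t z ?c ^ (N - n)" by (simp add: cR)
   finally show "(NN y. h l (merge I R (x, y)) \<partial>PiM R (%_. G)) = F (sh l x)"
    by (simp add: F_def)
  qed
  finally show "(NN et. h l et \<partial>PiM {..<N} (%_. G)) = (NN x. F (sh l x) \<partial>PiM I (%_. G))" .
 qed
 also have "... = (NN l. NN \<zeta>. F (shift n l \<zeta>) \<partial>PiM {..<n} (%_. G) \<partial>count_space l_set)"
 proof (rule nn_integral_cong)
  fix l
  have Fs: "(%\<zeta>. F (shift n l \<zeta>)) : bm (PiM {..<n} (%_. G))"
   by (rule measurable_borel_to_phase_vol_PiM) (rule measurable_compose[OF measurable_shift Fm])
  have d: "distr (PiM I (%_. G)) (PiM {..<n} (%_. G)) (%om. \<lambda>k\<in>{..<n}. om (J k)) = PiM {..<n} (%_. G)"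
   by (rule distr_PiM_reindex[of I "%_. G" J "{..<n}"]) (use prob_G J in \<open>auto simp: I_def\<close>)
  have mJ: "(%om. \<lambda>k\<in>{..<n}. om (J k)) : measurable (PiM I (%_. G)) (PiM {..<n} (%_. G))"
   by (rule measurable_restrict) (rule measurable_component_singleton, auto simp: I_def)
  have "(NN \<zeta>. F (shift n l \<zeta>) \<partial>PiM {..<n} (%_. G)) = (NN x. F (shift n l (\<lambda>k\<in>{..<n}. x (J k))) \<partial>PiM I (%_. G))"
   using nn_integral_distr[OF mJ, of "%\<zeta>. F (shift n l \<zeta>)"] Fs d by simp
  also have "... = (NN x. F (sh l x) \<partial>PiM I (%_. G))"
  proof (rule nn_integral_cong)
   fix x
   have "shift n l (\<lambda>k\<in>{..<n}. x (J k)) = sh l x" by (auto simp: sh_def shift_def fun_eq_iff)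
   then show "F (shift n l (\<lambda>k\<in>{..<n}. x (J k))) = F (sh l x)" by simp
  qed
  finally show "(NN x. F (sh l x) \<partial>PiM I (%_. G)) = (NN \<zeta>. F (shift n l \<zeta>) \<partial>PiM {..<n} (%_. G))" ..
 qed
 also have "... = (NN \<zeta>. NN l. F (shift n l \<zeta>) \<partial>count_space l_set \<partial>PiM {..<n} (%_. G))"
  by (rule nn_integral_count_space_nn_integral[OF cl, symmetric])
   (rule measurable_borel_to_phase_vol_PiM, rule measurable_compose[OF measurable_shift Fm])
 also have "... = (NN et. F et * (\<Prod>k<n. ennreal (g (et k))) \<partial>PiM {..<n} (%_. lborel))"
  unfolding l_set_def
  by (rule nn_integral_PiM_periodize[symmetric]) (use g_periodic G.sigma_finite_measure_axioms Fm in auto)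
 \<comment> \<open>On chains the data \<open>et\<close> are the pull-back of the reconstructed tree,
   so the density factors become functions of the tree.\<close>
 also have "... = (NN et. (if chain T ep z et n then (%c. ?Q c * (\<Prod>k<n. ennreal (g (bstart ep z c k)))) (unfold_col ep z et n) else 0) \<partial>PiM {..<n} (%_. lborel))"
  by (rule nn_integral_cong) (auto simp: F_def unfold_col_props(3)[OF ep(1)])
 also have "... = (NN c. ?Q c * (\<Prod>k<n. ennreal (g (bstart ep z c k))) * (\<Prod>k<n. weight ep z c k) \<partial>PiM {..<n} (%_. collision_vol T))"
 proof (rule collision_chain[symmetric, OF ep(1)])
  have "(%c. ennreal (g (bstart ep z c k))) : bm (PiM {..<n} (%_. borel))" if "k < n" for k
  proof -
   have "(%c. bstart ep z c k) : bm (PiM {..<n} (%_. borel))"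
    by (rule measurable_bstart[OF zm PiM_component]) (use that in simp)
   then show ?thesis by measurable
  qed
  then show "(%c. ?Q c * (\<Prod>k<n. ennreal (g (bstart ep z c k)))) : bm (PiM {..<n} (%_. borel))"
   by (intro borel_measurable_times_ennreal QQm borel_measurable_prod_ennreal) simp
 qed
 finally show ?thesis using lower by (simp add: Q_def)
qed

end

text \<open>\<open>\<rho>\<close> maps all records onto the admissible ones and fixes the latter.
  Pulling \<open>A\<close> back along it gives a Borel set, whose intersection with the admissible
  coordinates is \<open>A\<close>.\<close>

lemma sets_collision_vol_borel:
 fixes n :: nat
 assumes T: "0 <= T" and A: "A : sets (PiM {..<n} (%_. collision_vol T))"
 shows "A : sets (PiM {..<n} (%_. borel))"
proof -
 define K :: "collision set" where "K = {0..T} \<times> sphere 0 1 \<times> UNIV"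
 define q0 :: collision where "q0 = (0, axis 1 1, 0)"
 define \<rho> where "\<rho> q = (if q : K then q else q0)" for q
 have K: "K : sets borel" unfolding K_def by (intro borel_closed closed_Times) auto
 have q0: "q0 : K" using T by (simp add: q0_def K_def norm_axis_1)
 have \<rho>K: "\<rho> q : K" for q using q0 by (simp add: \<rho>_def)
 have [measurable]: "\<rho> : bm borel"
 proof -
  have "\<rho> = (%q. if q : K then q else q0)" by (simp add: \<rho>_def fun_eq_iff)
  also have "... : bm borel" using K by measurable
  finally show ?thesis .
 qed
 have "\<rho> : measurable borel (collision_vol T)"
 proof -
  have "(%q. (fst (\<rho> q), fst (snd (\<rho> q)), snd (snd (\<rho> q)))) : measurable borel (collision_vol T)"
   unfolding collision_vol_def
  proof (intro measurable_Pair)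
   show "(%q. fst (\<rho> q)) : measurable borel (restrict_space lborel {0..T})"
    by (rule measurable_restrict_space2) (use \<rho>K in \<open>auto simp: K_def mem_Times_iff\<close>)
   have "(%q. fst (snd (\<rho> q))) : measurable borel (restrict_space borel (sphere 0 1))"
    by (rule measurable_restrict_space2) (use \<rho>K in \<open>auto simp: K_def mem_Times_iff\<close>)
   then show "(%q. fst (snd (\<rho> q))) : measurable borel sphere_measure"
    by (simp add: measurable_cong_sets[OF refl sets_sphere_measure])
  qed simp
  then show ?thesis by simp
 qed
 then have R: "(%c. \<lambda>i\<in>{..<n}. \<rho> (c i)) : measurable (PiM {..<n} (%_. borel)) (PiM {..<n} (%_. collision_vol T))"
  by (intro measurable_restrict) (rule measurable_compose[OF measurable_component_singleton])
 have AK: "A \<subseteq> PiE {..<n} (%_. K)"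
  using sets.sets_into_space[OF A]
  by (simp add: space_PiM collision_vol_def space_pair_measure space_restrict_space space_sphere_measure K_def)
 have "A = (%c. \<lambda>i\<in>{..<n}. \<rho> (c i)) -` A \<inter> space (PiM {..<n} (%_. borel)) \<inter> PiE {..<n} (%_. K)"
 proof -
  have id: "(\<lambda>i\<in>{..<n}. \<rho> (c i)) = c" if "c : PiE {..<n} (%_. K)" for c
  proof (rule ext)
   fix i show "(\<lambda>i\<in>{..<n}. \<rho> (c i)) i = c i"
    using PiE_mem[OF that, of i] PiE_arb[OF that, of i] by (auto simp: \<rho>_def)
  qed
  have "c : space (PiM {..<n} (%_. borel))" if "c : PiE {..<n} (%_. K)" for c
   using that by (auto simp: space_PiM PiE_def)
  then show ?thesis using AK id by auto
 qed
 also have "... : sets (PiM {..<n} (%_. borel))"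
  by (rule sets.Int[OF measurable_sets[OF R A] sets_PiM_I_finite]) (use K in auto)
 finally show ?thesis .
qed

context rayleigh
begin

text \<open>There are \<open>\<Prod>{N - n + 1..N}\<close> ordered choices of \<open>n\<close>
  distinct labels. Uniqueness of the labelled history makes the corresponding events disjoint, so
  the lower bounds add up.\<close>

lemma history_lower_fixed:
 assumes ep: "0 < ep" "ep < 1 / 2" "ep < ep'" and t: "0 <= t" "t <= T" and n: "n <= N"
  and B: "Measurable.pred (PiM {..<n} (%_. borel)) B"
  and E: "E : sets (PiM {..<N} (%_. G))"
  and L: "!!js. {et : space (PiM {..<N} (%_. G)). \<exists>L. lhist N ep t 0 z et L & map fst L = js} : sets (PiM {..<N} (%_. G))"
  and hyp: "!!et c L. et : space (PiM {..<N} (%_. G)) ==> B c ==> lhist N ep t 0 z et L ==> map snd L = map c [0..<n] ==> et : E"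
 shows "of_nat (\<Prod>{N - n + 1..N}) * (NN c. (if good T ep n z c & tau c n <= t & B c then clear ep' n t z c ^ (N - n) else 0) *
   (\<Prod>k<n. ennreal (g (bstart ep z c k))) * (\<Prod>k<n. weight ep z c k) \<partial>PiM {..<n} (%_. collision_vol T)) <= emeasure (PiM {..<N} (%_. G)) E"
  (is "_ * ?v <= emeasure ?P E")
proof -
 define A where "A = {js :: nat list. length js = n & distinct js & set js \<subseteq> {..<N}}"
 define H where "H js = E \<inter> {et : space ?P. \<exists>L. lhist N ep t 0 z et L & map fst L = js}" for js
 have cA: "card A = \<Prod>{N - n + 1..N}"
  unfolding A_def using card_lists_distinct_length_eq[of "{..<N}" n] n by simp
 have "finite {js :: nat list. set js \<subseteq> {..<N} & length js = n}" by (rule finite_lists_length_eq) simp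
 then have fA: "finite A" by (rule rev_finite_subset) (auto simp: A_def)
 have le: "?v <= emeasure ?P (H js)" if js: "js : A" for js
 proof (rule history_lower_fixed_particles[OF ep t _ _ B])
  have js': "length js = n" "distinct js" "set js \<subseteq> {..<N}" using js by (auto simp: A_def)
  show "inj_on (%k. js ! k) {..<n}" using js' by (auto simp: inj_on_def nth_eq_iff_index_eq)
  show "(%k. js ! k) ` {..<n} \<subseteq> {..<N}" using js' nth_mem[of _ js] by blast
  show "H js : sets ?P" unfolding H_def by (intro sets.Int E L)
  fix et c assume et: "et : space ?P" and c: "B c" and h: "lhist N ep t 0 z et (map (%k. (js ! k, c k)) [0..<n])"
  have "map snd (map (%k. (js ! k, c k)) [0..<n]) = map c [0..<n]" by simp
  then have "et : E" by (rule hyp[OF et c h])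
  moreover have "map fst (map (%k. (js ! k, c k)) [0..<n]) = js" using js' map_nth[of js] by (simp add: comp_def)
  ultimately show "et : H js" unfolding H_def using h et by blast
 qed
 have "disjoint_family_on H A"
  unfolding disjoint_family_on_def
 proof (intro ballI impI)
  fix js js' :: "nat list" assume "js \<noteq> js'"
  have False if "et : H js" "et : H js'" for et
  proof -
   from that obtain L L' where "lhist N ep t 0 z et L" "map fst L = js" "lhist N ep t 0 z et L'" "map fst L' = js'"
    unfolding H_def by blast
   with lhist_unique[OF ep(1,2)] \<open>js \<noteq> js'\<close> show False by metis
  qed
  then show "H js \<inter> H js' = {}" by blast
 qed
 then have sum: "(\<Sum>js\<in>A. emeasure ?P (H js)) = emeasure ?P (\<Union>js\<in>A. H js)"
  by (intro sum_emeasure fA image_subsetI) (simp add: H_def, intro sets.Int E L)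
 have "of_nat (card A) * ?v = (\<Sum>js\<in>A. ?v)" by simp
 also have "... <= (\<Sum>js\<in>A. emeasure ?P (H js))" by (rule sum_mono) (rule le)
 also have "... <= emeasure ?P E" unfolding sum by (rule emeasure_mono[OF _ E]) (auto simp: H_def)
 finally show ?thesis unfolding cA .
qed

definition lower :: "nat => real => real => nat => real => phase \<times> (nat => collision) => ennreal" where
 "lower N ep ep' n t zc = (if good T ep n (fst zc) (snd zc) & tau (snd zc) n <= t
  then ennreal (f (fst zc)) * (of_nat (\<Prod>{N - n + 1..N}) * (clear ep' n t (fst zc) (snd zc) ^ (N - n) *
   (\<Prod>k<n. ennreal (g (bstart ep (fst zc) (snd zc) k))) * (\<Prod>k<n. weight ep (fst zc) (snd zc) k))) else 0)"

lemma lower_measurable: "lower N ep ep' n t : bm (tree_coords_vol T n)"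
proof -
 let ?R = "tree_coords_vol T n"
 note Z = tree_coords_components(1)[of T n] and C = tree_coords_components(2)[of _ n T]
 have "Measurable.pred ?R (%zc. good T ep n (fst zc) (snd zc))" by (rule pred_good[OF Z C])
 moreover have "(%zc. tau (snd zc) n) : bm ?R" by (rule measurable_tau[OF Z C])
 ultimately have P: "Measurable.pred ?R (%zc. good T ep n (fst zc) (snd zc) & tau (snd zc) n <= t)" by measurable
 have f: "(%zc. ennreal (f (fst zc))) : bm ?R"
  by (rule measurable_compose[OF Z]) measurable
 have b: "(%zc. ennreal (g (bstart ep (fst zc) (snd zc) k))) : bm ?R" if "k < n" for k
  by (rule measurable_compose[OF measurable_bstart[OF Z C]]) (use that in auto)
 have w: "(%zc. weight ep (fst zc) (snd zc) k) : bm ?R" if "k < n" for k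
  by (rule measurable_weight[OF Z C]) (use that in auto)
 have c: "(%zc. clear ep' n t (fst zc) (snd zc)) : bm ?R" by (rule clear_measurable[OF Z C])
 have "(%zc. ennreal (f (fst zc)) * (of_nat (\<Prod>{N - n + 1..N}) * (clear ep' n t (fst zc) (snd zc) ^ (N - n) *
   (\<Prod>k<n. ennreal (g (bstart ep (fst zc) (snd zc) k))) * (\<Prod>k<n. weight ep (fst zc) (snd zc) k)))) : bm ?R"
  by (intro borel_measurable_times_ennreal borel_measurable_prod_ennreal borel_measurable_power_ennreal f b w c) auto
 then show ?thesis unfolding lower_def using P by measurable
qed

text \<open>Fubini in the tagged initial data, with \<open>E\<close> the section of the preimage of
  \<open>S\<close> under the history.\<close>

theorem history_lower:
 assumes ep: "0 < ep" "ep < 1 / 2" "ep < ep'" and t: "0 <= t" "t <= T" and n: "n <= N"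
  and S: "S : sets (tree_vol T)" and len: "!!\<Phi>. \<Phi> : S ==> length (snd \<Phi>) = n"
 shows "(NN zc. indicator (tree_component T n S) zc * lower N ep ep' n t zc \<partial>tree_coords_vol T n)
  <= emeasure (empirical f g N ep T t) S"
proof -
 interpret G: prob_space G by (rule prob_G)
 interpret PG: product_sigma_finite "%_::nat. G" by standard
 let ?P = "PiM {..<N} (%_. G)" and ?F = "density phase_vol (%z. ennreal (f z))"
 interpret P: sigma_finite_measure ?P by (rule PG.sigma_finite) simp
 interpret C: product_sigma_finite "%_::nat. collision_vol T"
  by (intro product_sigma_finite.intro sigma_finite_collision_vol)
 interpret Cn: sigma_finite_measure "PiM {..<n} (%_. collision_vol T)" by (rule C.sigma_finite) simp
 let ?law = "initial_law f g N"
 have law: "?law = ?F \<Otimes>\<^sub>M ?P" by (simp add: initial_law_def)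
 have zm: "(%om. fst om) : measurable ?law phase_vol"
  unfolding law using measurable_fst[of ?F ?P] by (simp add: measurable_cong_sets[OF refl sets_density])
 have bm: "(%om. snd om j) : bm ?law" if "j < N" for j
 proof -
  have "(%et. et j) : measurable ?P G" using that by (intro measurable_component_singleton) simp
  then have "(%et. et j) : bm ?P" using measurable_compose[OF _ G_borel[of "%x. x" borel]] by simp
  then show ?thesis unfolding law by (rule measurable_compose[OF measurable_snd])
 qed
 have ext: "snd om : extensional {..<N}" if "om : space ?law" for om
  using that unfolding law space_pair_measure space_PiM PiE_def by auto
 note hm = history_measurable[OF ep(1,2) t zm bm ext]
 define H where "H = history N ep t -` S \<inter> space ?law"
 have H: "H : sets (?F \<Otimes>\<^sub>M ?P)" using measurable_sets[OF hm(1) S] unfolding H_def law .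
 have comp: "tree_component T n S : sets (phase_vol \<Otimes>\<^sub>M PiM {..<n} (%_. collision_vol T))"
  using S unfolding sets_tree_vol tree_coords_vol_def by blast
 have "emeasure (empirical f g N ep T t) S = emeasure (completion ?law) H"
  using emeasure_distr[OF measurable_completion[OF hm(1)] S] unfolding empirical_def H_def space_completion .
 also have "... = emeasure ?law H" using H by (simp add: law)
 also have "... = (NN z. emeasure ?P (Pair z -` H) \<partial>?F)"
  unfolding law by (rule P.emeasure_pair_measure_alt[OF H])
 also have "... = (NN z. ennreal (f z) * emeasure ?P (Pair z -` H) \<partial>phase_vol)"
 proof (rule nn_integral_density)
  show "(%z. ennreal (f z)) : bm phase_vol" by (rule measurable_phase_volI) measurable
  show "(%z. emeasure ?P (Pair z -` H)) : bm phase_vol"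
   using P.measurable_emeasure_Pair[OF H] by (simp add: measurable_cong_sets[OF sets_density refl])
 qed
 finally have emp: "emeasure (empirical f g N ep T t) S = ..." .
 let ?I = "%zc. indicator (tree_component T n S) zc * lower N ep ep' n t zc"
 have Im: "?I : bm (phase_vol \<Otimes>\<^sub>M PiM {..<n} (%_. collision_vol T))"
  using lower_measurable[of N ep ep' n t] comp
  by (intro borel_measurable_times_ennreal borel_measurable_indicator) (simp_all add: tree_coords_vol_def)
 have "(NN zc. ?I zc \<partial>tree_coords_vol T n) = (NN z. NN c. ?I (z, c) \<partial>PiM {..<n} (%_. collision_vol T) \<partial>phase_vol)"
  unfolding tree_coords_vol_def by (rule Cn.nn_integral_fst[symmetric, OF Im])
 also have "... <= (NN z. ennreal (f z) * emeasure ?P (Pair z -` H) \<partial>phase_vol)"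
 proof (rule nn_integral_mono)
  fix z assume z: "z : space phase_vol"
  define B where "B c \<longleftrightarrow> c : Pair z -` tree_component T n S" for c
  have Bs: "Pair z -` tree_component T n S : sets (PiM {..<n} (%_. collision_vol T))" by (rule sets_Pair1[OF comp])
  have "Pair z -` tree_component T n S : sets (PiM {..<n} (%_. borel))"
   by (rule sets_collision_vol_borel[OF _ Bs]) (use T_pos in simp)
  then have Bm[measurable]: "Measurable.pred (PiM {..<n} (%_. borel)) B"
   unfolding B_def by (rule pred_sets2) simp
  let ?v = "%c. (if good T ep n z c & tau c n <= t & B c then clear ep' n t z c ^ (N - n) else 0) *
   (\<Prod>k<n. ennreal (g (bstart ep z c k))) * (\<Prod>k<n. weight ep z c k)"
  have vm: "?v : bm (PiM {..<n} (%_. collision_vol T))"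
  proof (rule measurable_PiM_borel_collision)
   let ?B = "PiM {..<n} (%_. borel) :: (nat => collision) measure"
   have Z: "(%_. z) : bm ?B" by simp
   have [measurable]: "Measurable.pred ?B (%c. good T ep n z c)" by (rule pred_good[OF Z PiM_component])
   have [measurable]: "(%c. tau c n) : bm ?B" by (rule measurable_tau[OF Z PiM_component])
   have [measurable]: "(%c. clear ep' n t z c) : bm ?B" by (rule clear_measurable[OF Z PiM_component])
   have "(%c. weight ep z c k) : bm ?B" if "k < n" for k
    by (rule measurable_weight[OF Z PiM_component]) (use that in simp)
   moreover have "(%c. ennreal (g (bstart ep z c k))) : bm ?B" if "k < n" for k
   proof -
    have "(%c. bstart ep z c k) : bm ?B" by (rule measurable_bstart[OF Z PiM_component]) (use that in simp)
    then show ?thesis by measurable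
   qed
   moreover have "(%c. if good T ep n z c & tau c n <= t & B c then clear ep' n t z c ^ (N - n) else 0) : bm ?B"
    by measurable
   ultimately show "?v : bm ?B"
    by (intro borel_measurable_times_ennreal borel_measurable_prod_ennreal) simp_all
  qed
  have "(NN c. ?I (z, c) \<partial>PiM {..<n} (%_. collision_vol T)) = (NN c. (ennreal (f z) * of_nat (\<Prod>{N - n + 1..N})) * ?v c \<partial>PiM {..<n} (%_. collision_vol T))"
   by (rule nn_integral_cong) (simp add: lower_def B_def indicator_def mult.assoc)
  also have "... = ennreal (f z) * (of_nat (\<Prod>{N - n + 1..N}) * (NN c. ?v c \<partial>PiM {..<n} (%_. collision_vol T)))"
   unfolding nn_integral_cmult[OF vm] by (rule mult.assoc)
  also have "... <= ennreal (f z) * emeasure ?P (Pair z -` H)"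
  proof (rule mult_left_mono, rule history_lower_fixed[OF ep t n Bm])
   show "Pair z -` H : sets ?P" by (rule sets_Pair1[OF H])
   fix js
   have "Pair z -` {om : space ?law. \<exists>L. lhist N ep t 0 (fst om) (snd om) L & map fst L = js} : sets ?P"
    using hm(2)[of js] unfolding law by (rule sets_Pair1)
   also have "Pair z -` {om : space ?law. \<exists>L. lhist N ep t 0 (fst om) (snd om) L & map fst L = js}
    = {et : space ?P. \<exists>L. lhist N ep t 0 z et L & map fst L = js}"
    using z by (simp add: law space_pair_measure vimage_def)
   finally show "{et : space ?P. \<exists>L. lhist N ep t 0 z et L & map fst L = js} : sets ?P" .
  next
   fix et c L assume et: "et : space ?P" and B: "B c" and L: "lhist N ep t 0 z et L" "map snd L = map c [0..<n]"
   have "history N ep t (z, et) = (z, map snd L)" using history_eq(1)[OF ep(1,2) t(1), of N "(z, et)" L] L by simp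
   then have "history N ep t (z, et) : S" using B L(2) by (simp add: B_def tree_component_def)
   then show "et : Pair z -` H" using et z by (simp add: H_def law space_pair_measure)
  qed simp
  finally show "(NN c. ?I (z, c) \<partial>PiM {..<n} (%_. collision_vol T)) <= ennreal (f z) * emeasure ?P (Pair z -` H)" .
 qed
 finally show ?thesis unfolding emp .
qed

end

section \<open>The probability of further collisions\<close>

text \<open>The squared distance minus \<open>ep ^ 2\<close> is quadratic in time. If it is positive
  at 0 and negative at \<open>h\<close>, its smaller root lies in between.\<close>

lemma cylinder_hit:
 fixes p u :: "real^3"
 assumes ep: "0 < ep" and h: "0 <= h" "norm (p + h *. u) < ep"
 shows "norm p <= ep \<or> (0 < disc ep p u & 0 < root ep p u & root ep p u <= h)"
proof (cases "norm p <= ep")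
 case False
 define A where "A = u \<bullet> u"
 define B where "B = p \<bullet> u"
 define C where "C = p \<bullet> p - ep\<^sup>2"
 have C: "0 < C"
 proof -
  have "ep\<^sup>2 < (norm p)\<^sup>2" using False ep by (intro power_strict_mono) auto
  then show ?thesis by (simp add: C_def power2_norm_eq_inner)
 qed
 have neg: "C + 2 * h * B + h\<^sup>2 * A < 0"
 proof -
  have "(norm (p + h *. u))\<^sup>2 < ep\<^sup>2" using h(2) by (intro power_strict_mono) auto
  then show ?thesis unfolding power2_norm_eq_inner A_def B_def C_def
   by (simp add: inner_simps inner_commute algebra_simps power2_eq_square)
 qed
 have u: "u \<noteq> 0" using neg C by (auto simp: A_def B_def)
 then have A: "0 < A" by (simp add: A_def)
 have d: "disc ep p u = B\<^sup>2 - A * C" by (simp add: disc_def A_def B_def C_def)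
 have "(A * h + B)\<^sup>2 + A * C - B\<^sup>2 = A * (C + 2 * h * B + h\<^sup>2 * A)" by (simp add: power2_eq_square algebra_simps)
 also have "... < 0" using A neg by (simp add: mult_pos_neg)
 finally have q: "(A * h + B)\<^sup>2 < disc ep p u" by (simp add: d)
 then have disc: "0 < disc ep p u" by (smt (verit) zero_le_power2)
 have s: "\<bar>A * h + B\<bar> < sqrt (disc ep p u)" using q by (simp add: real_less_rsqrt)
 have "0 < h"
 proof (rule ccontr)
  assume "\<not> 0 < h"
  then have "h = 0" using h(1) by simp
  then show False using neg C by simp
 qed
 have B: "B < 0"
 proof (rule ccontr)
  assume "\<not> B < 0"
  then have "0 <= 2 * h * B" "0 <= h\<^sup>2 * A" using \<open>0 < h\<close> A by simp_all
  then show False using neg C by linarith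
 qed
 have "disc ep p u < B\<^sup>2" using A C by (simp add: d)
 then have "sqrt (disc ep p u) < \<bar>B\<bar>" using real_sqrt_less_mono by fastforce
 then have "0 < - B - sqrt (disc ep p u)" using B by simp
 then have "0 < root ep p u" using A by (simp add: root_def flip: A_def B_def)
 moreover have "- B - sqrt (disc ep p u) <= h * A" using s by (simp add: mult.commute)
 then have "root ep p u <= h" using A by (simp add: root_def divide_le_eq flip: A_def B_def)
 ultimately show ?thesis using disc by blast
qed simp

section \<open>Hitting probability of a single background particle\<close>

context rayleigh
begin

text \<open>A velocity-averaged modulus of continuity of the background density at scale
  \<open>ep\<close>. The Hoelder bound is constant in \<open>w\<close> and hence not integrable by
  itself; the cap by the envelope makes it so.\<close>

definition modulus :: "real => real" where
 "modulus ep = (LINT w|lborel. min (M * ep powr \<alpha>) (gb w) * (1 + norm w)\<^sup>2)"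

lemma modulus_integrable: "integrable lborel (%w. min (M * ep powr \<alpha>) (gb w) * (1 + norm w)\<^sup>2)"
 by (rule Bochner_Integration.integrable_bound[OF gb_integrable])
  (use M_pos gb_nonneg in \<open>auto simp: abs_mult min_def intro!: mult_right_mono\<close>)

lemma modulus_nonneg: "0 <= modulus ep"
 unfolding modulus_def by (rule integral_nonneg_AE) (use M_pos gb_nonneg in auto)

lemma nn_integral_modulus: "(NN w. ennreal (min (M * ep powr \<alpha>) (gb w) * (1 + norm w)\<^sup>2) \<partial>lborel) = ennreal (modulus ep)"
 unfolding modulus_def by (rule nn_integral_eq_integral[OF modulus_integrable]) (use M_pos gb_nonneg in auto)

lemma modulus_tendsto:
 assumes ep: "ep \<longlonglongrightarrow> 0" "!!k. 0 < ep k"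
 shows "(%k. modulus (ep k)) \<longlonglongrightarrow> 0"
proof -
 have "(%k. modulus (ep k)) \<longlonglongrightarrow> (LINT w|(lborel :: (real^3) measure). 0)"
  unfolding modulus_def
 proof (rule integral_dominated_convergence[OF _ _ gb_integrable])
  have "(%k. ep k powr \<alpha>) \<longlonglongrightarrow> 0" 
   using tendsto_powr2[OF ep(1) tendsto_const _ \<alpha>_pos] ep(2) by (simp add: less_imp_le)
  from tendsto_mult_left[OF this] have "(%k. M * ep k powr \<alpha>) \<longlonglongrightarrow> M * 0" .
  then have "(%k. min (M * ep k powr \<alpha>) (gb w) * (1 + norm w)\<^sup>2) \<longlonglongrightarrow> min (M * 0) (gb w) * (1 + norm w)\<^sup>2" for w
   by (rule tendsto_mult_right[OF tendsto_min[OF _ tendsto_const]])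
  then show "AE w in lborel. (%k. min (M * ep k powr \<alpha>) (gb w) * (1 + norm w)\<^sup>2) \<longlonglongrightarrow> 0"
   using gb_nonneg by (intro AE_I2) (simp add: min_absorb1)
  show "AE w in lborel. norm (min (M * ep k powr \<alpha>) (gb w) * (1 + norm w)\<^sup>2) <= gb w * (1 + norm w)\<^sup>2" for k
   using M_pos gb_nonneg by (intro AE_I2) (auto simp: abs_mult min_def intro!: mult_right_mono)
 qed auto
 then show ?thesis by simp
qed

definition kappa :: real where "kappa = unit_ball_vol 3 * Cg"

lemma ball_bound:
 assumes "0 < ep"
 shows "(NN b. (if norm (fst b + a *. snd b - x) <= ep then ennreal (g b) else 0) \<partial>lborel) <= ennreal (kappa * ep ^ 3)"
proof -
 have "(NN b. (if norm (fst b + a *. snd b - x) <= ep then ennreal (g b) else 0) \<partial>lborel)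
  = (NN w. NN y. (if norm (y + a *. w - x) <= ep then ennreal (g (y, w)) else 0) \<partial>lborel \<partial>lborel)"
 proof -
  have "Measurable.pred borel (%b. norm (fst b + a *. snd b - x) <= ep)"
   by (rule borel_measurable_le[unfolded pred_def[symmetric]]) measurable
  then have "(%b. if norm (fst b + a *. snd b - x) <= ep then ennreal (g b) else 0) : bm borel"
   by (intro measurable_If) (simp_all add: pred_def)
  then show ?thesis by (simp add: nn_integral_lborel_phase)
 qed
 also have "... <= (NN w. ennreal (unit_ball_vol 3 * ep ^ 3) * ennreal (gb w * (1 + norm w)\<^sup>2) \<partial>lborel)"
 proof (rule nn_integral_mono_AE)
  from g_le_gb show "AE w in lborel. (NN y. (if norm (y + a *. w - x) <= ep then ennreal (g (y, w)) else 0) \<partial>lborel)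
   <= ennreal (unit_ball_vol 3 * ep ^ 3) * ennreal (gb w * (1 + norm w)\<^sup>2)"
  proof eventually_elim
   case (elim w)
   have "(NN y. (if norm (y + a *. w - x) <= ep then ennreal (g (y, w)) else 0) \<partial>lborel)
    <= (NN y. ennreal (gb w) * indicator (cball (x - a *. w) ep) y \<partial>lborel)"
    using elim by (intro nn_integral_mono) (auto simp: indicator_def dist_norm norm_minus_commute algebra_simps ennreal_leI)
   also have "... = ennreal (gb w) * ennreal (unit_ball_vol 3 * ep ^ 3)"
    using assms by (subst nn_integral_cmult_indicator) (auto simp: emeasure_cball)
   also have "... <= ennreal (gb w * (1 + norm w)\<^sup>2) * ennreal (unit_ball_vol 3 * ep ^ 3)"
   proof (intro mult_right_mono ennreal_leI)
    have "1 <= (1 + norm w)\<^sup>2" by (intro one_le_power) simp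
    then show "gb w <= gb w * (1 + norm w)\<^sup>2" using mult_left_mono[OF _ gb_nonneg, of 1 "(1 + norm w)\<^sup>2" w] by simp
   qed simp
   finally show ?case by (simp add: mult.commute)
  qed
 qed
 also have "... = ennreal (kappa * ep ^ 3)"
  using assms Cg_nonneg by (subst nn_integral_cmult) (auto simp: nn_integral_gb kappa_def ennreal_mult[symmetric] mult_ac)
 finally show ?thesis .
qed

text \<open>The change of variables expresses the hitting probability as an integral of the density
  at the pulled-back position. This position differs by \<open>ep *. nu\<close> from the one in the
  loss rate; the modulus measures the cost of the replacement.\<close>

lemma hits_bound:
 assumes ep: "0 < ep" and a: "0 <= a" "a <= e"
 shows "(NN b. (if hits e ep x v a b then ennreal (g b) else 0) \<partial>lborel)
  <= ennreal (ep\<^sup>2 * ((LINT s:{a..e}|lborel. rate g s (x + (s - a) *. v) v) + (e - a) * (area * (1 + norm v) * modulus ep)))"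
proof -
 \<comment> \<open>The background density at the pull-back to time 0 of the record
   \<open>q\<close>.\<close>
 define H where "H q = ennreal (g (x + (fst q - a) *. v + ep *. fst (snd q) - fst q *. snd (snd q), snd (snd q)))" for q :: collision
 have [measurable]: "H : bm borel" unfolding H_def by measurable
 let ?r = "%s. rate g s (x + (s - a) *. v) v"
 let ?D = "area * (1 + norm v) * modulus ep"
 have D: "0 <= ?D" using area_nonneg modulus_nonneg by simp
 have "(NN b. (if hits e ep x v a b then ennreal (g b) else 0) \<partial>lborel) = (NN b. (if hits e ep x v a b then H (next_col ep x v a b) else 0) \<partial>lborel)"
 proof (rule nn_integral_cong)
  fix b :: phase
  show "(if hits e ep x v a b then ennreal (g b) else 0) = (if hits e ep x v a b then H (next_col ep x v a b) else 0)"
  proof (cases "hits e ep x v a b")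
   case True
   obtain y w where b: "b = (y, w)" by (cases b)
   define p where "p = y + a *. w - x"
   define r where "r = root ep p (w - v)"
   have d: "0 < disc ep p (- (v - w))" using True by (simp add: hits_def b p_def)
   have "x + r *. v + ep *. cyl_norm ep p (w - v) - (a + r) *. w = x + p - a *. w"
    using cyl_norm_props(3)[OF ep d] by (simp add: r_def algebra_simps)
   then have "x + r *. v + ep *. cyl_norm ep p (w - v) - (a + r) *. w = y" by (simp add: p_def)
   then have "H (next_col ep x v a b) = ennreal (g b)"
    by (simp add: H_def next_col_def b flip: p_def r_def)
   then show ?thesis by simp
  qed simp
 qed
 also have "... = (NN q. H q * (ennreal (ep\<^sup>2 * max 0 ((v - snd (snd q)) \<bullet> fst (snd q))) * indicator {a<..} (fst q)) \<partial>collision_vol e)"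
  by (rule collision_step[symmetric, OF ep a(1)]) measurable
 also have "... <= (NN q. H q * (ennreal (ep\<^sup>2 * max 0 ((v - snd (snd q)) \<bullet> fst (snd q))) * (if a <= fst q then 1 else 0)) \<partial>collision_vol e)"
  by (intro nn_integral_mono mult_left_mono) (auto simp: indicator_def)
 also have "... = (NN s. (NN nu. NN w. H (s, nu, w) * (ennreal (ep\<^sup>2 * max 0 ((v - w) \<bullet> nu)) * (if a <= s then 1 else 0)) \<partial>lborel \<partial>sphere_measure) * indicator {0..e} s \<partial>lborel)"
 proof -
  have "Measurable.pred borel (%q :: collision. a <= fst q)"
   by (rule borel_measurable_le[unfolded pred_def[symmetric]]) measurable
  then have [measurable]: "(%q :: collision. if a <= fst q then 1 else 0 :: ennreal) : bm borel"
   by (intro measurable_If) (simp_all add: pred_def)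
  have "(%q. H q * (ennreal (ep\<^sup>2 * max 0 ((v - snd (snd q)) \<bullet> fst (snd q))) * (if a <= fst q then 1 else 0))) : bm borel"
   by (intro borel_measurable_times_ennreal) measurable
  then show ?thesis by (simp add: nn_integral_collision_vol)
 qed
 also have "... <= (NN s. ennreal (ep\<^sup>2 * (?r s + ?D)) * indicator {a..e} s \<partial>lborel)"
 proof (rule nn_integral_mono)
  fix s
  show "(NN nu. NN w. H (s, nu, w) * (ennreal (ep\<^sup>2 * max 0 ((v - w) \<bullet> nu)) * (if a <= s then 1 else 0)) \<partial>lborel \<partial>sphere_measure) * indicator {0..e} s
   <= ennreal (ep\<^sup>2 * (?r s + ?D)) * indicator {a..e} s"
  proof (cases "s : {a..e}")
   case True
   let ?x = "x + (s - a) *. v"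
   let ?m = "%w. min (M * ep powr \<alpha>) (gb w) * (1 + norm w)\<^sup>2"
   have m0: "0 <= ?m w" for w using M_pos gb_nonneg by simp
   have "(NN nu. NN w. H (s, nu, w) * ennreal (ep\<^sup>2 * max 0 ((v - w) \<bullet> nu)) \<partial>lborel \<partial>sphere_measure)
    <= (NN nu. NN w. ennreal (ep\<^sup>2) * (ennreal (kern s ?x v (nu, w)) + ennreal ((1 + norm v) * ?m w)) \<partial>lborel \<partial>sphere_measure)"
   proof (rule nn_integral_mono, rule nn_integral_mono_AE)
    fix nu assume "nu : space sphere_measure"
    then have nu: "norm nu = 1" by (simp add: space_sphere_measure)
    from g_le_gb g_holder show "AE w in lborel. H (s, nu, w) * ennreal (ep\<^sup>2 * max 0 ((v - w) \<bullet> nu))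
     <= ennreal (ep\<^sup>2) * (ennreal (kern s ?x v (nu, w)) + ennreal ((1 + norm v) * ?m w))"
    proof eventually_elim
     case (elim w)
     let ?y = "?x - s *. w"
     have n: "norm (?y + ep *. nu - ?y) = ep" using nu ep by simp
     have "\<bar>g (?y + ep *. nu, w) - g (?y, w)\<bar> <= M * norm (?y + ep *. nu - ?y) powr \<alpha>" using elim(2) by blast
     then have "\<bar>g (?y + ep *. nu, w) - g (?y, w)\<bar> <= M * ep powr \<alpha>" unfolding n .
     moreover have "g (?y + ep *. nu, w) <= gb w" "0 <= g (?y, w)" using elim(1) g_nonneg by auto
     \<comment> \<open>The increase is at most the Hoelder bound, and by positivity of the density
       also at most the envelope.\<close>
     ultimately have "g (?y + ep *. nu, w) <= g (?y, w) + min (M * ep powr \<alpha>) (gb w)" by linarith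
     then have "g (?y + ep *. nu, w) * max 0 ((v - w) \<bullet> nu) <= (g (?y, w) + min (M * ep powr \<alpha>) (gb w)) * max 0 ((v - w) \<bullet> nu)"
      by (intro mult_right_mono) auto
     also have "... = kern s ?x v (nu, w) + min (M * ep powr \<alpha>) (gb w) * max 0 ((v - w) \<bullet> nu)"
      by (simp add: kern_Pair distrib_right)
     also have "min (M * ep powr \<alpha>) (gb w) * max 0 ((v - w) \<bullet> nu) <= min (M * ep powr \<alpha>) (gb w) * ((1 + norm v) * (1 + norm w)\<^sup>2)"
      using M_pos gb_nonneg by (intro mult_left_mono kernel_weight(1)[OF nu]) simp
     finally have le: "g (?y + ep *. nu, w) * max 0 ((v - w) \<bullet> nu) <= kern s ?x v (nu, w) + (1 + norm v) * ?m w" by (simp add: mult_ac)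
     have "H (s, nu, w) * ennreal (ep\<^sup>2 * max 0 ((v - w) \<bullet> nu)) = ennreal (ep\<^sup>2 * (g (?y + ep *. nu, w) * max 0 ((v - w) \<bullet> nu)))"
      using g_nonneg by (simp add: H_def ennreal_mult[symmetric] mult_ac algebra_simps)
     also have "... <= ennreal (ep\<^sup>2 * (kern s ?x v (nu, w) + (1 + norm v) * ?m w))"
      using le by (intro ennreal_leI mult_left_mono) auto
     also have "... = ennreal (ep\<^sup>2) * (ennreal (kern s ?x v (nu, w)) + ennreal ((1 + norm v) * ?m w))"
      using m0[of w] kern_nonneg by (simp add: ennreal_mult ennreal_plus)
     finally show ?case .
    qed
   qed
   also have "... = ennreal (ep\<^sup>2) * ((NN nu. NN w. ennreal (kern s ?x v (nu, w)) \<partial>lborel \<partial>sphere_measure) + (NN nu. NN w. ennreal ((1 + norm v) * ?m w) \<partial>lborel \<partial>sphere_measure))"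
   proof -
    have k1: "(%p. ennreal (kern s ?x v p)) : bm (sphere_measure \<Otimes>\<^sub>M lborel)"
     by (rule measurable_compose[OF kern_measurable]) simp
    have k2: "(%w. ennreal (kern s ?x v (nu, w))) : bm lborel" for nu unfolding kern_def by simp
    have k3: "(%nu. NN w. ennreal (kern s ?x v (nu, w)) \<partial>lborel) : bm sphere_measure"
     using lborel.borel_measurable_nn_integral_fst[OF k1] .
    show ?thesis
     using k2 k3 by (simp add: nn_integral_cmult nn_integral_add)
   qed
   also have "(NN nu. NN w. ennreal ((1 + norm v) * ?m w) \<partial>lborel \<partial>sphere_measure) = ennreal ?D"
   proof -
    have "(NN w. ennreal ((1 + norm v) * ?m w) \<partial>lborel) = (NN w. ennreal (1 + norm v) * ennreal (?m w) \<partial>lborel)"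
     using m0 by (intro nn_integral_cong) (simp add: ennreal_mult)
    also have "... = ennreal ((1 + norm v) * modulus ep)"
     using modulus_nonneg by (subst nn_integral_cmult) (auto simp: nn_integral_modulus ennreal_mult)
    finally show ?thesis using area_nonneg modulus_nonneg by (simp add: emeasure_sphere ennreal_mult mult_ac)
   qed
   finally show ?thesis using True a rate_nonneg D by (simp add: ennreal_rate[symmetric] ennreal_mult ennreal_plus)
  next
   case False
   then show ?thesis using a by (auto simp: indicator_def)
  qed
 qed
 also have "... = ennreal (ep\<^sup>2 * ((LINT s:{a..e}|lborel. ?r s) + (e - a) * ?D))"
 proof -
  have "continuous_on UNIV ?r"
   using seg_rate_continuous[of "(x - a *. v, v)" c 0 for c] by (simp add: seg_rate_def algebra_simps)
  then have c: "continuous_on {a..e} (%s. ep\<^sup>2 * (?r s + ?D))" by (auto intro!: continuous_intros elim: continuous_on_subset)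
  have r: "set_integrable lborel {a..e} ?r"
   by (rule borel_integrable_atLeastAtMost') (rule continuous_on_subset[OF \<open>continuous_on UNIV ?r\<close>], simp)
  have "(NN s. ennreal (ep\<^sup>2 * (?r s + ?D)) * indicator {a..e} s \<partial>lborel) = (NN s. ennreal (indicator {a..e} s *. (ep\<^sup>2 * (?r s + ?D))) \<partial>lborel)"
   by (intro nn_integral_cong) (auto simp: indicator_def)
  also have "... = ennreal (LINT s:{a..e}|lborel. ep\<^sup>2 * (?r s + ?D))"
   unfolding set_lebesgue_integral_def
   by (rule nn_integral_eq_integral) (use borel_integrable_atLeastAtMost'[OF c] rate_nonneg D in \<open>auto simp: set_integrable_def indicator_def\<close>)
  also have "(LINT s:{a..e}|lborel. ep\<^sup>2 * (?r s + ?D)) = ep\<^sup>2 * ((LINT s:{a..e}|lborel. ?r s) + (e - a) * ?D)"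
  proof -
   have D: "set_integrable lborel {a..e} (%_. ?D)" "(LINT s:{a..e}|lborel. ?D) = (e - a) * ?D"
    using a by (simp_all add: set_integrable_def set_lebesgue_integral_def)
   show ?thesis using set_integral_add(2)[OF r D(1)] D(2) by simp
  qed
  finally show ?thesis .
 qed
 finally show ?thesis .
qed

end

context rayleigh
begin

definition piece_end :: "(nat => collision) => nat => real => nat => real" where
 "piece_end c n t m = (if m < n then tau c (Suc m) else t)"

definition total_loss :: "phase => (nat => collision) => nat => real => real" where
 "total_loss z c n t = (\<Sum>m\<le>n. seg_loss g z c m (piece_end c n t m))"

text \<open>For each piece, the first term bounds the probability of an overlap at its start, the
  second the error made by evaluating the density at a shifted position.\<close>

definition remainder :: "real => phase => (nat => collision) => nat => real" where
 "remainder ep z c n = (\<Sum>m\<le>n. kappa * ep ^ 3 + ep\<^sup>2 * (T * (area * (1 + norm (vel z c m)) * modulus ep)))"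

text \<open>A hit happens on some piece of the trajectory, either by overlap at the start of the
  piece or by entry during it. For the piece 0 the first alternative covers initial
  overlaps.\<close>

lemma nohit_pieces:
 assumes o: "ord n c" and t: "tau c n <= t" and ep: "0 < ep" and hit: "\<not> nohit ep n z c t b"
 obtains m l where "m <= n" "l : lattice"
  "norm (fst b + l + tau c m *. snd b - pos z c m) <= ep \<or> hits (piece_end c n t m) ep (pos z c m) (vel z c m) (tau c m) (fst b + l, snd b)"
proof -
 obtain s where s: "0 <= s" "s <= t" "torus_dist (traj z c n s) (fst b + s *. snd b) < ep"
  using hit by (auto simp: nohit_def not_le)
 then obtain l where l: "l : lattice" "norm (traj z c n s - (fst b + s *. snd b) - l) < ep"
  unfolding torus_dist_less_iff by blast
 define m where "m = (GREATEST m. m <= n & tau c m <= s)"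
 have m: "m <= n & tau c m <= s"
  unfolding m_def by (rule GreatestI_nat[of _ 0 n]) (use s in auto)
 have "s < tau c (Suc m)" if "m < n"
 proof (rule ccontr)
  assume "\<not> s < tau c (Suc m)"
  then have "Suc m <= m" unfolding m_def by (intro Greatest_le_nat[of _ _ n]) (use that in \<open>auto simp flip: m_def\<close>)
  then show False by simp
 qed
 then have e: "s <= piece_end c n t m" "m < n ==> s <= fst (c m)" using s(2) by (auto simp: piece_end_def)
 let ?p = "fst b + l + tau c m *. snd b - pos z c m" and ?u = "snd b - vel z c m"
 have "?p + (s - tau c m) *. ?u = - (traj z c n s - (fst b + s *. snd b) - l)"
 proof -
  have "traj z c n s = pos z c m + (s - tau c m) *. vel z c m"
   by (rule traj_piece[OF o conjunct1[OF m] conjunct2[OF m] e(2)])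
  then show ?thesis by (simp add: algebra_simps)
 qed
 then have "norm (?p + (s - tau c m) *. ?u) < ep" using l(2) by (simp only: norm_minus_cancel)
 from cylinder_hit[OF ep _ this] m have "norm ?p <= ep \<or> (0 < disc ep ?p ?u & 0 < root ep ?p ?u & root ep ?p ?u <= s - tau c m)" by simp
 then have "norm ?p <= ep \<or> hits (piece_end c n t m) ep (pos z c m) (vel z c m) (tau c m) (fst b + l, snd b)"
  using e(1) by (auto simp: hits_def)
 then show ?thesis using that[of m l] m l(1) by blast
qed

text \<open>Union bound over the \<open>n + 1\<close> pieces and over all lattice images of the
  particle. It is stated with a sum instead of a difference because the values are extended
  nonnegative reals.\<close>

lemma clear_bound:
 assumes o: "ord n c" and t: "tau c n <= t" "t <= T" and ep: "0 < ep"
 shows "1 <= clear ep n t z c + ennreal (ep\<^sup>2 * total_loss z c n t + remainder ep z c n)"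
proof -
 interpret G: prob_space G by (rule prob_G)
 let ?e = "piece_end c n t"
 define W where "W m b = (if norm (fst b + tau c m *. snd b - pos z c m) <= ep then 1 else 0) +
  (if hits (?e m) ep (pos z c m) (vel z c m) (tau c m) b then 1 else 0 :: ennreal)" for m and b :: phase
 have W1: "(%b. if norm (fst b + tau c m *. snd b - pos z c m) <= ep then 1 else 0 :: ennreal) : bm borel" for m
 proof -
  have "Measurable.pred borel (%b. norm (fst b + tau c m *. snd b - pos z c m) <= ep)"
   by (rule borel_measurable_le[unfolded pred_def[symmetric]]) measurable
  then show ?thesis by (intro measurable_If) (simp_all add: pred_def)
 qed
 have W2: "(%b. if hits (?e m) ep (pos z c m) (vel z c m) (tau c m) b then 1 else 0 :: ennreal) : bm borel" for m
  using measurable_next_col(2)[of "%_. pos z c m" borel "%_. vel z c m" "%_. tau c m" "%b. b" "?e m" ep]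
  by (intro measurable_If) (simp_all add: pred_def)
 have Wm[measurable]: "W m : bm borel" for m
  unfolding W_def by (intro borel_measurable_add W1 W2)
 \<comment> \<open>The overlap and entry events of piece \<open>m\<close>, counted over all lattice
   images of the particle. The count dominates the indicator of a hit and unfolds to an integral
   over the whole space.\<close>
 define U where "U m b = (NN l. W m (fst b + l, snd b) \<partial>count_space lattice)" for m and b :: phase
 have Ub: "U m : bm borel" for m
  unfolding U_def by (intro borel_measurable_nn_integral_count_space countable_lattice measurable_compose[OF _ Wm]) measurable
 have piece: "(NN b. U m b \<partial>G) <= ennreal (ep\<^sup>2 * seg_loss g z c m (?e m) + (kappa * ep ^ 3 + ep\<^sup>2 * (T * (area * (1 + norm (vel z c m)) * modulus ep))))"
  if m: "m <= n" for m
 proof -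
  have a: "0 <= tau c m" "tau c m <= ?e m" "?e m <= T"
   using ord_nonneg[OF ord_mono[OF o m]] ord_tau_le[OF o, of m] ord_tau_le[OF o, of "Suc m"] ord_tau_le[OF ord_mono[OF o, of "Suc m"], of m] t m
   by (auto simp: piece_end_def simp del: tau.simps)
  have k: "0 <= kappa * ep ^ 3" using Cg_nonneg ep by (simp add: kappa_def)
  have d: "0 <= area * (1 + norm (vel z c m)) * modulus ep" using area_nonneg modulus_nonneg by simp
  have "(NN b. U m b \<partial>G) = (NN b. ennreal (g b) * U m b \<partial>phase_vol)"
   by (rule nn_integral_density) (auto intro!: measurable_phase_volI Ub)
  also have "... = (NN b. NN l. W m (fst b + l, snd b) * ennreal (g (fst b + l, snd b)) \<partial>count_space lattice \<partial>phase_vol)"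
  proof (rule nn_integral_cong)
   fix b :: phase
   have "(NN l. W m (fst b + l, snd b) * ennreal (g (fst b + l, snd b)) \<partial>count_space lattice) = (NN l. ennreal (g b) * W m (fst b + l, snd b) \<partial>count_space lattice)"
    using g_periodic[of _ "fst b" "snd b"] by (intro nn_integral_cong) (simp add: mult.commute)
   also have "... = ennreal (g b) * U m b" unfolding U_def by (rule nn_integral_cmult) simp
   finally show "ennreal (g b) * U m b = (NN l. W m (fst b + l, snd b) * ennreal (g (fst b + l, snd b)) \<partial>count_space lattice)" ..
  qed
  also have "... = (NN b. W m b * ennreal (g b) \<partial>lborel)"
   by (rule nn_integral_periodize_phase[symmetric]) measurable
  also have "... = (NN b. (if norm (fst b + tau c m *. snd b - pos z c m) <= ep then 1 else 0) * ennreal (g b) +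
    (if hits (?e m) ep (pos z c m) (vel z c m) (tau c m) b then 1 else 0) * ennreal (g b) \<partial>lborel)"
   unfolding W_def distrib_right ..
  also have "... = (NN b. (if norm (fst b + tau c m *. snd b - pos z c m) <= ep then 1 else 0) * ennreal (g b) \<partial>lborel) +
    (NN b. (if hits (?e m) ep (pos z c m) (vel z c m) (tau c m) b then 1 else 0) * ennreal (g b) \<partial>lborel)"
   using borel_measurable_times_ennreal[OF W1, of "%b. ennreal (g b)" m] borel_measurable_times_ennreal[OF W2, of "%b. ennreal (g b)" m]
   by (intro nn_integral_add) simp_all
  also have "... <= ennreal (kappa * ep ^ 3) + ennreal (ep\<^sup>2 * ((LINT s:{tau c m..?e m}|lborel. rate g s (pos z c m + (s - tau c m) *. vel z c m) (vel z c m)) + (?e m - tau c m) * (area * (1 + norm (vel z c m)) * modulus ep)))"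
   by (intro add_mono order_trans[OF _ ball_bound[OF ep]] order_trans[OF _ hits_bound[OF ep a(1,2)]] nn_integral_mono) auto
  also have "... <= ennreal (kappa * ep ^ 3) + ennreal (ep\<^sup>2 * (seg_loss g z c m (?e m) + T * (area * (1 + norm (vel z c m)) * modulus ep)))"
   unfolding seg_loss_def seg_rate_def
   by (intro add_left_mono ennreal_leI mult_left_mono mult_right_mono) (use a d in auto)
  also have "... = ennreal (ep\<^sup>2 * seg_loss g z c m (?e m) + (kappa * ep ^ 3 + ep\<^sup>2 * (T * (area * (1 + norm (vel z c m)) * modulus ep))))"
  proof -
   have "0 <= ep\<^sup>2 * (seg_loss g z c m (?e m) + T * (area * (1 + norm (vel z c m)) * modulus ep))"
    using d seg_loss_nonneg[of z c m "?e m"] T_pos area_nonneg modulus_nonneg by (intro mult_nonneg_nonneg add_nonneg_nonneg[OF _ mult_nonneg_nonneg]) auto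
   from ennreal_plus[OF k this] show ?thesis by (simp only: distrib_left ac_simps)
  qed
  finally show ?thesis .
 qed
 have nh: "(%b. if nohit ep n z c t b then 1 else 0 :: ennreal) : bm G"
 proof -
  have "Measurable.pred G (%b. nohit ep n z c t b)" by (intro pred_nohit G_borel) simp_all
  then show ?thesis by measurable
 qed
 have "1 = (NN b. 1 \<partial>G)" using G.emeasure_space_1 by simp
 also have "... <= (NN b. (if nohit ep n z c t b then 1 else 0) + (\<Sum>m\<le>n. U m b) \<partial>G)"
 proof (rule nn_integral_mono)
  fix b
  show "1 <= (if nohit ep n z c t b then 1 else 0) + (\<Sum>m\<le>n. U m b)"
  proof (cases "nohit ep n z c t b")
   case False
   then obtain m l where ml: "m <= n" "l : lattice"
    "norm (fst b + l + tau c m *. snd b - pos z c m) <= ep \<or> hits (?e m) ep (pos z c m) (vel z c m) (tau c m) (fst b + l, snd b)"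
    using nohit_pieces[OF o t(1) ep] by blast
   have "1 <= W m (fst b + l, snd b)" using ml(3) by (auto simp: W_def)
   also have "... <= U m b" unfolding U_def by (rule nn_integral_ge_point[OF ml(2)])
   also have "... <= (\<Sum>m\<le>n. U m b)" by (rule member_le_sum) (use ml in auto)
   finally show ?thesis using False by simp
  qed simp
 qed
 also have "... = clear ep n t z c + (\<Sum>m\<le>n. NN b. U m b \<partial>G)"
  unfolding clear_def by (subst nn_integral_add[OF nh]) (auto intro!: borel_measurable_sum measurable_phase_volI Ub simp: nn_integral_sum[OF G_borel[OF Ub]])
 also have "... <= clear ep n t z c + (\<Sum>m\<le>n. ennreal (ep\<^sup>2 * seg_loss g z c m (?e m) + (kappa * ep ^ 3 + ep\<^sup>2 * (T * (area * (1 + norm (vel z c m)) * modulus ep)))))"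
  by (intro add_left_mono sum_mono piece) simp
 also have "... = clear ep n t z c + ennreal (ep\<^sup>2 * total_loss z c n t + remainder ep z c n)"
  using seg_loss_nonneg[of z c] Cg_nonneg ep area_nonneg modulus_nonneg T_pos
  by (subst sum_ennreal) (auto simp: total_loss_def remainder_def sum.distrib sum_distrib_left kappa_def intro!: add_nonneg_nonneg mult_nonneg_nonneg)
 finally show ?thesis .
qed

end

section \<open>Almost no tree has a recollision\<close>

lemma measurable_cross3[measurable (raw)]:
 assumes [measurable]: "f : bm R" "g : bm R"
 shows "(%x. cross3 (f x) (g x)) : bm R"
 by (rule borel_measurable_continuous_Pair[OF assms, of cross3])
  (intro continuous_on_cross continuous_on_fst continuous_on_snd continuous_on_id)

text \<open>Requiring \<open>a \<noteq> 0\<close> makes this a null condition for every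
  \<open>a\<close>; degenerate directions need other conditions.\<close>

definition on_plane :: "real^3 => real^3 => bool" where
 "on_plane a x \<longleftrightarrow> a \<noteq> 0 & a \<bullet> x = 0"

text \<open>The line spanned by \<open>q\<close>, enlarged to a finite union of planes.\<close>

definition near_line :: "real^3 => real^3 => bool" where
 "near_line q x \<longleftrightarrow> (\<exists>i\<in>(UNIV :: 3 set). on_plane (cross3 q (axis i 1)) x)"

lemma near_lineI:
 assumes "q \<noteq> 0" shows "near_line q (r *. q)"
proof -
 obtain i where "cross3 q (axis i 1) \<noteq> 0" using cross_basis_nonzero[OF assms] by blast
 then show ?thesis by (auto simp: near_line_def on_plane_def dot_cross_self inner_commute[of _ q])
qed

lemma measurable_planes:
 assumes [measurable]: "a : bm R" "x : bm R"
 shows "Measurable.pred R (%om. on_plane (a om) (x om))" and "Measurable.pred R (%om. near_line (a om) (x om))"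
proof -
 have *: "Measurable.pred R (%om. on_plane (b om) (x om))" if [measurable]: "b : bm R" for b
  unfolding on_plane_def by measurable
 show "Measurable.pred R (%om. near_line (a om) (x om))"
  unfolding near_line_def by (intro pred_countable_ball *) (auto intro: countable_finite)
 show "Measurable.pred R (%om. on_plane (a om) (x om))" by (rule *) measurable
qed

lemma AE_not_on_plane: "AE w in lborel. \<not> on_plane a (w - v)"
proof (cases "a = 0")
 case False
 have "negligible {w. a \<bullet> w = a \<bullet> v}" using False by (rule negligible_hyperplane[OF disjI1])
 moreover have "closed {w. a \<bullet> w = a \<bullet> v}" by (rule closed_hyperplane)
 then have "{w. a \<bullet> w = a \<bullet> v} : sets lborel" by simp
 ultimately have "{w. a \<bullet> w = a \<bullet> v} : null_sets lborel"
  by (simp add: negligible_iff_null_sets null_sets_def)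
 then show ?thesis by (rule AE_I') (auto simp: on_plane_def inner_diff_right)
qed (simp add: on_plane_def)

lemma AE_not_near_line: "AE w in lborel. \<not> near_line q (w - v)"
proof -
 have "AE w in lborel. \<forall>i\<in>UNIV. \<not> on_plane (cross3 q (axis i 1)) (w - v)" by (rule AE_finite_allI) (auto intro: AE_not_on_plane)
 then show ?thesis by (simp add: near_line_def)
qed

text \<open>Surface measure is defined by cones, and the cone over a plane section of the sphere
  lies in the same plane through the origin.\<close>

lemma AE_sphere_not_on_plane: "AE nu in sphere_measure. \<not> on_plane a nu"
proof -
 have P[measurable]: "Measurable.pred borel (on_plane a)" by (rule measurable_planes(1)) auto
 then have F[measurable]: "(%nu. if on_plane a nu then 1 else 0 :: ennreal) : bm borel" by measurable
 have "(NN nu. (if on_plane a nu then 1 else 0) \<partial>sphere_measure)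
  = 3 * (NN y. (if on_plane a (sgn y) then 1 else 0) * indicator (ball 0 1 - {0}) y \<partial>lborel)"
  by (rule nn_integral_sphere) measurable
 also have "(NN y. (if on_plane a (sgn y) then 1 else 0) * indicator (ball 0 1 - {0}) y \<partial>lborel) = (NN (y :: real^3). 0 \<partial>lborel)"
  by (rule nn_integral_cong_AE)
   (use AE_not_on_plane[of a 0] in \<open>eventually_elim, auto simp: on_plane_def indicator_def sgn_vec_def sgn_div_norm\<close>)
 finally have 0: "(NN nu. (if on_plane a nu then 1 else 0) \<partial>sphere_measure) = 0" by simp
 have "(%nu. if on_plane a nu then 1 else 0 :: ennreal) : bm sphere_measure"
  by (simp add: measurable_cong_sets[OF sets_sphere_measure refl] measurable_restrict_space1)
 from nn_integral_0_iff_AE[OF this] 0 show ?thesis by (auto elim!: eventually_mono split: if_splits)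
qed

lemma AE_sphere_not_near_line: "AE nu in sphere_measure. \<not> near_line q nu"
proof -
 have "AE nu in sphere_measure. \<forall>i\<in>UNIV. \<not> on_plane (cross3 q (axis i 1)) nu" by (rule AE_finite_allI) (auto intro: AE_sphere_not_on_plane)
 then show ?thesis by (simp add: near_line_def)
qed

lemma AE_collision_vol:
 assumes P: "Measurable.pred borel P" and ae: "AE t in lborel. AE nu in sphere_measure. AE w in lborel. P (t, nu, w)"
 shows "AE x in collision_vol T. P x"
proof -
 let ?F = "%x. if P x then 0 else 1 :: ennreal"
 have F: "?F : bm borel" using P by measurable
 have "(NN x. ?F x \<partial>collision_vol T) = (NN t. (NN nu. NN w. ?F (t, nu, w) \<partial>lborel \<partial>sphere_measure) * indicator {0..T} t \<partial>lborel)"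
  by (rule nn_integral_collision_vol[OF F])
 also have "... = (NN (t :: real). 0 \<partial>lborel)"
 proof (rule nn_integral_cong_AE)
  from ae show "AE t in lborel. (NN nu. NN w. ?F (t, nu, w) \<partial>lborel \<partial>sphere_measure) * indicator {0..T} t = 0"
  proof eventually_elim
   case (elim t)
   have "(NN nu. NN w. ?F (t, nu, w) \<partial>lborel \<partial>sphere_measure) = (NN nu. 0 \<partial>sphere_measure)"
   proof (rule nn_integral_cong_AE)
    from elim show "AE nu in sphere_measure. (NN w. ?F (t, nu, w) \<partial>lborel) = 0"
    proof eventually_elim
     case (elim nu)
     have "(NN w. ?F (t, nu, w) \<partial>lborel) = (NN (w :: real^3). 0 \<partial>lborel)"
      by (rule nn_integral_cong_AE) (use elim in \<open>eventually_elim, simp\<close>)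
     then show ?case by simp
    qed
   qed
   then show ?case by simp
  qed
 qed
 finally have "(NN x. ?F x \<partial>collision_vol T) = 0" by simp
 with nn_integral_0_iff_AE[OF collision_vol_measurable[OF F]] show ?thesis
  by (auto elim!: eventually_mono split: if_splits)
qed

lemma AE_tree_coords_Suc:
 assumes P: "Measurable.pred (tree_coords_vol T (Suc n)) P"
  and ae: "AE zc in tree_coords_vol T n. AE x in collision_vol T. P (fst zc, (snd zc)(n := x))"
 shows "AE zc in tree_coords_vol T (Suc n). P zc"
proof -
 let ?F = "%zc. if P zc then 0 else 1 :: ennreal"
 have F: "?F : bm (tree_coords_vol T (Suc n))" using P by measurable
 have "(NN zc. ?F zc \<partial>tree_coords_vol T (Suc n)) = (NN zc. NN x. ?F (fst zc, (snd zc)(n := x)) \<partial>collision_vol T \<partial>tree_coords_vol T n)"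
  by (rule nn_integral_tree_coords_Suc[OF F])
 also have "... = (NN zc. 0 \<partial>tree_coords_vol T n)"
 proof (rule nn_integral_cong_AE)
  from ae show "AE zc in tree_coords_vol T n. (NN x. ?F (fst zc, (snd zc)(n := x)) \<partial>collision_vol T) = 0"
  proof eventually_elim
   case (elim zc)
   have "(NN x. ?F (fst zc, (snd zc)(n := x)) \<partial>collision_vol T) = (NN x. 0 \<partial>collision_vol T)"
    by (rule nn_integral_cong_AE) (use elim in \<open>eventually_elim, simp\<close>)
   then show ?case by simp
  qed
 qed
 finally have "(NN zc. ?F zc \<partial>tree_coords_vol T (Suc n)) = 0" by simp
 with nn_integral_0_iff_AE[OF F] show ?thesis by (auto elim!: eventually_mono split: if_splits)
qed

section \<open>Generic trees\<close>

definition reflect :: "real^3 => real^3 => real^3" where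
 "reflect nu x = x - (2 * (nu \<bullet> x)) *. nu"

definition out_vel :: "phase => (nat => collision) => nat => real^3" where
 "out_vel z c k = snd (snd (c k)) + (fst (snd (c k)) \<bullet> (vel z c k - snd (snd (c k)))) *. fst (snd (c k))"

text \<open>Relative position, at the time of collision \<open>j\<close> and for point particles, of
  the tagged particle and the translate by \<open>l\<close> of the particle of collision
  \<open>k\<close>.\<close>

definition lag :: "phase => (nat => collision) => nat => nat => real^3 => real^3" where
 "lag z c k j l = pos z c (Suc j) - bpath 0 z c k (fst (c j)) - l"

text \<open>
 Conditions on the last collision \<open>j\<close> of a tree, given the others: the incoming background particle
 has not met the tagged particle before, does not meet it again right after the collision, and the
 new tagged velocity does not lead to an earlier background particle.
\<close>

definition avoid :: "phase => (nat => collision) => nat => bool" where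
 "avoid z c j \<longleftrightarrow> 0 < fst (c j) \<and>
  (\<forall>m\<in>{..j}. snd (snd (c j)) \<noteq> vel z c m \<and>
   (\<forall>l\<in>lattice. \<not> near_line (l + pos z c (Suc j) - pos z c m - (fst (c j) - tau c m) *. vel z c m) (snd (snd (c j)) - vel z c m))) \<and>
  (\<forall>l\<in>lattice. \<not> near_line (reflect (fst (snd (c j))) l) (snd (snd (c j)) - vel z c j)) \<and>
  (\<forall>k\<in>{..<j}. \<forall>l\<in>lattice. \<not> on_plane (cross3 (lag z c k j l) (vel z c j - out_vel z c k)) (fst (snd (c j))) \<and>
   \<not> near_line (lag z c k j l) (fst (snd (c j))) & \<not> near_line (vel z c j - out_vel z c k) (fst (snd (c j))))"

lemma bpath_cong: "(!!i. i <= k ==> c i = c' i) ==> bpath ep z c k s = bpath ep z c' k s"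
 using coords_cong(3)[of "Suc k" c c' z] coords_cong(2)[of k c c' z] by (simp add: bpath_def del: pos.simps)

lemma avoid_cong:
 assumes "!!i. i <= j ==> c i = c' i"
 shows "avoid z c j = avoid z c' j"
proof -
 have "lag z c k j = lag z c' k j" if "k < j" for k
  unfolding lag_def using that assms coords_cong(3)[of "Suc j" c c' z] bpath_cong[of k c c' 0 z]
  by (simp add: fun_eq_iff del: pos.simps)
 moreover have "out_vel z c k = out_vel z c' k" if "k < j" for k
  unfolding out_vel_def using that assms coords_cong(2)[of k c c' z] by simp
 moreover have "vel z c m = vel z c' m" "tau c m = tau c' m" "pos z c m = pos z c' m" if "m <= j" for m
  using that assms coords_cong[of m c c'] by simp_all
 moreover have "pos z c (Suc j) = pos z c' (Suc j)" "c j = c' j" using assms coords_cong(3)[of "Suc j" c c' z] by (simp_all del: pos.simps)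
 ultimately show ?thesis unfolding avoid_def by simp
qed

lemma pred_avoid:
 assumes Z: "Z : bm R" and C: "!!i. i <= j ==> (%om. C om i) : bm R"
 shows "Measurable.pred R (%om. avoid (Z om) (C om) j)"
proof -
 note [measurable] = C[OF order_refl]
 have p[measurable]: "(%om. pos (Z om) (C om) m) : bm R" if "m <= Suc j" for m by (rule measurable_pos[OF Z C]) (use that in simp)
 have v[measurable]: "(%om. vel (Z om) (C om) m) : bm R" if "m <= j" for m by (rule measurable_vel[OF Z C]) (use that in simp)
 have t[measurable]: "(%om. tau (C om) m) : bm R" if "m <= j" for m by (rule measurable_tau[OF Z C]) (use that in simp)
 have o: "(%om. out_vel (Z om) (C om) k) : bm R" if "k < j" for k
 proof -
  have [measurable]: "(%om. C om k) : bm R" "(%om. vel (Z om) (C om) k) : bm R" using that C v by auto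
  show ?thesis unfolding out_vel_def by measurable
 qed
 have lg: "(%om. lag (Z om) (C om) k j l) : bm R" if "k < j" for k l
 proof -
  have [measurable]: "(%om. C om k) : bm R" "(%om. vel (Z om) (C om) k) : bm R"
   "(%om. pos (Z om) (C om) (Suc k)) : bm R" "(%om. pos (Z om) (C om) (Suc j)) : bm R"
   using that C v p[of "Suc k"] p[of "Suc j"] by (simp_all del: pos.simps)
  show ?thesis unfolding lag_def bpath_def case_prod_beta' by measurable
 qed
 have neg: "Measurable.pred R (%om. \<not> Q om)" if "Measurable.pred R Q" for Q using that by measurable
 have pSj: "(%om. pos (Z om) (C om) (Suc j)) : bm R" by (rule p) simp
 show ?thesis
  unfolding avoid_def
 proof (intro pred_conj pred_countable_ball countable_lattice neg measurable_planes)
  show "Measurable.pred R (%om. 0 < fst (C om j))" by measurable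
  show "Measurable.pred R (%om. snd (snd (C om j)) = vel (Z om) (C om) m)" if "m : {..j}" for m
  proof -
   have [measurable]: "(%om. vel (Z om) (C om) m) : bm R" by (rule v) (use that in simp)
   show ?thesis by measurable
  qed
  show "(%om. l + pos (Z om) (C om) (Suc j) - pos (Z om) (C om) m - (fst (C om j) - tau (C om) m) *. vel (Z om) (C om) m) : bm R"
   if "m : {..j}" for m l
  proof -
   have [measurable]: "(%om. vel (Z om) (C om) m) : bm R" by (rule v) (use that in simp)
   have [measurable]: "(%om. tau (C om) m) : bm R" by (rule t) (use that in simp)
   have [measurable]: "(%om. pos (Z om) (C om) m) : bm R" by (rule p) (use that in simp)
   note [measurable] = pSj
   show ?thesis by measurable
  qed
  show "(%om. snd (snd (C om j)) - vel (Z om) (C om) m) : bm R" if "m : {..j}" for m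
  proof -
   have [measurable]: "(%om. vel (Z om) (C om) m) : bm R" by (rule v) (use that in simp)
   show ?thesis by measurable
  qed
  show "(%om. reflect (fst (snd (C om j))) l) : bm R" for l unfolding reflect_def by measurable
  show "(%om. snd (snd (C om j)) - vel (Z om) (C om) j) : bm R" 
  proof -
   have [measurable]: "(%om. vel (Z om) (C om) j) : bm R" by (rule v) simp
   show ?thesis by measurable
  qed
  fix k l assume "k : {..<j}"
  then have [measurable]: "(%om. lag (Z om) (C om) k j l) : bm R" "(%om. out_vel (Z om) (C om) k) : bm R"
   "(%om. vel (Z om) (C om) j) : bm R" using lg o v by auto
  show "(%om. cross3 (lag (Z om) (C om) k j l) (vel (Z om) (C om) j - out_vel (Z om) (C om) k)) : bm R" by measurable
  show "(%om. lag (Z om) (C om) k j l) : bm R" by measurable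
  show "(%om. vel (Z om) (C om) j - out_vel (Z om) (C om) k) : bm R" by measurable
  show "(%om. fst (snd (C om j))) : bm R" "(%om. fst (snd (C om j))) : bm R" "(%om. fst (snd (C om j))) : bm R" by measurable
 qed auto
qed

text \<open>The conditions are arranged for Fubini: for a given time those on the normal exclude
  countably many planes, and for given time and normal those on the incoming velocity do so
  too.\<close>

lemma AE_avoid_last:
 shows "AE x in collision_vol T. avoid z (c(n := x)) n"
proof -
 have vt: "vel z (c(n := x)) m = vel z c m" "tau (c(n := x)) m = tau c m" "pos z (c(n := x)) m = pos z c m" if "m <= n" for m x
  using that coords_cong[of m "c(n := x)" c] by simp_all
 have ov: "out_vel z (c(n := x)) k = out_vel z c k" if "k < n" for k x
  using that vt[of k] by (simp add: out_vel_def)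
 have lg: "lag z (c(n := x)) k n l = pos z c n + (fst x - tau c n) *. vel z c n - bpath 0 z c k (fst x) - l" if "k < n" for k x l
  using that vt[of n x] bpath_cong[of k "c(n := x)" c] by (simp add: lag_def)
 have pS: "pos z (c(n := x)) (Suc n) = pos z c n + (fst x - tau c n) *. vel z c n" for x
  using vt[of n x] by simp
 let ?X = "%t. pos z c n + (t - tau c n) *. vel z c n"
 let ?lag = "%t k l. ?X t - bpath 0 z c k t - l"
 have iff: "avoid z (c(n := (t, nu, w))) n \<longleftrightarrow> 0 < t \<and>
  (\<forall>m\<in>{..n}. w \<noteq> vel z c m & (\<forall>l\<in>lattice. \<not> near_line (l + ?X t - pos z c m - (t - tau c m) *. vel z c m) (w - vel z c m))) \<and>
  (\<forall>l\<in>lattice. \<not> near_line (reflect nu l) (w - vel z c n)) \<and>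
  (\<forall>k\<in>{..<n}. \<forall>l\<in>lattice. \<not> on_plane (cross3 (?lag t k l) (vel z c n - out_vel z c k)) nu \<and>
   \<not> near_line (?lag t k l) nu & \<not> near_line (vel z c n - out_vel z c k) nu)" for t nu w
  unfolding avoid_def by (simp add: vt ov lg pS del: pos.simps)
 have "AE x in collision_vol T. avoid z (c(n := x)) n \<or> fst x <= 0"
 proof (rule AE_collision_vol)
  have [measurable]: "Measurable.pred borel (%x. avoid z (c(n := x)) n)"
   by (rule pred_avoid) (auto simp: fun_upd_def)
  show "Measurable.pred borel (%x. avoid z (c(n := x)) n \<or> fst x <= 0)" by measurable
  show "AE t in lborel. AE nu in sphere_measure. AE w in lborel. avoid z (c(n := (t, nu, w))) n \<or> fst (t, nu, w) <= 0"
  proof (rule AE_I2)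
   fix t
   have "AE nu in sphere_measure. \<forall>k\<in>{..<n}. \<forall>l\<in>lattice. \<not> on_plane (cross3 (?lag t k l) (vel z c n - out_vel z c k)) nu \<and>
    \<not> near_line (?lag t k l) nu & \<not> near_line (vel z c n - out_vel z c k) nu"
    by (simp add: AE_finite_all AE_ball_countable countable_lattice AE_sphere_not_on_plane AE_sphere_not_near_line)
   then show "AE nu in sphere_measure. AE w in lborel. avoid z (c(n := (t, nu, w))) n \<or> fst (t, nu, w) <= 0"
   proof eventually_elim
    case (elim nu)
    have "AE w in lborel. \<forall>m\<in>{..n}. w \<noteq> vel z c m & (\<forall>l\<in>lattice. \<not> near_line (l + ?X t - pos z c m - (t - tau c m) *. vel z c m) (w - vel z c m))"
     by (simp add: AE_finite_all AE_ball_countable countable_lattice AE_not_near_line AE_lborel_singleton)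
    moreover have "AE w in lborel. \<forall>l\<in>lattice. \<not> near_line (reflect nu l) (w - vel z c n)"
     by (simp add: AE_ball_countable countable_lattice AE_not_near_line)
    ultimately show ?case
    proof eventually_elim
     case E: (elim w)
     show ?case unfolding iff using elim E by auto
    qed
   qed
  qed
 qed
 moreover have "AE x in collision_vol T. fst x \<noteq> 0 & 0 <= fst x"
 proof -
  have "AE x in collision_vol T. fst x \<noteq> 0"
   by (rule AE_collision_vol) (use AE_lborel_singleton[of "0 :: real"] in auto)
  moreover have "AE x in collision_vol T. 0 <= fst x"
   by (rule AE_I2) (auto simp: collision_vol_def space_pair_measure space_restrict_space)
  ultimately show ?thesis by eventually_elim auto
 qed
 ultimately show ?thesis by eventually_elim auto
qed

text \<open>Each collision is generic given its predecessors. \<open>U\<close> will be the null set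
  of velocities at which the Hoelder bound fails.\<close>

lemma AE_avoid:
 assumes U: "U : null_sets lborel"
 shows "AE zc in tree_coords_vol T n. \<forall>k<n. avoid (fst zc) (snd zc) k & snd (snd (snd zc k)) \<notin> U"
proof (induction n)
 case (Suc n)
 have U'[measurable]: "U : sets borel" using U by auto
 show ?case
 proof (rule AE_tree_coords_Suc)
  have "Measurable.pred (tree_coords_vol T (Suc n)) (%zc. snd (snd (snd zc k)) \<notin> U)" if "k < Suc n" for k
  proof -
   have [measurable]: "(%zc. snd zc k) : bm (tree_coords_vol T (Suc n))" by (rule tree_coords_components(2)[OF that])
   show ?thesis by measurable
  qed
  then have "Measurable.pred (tree_coords_vol T (Suc n)) (%zc. \<forall>k\<in>{..<Suc n}. avoid (fst zc) (snd zc) k & snd (snd (snd zc k)) \<notin> U)"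
   by (intro pred_countable_ball pred_conj pred_avoid tree_coords_components) auto
  then show "Measurable.pred (tree_coords_vol T (Suc n)) (%zc. \<forall>k<Suc n. avoid (fst zc) (snd zc) k & snd (snd (snd zc k)) \<notin> U)"
   unfolding Ball_def lessThan_iff .
  from Suc show "AE zc in tree_coords_vol T n. AE x in collision_vol T. \<forall>k<Suc n. avoid (fst (fst zc, (snd zc)(n := x))) (snd (fst zc, (snd zc)(n := x))) k & snd (snd (snd (fst zc, (snd zc)(n := x)) k)) \<notin> U"
  proof eventually_elim
   case (elim zc)
   have "AE x in collision_vol T. snd (snd x) \<notin> U"
    by (rule AE_collision_vol) (use AE_not_in[OF U] in auto)
   with AE_avoid_last[where T = T and z = "fst zc" and c = "snd zc" and n = n] show ?case
   proof eventually_elim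
    case E: (elim x)
    show ?case
    proof (intro allI impI)
     fix k assume "k < Suc n"
     then show "avoid (fst (fst zc, (snd zc)(n := x))) (snd (fst zc, (snd zc)(n := x))) k & snd (snd (snd (fst zc, (snd zc)(n := x)) k)) \<notin> U"
      using elim E avoid_cong[of k "(snd zc)(n := x)" "snd zc" "fst zc"] by (cases "k = n") auto
    qed
   qed
  qed
 qed
qed simp


section \<open>Separation of particles along generic trees\<close>

lemma reflect_reflect:
 assumes "nu \<bullet> nu = 1"
 shows "reflect nu (d *. reflect nu x) = d *. x"
proof -
 have "nu \<bullet> (d *. reflect nu x) = - (d * (nu \<bullet> x))"
  using assms by (simp add: reflect_def inner_diff_right algebra_simps)
 then have "reflect nu (d *. reflect nu x) = d *. reflect nu x - (2 * - (d * (nu \<bullet> x))) *. nu"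
  by (simp only: reflect_def[of nu "d *. reflect nu x"])
 also have "... = d *. x" by (simp add: reflect_def scaleR_diff_right mult.left_commute)
 finally show ?thesis .
qed

text \<open>A time equal to a collision time is assigned to the piece that ends there. The elapsed
  time on the piece is then positive unless the piece is the first.\<close>

lemma piece_left_open:
 assumes "ord n c" "0 <= s"
 obtains m where "m <= n" "m = 0 \<or> tau c m < s" "tau c m <= s" "m < n ==> s <= fst (c m)"
proof -
 define m where "m = (GREATEST m. m <= n & (m = 0 \<or> tau c m < s))"
 have m: "m <= n & (m = 0 \<or> tau c m < s)"
  unfolding m_def by (rule GreatestI_nat[of _ 0 n]) auto
 have "s <= fst (c m)" if "m < n"
 proof (rule ccontr)
  assume "\<not> s <= fst (c m)"
  then have "Suc m <= m" unfolding m_def by (intro Greatest_le_nat[of _ _ n]) (use that in \<open>auto simp flip: m_def\<close>)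
  then show False by simp
 qed
 then show ?thesis using m assms that[of m] by auto
qed

text \<open>A second meeting of point particles is a vector equation which, in each of three cases,
  confines the last chosen incoming velocity or normal to a line or plane excluded by
  \<open>avoid\<close>. The lattice vector in the equation ranges over a countable set only.\<close>

lemma no_recollision:
 assumes o: "ord n c" and k: "k < n" and av: "!!j. j < n ==> avoid z c j" and nu: "!!j. j < n ==> norm (fst (snd (c j))) = 1"
  and tr: "!!j. j < n ==> 0 < (vel z c j - snd (snd (c j))) \<bullet> fst (snd (c j))"
  and s: "0 <= s" "s \<noteq> fst (c k)"
 shows "traj z c n s - bpath 0 z c k s \<notin> lattice"
proof
 assume L: "traj z c n s - bpath 0 z c k s : lattice"
 define l where "l = traj z c n s - bpath 0 z c k s"
 obtain m where m: "m <= n" "m = 0 \<or> tau c m < s" "tau c m <= s" "m < n ==> s <= fst (c m)"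
  using piece_left_open[OF o s(1)] by blast
 have tp: "traj z c n s = pos z c m + (s - tau c m) *. vel z c m" by (rule traj_piece[OF o m(1,3,4)])
 obtain t nu' w where ck: "c k = (t, nu', w)" by (cases "c k") auto
 have n1: "nu' \<bullet> nu' = 1" using nu[OF k] ck by (simp add: norm_eq_1)
 have bp: "bpath 0 z c k r = pos z c (Suc k) + (if r <= t then (r - t) *. w else (r - t) *. out_vel z c k)" for r
  by (simp add: bpath_def ck out_vel_def min_def max_def del: pos.simps)
 consider "m <= k" | "m = Suc k" | j where "m = Suc j" "k < j" "j < n" using m(1) by (metis Suc_le_eq less_Suc_eq_le not_less_eq old.nat.exhaust not_less_zero le_less)
 then show False
 proof cases
  \<comment> \<open>A meeting before the collision: the incoming velocity relative to piece
    \<open>m\<close> is parallel to \<open>q\<close>, which does not depend on that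
    velocity.\<close>
  case 1
  have "fst (c m) <= t" using 1 ord_less[OF o, of m k] k ck by (cases "m = k") auto
  then have st: "s < t" using m(4) 1 k s(2) ck by fastforce
  define q where "q = l + pos z c (Suc k) - pos z c m - (t - tau c m) *. vel z c m"
  have "l = pos z c m + (s - tau c m) *. vel z c m - pos z c (Suc k) - (s - t) *. w"
   using st by (simp add: l_def tp bp del: pos.simps)
  then have q: "q = (t - s) *. (w - vel z c m)" by (simp add: q_def algebra_simps del: pos.simps vel.simps)
  have nw: "w \<noteq> vel z c m" "\<not> near_line q (w - vel z c m)"
   using av[OF k] 1 L by (auto simp: avoid_def ck q_def l_def simp del: pos.simps vel.simps tau.simps)
  have "q \<noteq> 0" using st nw(1) unfolding q by simp
  then have "near_line q ((1 / (t - s)) *. q)" by (rule near_lineI)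
  moreover have "(1 / (t - s)) *. q = w - vel z c m" using st unfolding q by simp
  ultimately show False using nw(2) by metis
 next
  \<comment> \<open>A meeting on the piece right after the collision: the relative velocity has been
    reflected by the normal, so reflecting the equation back constrains the incoming velocity. If
    \<open>l = 0\<close>, the two incoming velocities would be equal.\<close>
  case 2
  then have st: "t < s" using m(2) ck by simp
  define r where "r = vel z c k - w"
  have "l = (s - t) *. (vel z c (Suc k) - out_vel z c k)"
   using st unfolding l_def tp bp 2 by (simp add: ck algebra_simps del: pos.simps vel.simps)
  also have "vel z c (Suc k) - out_vel z c k = reflect nu' r"
  proof -
   define b where "b = nu' \<bullet> r"
   have v: "vel z c (Suc k) = vel z c k - b *. nu'" and w: "out_vel z c k = w + b *. nu'"
    by (simp_all add: ck deflect_def out_vel_def b_def r_def)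
   have r: "reflect nu' r = vel z c k - w - (2 * b) *. nu'" by (simp add: reflect_def b_def r_def)
   show ?thesis unfolding v w r mult_2 scaleR_add_left by (simp only: diff_diff_eq ac_simps)
  qed
  finally have "reflect nu' l = (s - t) *. r" by (simp only: reflect_reflect[OF n1])
  then have e: "w - vel z c k = (- 1 / (s - t)) *. reflect nu' l" using st by (simp add: r_def)
  have "w \<noteq> vel z c k" "\<not> near_line (reflect nu' l) (w - vel z c k)"
   using av[OF k] L by (auto simp: avoid_def ck l_def simp del: pos.simps vel.simps tau.simps)
  then show False
   using near_lineI[of "reflect nu' l" "- 1 / (s - t)"] unfolding e[symmetric]
   by (cases "reflect nu' l = 0") (use e in simp_all)
 next
  \<comment> \<open>A meeting after a later collision \<open>j\<close>: its normal is a combination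
    of \<open>p\<close> and \<open>u\<close>, neither of which depends on that normal. If they are
    independent, this is a plane, otherwise a line spanned by one of them.\<close>
  case 3
  obtain tj nuj wj where cj: "c j = (tj, nuj, wj)" by (cases "c j") auto
  have ttj: "t < tj" using ord_less[OF o, of k j] 3 ck cj by simp
  define h where "h = s - tj"
  have h: "0 < h" using m(2) 3 cj by (simp add: h_def)
  define a where "a = (vel z c j - wj) \<bullet> nuj"
  have a: "0 < a" using tr[of j] 3 cj by (simp add: a_def)
  define p where "p = lag z c k j l"
  define u where "u = vel z c j - out_vel z c k"
  have Vm: "vel z c m = vel z c j - a *. nuj" using 3 by (simp add: cj deflect_def a_def inner_commute)
  have "p = pos z c (Suc j) - (pos z c (Suc k) + (tj - t) *. out_vel z c k) - l"
   using ttj by (simp add: p_def lag_def cj bp del: pos.simps)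
  moreover have "l = pos z c (Suc j) + h *. (vel z c j - a *. nuj) - (pos z c (Suc k) + (s - t) *. out_vel z c k)"
   unfolding l_def tp Vm bp using 3 h ttj by (simp add: cj h_def del: pos.simps)
  ultimately have "p + h *. u = (h * a) *. nuj" by (simp add: u_def h_def algebra_simps del: pos.simps)
  then have nuj: "nuj = (1 / (h * a)) *. (p + h *. u)" using h a by simp
  have nj: "nuj \<noteq> 0" using nu[of j] 3 cj by auto
  have av: "\<not> on_plane (cross3 p u) nuj" "\<not> near_line p nuj" "\<not> near_line u nuj"
   using av[of j] 3 L by (auto simp: avoid_def cj p_def u_def l_def simp del: pos.simps vel.simps tau.simps)
  show False
  proof (cases "cross3 p u = 0")
   case False
   have "cross3 p u \<bullet> nuj = 0" by (simp add: nuj inner_simps dot_cross_self inner_commute[of "cross3 p u"])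
   then show False using av(1) False by (simp add: on_plane_def)
  next
   case True
   have "collinear {0, p, u}" using True by (simp add: cross_eq_0)
   show False
   proof (cases "p = 0")
    case True
    then have "u \<noteq> 0" using nj nuj by auto
    then show False using near_lineI[of u "1 / a"] av(3) True h by (simp add: nuj)
   next
    case False
    then obtain b where "u = b *. p" using \<open>collinear {0, p, u}\<close> by (auto simp: collinear_lemma)
    then have "nuj = ((1 + h * b) / (h * a)) *. p" by (simp add: nuj algebra_simps add_divide_distrib)
    then show False using near_lineI[OF False, of "(1 + h * b) / (h * a)"] av(2) by simp
   qed
  qed
 qed
qed

text \<open>Near its collision the pair separates at least linearly on both sides, with slope the
  normal component of the relative velocity. This component only changes its sign at the
  collision.\<close>

lemma good_near:
 assumes o: "ord n c" and k: "k < n" and tk: "0 < fst (c k)" and nu: "norm (fst (snd (c k))) = 1"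
  and tr: "0 < (vel z c k - snd (snd (c k))) \<bullet> fst (snd (c k))"
 obtains \<delta> where "0 < \<delta>" "!!ep s. 0 < ep ==> ep <= 1 / 4 ==> \<bar>s - fst (c k)\<bar> <= \<delta> ==>
  ep + \<bar>s - fst (c k)\<bar> * ((vel z c k - snd (snd (c k))) \<bullet> fst (snd (c k))) <= torus_dist (traj z c n s) (bpath ep z c k s)"
proof -
 obtain t nu' w where ck: "c k = (t, nu', w)" by (cases "c k") auto
 define r where "r = vel z c k - w"
 define \<rho> where "\<rho> = r \<bullet> nu'"
 have n1: "nu' \<bullet> nu' = 1" "norm nu' = 1" using nu ck by (simp_all add: norm_eq_1)
 define R where "R = r - (2 * \<rho>) *. nu'"
 have gap: "0 < t - tau c k"
  using ord_mono[OF o, of "Suc k"] k tk ck by (cases k) (auto simp: ord_Suc)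
 define d1 where "d1 = (if Suc k < n then fst (c (Suc k)) - t else 1)"
 have d1: "0 < d1" using ord_less[OF o, of k "Suc k"] ck by (auto simp: d1_def)
 \<comment> \<open>Up to \<open>\<delta>\<close> only the two pieces adjacent to the collision
   matter, and the displacement is at most 1/4. With \<open>ep <= 1 / 4\<close> the torus distance
   is then an ordinary norm.\<close>
 define \<delta> where "\<delta> = min (min (t - tau c k) d1) (1 / (4 * (1 + norm r + norm R)))"
 have den: "0 < 1 + norm r + norm R" by (smt (verit) norm_ge_zero)
 have \<delta>: "0 < \<delta>" using gap d1 den by (simp add: \<delta>_def)
 have small: "\<bar>h\<bar> * norm q <= 1 / 4" if "\<bar>h\<bar> <= \<delta>" "norm q <= 1 + norm r + norm R" for h :: real and q :: "real^3"
 proof -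
  have "\<bar>h\<bar> * norm q <= (1 / (4 * (1 + norm r + norm R))) * (1 + norm r + norm R)"
   using that \<delta> by (intro mult_mono) (auto simp: \<delta>_def)
  also have "... = 1 / 4" using den by (simp only: divide_simps mult_ac) (use den in auto)
  finally show ?thesis .
 qed
 have main: "ep + \<bar>s - t\<bar> * \<rho> <= torus_dist (traj z c n s) (bpath ep z c k s)"
  if ep: "0 < ep" "ep <= 1 / 4" and s: "\<bar>s - t\<bar> <= \<delta>" for ep s
 proof -
  obtain q where q: "traj z c n s - bpath ep z c k s = (s - t) *. q - ep *. nu'" "norm q <= 1 + norm r + norm R" "- ((s - t) * (q \<bullet> nu')) = \<bar>s - t\<bar> * \<rho>"
  proof (cases "s <= t")
   case True
   have a: "traj z c n s = pos z c k + (s - tau c k) *. vel z c k"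
    by (rule traj_piece[OF o]) (use k True s ck in \<open>auto simp: \<delta>_def\<close>)
   have b: "bpath ep z c k s = pos z c (Suc k) + ep *. nu' + (s - t) *. w"
    using True by (simp add: bpath_def ck min_absorb2 max_absorb1 del: pos.simps)
   have "traj z c n s - bpath ep z c k s = (s - t) *. r - ep *. nu'"
    unfolding a b by (simp add: r_def ck algebra_simps)
   moreover have "- ((s - t) * (r \<bullet> nu')) = \<bar>s - t\<bar> * \<rho>" using True by (simp add: \<rho>_def left_diff_distrib)
   ultimately show ?thesis using norm_ge_zero[of R] by (intro that[of r]) auto
  next
   case False
   have v: "vel z c (Suc k) = vel z c k - \<rho> *. nu'" by (simp add: ck deflect_def \<rho>_def r_def inner_commute)
   have a: "traj z c n s = pos z c (Suc k) + (s - tau c (Suc k)) *. vel z c (Suc k)"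
    by (rule traj_piece[OF o]) (use k False s ck in \<open>auto simp: \<delta>_def d1_def split: if_splits\<close>)
   have b: "bpath ep z c k s = pos z c (Suc k) + ep *. nu' + (s - t) *. (w + \<rho> *. nu')"
    using False by (simp add: bpath_def ck min_absorb1 max_absorb2 \<rho>_def r_def inner_commute del: pos.simps)
   have "traj z c n s - bpath ep z c k s = (s - t) *. (vel z c k - \<rho> *. nu' - (w + \<rho> *. nu')) - ep *. nu'"
    unfolding a b v by (simp add: ck scaleR_diff_right scaleR_add_right del: pos.simps)
   also have "vel z c k - \<rho> *. nu' - (w + \<rho> *. nu') = R"
    unfolding R_def r_def mult_2 scaleR_add_left by (simp only: diff_diff_eq ac_simps)
   finally have "traj z c n s - bpath ep z c k s = (s - t) *. R - ep *. nu'" .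
   moreover have "R \<bullet> nu' = - \<rho>" using n1 by (simp add: R_def inner_diff_left \<rho>_def[symmetric])
   ultimately show ?thesis using that[of R] False by simp
  qed
  have "norm ((s - t) *. q - ep *. nu') <= \<bar>s - t\<bar> * norm q + ep"
   using norm_triangle_ineq4[of "(s - t) *. q" "ep *. nu'"] n1 ep by simp
  also have "... <= 1 / 2" using small[OF s q(2)] ep by simp
  finally have "torus_dist (traj z c n s) (bpath ep z c k s) = norm ((s - t) *. q - ep *. nu')"
   using torus_dist_eq_norm[OF lattice_zero, of "traj z c n s" "bpath ep z c k s"] q(1) by simp
  moreover have "ep + \<bar>s - t\<bar> * \<rho> <= norm ((s - t) *. q - ep *. nu')"
  proof -
   have "ep + \<bar>s - t\<bar> * \<rho> = - (((s - t) *. q - ep *. nu') \<bullet> nu')"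
    unfolding q(3)[symmetric] using n1 by (simp add: inner_diff_left)
   also have "... <= norm ((s - t) *. q - ep *. nu') * norm nu'"
    using Cauchy_Schwarz_ineq2[of "(s - t) *. q - ep *. nu'" nu'] by linarith
   finally show ?thesis using n1 by simp
  qed
  ultimately show ?thesis by simp
 qed
 show ?thesis by (rule that[OF \<delta>]) (use main in \<open>simp add: ck \<rho>_def r_def\<close>)
qed

text \<open>Near the collision time the linear bound applies. The remaining times form a compact set
  on which the limiting distance has a positive minimum, and finite diameter changes distances by at
  most \<open>ep\<close>.\<close>

lemma good_eventually_one:
 assumes o: "ord n c" and k: "k < n" and av: "!!j. j < n ==> avoid z c j" and nu: "!!j. j < n ==> norm (fst (snd (c j))) = 1"
  and tr: "!!j. j < n ==> 0 < (vel z c j - snd (snd (c j))) \<bullet> fst (snd (c j))" and T: "0 < T" "fst (c k) <= T"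
 obtains m :: nat and e where "0 < e" "!!ep s. 0 < ep ==> ep <= e ==> s : {0..T} ==>
  ep + \<bar>s - fst (c k)\<bar> / real (Suc m) <= torus_dist (traj z c n s) (bpath ep z c k s)"
proof -
 let ?t = "fst (c k)" and ?D = "%s. torus_dist (traj z c n s) (bpath 0 z c k s)"
 define \<rho> where "\<rho> = (vel z c k - snd (snd (c k))) \<bullet> fst (snd (c k))"
 have \<rho>: "0 < \<rho>" using tr[OF k] by (simp add: \<rho>_def)
 have t0: "0 < ?t" using av[OF k] by (simp add: avoid_def)
 obtain \<delta> where \<delta>: "0 < \<delta>" and near: "!!ep s. 0 < ep ==> ep <= 1 / 4 ==> \<bar>s - ?t\<bar> <= \<delta> ==> ep + \<bar>s - ?t\<bar> * \<rho> <= torus_dist (traj z c n s) (bpath ep z c k s)"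
  using good_near[OF o k t0 nu[OF k] tr[OF k]] unfolding \<rho>_def by blast
 define K where "K = {0..T} - {?t - \<delta><..<?t + \<delta>}"
 have "compact K" unfolding K_def by (rule compact_diff) auto
 have cont: "continuous_on K ?D"
  by (intro continuous_on_torus_dist continuous_on_subset[OF traj_continuous] continuous_on_subset[OF bpath_continuous]) auto
 have pos: "0 < ?D s" if "s : K" for s
 proof -
  have "s \<noteq> ?t" "0 <= s" using that \<delta> by (auto simp: K_def)
  then show ?thesis
   using no_recollision[OF o k av nu tr, of s] torus_dist_eq_0_iff[of "traj z c n s" "bpath 0 z c k s"] torus_dist_nonneg[of "traj z c n s" "bpath 0 z c k s"]
   by force
 qed
 obtain \<mu> where \<mu>: "0 < \<mu>" "!!s. s : K ==> \<mu> <= ?D s"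
 proof (cases "K = {}")
  case False
  then obtain s0 where "s0 : K" "\<forall>s\<in>K. ?D s0 <= ?D s" using continuous_attains_inf[OF \<open>compact K\<close> _ cont] by blast
  then show ?thesis using that[of "?D s0"] pos by blast
 qed (use that[of 1] in auto)
 have "0 < min \<rho> (\<mu> / (2 * T))" using \<rho> \<mu> T by simp
 \<comment> \<open>The bound by \<open>\<rho>\<close> is for times near the collision. The bound by
   \<open>\<mu> / (2 * T)\<close> keeps the margin below \<open>\<mu> / 2\<close> elsewhere;
   \<open>ep <= \<mu> / 4\<close> pays for \<open>ep\<close> itself and for the change of
   distance.\<close>
 then obtain m :: nat where m: "inverse (real (Suc m)) < min \<rho> (\<mu> / (2 * T))" using reals_Archimedean by blast
 show ?thesis
 proof (rule that[of "min (1 / 4) (\<mu> / 4)" m])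
  fix ep s assume ep: "0 < ep" "ep <= min (1 / 4) (\<mu> / 4)" and s: "s : {0..T}"
  have div: "\<bar>s - ?t\<bar> / real (Suc m) = \<bar>s - ?t\<bar> * inverse (real (Suc m))" by (simp add: field_simps)
  show "ep + \<bar>s - ?t\<bar> / real (Suc m) <= torus_dist (traj z c n s) (bpath ep z c k s)"
  proof (cases "s : K")
   case True
   have "\<bar>s - ?t\<bar> * inverse (real (Suc m)) <= T * (\<mu> / (2 * T))" using s T t0 m by (intro mult_mono) auto
   then have "\<bar>s - ?t\<bar> / real (Suc m) <= \<mu> / 2" unfolding div using T by simp
   moreover have "\<bar>torus_dist (traj z c n s) (bpath ep z c k s) - ?D s\<bar> <= ep"
   proof -
    have "traj z c n s - bpath ep z c k s - (traj z c n s - bpath 0 z c k s) = - (ep *. fst (snd (c k)))"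
     by (simp add: bpath_def case_prod_beta')
    then show ?thesis using torus_dist_lipschitz[of "traj z c n s" "bpath ep z c k s" "traj z c n s" "bpath 0 z c k s"] nu[OF k] ep by simp
   qed
   ultimately show ?thesis using \<mu>(2)[OF True] ep(2) unfolding min_le_iff_disj min.bounded_iff abs_le_iff by linarith
  next
   case False
   then have "\<bar>s - ?t\<bar> <= \<delta>" using s by (auto simp: K_def)
   moreover have "\<bar>s - ?t\<bar> / real (Suc m) <= \<bar>s - ?t\<bar> * \<rho>" unfolding div using m by (intro mult_left_mono) auto
   ultimately show ?thesis using near[of ep s] ep by auto
  qed
 qed (use \<mu> in auto)
qed

lemma good_eventually:
 assumes o: "ord n c" and av: "!!j. j < n ==> avoid z c j" and nu: "!!j. j < n ==> norm (fst (snd (c j))) = 1"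
  and tr: "!!j. j < n ==> 0 < (vel z c j - snd (snd (c j))) \<bullet> fst (snd (c j))" and T: "0 < T" "tau c n <= T"
 shows "\<forall>\<^sub>F ep in at_right 0. good T ep n z c"
proof -
 let ?P = "%k m e. 0 < e & (\<forall>ep s. 0 < ep & ep <= e & s : {0..T} --> ep + \<bar>s - fst (c k)\<bar> / real (Suc m) <= torus_dist (traj z c n s) (bpath ep z c k s))"
 have "\<exists>m e. ?P k m e" if k: "k < n" for k
 proof -
  have "fst (c k) <= T" using ord_tau_le[OF o, of "Suc k"] k T by simp
  obtain m :: nat and e where e: "0 < e" and *: "!!ep s. 0 < ep ==> ep <= e ==> s : {0..T} ==>
    ep + \<bar>s - fst (c k)\<bar> / real (Suc m) <= torus_dist (traj z c n s) (bpath ep z c k s)"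
   by (rule good_eventually_one[OF o k av nu tr T(1) \<open>fst (c k) <= T\<close>]) (assumption | rule that)+
  show ?thesis by (intro exI[of _ m] exI[of _ e] conjI allI impI e *) simp_all
 qed
 then have "\<forall>k\<in>{..<n}. \<exists>p. ?P k (fst p) (snd p)" unfolding split_paired_Ex fst_conv snd_conv by blast
 from bchoice[OF this] obtain p where p: "\<forall>k\<in>{..<n}. ?P k (fst (p k)) (snd (p k))" by blast
 define m where "m k = fst (p k)" for k
 define e where "e k = snd (p k)" for k
 have me: "?P k (m k) (e k)" if "k < n" for k using p that unfolding m_def e_def by blast
 define m' where "m' = (\<Sum>k<n. m k)"
 define e' where "e' = Min (insert 1 (e ` {..<n}))"
 have e': "0 < e'" "!!k. k < n ==> e' <= e k" unfolding e'_def using me by (auto intro: Min_le)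
 have m': "m k <= m'" if "k < n" for k unfolding m'_def using that by (intro member_le_sum) auto
 have "good T ep n z c" if ep: "0 < ep" "ep < e'" for ep
  unfolding good_def
 proof (intro conjI impI allI o exI[of _ m'] ballI)
  show "0 < fst (c 0)" if "0 < n" using av[OF that] by (simp add: avoid_def)
  show "norm (fst (snd (c k))) = 1" if "k < n" for k by (rule nu[OF that])
  fix k s assume k: "k < n" and s: "s : \<rat> \<inter> {0..T}"
  have "\<bar>s - fst (c k)\<bar> / real (Suc m') <= \<bar>s - fst (c k)\<bar> / real (Suc (m k))"
   using m'[OF k] by (intro divide_left_mono) auto
  moreover have "ep + \<bar>s - fst (c k)\<bar> / real (Suc (m k)) <= torus_dist (traj z c n s) (bpath ep z c k s)"
  proof -
   have "0 < ep & ep <= e k & s : {0..T}" using e'(2)[OF k] ep s by auto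
   then show ?thesis using me[OF k] by blast
  qed
  ultimately show "ep + \<bar>s - fst (c k)\<bar> / real (Suc m') <= torus_dist (traj z c n s) (bpath ep z c k s)" by linarith
 qed
 then show ?thesis unfolding eventually_at_right_field using e'(1) by blast
qed

section \<open>Convergence of the lower bound\<close>

lemma falling_factorial_limit: "(%N. real (\<Prod>{N - n + 1..N}) * (1 / real N) ^ n) \<longlonglongrightarrow> 1"
proof (induction n)
 case (Suc n)
 have "(%N. 1 - real n * (1 / real N)) \<longlonglongrightarrow> 1 - real n * 0"
  by (intro tendsto_intros lim_1_over_n)
 from tendsto_mult[OF Suc this]
 have "(%N. real (\<Prod>{N - n + 1..N}) * (1 / real N) ^ n * (1 - real n * (1 / real N))) \<longlonglongrightarrow> 1" by simp
 moreover have "\<forall>\<^sub>F N in sequentially. real (\<Prod>{N - n + 1..N}) * (1 / real N) ^ n * (1 - real n * (1 / real N))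
   = real (\<Prod>{N - Suc n + 1..N}) * (1 / real N) ^ Suc n"
  using eventually_ge_at_top[of "Suc n"]
 proof eventually_elim
  case (elim N)
  then have "{N - Suc n + 1..N} = insert (N - n) {N - n + 1..N}" by auto
  then have P: "real (\<Prod>{N - Suc n + 1..N}) = (real N - real n) * real (\<Prod>{N - n + 1..N})"
   using elim by (simp add: of_nat_diff)
  have "1 - real n * (1 / real N) = (real N - real n) * (1 / real N)" using elim by (simp add: field_simps)
  then show ?case unfolding P by (simp only: power_Suc mult_ac)
 qed
 ultimately show ?case by (rule Lim_transform_eventually)
qed simp

lemma exp_diff_le:
 fixes a b :: real
 assumes "0 <= a"
 shows "exp (- a) - exp (- b) <= \<bar>b - a\<bar>"
proof -
 have "exp (- b) = exp (- a) * exp (- (b - a))" by (simp flip: exp_add)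
 then have "exp (- a) - exp (- b) = exp (- a) * (1 - exp (- (b - a)))" by (simp add: right_diff_distrib)
 also have "... <= exp (- a) * \<bar>b - a\<bar>"
 proof (rule mult_left_mono)
  show "1 - exp (- (b - a)) <= \<bar>b - a\<bar>"
   using exp_ge_add_one_self[of "- (b - a)"] abs_ge_self[of "b - a"] by linarith
 qed simp
 also have "... <= 1 * \<bar>b - a\<bar>" using assms by (intro mult_right_mono) auto
 finally show ?thesis by simp
qed

text \<open>From \<open>1 / (1 - y) = 1 + y / (1 - y)\<close> and the elementary bound
  \<open>1 + x <= exp x\<close>.\<close>

lemma power_lower_exp:
 fixes y :: real
 assumes "0 <= y" "y < 1"
 shows "exp (- (real N * y / (1 - y))) <= (1 - y) ^ N"
proof -
 have "1 / (1 - y) = 1 + y / (1 - y)" using assms by (simp add: field_simps)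
 also have "... <= exp (y / (1 - y))" by (rule exp_ge_add_one_self)
 finally have "exp (- (y / (1 - y))) <= 1 - y" using assms by (simp add: exp_minus field_simps)
 then have "exp (- (y / (1 - y))) ^ N <= (1 - y) ^ N" by (rule power_mono) simp
 then show ?thesis by (simp flip: exp_of_nat_mult)
qed

section \<open>Asymptotics of the scaled parameters\<close>

lemma Bseq_mult_zero:
 fixes a b :: "nat => real"
 assumes "a \<longlonglongrightarrow> 0" "Bseq b"
 shows "(%N. a N * b N) \<longlonglongrightarrow> 0"
proof -
 obtain K where K: "!!N. norm (b N) <= K" using BseqE[OF assms(2)] by metis
 have ab: "norm (a N * b N) <= norm (a N) * K" for N
  unfolding norm_mult by (intro mult_left_mono K) simp
 have "(%N. norm (a N) * K) \<longlonglongrightarrow> 0"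
  using tendsto_mult_right[OF tendsto_norm_zero[OF assms(1)], of K] by simp
 then show ?thesis by (rule Lim_null_comparison[OF always_eventually[OF allI[OF ab]]])
qed

definition eps :: "nat => real" where "eps N = 1 / sqrt (real N)"

text \<open>The enlarged radius for particles that must not hit: strictly above
  \<open>eps N\<close>, yet \<open>N * eps' N ^ 2\<close> still tends to 1, so the exponent is the
  same in the limit.\<close>

definition eps' :: "nat => real" where "eps' N = eps N * (1 + eps N)"

lemma eps_tendsto: "eps \<longlonglongrightarrow> 0"
 unfolding eps_def by (rule real_tendsto_divide_at_top[OF tendsto_const filterlim_compose[OF sqrt_at_top filterlim_real_sequentially]])

lemma eps'_tendsto: "eps' \<longlonglongrightarrow> 0"
 using tendsto_mult[OF eps_tendsto tendsto_add[OF tendsto_const[of 1] eps_tendsto]] by (simp add: eps'_def[abs_def])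

lemma eps_square: "0 < N ==> real N * (eps N)\<^sup>2 = 1" "(eps N)\<^sup>2 = 1 / real N"
 by (simp_all add: eps_def power_divide)

lemma eps_pos: "0 < N ==> 0 < eps N" "0 < N ==> eps N < eps' N" "0 < N ==> 0 < eps' N"
proof -
 show p: "0 < eps N" if "0 < N" using that by (simp add: eps_def)
 then show "eps N < eps' N" if "0 < N" using that by (simp add: eps'_def algebra_simps)
 then show "0 < eps' N" if "0 < N" using that p by fastforce
qed

lemma eps'_square: "0 < N ==> real N * (eps' N)\<^sup>2 = (1 + eps N)\<^sup>2"
 using eps_square(1)[of N] by (simp add: eps'_def power_mult_distrib mult.assoc[symmetric])

context rayleigh
begin

lemma dens_formula:
 "dens f g z c n = f z * (\<Prod>k<n. gain g z c k) * exp (- (\<Sum>k<n. seg_loss g z c k (tau c (Suc k))))"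
proof (induction n)
 case (Suc n)
 have "exp (- (\<Sum>k<Suc n. seg_loss g z c k (tau c (Suc k)))) = exp (- (\<Sum>k<n. seg_loss g z c k (tau c (Suc k)))) * exp (- seg_loss g z c n (tau c (Suc n)))"
  by (simp flip: exp_add)
 then show ?case unfolding dens.simps Suc.IH prod.lessThan_Suc by (simp only: mult_ac)
qed simp

text \<open>The total loss is the exponent in the idealised density: the losses up to the collisions
  contained in \<open>dens\<close>, and that of the last piece up to \<open>t\<close>.\<close>

lemma total_loss_eq: "total_loss z c n t = (\<Sum>k<n. seg_loss g z c k (tau c (Suc k))) + seg_loss g z c n t"
 unfolding total_loss_def lessThan_Suc_atMost[symmetric] by (simp add: piece_end_def)

lemma seg_loss_le:
 assumes "tau c n <= t"
 shows "seg_loss g z c n t <= Cr * (1 + norm (vel z c n)) * (t - tau c n)"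
proof -
 let ?C = "Cr * (1 + norm (vel z c n))"
 have 1: "set_integrable lborel {tau c n..t} (seg_rate g z c n)"
  by (rule borel_integrable_atLeastAtMost') (rule continuous_on_subset[OF seg_rate_continuous], simp)
 have 2: "set_integrable lborel {tau c n..t} (%_. ?C)" "(LINT s:{tau c n..t}|lborel. ?C) = (t - tau c n) * ?C"
  using assms by (simp_all add: set_integrable_def set_lebesgue_integral_def)
 have "(LINT s:{tau c n..t}|lborel. seg_rate g z c n s) <= (LINT s:{tau c n..t}|lborel. ?C)"
  by (rule set_integral_mono[OF 1 2(1)]) (rule seg_rate_le)
 then show ?thesis unfolding seg_loss_def 2(2) by (simp only: mult.commute)
qed

text \<open>As \<open>N * eps' N ^ 2\<close> stays bounded, the overlap terms are of order
  \<open>eps' N\<close> and the others of the order of the modulus at \<open>eps' N\<close>.\<close>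

lemma remainder_tendsto: "(%N. real N * remainder (eps' N) z c n) \<longlonglongrightarrow> 0"
proof -
 let ?a = "%m N. (1 + eps N)\<^sup>2 * (kappa * eps' N + T * (area * (1 + norm (vel z c m)) * modulus (eps' N)))"
 have pos: "0 < N ==> 0 < eps' N" for N by (rule eps_pos(3))
 have m: "(%N. modulus (eps' N)) \<longlonglongrightarrow> 0"
 proof -
  \<comment> \<open>The index is shifted because \<open>eps' 0 = 0\<close>, whereas
    \<open>modulus_tendsto\<close> is about positive sequences.\<close>
  have "(%N. modulus (eps' (Suc N))) \<longlonglongrightarrow> 0"
   by (rule modulus_tendsto) (use LIMSEQ_Suc[OF eps'_tendsto] pos in auto)
  then show ?thesis by (rule LIMSEQ_imp_Suc[where f = "%N. modulus (eps' N)"])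
 qed
 have "(%N. \<Sum>m\<le>n. ?a m N) \<longlonglongrightarrow> (\<Sum>m\<le>n. (1 + 0)\<^sup>2 * (kappa * 0 + T * (area * (1 + norm (vel z c m)) * 0)))"
  by (intro tendsto_intros eps_tendsto eps'_tendsto m)
 then have "(%N. \<Sum>m\<le>n. ?a m N) \<longlonglongrightarrow> 0" by simp
 moreover have "\<forall>\<^sub>F N in sequentially. (\<Sum>m\<le>n. ?a m N) = real N * remainder (eps' N) z c n"
  using eventually_gt_at_top[of 0]
 proof eventually_elim
  case (elim N)
  show ?case
   unfolding remainder_def sum_distrib_left eps'_square[OF elim, symmetric]
   by (rule sum.cong[OF refl]) (simp add: algebra_simps power2_eq_square power3_eq_cube)
 qed
 ultimately show ?thesis by (rule Lim_transform_eventually)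
qed

text \<open>\<open>clear_bound\<close> gives \<open>1 - y\<close> as a lower bound for
  \<open>clear\<close>. Its power is bounded below by \<open>power_lower_exp\<close> after raising
  the exponent from \<open>N - n\<close> to \<open>N\<close>.\<close>

lemma lower_ge:
 assumes good: "good T ep n z c" and t: "tau c n <= t" "t <= T" and ep: "0 < ep" "0 < ep'"
  and y: "ep'\<^sup>2 * total_loss z c n t + remainder ep' z c n <= y" "0 <= y" "y < 1"
 shows "ennreal (f z * (real (\<Prod>{N - n + 1..N}) * (ep\<^sup>2) ^ n) *
   (\<Prod>k<n. max 0 ((vel z c k - snd (snd (c k))) \<bullet> fst (snd (c k))) * g (bstart ep z c k)) * exp (- (real N * y / (1 - y))))
  <= lower N ep ep' n t (z, c)"
proof -
 have o: "ord n c" and c0: "0 < n ==> 0 < fst (c 0)" using good by (auto simp: good_def)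
 let ?m = "%k. max 0 ((vel z c k - snd (snd (c k))) \<bullet> fst (snd (c k)))"
 have "ennreal 1 <= clear ep' n t z c + ennreal y"
 proof -
  have "1 <= clear ep' n t z c + ennreal (ep'\<^sup>2 * total_loss z c n t + remainder ep' z c n)" by (rule clear_bound[OF o t ep(2)])
  also have "... <= clear ep' n t z c + ennreal y" by (rule add_left_mono[OF ennreal_leI[OF y(1)]])
  finally show ?thesis by simp
 qed
 then have "ennreal 1 - ennreal y <= clear ep' n t z c" by (simp add: ennreal_minus_le_iff add.commute)
 then have "ennreal (1 - y) <= clear ep' n t z c" using ennreal_minus[OF y(2), of 1] by simp
 then have "ennreal (1 - y) ^ (N - n) <= clear ep' n t z c ^ (N - n)" by (rule power_mono) simp
 moreover have "exp (- (real N * y / (1 - y))) <= (1 - y) ^ (N - n)"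
  using power_lower_exp[OF y(2,3), of N] power_decreasing[of "N - n" N "1 - y"] y by linarith
 then have "ennreal (exp (- (real N * y / (1 - y)))) <= ennreal (1 - y) ^ (N - n)"
  using y by (simp add: ennreal_power ennreal_leI)
 ultimately have cl: "ennreal (exp (- (real N * y / (1 - y)))) <= clear ep' n t z c ^ (N - n)" by (rule order_trans[rotated])
 have "tau c k < fst (c k)" if "k < n" for k
  using ord_mono[OF o, of "Suc k"] that c0 by (cases k) (auto simp: ord_Suc)
 then have "(\<Prod>k<n. weight ep z c k) = (\<Prod>k<n. ennreal (ep\<^sup>2 * ?m k))"
  by (intro prod.cong refl) (simp add: weight_def)
 also have "... = ennreal ((ep\<^sup>2) ^ n * (\<Prod>k<n. ?m k))" by (simp add: prod_ennreal prod.distrib)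
 finally have w: "(\<Prod>k<n. weight ep z c k) = ennreal ((ep\<^sup>2) ^ n * (\<Prod>k<n. ?m k))" .
 have gp: "(\<Prod>k<n. ennreal (g (bstart ep z c k))) = ennreal (\<Prod>k<n. g (bstart ep z c k))" by (rule prod_ennreal) (rule g_nonneg)
 have nn: "0 <= (\<Prod>k<n. ?m k)" "0 <= (\<Prod>k<n. g (bstart ep z c k))" by (auto intro!: prod_nonneg g_nonneg)
 have "ennreal (f z * (real (\<Prod>{N - n + 1..N}) * (ep\<^sup>2) ^ n) * (\<Prod>k<n. ?m k * g (bstart ep z c k)) * exp (- (real N * y / (1 - y))))
  = ennreal (f z * (real (\<Prod>{N - n + 1..N}) * (exp (- (real N * y / (1 - y))) * (\<Prod>k<n. g (bstart ep z c k)) * ((ep\<^sup>2) ^ n * (\<Prod>k<n. ?m k)))))"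
  by (simp only: prod.distrib mult_ac)
 also have "... = ennreal (f z) * (ennreal (real (\<Prod>{N - n + 1..N})) * (ennreal (exp (- (real N * y / (1 - y)))) * ennreal (\<Prod>k<n. g (bstart ep z c k)) * ennreal ((ep\<^sup>2) ^ n * (\<Prod>k<n. ?m k))))"
  using nn f_nonneg[of z] by (simp add: ennreal_mult del: of_nat_prod)
 also have "... <= ennreal (f z) * (ennreal (real (\<Prod>{N - n + 1..N})) * (clear ep' n t z c ^ (N - n) * ennreal (\<Prod>k<n. g (bstart ep z c k)) * ennreal ((ep\<^sup>2) ^ n * (\<Prod>k<n. ?m k))))"
  by (intro mult_left_mono mult_right_mono cl) auto
 also have "... = lower N ep ep' n t (z, c)"
  unfolding lower_def fst_conv snd_conv w gp using good t by (simp add: ennreal_of_nat_eq_real_of_nat del: of_nat_prod)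
 finally show ?thesis .
qed

lemma gain_tendsto:
 assumes hold: "!!x y. \<bar>g (x, snd (snd (c k))) - g (y, snd (snd (c k)))\<bar> <= M * norm (x - y) powr \<alpha>"
  and nu: "norm (fst (snd (c k))) = 1"
 shows "(%N. max 0 ((vel z c k - snd (snd (c k))) \<bullet> fst (snd (c k))) * g (bstart (eps N) z c k)) \<longlonglongrightarrow> gain g z c k"
proof -
 obtain r nu' w where ck: "c k = (r, nu', w)" by (cases "c k") auto
 let ?y = "pos z c (Suc k) - r *. w"
 have "(%N. g (?y + eps N *. nu', w) - g (?y, w)) \<longlonglongrightarrow> 0"
 proof (rule Lim_null_comparison)
  have "norm (g (?y + eps N *. nu', w) - g (?y, w)) <= M * eps N powr \<alpha>" for N
   using hold[of "?y + eps N *. nu'" ?y] nu by (simp add: ck eps_def)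
  then show "\<forall>\<^sub>F N in sequentially. norm (g (?y + eps N *. nu', w) - g (?y, w)) <= M * eps N powr \<alpha>" by simp
  have "(%N. eps N powr \<alpha>) \<longlonglongrightarrow> 0"
   using tendsto_powr2[OF eps_tendsto tendsto_const _ \<alpha>_pos] by (simp add: eps_def)
  from tendsto_mult_left[OF this, of M] show "(%N. M * eps N powr \<alpha>) \<longlonglongrightarrow> 0" by simp
 qed
 then have "(%N. g (?y + eps N *. nu', w)) \<longlonglongrightarrow> g (?y, w)" by (rule LIM_zero_cancel)
 from tendsto_mult_left[OF this, of "max 0 ((vel z c k - w) \<bullet> nu')"]
 show ?thesis by (simp add: ck gain_def bstart_def algebra_simps)
qed

text \<open>Pointwise convergence along arbitrary times \<open>t N\<close>. The loss need not
  converge along such a sequence; it is only bounded, and the exponent of the lower bound is shown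
  to approach it.\<close>

lemma deficit_tendsto:
 assumes o: "ord n c" and av: "!!j. j < n ==> avoid z c j" and nu: "!!j. j < n ==> norm (fst (snd (c j))) = 1"
  and hold: "!!j x y. j < n ==> \<bar>g (x, snd (snd (c j))) - g (y, snd (snd (c j)))\<bar> <= M * norm (x - y) powr \<alpha>"
  and tT: "tau c n <= T" and t: "!!N. 0 <= t N" "!!N. t N <= T"
 shows "(%N. (if tau c n <= t N then ennreal (exp (- seg_loss g z c n (t N)) * dens f g z c n) else 0) - lower N (eps N) (eps' N) n (t N) (z, c)) \<longlonglongrightarrow> 0"
proof (cases "\<forall>j<n. 0 < (vel z c j - snd (snd (c j))) \<bullet> fst (snd (c j))")
 \<comment> \<open>A collision that is not strictly approaching has kernel 0, so the idealised
   density vanishes and truncated subtraction leaves 0.\<close>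
 case False
 then obtain j where "j < n" "gain g z c j = 0" by (auto simp: gain_def not_less)
 then have "(\<Prod>k<n. gain g z c k) = 0" by auto
 then have d: "dens f g z c n = 0" unfolding dens_formula by simp
 have "(if tau c n <= t N then ennreal (exp (- seg_loss g z c n (t N)) * dens f g z c n) else 0) - lower N (eps N) (eps' N) n (t N) (z, c) = 0" for N
  by (cases "tau c n <= t N") (simp_all add: d)
 then show ?thesis by (simp only: tendsto_const)
next
 case True
 define x where "x = f z * (\<Prod>k<n. gain g z c k)"
 \<comment> \<open>The maximum keeps the bound on \<open>\<Lambda> N\<close> valid also for those
   \<open>N\<close> with \<open>t N < tau c n\<close>, for which the tree does not yet
   count.\<close>
 define \<Lambda> where "\<Lambda> N = total_loss z c n (max (t N) (tau c n))" for N
 define x' where "x' N = f z * (real (\<Prod>{N - n + 1..N}) * ((eps N)\<^sup>2) ^ n) *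
   (\<Prod>k<n. max 0 ((vel z c k - snd (snd (c k))) \<bullet> fst (snd (c k))) * g (bstart (eps N) z c k))" for N
 define y where "y N = (eps' N)\<^sup>2 * \<Lambda> N + remainder (eps' N) z c n" for N
 \<comment> \<open>The exponent supplied by \<open>power_lower_exp\<close>; since \<open>y N\<close>
   tends to 0 and \<open>N * y N\<close> approaches \<open>\<Lambda> N\<close>, so does
   \<open>u N\<close>.\<close>
 define u where "u N = real N * y N / (1 - y N)" for N
 define B where "B = (\<Sum>k<n. seg_loss g z c k (tau c (Suc k))) + Cr * (1 + norm (vel z c n)) * T"
 have \<Lambda>: "0 <= \<Lambda> N" "\<Lambda> N <= B" for N
 proof -
  show "0 <= \<Lambda> N" unfolding \<Lambda>_def total_loss_eq by (intro add_nonneg_nonneg sum_nonneg seg_loss_nonneg)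
  have "seg_loss g z c n (max (t N) (tau c n)) <= Cr * (1 + norm (vel z c n)) * (max (t N) (tau c n) - tau c n)" by (rule seg_loss_le) simp
  also have "... <= Cr * (1 + norm (vel z c n)) * T"
   using t(2)[of N] tT ord_nonneg[OF o] Cr_nonneg by (intro mult_left_mono) auto
  finally show "\<Lambda> N <= B" unfolding \<Lambda>_def total_loss_eq B_def by simp
 qed
 have rem0: "0 <= remainder (eps' N) z c n" for N
  unfolding remainder_def kappa_def using Cg_nonneg area_nonneg modulus_nonneg T_pos
  by (intro sum_nonneg add_nonneg_nonneg mult_nonneg_nonneg) (auto simp: eps'_def eps_def)
 have y0: "0 <= y N" for N unfolding y_def using \<Lambda> rem0 by simp
 have bfun: "Bseq \<Lambda>" by (rule BseqI'[of _ B]) (use \<Lambda> in auto)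
 have Ny: "(%N. real N * y N - \<Lambda> N) \<longlonglongrightarrow> 0"
 proof -
  have "(%N. (1 + eps N)\<^sup>2 - 1) \<longlonglongrightarrow> (1 + 0)\<^sup>2 - 1" by (intro tendsto_intros eps_tendsto)
  then have "(%N. (1 + eps N)\<^sup>2 - 1) \<longlonglongrightarrow> 0" by simp
  from Bseq_mult_zero[OF this bfun] have "(%N. ((1 + eps N)\<^sup>2 - 1) * \<Lambda> N) \<longlonglongrightarrow> 0" .
  from tendsto_add[OF this remainder_tendsto[of z c n]]
  have "(%N. ((1 + eps N)\<^sup>2 - 1) * \<Lambda> N + real N * remainder (eps' N) z c n) \<longlonglongrightarrow> 0" by simp
  moreover have "\<forall>\<^sub>F N in sequentially. ((1 + eps N)\<^sup>2 - 1) * \<Lambda> N + real N * remainder (eps' N) z c n = real N * y N - \<Lambda> N"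
   using eventually_gt_at_top[of 0]
  proof eventually_elim
   case (elim N)
   show ?case unfolding y_def eps'_square[OF elim, symmetric] by (simp add: algebra_simps)
  qed
  ultimately show ?thesis by (rule Lim_transform_eventually)
 qed
 have y_lim: "y \<longlonglongrightarrow> 0"
 proof (rule tendsto_sandwich[OF _ _ tendsto_const])
  have "(%N. (\<bar>real N * y N - \<Lambda> N\<bar> + B) * (1 / real N)) \<longlonglongrightarrow> (\<bar>0\<bar> + B) * 0"
   by (intro tendsto_intros Ny lim_1_over_n)
  then show "(%N. (\<bar>real N * y N - \<Lambda> N\<bar> + B) * (1 / real N)) \<longlonglongrightarrow> 0" by simp
  show "\<forall>\<^sub>F N in sequentially. y N <= (\<bar>real N * y N - \<Lambda> N\<bar> + B) * (1 / real N)"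
   using eventually_gt_at_top[of 0]
  proof eventually_elim
   case (elim N)
   have "real N * y N <= \<bar>real N * y N - \<Lambda> N\<bar> + B" using \<Lambda>(2)[of N] by linarith
   then show ?case using elim by (simp add: field_simps)
  qed
 qed (use y0 in auto)
 have u_lim: "(%N. u N - \<Lambda> N) \<longlonglongrightarrow> 0"
 proof -
  from Bseq_mult_zero[OF y_lim bfun] have "(%N. y N * \<Lambda> N) \<longlonglongrightarrow> 0" .
  from tendsto_divide[OF tendsto_add[OF Ny this] tendsto_diff[OF tendsto_const[of 1] y_lim]]
  have "(%N. (real N * y N - \<Lambda> N + y N * \<Lambda> N) / (1 - y N)) \<longlonglongrightarrow> 0" by simp
  moreover have "\<forall>\<^sub>F N in sequentially. (real N * y N - \<Lambda> N + y N * \<Lambda> N) / (1 - y N) = u N - \<Lambda> N"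
   using order_tendstoD(2)[OF y_lim zero_less_one]
  proof eventually_elim
   case (elim N)
   then show ?case unfolding u_def by (simp add: field_simps)
  qed
  ultimately show ?thesis by (rule Lim_transform_eventually)
 qed
 have x_lim: "x' \<longlonglongrightarrow> x"
 proof -
  have "(%N. \<Prod>k<n. max 0 ((vel z c k - snd (snd (c k))) \<bullet> fst (snd (c k))) * g (bstart (eps N) z c k)) \<longlonglongrightarrow> (\<Prod>k<n. gain g z c k)"
   by (rule tendsto_prod) (use gain_tendsto hold nu in auto)
  from tendsto_mult[OF tendsto_mult[OF tendsto_const falling_factorial_limit] this]
  have "(%N. f z * (real (\<Prod>{N - n + 1..N}) * (1 / real N) ^ n) * (\<Prod>k<n. max 0 ((vel z c k - snd (snd (c k))) \<bullet> fst (snd (c k))) * g (bstart (eps N) z c k)))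
   \<longlonglongrightarrow> f z * 1 * (\<Prod>k<n. gain g z c k)" .
  then show ?thesis unfolding x'_def x_def eps_square(2) by simp
 qed
 have x'0: "0 <= x' N" for N
  unfolding x'_def using f_nonneg by (intro mult_nonneg_nonneg prod_nonneg g_nonneg) (auto simp del: of_nat_prod)
 have "\<forall>\<^sub>F N in sequentially. 0 < eps N" by (rule eventually_mono[OF eventually_gt_at_top[of 0] eps_pos(1)])
 then have "filterlim eps (at_right 0) sequentially"
  using eps_tendsto by (auto simp: filterlim_at elim!: eventually_mono)
 moreover have "\<forall>\<^sub>F ep in at_right 0. good T ep n z c"
  by (rule good_eventually[OF o av nu _ T_pos tT]) (use True in auto)
 ultimately have good: "\<forall>\<^sub>F N in sequentially. good T (eps N) n z c" by (rule eventually_compose_filterlim[rotated])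
 let ?D = "%N. (if tau c n <= t N then ennreal (exp (- seg_loss g z c n (t N)) * dens f g z c n) else 0) - lower N (eps N) (eps' N) n (t N) (z, c)"
 let ?e = "%N. \<bar>x - x' N\<bar> + x' N * \<bar>u N - \<Lambda> N\<bar>"
 have ev: "\<forall>\<^sub>F N in sequentially. ?D N <= ennreal (?e N)"
  using good order_tendstoD(2)[OF y_lim zero_less_one] eventually_gt_at_top[of 0]
 proof eventually_elim
  case (elim N)
  show ?case
  proof (cases "tau c n <= t N")
   case le: True
   then have \<Lambda>N: "\<Lambda> N = total_loss z c n (t N)" by (simp add: \<Lambda>_def max_absorb1)
   have P: "exp (- seg_loss g z c n (t N)) * dens f g z c n = x * exp (- \<Lambda> N)"
    unfolding dens_formula x_def \<Lambda>N total_loss_eq by (simp add: exp_diff exp_minus field_simps)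
   have "ennreal (x' N * exp (- u N)) <= lower N (eps N) (eps' N) n (t N) (z, c)"
    unfolding x'_def u_def
    by (rule lower_ge[OF elim(1) le t(2) eps_pos(1)[OF elim(3)] eps_pos(3)[OF elim(3)] _ y0 elim(2)]) (simp add: y_def \<Lambda>N)
   then have "?D N <= ennreal (x * exp (- \<Lambda> N)) - ennreal (x' N * exp (- u N))"
    using le by (simp add: P ennreal_minus_mono)
   also have "... = ennreal (x * exp (- \<Lambda> N) - x' N * exp (- u N))" using x'0 by (simp add: ennreal_minus)
   also have "... <= ennreal (?e N)"
   proof (rule ennreal_leI)
    \<comment> \<open>The error is split into that of the prefactor and that of the exponent;
      \<open>exp\<close> of a nonpositive number is at most 1, and \<open>exp_diff_le\<close> is its
      Lipschitz bound.\<close>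
    have "x * exp (- \<Lambda> N) - x' N * exp (- u N) = (x - x' N) * exp (- \<Lambda> N) + x' N * (exp (- \<Lambda> N) - exp (- u N))" by (simp add: algebra_simps)
    moreover have "(x - x' N) * exp (- \<Lambda> N) <= \<bar>x - x' N\<bar> * 1" using \<Lambda>(1)[of N] by (intro mult_mono) auto
    moreover have "x' N * (exp (- \<Lambda> N) - exp (- u N)) <= x' N * \<bar>u N - \<Lambda> N\<bar>" by (intro mult_left_mono exp_diff_le \<Lambda> x'0)
    ultimately show "x * exp (- \<Lambda> N) - x' N * exp (- u N) <= ?e N" by simp
   qed
   finally show ?thesis .
  qed simp
 qed
 have "?e \<longlonglongrightarrow> \<bar>x - x\<bar> + x * \<bar>0\<bar>" by (intro tendsto_intros x_lim u_lim)
 then have "?e \<longlonglongrightarrow> 0" by simp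
 then have "(%N. ennreal (?e N)) \<longlonglongrightarrow> ennreal 0" by (intro tendsto_ennrealI)
 then show ?thesis by (intro tendsto_sandwich[OF _ ev tendsto_const]) auto
qed

end

section \<open>Integration over trees\<close>

abbreviation tree_of :: "nat => phase \<times> (nat => collision) => tree" where
 "tree_of n zc \<equiv> (fst zc, map (snd zc) [0..<n])"

abbreviation trees :: "real => nat => (phase \<times> (nat => collision)) set" where
 "trees T n \<equiv> tree_component T n (collision_trees T)"

lemma mem_tree_component: "zc : tree_component T n S \<longleftrightarrow> zc : space (tree_coords_vol T n) & tree_of n zc : S"
 by (auto simp: tree_component_def)

lemma measurable_tree_of:
 assumes F: "F : bm (tree_vol T)"
 shows "(%zc. F (tree_of n zc) * indicator (trees T n) zc :: ennreal) : bm (tree_coords_vol T n)"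
proof -
 let ?R = "restrict_space (tree_coords_vol T n) (trees T n)"
 have sp: "space ?R = trees T n"
  using sets.sets_into_space[OF tree_component_trees_sets[of T n]] by (auto simp: space_restrict_space)
 have "tree_of n : measurable ?R (tree_vol T)"
 proof (rule measurableI)
  show "tree_of n zc : space (tree_vol T)" if "zc : space ?R" for zc
   using that unfolding sp mem_tree_component space_tree_vol by blast
  fix S assume S: "S : sets (tree_vol T)"
  then have "S \<subseteq> collision_trees T" "tree_component T n S : sets (tree_coords_vol T n)" by (auto simp: sets_tree_vol)
  moreover have "tree_of n -` S \<inter> space ?R = trees T n \<inter> tree_component T n S"
   unfolding sp using \<open>S \<subseteq> collision_trees T\<close> by (auto simp: mem_tree_component)
  ultimately show "tree_of n -` S \<inter> space ?R : sets ?R" unfolding sets_restrict_space by blast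
 qed
 then have "(%zc. F (tree_of n zc)) : bm ?R" using F by (rule measurable_compose)
 then show ?thesis
  by (subst (asm) borel_measurable_restrict_space_iff_ennreal) (use tree_component_trees_sets in auto)
qed

text \<open>The tree measure is the sum of its components, extended from sets to functions by
  monotone approximation. The sum over \<open>n\<close> is treated as an integral over count space
  to exchange it with suprema.\<close>

lemma nn_integral_tree_vol:
 assumes "F : bm (tree_vol T)"
 shows "(NN \<Phi>. F \<Phi> \<partial>tree_vol T) = (\<Sum>n. NN zc. F (tree_of n zc) * indicator (trees T n) zc \<partial>tree_coords_vol T n)"
 using assms
proof (induction rule: borel_measurable_induct)
 case (cong F G)
 have "G (tree_of n zc) * indicator (trees T n) zc = F (tree_of n zc) * indicator (trees T n) zc" for n zc
  using cong(3)[of "tree_of n zc"] by (auto simp: indicator_def mem_tree_component space_tree_vol)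
 then show ?case using cong(4) nn_integral_cong[of "tree_vol T" F G] cong(3) by simp
next
 case (set A)
 have "(NN zc. indicator A (tree_of n zc) * indicator (trees T n) zc \<partial>tree_coords_vol T n) = emeasure (tree_coords_vol T n) (tree_component T n A)" for n
 proof -
  have A: "A \<subseteq> collision_trees T" "tree_component T n A : sets (tree_coords_vol T n)" using set by (auto simp: sets_tree_vol)
  have "(NN zc. indicator A (tree_of n zc) * indicator (trees T n) zc \<partial>tree_coords_vol T n) = (NN zc. indicator (tree_component T n A) zc \<partial>tree_coords_vol T n)"
   by (rule nn_integral_cong) (use A(1) in \<open>auto simp: indicator_def mem_tree_component\<close>)
  then show ?thesis using A(2) by simp
 qed
 then show ?case using set by (simp add: emeasure_tree_vol)
next
 case (mult F c)
 show ?case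
  using mult by (simp add: nn_integral_cmult mult.assoc measurable_tree_of)
next
 case (add F G)
 then show ?case
  by (simp add: nn_integral_add distrib_right measurable_tree_of suminf_add[symmetric])
next
 case (seq F)
 have "(NN \<Phi>. (SUP i. F i) \<Phi> \<partial>tree_vol T) = (SUP i. NN \<Phi>. F i \<Phi> \<partial>tree_vol T)"
  unfolding SUP_apply by (rule nn_integral_monotone_convergence_SUP) (use seq in auto)
 also have "... = (SUP i. NN n. (NN zc. F i (tree_of n zc) * indicator (trees T n) zc \<partial>tree_coords_vol T n) \<partial>count_space UNIV)"
  by (simp add: seq nn_integral_count_space_nat)
 also have "... = (NN n. (SUP i. NN zc. F i (tree_of n zc) * indicator (trees T n) zc \<partial>tree_coords_vol T n) \<partial>count_space UNIV)"
  by (rule nn_integral_monotone_convergence_SUP[symmetric])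
   (use seq(3) in \<open>auto simp: incseq_def le_fun_def intro!: nn_integral_mono mult_right_mono\<close>)
 also have "... = (NN n. (NN zc. (SUP i. F i) (tree_of n zc) * indicator (trees T n) zc \<partial>tree_coords_vol T n) \<partial>count_space UNIV)"
 proof (rule nn_integral_cong)
  fix n
  have "(SUP i. NN zc. F i (tree_of n zc) * indicator (trees T n) zc \<partial>tree_coords_vol T n) = (NN zc. (SUP i. F i (tree_of n zc) * indicator (trees T n) zc) \<partial>tree_coords_vol T n)"
   by (rule nn_integral_monotone_convergence_SUP[symmetric])
    (use seq(1,3) in \<open>auto simp: incseq_def le_fun_def intro!: mult_right_mono measurable_tree_of\<close>)
  also have "... = (NN zc. (SUP i. F i) (tree_of n zc) * indicator (trees T n) zc \<partial>tree_coords_vol T n)"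
   unfolding SUP_apply by (intro nn_integral_cong) (simp only: SUP_mult_right_ennreal)
  finally show "(SUP i. NN zc. F i (tree_of n zc) * indicator (trees T n) zc \<partial>tree_coords_vol T n) = ..." .
 qed
 finally show ?case by (simp add: nn_integral_count_space_nat)
qed

text \<open>By construction the value is either the mass of the preimage or the default 0, and both
  are bounded by the total mass.\<close>

lemma emeasure_distr_le: "emeasure (distr R R' h) A <= emeasure R (space R)"
 unfolding distr_def emeasure_measure_of_conv by (auto intro: emeasure_space)

section \<open>Comparison of the two laws on trees\<close>

context rayleigh
begin

definition ideal :: "nat => real => phase \<times> (nat => collision) => ennreal" where
 "ideal n t zc = (if alive n t zc then ennreal (exp (- seg_loss g (fst zc) (snd zc) n t) * dens f g (fst zc) (snd zc) n) else 0)"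

text \<open>For \<open>n > N\<close> there are no \<open>n\<close> distinct particles to choose
  from, but truncated subtraction would give \<open>N!\<close> in \<open>lower\<close>; hence the
  explicit 0.\<close>

definition low :: "nat => nat => real => phase \<times> (nat => collision) => ennreal" where
 "low N n t zc = (if n <= N then lower N (eps N) (eps' N) n t zc else 0)"

text \<open>Subtraction of extended nonnegative reals is truncated, so this integrates the positive
  part of the difference. It is a bound that no longer mentions the set \<open>S\<close>.\<close>

definition deficit :: "nat => real => ennreal" where
 "deficit N t = (\<Sum>n. NN zc. ideal n t zc - low N n t zc \<partial>tree_coords_vol T n)"

lemma ideal_measurable: "ideal n t : bm (tree_coords_vol T n)"
 unfolding ideal_def by measurable

lemma low_measurable: "low N n t : bm (tree_coords_vol T n)"
 unfolding low_def by (cases "n <= N") (simp_all add: lower_measurable)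

lemma ideal_le: "t <= T ==> ideal n t zc <= (if alive n T zc then ennreal (dens f g (fst zc) (snd zc) n) else 0)"
 using dens_nonneg[of "fst zc" "snd zc" n] seg_loss_nonneg[of "fst zc" "snd zc" n t] by (auto simp: ideal_def alive_def intro!: ennreal_leI mult_left_le_one_le)

lemma jumps_finite: "jumps n T < \<infinity>"
proof -
 have "jumps n T <= (\<Sum>n. jumps n T)" using sum_le_suminf[of "%n. jumps n T" "{n}"] by simp
 then show ?thesis using suminf_jumps by (rule order_le_less_trans)
qed

lemma deficit_part_le: "t <= T ==> (NN zc. ideal n t zc - low N n t zc \<partial>tree_coords_vol T n) <= jumps n T"
 unfolding jumps_def by (intro nn_integral_mono order_trans[OF diff_le_self_ennreal ideal_le])

lemma deficit_finite: "t <= T ==> deficit N t < \<infinity>"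
 unfolding deficit_def by (rule order_le_less_trans[OF suminf_le[OF deficit_part_le] suminf_jumps]) auto

text \<open>Dominated convergence twice: for fixed \<open>n\<close> with the density at the final
  time \<open>T\<close> as majorant, then in \<open>n\<close> with the summable
  \<open>jumps n T\<close>. Neither majorant depends on the times \<open>t N\<close>.\<close>

lemma deficit_limit:
 assumes t: "!!N. 0 <= t N" "!!N. t N <= T"
 shows "(%N. deficit N (t N)) \<longlonglongrightarrow> 0"
proof -
 from g_holder obtain U where U: "U : null_sets lborel" "{w. \<not> (\<forall>x y. \<bar>g (x, w) - g (y, w)\<bar> <= M * norm (x - y) powr \<alpha>)} \<subseteq> U"
  by (auto simp: eventually_ae_filter)
 have part: "(%N. NN zc. ideal n (t N) zc - low N n (t N) zc \<partial>tree_coords_vol T n) \<longlonglongrightarrow> (NN zc. 0 \<partial>tree_coords_vol T n)" for n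
 proof (rule nn_integral_dominated_convergence[where w = "%zc. if alive n T zc then ennreal (dens f g (fst zc) (snd zc) n) else 0"])
  show "(%zc. ideal n (t N) zc - low N n (t N) zc) : bm (tree_coords_vol T n)" for N
   by (intro borel_measurable_minus_ennreal ideal_measurable low_measurable)
  show "(%zc. if alive n T zc then ennreal (dens f g (fst zc) (snd zc) n) else 0) : bm (tree_coords_vol T n)" by measurable
  show "AE zc in tree_coords_vol T n. ideal n (t N) zc - low N n (t N) zc <= (if alive n T zc then ennreal (dens f g (fst zc) (snd zc) n) else 0)" for N
   by (rule AE_I2) (rule order_trans[OF diff_le_self_ennreal ideal_le[OF t(2)]])
  show "(NN zc. (if alive n T zc then ennreal (dens f g (fst zc) (snd zc) n) else 0) \<partial>tree_coords_vol T n) < \<infinity>"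
   using jumps_finite[of n] by (simp add: jumps_def)
  have sp: "AE zc in tree_coords_vol T n. zc : space (tree_coords_vol T n)" by (rule AE_space)
  from AE_avoid[OF U(1), where T = T and n = n] sp show "AE zc in tree_coords_vol T n. (%N. ideal n (t N) zc - low N n (t N) zc) \<longlonglongrightarrow> 0"
  proof eventually_elim
   case (elim zc)
   obtain z c where zc: "zc = (z, c)" by (cases zc) auto
   show ?case
   proof (cases "ord n c & tau c n <= T")
    case True
    have "(%N. (if tau c n <= t N then ennreal (exp (- seg_loss g z c n (t N)) * dens f g z c n) else 0) - lower N (eps N) (eps' N) n (t N) (z, c)) \<longlonglongrightarrow> 0"
    proof (rule deficit_tendsto)
     show "ord n c" "tau c n <= T" using True by auto
     show "avoid z c j" if "j < n" for j using elim(1) that by (simp add: zc)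
     show "norm (fst (snd (c j))) = 1" if "j < n" for j
      using elim(2) that by (auto simp: zc space_tree_coords_vol PiE_iff mem_Times_iff)
     fix j x y assume j: "j < n"
     have "snd (snd (c j)) \<notin> U" using elim(1) j by (simp add: zc)
     then show "\<bar>g (x, snd (snd (c j))) - g (y, snd (snd (c j)))\<bar> <= M * norm (x - y) powr \<alpha>" using U(2) by blast
    qed (use t in auto)
    moreover have "\<forall>\<^sub>F N in sequentially. (if tau c n <= t N then ennreal (exp (- seg_loss g z c n (t N)) * dens f g z c n) else 0) - lower N (eps N) (eps' N) n (t N) (z, c) = ideal n (t N) zc - low N n (t N) zc"
     using eventually_ge_at_top[of n] by eventually_elim (use True in \<open>simp add: ideal_def low_def alive_def zc\<close>)
    ultimately show ?thesis by (rule Lim_transform_eventually)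
   next
    case False
    then have "\<not> alive n (t N) zc" for N using t(2)[of N] by (auto simp: alive_def zc)
    then have "ideal n (t N) zc - low N n (t N) zc = 0" for N by (simp add: ideal_def)
    then show ?thesis by (simp only: tendsto_const)
   qed
  qed
 qed auto
 have "(%N. NN n. (NN zc. ideal n (t N) zc - low N n (t N) zc \<partial>tree_coords_vol T n) \<partial>count_space UNIV) \<longlonglongrightarrow> (NN (n :: nat). 0 \<partial>count_space UNIV)"
  by (rule nn_integral_dominated_convergence[where w = "%n. jumps n T"])
   (use part deficit_part_le[OF t(2)] suminf_jumps in \<open>auto simp: nn_integral_count_space_nat\<close>)
 then show ?thesis by (simp add: deficit_def nn_integral_count_space_nat)
qed

lemma trees_ord: "zc : trees T n ==> ord n (snd zc)"
proof -
 assume "zc : trees T n"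
 then have sp: "zc : space (tree_coords_vol T n)" and o: "\<forall>j<n. \<forall>i<j. fst (snd zc i) < fst (snd zc j)"
  unfolding tree_component_trees by auto
 have "0 <= fst (snd zc i)" if "i < n" for i
  using sp that by (auto simp: space_tree_coords_vol PiE_iff mem_Times_iff)
 moreover then have "0 <= tau (snd zc) n" by (cases n) auto
 ultimately show ?thesis using o by (simp add: ord_def)
qed

lemma idealised_trees:
 "zc : trees T n ==> 0 <= t ==> idealised f g t (tree_of n zc) =
  (if tau (snd zc) n <= t then exp (- seg_loss g (fst zc) (snd zc) n t) * dens f g (fst zc) (snd zc) n else 0)"
 by (rule idealised_coords[OF trees_ord])

lemma idealised_measurable:
 assumes "0 <= t" shows "idealised f g t : bm (tree_vol T)"
proof (rule measurableI)
 fix A :: "real set" assume A: "A : sets borel"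
 let ?S = "idealised f g t -` A \<inter> space (tree_vol T)"
 let ?h = "%n zc. if tau (snd zc) n <= t then exp (- seg_loss g (fst zc) (snd zc) n t) * dens f g (fst zc) (snd zc) n else 0"
 have "tree_component T n ?S : sets (tree_coords_vol T n)" for n
 proof -
  have "?h n : bm (tree_coords_vol T n)" by measurable
  then have "?h n -` A \<inter> space (tree_coords_vol T n) : sets (tree_coords_vol T n)" using A by (rule measurable_sets)
  moreover have "tree_component T n ?S = (?h n -` A \<inter> space (tree_coords_vol T n)) \<inter> trees T n"
   using idealised_trees[OF _ assms] by (auto simp: mem_tree_component space_tree_vol)
  ultimately show ?thesis using tree_component_trees_sets by auto
 qed
 then show "?S : sets (tree_vol T)" by (auto simp: sets_tree_vol space_tree_vol)
qed simp

lemma idealised_nonneg: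
 assumes \<Phi>: "\<Phi> : space (tree_vol T)" and t: "0 <= t"
 shows "0 <= idealised f g t \<Phi>"
proof -
 obtain x v cs where P: "\<Phi> = ((x, v), cs)" by (cases \<Phi>) auto
 define c where "c i = cs ! i" for i
 have cs: "map c [0..<length cs] = cs" unfolding c_def by (rule map_nth)
 have o: "\<forall>(s, nu, w)\<in>set cs. s : {0..T} & norm nu = 1" "sorted_wrt (<) (map fst cs)"
  using \<Phi> by (auto simp: P space_tree_vol collision_trees_def)
 have 1: "0 <= fst (c i)" if "i < length cs" for i
  using o(1) nth_mem[OF that] by (auto simp: c_def)
 have 2: "fst (c i) < fst (c j)" if "i < j" "j < length cs" for i j
  using o(2) that by (simp add: sorted_wrt_iff_nth_less c_def)
 have 3: "0 <= tau c (length cs)" using 1 by (cases "length cs") auto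
 have "ord (length cs) c" unfolding ord_def using 1 2 3 by auto
 from idealised_coords[OF this t, of f g "(x, v)"] show ?thesis
  using dens_nonneg by (simp add: P cs)
qed

definition ideal_law :: "real => tree set => ennreal" where
 "ideal_law t S = (\<Sum>n. NN zc. ideal n t zc * indicator (tree_component T n S) zc \<partial>tree_coords_vol T n)"

lemma ideal_law_integral:
 assumes S: "S : sets (tree_vol T)" and t: "0 <= t"
 shows "ideal_law t S = (NN \<Phi>. ennreal (indicator S \<Phi> *. idealised f g t \<Phi>) \<partial>tree_vol T)"
proof -
 have m: "(%\<Phi>. ennreal (indicator S \<Phi> *. idealised f g t \<Phi>)) : bm (tree_vol T)"
  using idealised_measurable[OF t] S by measurable
 have "S \<subseteq> collision_trees T" using S by (simp add: sets_tree_vol)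
 then show ?thesis
  unfolding nn_integral_tree_vol[OF m] ideal_law_def
  by (intro suminf_cong nn_integral_cong)
   (use idealised_trees[OF _ t] trees_ord in \<open>auto simp: indicator_def mem_tree_component ideal_def alive_def\<close>)
qed

text \<open>Coordinates that are not in chronological order are not trees, but \<open>ideal\<close>
  vanishes there, so restriction to trees loses no mass.\<close>

lemma ideal_law_space: "0 <= t ==> t <= T ==> ideal_law t (space (tree_vol T)) = 1"
proof -
 have eq: "ideal n t zc * indicator (trees T n) zc = ideal n t zc" if zc: "zc : space (tree_coords_vol T n)" for n zc
 proof (cases "ord n (snd zc)")
  case True
  then have "zc : trees T n" unfolding tree_component_trees using zc by (auto simp: ord_def)
  then show ?thesis by simp
 qed (simp add: ideal_def alive_def)
 assume "0 <= t" "t <= T"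
 then have "(\<Sum>n. NN zc. ideal n t zc \<partial>tree_coords_vol T n) = 1" using mass_total by (simp add: mass_def ideal_def)
 moreover have "ideal_law t (space (tree_vol T)) = (\<Sum>n. NN zc. ideal n t zc \<partial>tree_coords_vol T n)"
  unfolding ideal_law_def space_tree_vol by (intro suminf_cong nn_integral_cong eq)
 ultimately show ?thesis by simp
qed

text \<open>\<open>S\<close> is cut according to the number of collisions, so that
  \<open>history_lower\<close> applies to each part.\<close>

lemma ideal_law_le:
 assumes S: "S : sets (tree_vol T)" and t: "0 <= t" "t <= T" and N: "0 < N" "eps N < 1 / 2"
 shows "ideal_law t S <= emeasure (empirical f g N (eps N) T t) S + deficit N t"
proof -
 let ?E = "empirical f g N (eps N) T t"
 define Sn where "Sn n = {\<Phi> : S. length (snd \<Phi>) = n}" for n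
 have comp: "tree_component T m (Sn n) = (if m = n then tree_component T n S else {})" for m n
  by (auto simp: mem_tree_component Sn_def)
 have Sn: "Sn n : sets (tree_vol T)" for n
  using S by (auto simp: sets_tree_vol comp) (auto simp: Sn_def)
 have setsE: "sets ?E = sets (tree_vol T)" by (simp add: empirical_def)
 have part: "(NN zc. ideal n t zc * indicator (tree_component T n S) zc \<partial>tree_coords_vol T n)
   <= emeasure ?E (Sn n) + (NN zc. ideal n t zc - low N n t zc \<partial>tree_coords_vol T n)" for n
 proof -
  have cS: "tree_component T n S : sets (tree_coords_vol T n)" using S by (simp add: sets_tree_vol)
  have "(NN zc. ideal n t zc * indicator (tree_component T n S) zc \<partial>tree_coords_vol T n)
   <= (NN zc. indicator (tree_component T n S) zc * low N n t zc + (ideal n t zc - low N n t zc) \<partial>tree_coords_vol T n)"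
  proof (rule nn_integral_mono)
   fix zc
   have "ideal n t zc <= low N n t zc + (ideal n t zc - low N n t zc)"
    using ennreal_minus_le_iff[of "ideal n t zc" "low N n t zc" "ideal n t zc - low N n t zc"] by simp
   then show "ideal n t zc * indicator (tree_component T n S) zc <= indicator (tree_component T n S) zc * low N n t zc + (ideal n t zc - low N n t zc)"
    by (auto simp: indicator_def)
  qed
  also have "... = (NN zc. indicator (tree_component T n S) zc * low N n t zc \<partial>tree_coords_vol T n) + (NN zc. ideal n t zc - low N n t zc \<partial>tree_coords_vol T n)"
   by (rule nn_integral_add)
    (intro borel_measurable_times_ennreal borel_measurable_indicator cS low_measurable borel_measurable_minus_ennreal ideal_measurable)+
  also have "(NN zc. indicator (tree_component T n S) zc * low N n t zc \<partial>tree_coords_vol T n) <= emeasure ?E (Sn n)"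
  proof (cases "n <= N")
   case True
   have "(NN zc. indicator (tree_component T n (Sn n)) zc * lower N (eps N) (eps' N) n t zc \<partial>tree_coords_vol T n) <= emeasure ?E (Sn n)"
    by (rule history_lower[OF eps_pos(1)[OF N(1)] N(2) eps_pos(2)[OF N(1)] t True Sn]) (simp add: Sn_def)
   then show ?thesis using True by (simp add: low_def comp)
  qed (simp add: low_def)
  finally show ?thesis by simp
 qed
 have "disjoint_family Sn" by (auto simp: disjoint_family_on_def Sn_def)
 moreover have "range Sn \<subseteq> sets ?E" using Sn setsE by auto
 ultimately have "(\<Sum>n. emeasure ?E (Sn n)) = emeasure ?E (\<Union>n. Sn n)" by (rule suminf_emeasure[rotated])
 also have "(\<Union>n. Sn n) = S" by (auto simp: Sn_def)
 finally have sum: "(\<Sum>n. emeasure ?E (Sn n)) = emeasure ?E S" .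
 have "ideal_law t S <= (\<Sum>n. emeasure ?E (Sn n) + (NN zc. ideal n t zc - low N n t zc \<partial>tree_coords_vol T n))"
  unfolding ideal_law_def by (rule suminf_le[OF part]) auto
 also have "... = emeasure ?E S + deficit N t" by (simp add: suminf_add[symmetric] sum deficit_def)
 finally show ?thesis .
qed

lemma empirical_le_1: "emeasure (empirical f g N ep T t) S <= 1"
proof -
 interpret F: prob_space "density phase_vol (%z. ennreal (f z))"
 proof (rule prob_spaceI)
  have "(%z. ennreal (f z)) : bm phase_vol" by (rule measurable_phase_volI) measurable
  then have "emeasure (density phase_vol (%z. ennreal (f z))) (space phase_vol) = (NN z. ennreal (f z) * indicator (space phase_vol) z \<partial>phase_vol)"
   by (subst emeasure_density) auto
  also have "... = (NN z. ennreal (f z) \<partial>phase_vol)" by (intro nn_integral_cong) simp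
  finally show "emeasure (density phase_vol (%z. ennreal (f z))) (space (density phase_vol (%z. ennreal (f z)))) = 1" using f_int by simp
 qed
 interpret P: prob_space "PiM {..<N} (%_. G)" by (rule prob_space_PiM) (rule prob_G)
 interpret L: pair_prob_space "density phase_vol (%z. ennreal (f z))" "PiM {..<N} (%_. G)" ..
 have "emeasure (empirical f g N ep T t) S <= emeasure (completion (initial_law f g N)) (space (completion (initial_law f g N)))"
  unfolding empirical_def by (rule emeasure_distr_le)
 also have "... = emeasure (initial_law f g N) (space (initial_law f g N))" by simp
 also have "... = 1" unfolding initial_law_def by (rule L.emeasure_space_1)
 finally show ?thesis .
qed

text \<open>The one-sided bound is used for \<open>S\<close> and for its complement. As the
  idealised masses add up to 1 and the empirical ones to at most 1, the bound for the complement is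
  the reverse bound for \<open>S\<close>.\<close>

lemma distance_le_deficit:
 assumes S: "S : sets (tree_vol T)" and t: "0 <= t" "t <= T" and N: "0 < N" "eps N < 1 / 2"
 shows "\<bar>(LINT \<Phi>:S|tree_vol T. idealised f g t \<Phi>) - measure (empirical f g N (eps N) T t) S\<bar> <= enn2real (deficit N t)"
proof -
 let ?E = "empirical f g N (eps N) T t" and ?S' = "space (tree_vol T) - S"
 have S': "?S' : sets (tree_vol T)" using S by auto
 have setsE: "sets ?E = sets (tree_vol T)" by (simp add: empirical_def)
 have SE: "S : sets ?E" "?S' : sets ?E" using S S' setsE by auto
 have U: "S \<union> ?S' = space (tree_vol T)" using sets.sets_into_space[OF S] by blast
 have D: "deficit N t < \<infinity>" by (rule deficit_finite[OF t(2)])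
 have add: "ideal_law t S + ideal_law t ?S' = 1"
 proof -
  have m: "(%\<Phi>. ennreal (indicator A \<Phi> *. idealised f g t \<Phi>)) : bm (tree_vol T)" if "A : sets (tree_vol T)" for A
   using idealised_measurable[OF t(1)] that by measurable
  have "ideal_law t S + ideal_law t ?S' = (NN \<Phi>. ennreal (indicator S \<Phi> *. idealised f g t \<Phi>) + ennreal (indicator ?S' \<Phi> *. idealised f g t \<Phi>) \<partial>tree_vol T)"
   unfolding ideal_law_integral[OF S t(1)] ideal_law_integral[OF S' t(1)] by (rule nn_integral_add[OF m[OF S] m[OF S'], symmetric])
  also have "... = ideal_law t (space (tree_vol T))"
   unfolding ideal_law_integral[OF sets.top t(1)] by (intro nn_integral_cong) (auto simp: indicator_def)
  finally show ?thesis using ideal_law_space[OF t] by simp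
 qed
 have e1: "emeasure ?E S + emeasure ?E ?S' <= 1"
  using plus_emeasure[OF SE] empirical_le_1[of N "eps N" t "S \<union> ?S'"] by simp
 have u1: "ideal_law t S <= emeasure ?E S + deficit N t" and u2: "ideal_law t ?S' <= emeasure ?E ?S' + deficit N t"
  by (rule ideal_law_le[OF S t N], rule ideal_law_le[OF S' t N])
 have le1: "ideal_law t S <= 1" "ideal_law t ?S' <= 1" "emeasure ?E S <= 1" "emeasure ?E ?S' <= 1"
  using add empirical_le_1 by (metis le_iff_add, metis le_iff_add add.commute, blast, blast)
 obtain p p' e e' d where r: "ideal_law t S = ennreal p" "ideal_law t ?S' = ennreal p'" "emeasure ?E S = ennreal e" "emeasure ?E ?S' = ennreal e'" "deficit N t = ennreal d"
  and nn: "0 <= p" "0 <= p'" "0 <= e" "0 <= e'" "0 <= d"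
 proof -
  have "\<exists>r\<ge>0. q = ennreal r" if "q <= 1 \<or> q < \<infinity>" for q :: ennreal using that by (cases q) (auto simp: top_unique)
  then show ?thesis using that le1 D by metis
 qed
 have "p + p' = 1" using add nn by (simp add: r ennreal_plus[symmetric] del: ennreal_plus)
 moreover have "e + e' <= 1" using e1 nn by (simp add: r ennreal_plus[symmetric] del: ennreal_plus)
 moreover have "p <= e + d" "p' <= e' + d" using u1 u2 nn by (simp_all add: r ennreal_plus[symmetric] del: ennreal_plus)
 ultimately have "\<bar>p - e\<bar> <= d" by linarith
 moreover have "(LINT \<Phi>:S|tree_vol T. idealised f g t \<Phi>) = p"
 proof -
  have "(LINT \<Phi>:S|tree_vol T. idealised f g t \<Phi>) = enn2real (NN \<Phi>. ennreal (indicator S \<Phi> *. idealised f g t \<Phi>) \<partial>tree_vol T)"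
   unfolding set_lebesgue_integral_def
  proof (rule integral_eq_nn_integral)
   show "(%\<Phi>. indicator S \<Phi> *. idealised f g t \<Phi>) : bm (tree_vol T)" using idealised_measurable[OF t(1)] S by measurable
   show "AE \<Phi> in tree_vol T. 0 <= indicator S \<Phi> *. idealised f g t \<Phi>" by (rule AE_I2) (use idealised_nonneg t in auto)
  qed
  then show ?thesis unfolding ideal_law_integral[OF S t(1), symmetric] r using nn by simp
 qed
 moreover have "measure ?E S = e" using nn by (simp add: measure_def r)
 ultimately show ?thesis using nn by (simp add: r)
qed

lemma uniform_convergence:
 "uniform_limit {0..T} (%N t. SUP S\<in>sets (tree_vol T). \<bar>(LINT \<Phi>:S|tree_vol T. idealised f g t \<Phi>) - measure (empirical f g N (1 / sqrt (real N)) T t) S\<bar>) (%_. 0) sequentially"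
proof (rule uniform_limitI)
 fix e :: real assume e: "0 < e"
 let ?d = "%N t. enn2real (deficit N t)"
 \<comment> \<open>For each \<open>N\<close> a time with deficit at least \<open>e\<close>, if there
   is one, and 0 otherwise. Convergence along this sequence rules such times out for large
   \<open>N\<close>.\<close>
 define t where "t N = (if \<exists>s\<in>{0..T}. e <= ?d N s then SOME s. s : {0..T} & e <= ?d N s else 0)" for N
 have tT: "t N : {0..T}" and worst: "s : {0..T} ==> e <= ?d N s ==> e <= ?d N (t N)" for N s
 proof -
  have *: "t N : {0..T} & e <= ?d N (t N)" if "\<exists>s. s : {0..T} & e <= ?d N s"
   using someI_ex[OF that] that by (auto simp: t_def)
  show "e <= ?d N (t N)" if "s : {0..T}" "e <= ?d N s" using * that by blast
  show "t N : {0..T}" using * T_pos by (cases "\<exists>s. s : {0..T} & e <= ?d N s") (auto simp: t_def)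
 qed
 have "(%N. deficit N (t N)) \<longlonglongrightarrow> ennreal 0" using deficit_limit[of t] tT by simp
 then have "(%N. ?d N (t N)) \<longlonglongrightarrow> 0" using tendsto_enn2real[of "%N. deficit N (t N)" 0 sequentially] by simp
 then have "\<forall>\<^sub>F N in sequentially. ?d N (t N) < e" using e by (rule order_tendstoD(2))
 moreover have "\<forall>\<^sub>F N in sequentially. eps N < 1 / 2" by (rule order_tendstoD(2)[OF eps_tendsto]) simp
 ultimately show "\<forall>\<^sub>F N in sequentially. \<forall>t\<in>{0..T}. dist (SUP S\<in>sets (tree_vol T). \<bar>(LINT \<Phi>:S|tree_vol T. idealised f g t \<Phi>) - measure (empirical f g N (1 / sqrt (real N)) T t) S\<bar>) 0 < e"
  using eventually_gt_at_top[of 0]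
 proof eventually_elim
  case (elim N)
  show ?case
  proof
   fix s assume s: "s : {0..T}"
   let ?b = "%S. \<bar>(LINT \<Phi>:S|tree_vol T. idealised f g s \<Phi>) - measure (empirical f g N (1 / sqrt (real N)) T s) S\<bar>"
   have le: "?b S <= ?d N s" if "S : sets (tree_vol T)" for S
    using distance_le_deficit[OF that _ _ elim(3,2), of s] s by (simp add: eps_def)
   have "(SUP S\<in>sets (tree_vol T). ?b S) <= ?d N s" by (rule cSUP_least) (use le in auto)
   moreover have "?b {} <= (SUP S\<in>sets (tree_vol T). ?b S)"
    by (rule cSUP_upper[OF sets.empty_sets bdd_aboveI2[OF le]])
   then have "0 <= (SUP S\<in>sets (tree_vol T). ?b S)" using abs_ge_zero order_trans by blast
   moreover have "?d N s < e" using worst[OF s, of N] elim(1) by (meson not_le)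
   ultimately show "dist (SUP S\<in>sets (tree_vol T). ?b S) 0 < e" by (simp add: dist_real_def)
  qed
 qed
qed

end

section \<open>Admissible densities\<close>

text \<open>The integral of the indicator of the exceptional set over space is an integral over the
  torus of a sum over translates, in which by periodicity every term vanishes almost
  everywhere.\<close>

lemma AE_torus_periodic:
 assumes P: "Measurable.pred borel P" and per: "!!x k. k : lattice ==> P (x + k) = P x" and ae: "AE x in torus_vol. P x"
 shows "AE x in lborel. P x"
proof -
 let ?F = "%x. if P x then 0 else 1 :: ennreal"
 have F: "?F : bm borel" using P by measurable
 have "(NN x. ?F x \<partial>lborel) = (NN x. (NN k. ?F (x + k) \<partial>count_space lattice) \<partial>torus_vol)"
  by (rule nn_integral_periodize[OF F])
 also have "... = (NN x. 0 \<partial>torus_vol)"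
 proof (rule nn_integral_cong_AE)
  from ae show "AE x in torus_vol. (NN k. ?F (x + k) \<partial>count_space lattice) = 0"
  proof eventually_elim
   case (elim x)
   have "(NN k. ?F (x + k) \<partial>count_space lattice) = (NN k. 0 \<partial>count_space lattice)"
    by (rule nn_integral_cong) (use elim per in auto)
   then show ?case by simp
  qed
 qed
 finally have "(NN x. ?F x \<partial>lborel) = 0" by simp
 with nn_integral_0_iff_AE[of ?F lborel] F show ?thesis by (auto elim!: eventually_mono split: if_splits)
qed

text \<open>The set where a continuous function exceeds its essential supremum is open and null,
  hence empty.\<close>

lemma periodic_le_esssup:
 fixes u :: "real^3 => real"
 assumes c: "continuous_on UNIV u" and per: "!!x k. k : lattice ==> u (x + k) = u x"
 shows "ennreal (u x) <= esssup torus_vol (%x. ennreal (u x))"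
proof (rule ccontr)
 let ?s = "esssup torus_vol (%x. ennreal (u x))"
 assume "\<not> ennreal (u x) <= ?s"
 then have lt: "?s < ennreal (u x)" by simp
 then obtain r where r: "?s = ennreal r" "0 <= r" by (cases ?s) auto
 then have ru: "r < u x" using lt by (simp add: ennreal_less_iff)
 have [measurable]: "u : bm borel" using c by (rule borel_measurable_continuous_onI)
 have "AE x in torus_vol. ennreal (u x) <= ?s" by (rule esssup_AE)
 then have "AE x in torus_vol. u x <= r"
  by eventually_elim (use r in \<open>simp add: ennreal_le_iff\<close>)
 then have ae: "AE x in lborel. u x <= r" by (intro AE_torus_periodic) (auto simp: per)
 let ?S = "{x. r < u x}"
 have "open ?S" using c by (intro open_Collect_less) auto
 moreover have "?S : null_sets lborel"
 proof (rule AE_iff_null_sets[THEN iffD2])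
  show "?S : sets lborel" using \<open>open ?S\<close> by simp
  show "AE x in lborel. x \<notin> ?S" using ae by (simp add: not_less)
 qed
 then have "negligible ?S" by (simp add: negligible_iff_null_sets null_sets_completionI)
 ultimately have "?S = {}" using open_not_negligible by blast
 then show False using ru by blast
qed

text \<open>The envelope is a supremum over a countable dense set of positions, which makes it Borel
  measurable. For almost every velocity the density is continuous in position, so this supremum
  dominates it everywhere and does not exceed the essential supremum, whose finiteness comes from
  admissibility.\<close>

lemma background_bound:
 assumes g: "background_admissible g"
 obtains gb M \<alpha> where "gb : bm borel" "!!w. 0 <= gb w"
  "(NN w. ennreal (gb w * (1 + norm w)\<^sup>2) \<partial>lborel) < \<infinity>"
  "AE w in lborel. \<forall>x. g (x, w) <= gb w" "0 < M" "0 < \<alpha>"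
  "AE w in lborel. \<forall>x y. \<bar>g (x, w) - g (y, w)\<bar> <= M * norm (x - y) powr \<alpha>"
proof -
 from g have pd: "prob_density g"
  and mom: "(NN v. ess_sup_position g v * ennreal (1 + (norm v)\<^sup>2) \<partial>lborel) < \<infinity>"
  and sup: "esssup lborel (%v. ess_sup_position g v * ennreal (1 + norm v)) < \<infinity>"
  by (auto simp: background_admissible_def)
 from pd have gm[measurable]: "g : bm borel" and g0: "!!z. 0 <= g z"
  and per: "!!x v k. k : lattice ==> g (x + k, v) = g (x, v)"
  by (auto simp: prob_density_def)
 from g obtain M \<alpha> where M: "0 < M" "0 < \<alpha>"
  and h: "AE v in lborel. \<forall>x y. x - y \<notin> lattice --> \<bar>g (x, v) - g (y, v)\<bar> < M * torus_dist x y powr \<alpha>"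
  by (auto simp: background_admissible_def)
 have hold: "AE w in lborel. \<forall>x y. \<bar>g (x, w) - g (y, w)\<bar> <= M * norm (x - y) powr \<alpha>"
  using h
 proof eventually_elim
  case (elim w)
  show ?case
  proof (intro allI)
   fix x y
   show "\<bar>g (x, w) - g (y, w)\<bar> <= M * norm (x - y) powr \<alpha>"
   proof (cases "x - y : lattice")
    case True
    then have "g (x, w) = g (y, w)" using per[of "x - y" y w] by simp
    then show ?thesis using M by simp
   next
    case False
    have "torus_dist x y powr \<alpha> <= norm (x - y) powr \<alpha>"
     using torus_dist_le[OF lattice_zero, of x y] torus_dist_nonneg[of x y] M by (intro powr_mono2) auto
    then have "M * torus_dist x y powr \<alpha> <= M * norm (x - y) powr \<alpha>" using M by simp
    then show ?thesis using elim False by fastforce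
   qed
  qed
 qed
 obtain D :: "(real^3) set" where D: "countable D" "!!X. open X ==> X \<noteq> {} ==> \<exists>d\<in>D. d : X"
  using countable_dense_exists by blast
 define gs where "gs w = (SUP x\<in>D. ennreal (g (x, w)))" for w
 define gb where "gb w = enn2real (gs w)" for w
 have [measurable]: "gs : bm borel"
  unfolding gs_def by (rule borel_measurable_SUP[OF D(1)]) measurable
 have gbm[measurable]: "gb : bm borel" unfolding gb_def by measurable
 have "AE w in lborel. ess_sup_position g w * ennreal (1 + norm w) <= esssup lborel (%v. ess_sup_position g v * ennreal (1 + norm v))"
  by (rule esssup_AE)
 with hold have bd: "AE w in lborel. (\<forall>x. g (x, w) <= gb w) & ennreal (gb w) <= ess_sup_position g w"
 proof eventually_elim
  case (elim w)
  have ch: "\<bar>g (x, w) - g (y, w)\<bar> <= M * norm (x - y) powr \<alpha>" for x y using elim(1) by blast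
  have c: "continuous_on UNIV (%x. g (x, w))"
   unfolding continuous_on_def
  proof
   fix x :: "real^3"
   have "((%y. g (y, w) - g (x, w)) \<longlongrightarrow> 0) (at x)"
   proof (rule Lim_null_comparison)
    show "\<forall>\<^sub>F y in at x. norm (g (y, w) - g (x, w)) <= M * norm (y - x) powr \<alpha>" using ch by simp
    have "((%y. norm (y - x)) \<longlongrightarrow> norm (x - x)) (at x)" by (intro tendsto_intros)
    then have "((%y. norm (y - x)) \<longlongrightarrow> 0) (at x)" by simp
    from tendsto_powr2[OF this tendsto_const _ M(2)] have "((%y. norm (y - x) powr \<alpha>) \<longlongrightarrow> 0) (at x)" by simp
    from tendsto_mult_left[OF this, of M] show "((%y. M * norm (y - x) powr \<alpha>) \<longlongrightarrow> 0) (at x)" by simp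
   qed
   then show "((%x. g (x, w)) \<longlongrightarrow> g (x, w)) (at x within UNIV)" by (rule LIM_zero_cancel)
  qed
  have le: "ennreal (g (x, w)) <= ess_sup_position g w" for x
   unfolding ess_sup_position_def by (rule periodic_le_esssup[OF c]) (rule per)
  have "ess_sup_position g w * ennreal (1 + norm w) < \<infinity>" using elim(2) sup by (rule order_le_less_trans)
  moreover have "0 < 1 + norm w" by (smt (verit) norm_ge_zero)
  ultimately have "ess_sup_position g w \<noteq> \<infinity>" by (auto simp: ennreal_top_mult)
  moreover have gs_le: "gs w <= ess_sup_position g w" unfolding gs_def by (rule SUP_least) (rule le)
  ultimately have fin: "gs w < \<infinity>" by (metis infinity_ennreal_def less_top order_le_less_trans)
  then have gsb: "ennreal (gb w) = gs w" unfolding gb_def by simp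
  have "g (x, w) <= gb w" for x
  proof (rule ccontr)
   assume "\<not> g (x, w) <= gb w"
   then have "x : {y. gb w < g (y, w)}" by simp
   then have "{y. gb w < g (y, w)} \<noteq> {}" by blast
   moreover have "open {y. gb w < g (y, w)}" using c by (intro open_Collect_less) auto
   ultimately obtain d where d: "d : D" "gb w < g (d, w)" using D(2) by blast
   have "ennreal (g (d, w)) <= ennreal (gb w)" unfolding gsb gs_def by (rule SUP_upper[OF d(1)])
   then have "g (d, w) <= gb w" by (simp add: gb_def)
   then show False using d(2) by simp
  qed
  then show ?case using gsb gs_le by simp
 qed
 \<comment> \<open>By \<open>(1 + r) ^ 2 <= 2 * (1 + r ^ 2)\<close>, which is
   \<open>0 <= (1 - r) ^ 2\<close> rearranged.\<close>
 have "(NN w. ennreal (gb w * (1 + norm w)\<^sup>2) \<partial>lborel) <= (NN w. ennreal 2 * (ennreal (gb w) * ennreal (1 + (norm w)\<^sup>2)) \<partial>lborel)"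
 proof (rule nn_integral_mono)
  fix w :: "real^3"
  have "(1 + norm w)\<^sup>2 <= 2 * (1 + (norm w)\<^sup>2)"
   using zero_le_power2[of "1 - norm w"] by (simp add: power2_eq_square algebra_simps)
  then have "gb w * (1 + norm w)\<^sup>2 <= 2 * (gb w * (1 + (norm w)\<^sup>2))"
   using mult_left_mono[of "(1 + norm w)\<^sup>2" "2 * (1 + (norm w)\<^sup>2)" "gb w"] by (simp add: gb_def mult_ac)
  then have "ennreal (gb w * (1 + norm w)\<^sup>2) <= ennreal (2 * (gb w * (1 + (norm w)\<^sup>2)))" by (rule ennreal_leI)
  also have "... = ennreal 2 * (ennreal (gb w) * ennreal (1 + (norm w)\<^sup>2))"
   using ennreal_mult[of 2 "gb w * (1 + (norm w)\<^sup>2)"] ennreal_mult[of "gb w" "1 + (norm w)\<^sup>2"] by (simp only: gb_def enn2real_nonneg) simp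
  finally show "ennreal (gb w * (1 + norm w)\<^sup>2) <= ennreal 2 * (ennreal (gb w) * ennreal (1 + (norm w)\<^sup>2))" .
 qed
 also have "... = ennreal 2 * (NN w. ennreal (gb w) * ennreal (1 + (norm w)\<^sup>2) \<partial>lborel)"
  by (rule nn_integral_cmult) measurable
 also have "... <= ennreal 2 * (NN v. ess_sup_position g v * ennreal (1 + (norm v)\<^sup>2) \<partial>lborel)"
  by (intro mult_left_mono nn_integral_mono_AE) (use bd in \<open>eventually_elim, auto intro: mult_right_mono\<close>)
 also have "... < \<infinity>" using mom by (simp add: ennreal_mult_less_top)
 finally have fin: "(NN w. ennreal (gb w * (1 + norm w)\<^sup>2) \<partial>lborel) < \<infinity>" .
 have "AE w in lborel. \<forall>x. g (x, w) <= gb w" using bd by eventually_elim simp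
 then show ?thesis using that[OF gbm _ fin _ M hold] by (simp add: gb_def)
qed

theorem theorem5p6:
  fixes T :: real and f0 g0 :: "phase \<Rightarrow> real"
  assumes "0 < T"
    and "tagged_admissible f0"
    and "background_admissible g0"
  shows "uniform_limit {0..T}
    (\<lambda>N t. SUP S\<in>sets (tree_vol T).
       \<bar>(LINT \<Phi>:S|tree_vol T. idealised f0 g0 t \<Phi>)
          - measure (empirical f0 g0 N (1 / sqrt (real N)) T t) S\<bar>)
    (\<lambda>_. 0) sequentially"
proof -
 obtain gb M \<alpha> where gb: "gb : bm borel" "!!w. 0 <= gb w"
  "(NN w. ennreal (gb w * (1 + norm w)\<^sup>2) \<partial>lborel) < \<infinity>"
  "AE w in lborel. \<forall>x. g0 (x, w) <= gb w" "0 < M" "0 < \<alpha>"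
  "AE w in lborel. \<forall>x y. \<bar>g0 (x, w) - g0 (y, w)\<bar> <= M * norm (x - y) powr \<alpha>"
  by (rule background_bound[OF assms(3)]) (rule that)
 have f: "f0 : bm borel" "!!z. 0 <= f0 z" "(NN z. ennreal (f0 z) \<partial>phase_vol) = 1"
  and mom: "(NN (x, v). ennreal (f0 (x, v) * (1 + (norm v)\<^sup>2)) \<partial>phase_vol) < \<infinity>"
  using assms(2) by (auto simp: tagged_admissible_def prob_density_def)
 have g: "g0 : bm borel" "!!z. 0 <= g0 z" "!!x v k. k : lattice ==> g0 (x + k, v) = g0 (x, v)"
  "(NN z. ennreal (g0 z) \<partial>phase_vol) = 1"
  using assms(3) by (auto simp: background_admissible_def prob_density_def)
 \<comment> \<open>The locale asks for a first moment of the tagged particle; it follows from the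
   second by \<open>1 + r <= 2 * (1 + r ^ 2)\<close>.\<close>
 have "(NN z. ennreal (f0 z * (1 + norm (snd z))) \<partial>phase_vol) <= (NN z. ennreal 2 * ennreal (f0 z * (1 + (norm (snd z))\<^sup>2)) \<partial>phase_vol)"
 proof (rule nn_integral_mono)
  fix z :: phase
  have "1 + norm (snd z) <= 2 * (1 + (norm (snd z))\<^sup>2)"
  proof -
   have "0 <= (1 - norm (snd z))\<^sup>2" "0 <= (norm (snd z))\<^sup>2" "0 <= norm (snd z)" by simp_all
   moreover have "(1 - norm (snd z))\<^sup>2 = 1 - 2 * norm (snd z) + (norm (snd z))\<^sup>2" by (simp add: power2_diff)
   ultimately show ?thesis by argo
  qed
  then have "f0 z * (1 + norm (snd z)) <= f0 z * (2 * (1 + (norm (snd z))\<^sup>2))" by (rule mult_left_mono[OF _ f(2)])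
  then have "ennreal (f0 z * (1 + norm (snd z))) <= ennreal (f0 z * (2 * (1 + (norm (snd z))\<^sup>2)))" by (rule ennreal_leI)
  then show "ennreal (f0 z * (1 + norm (snd z))) <= ennreal 2 * ennreal (f0 z * (1 + (norm (snd z))\<^sup>2))"
   using f(2)[of z] ennreal_mult[of 2 "f0 z * (1 + (norm (snd z))\<^sup>2)"] by (simp only: mult.left_commute[of "f0 z"]) simp
 qed
 also have "... = ennreal 2 * (NN z. ennreal (f0 z * (1 + (norm (snd z))\<^sup>2)) \<partial>phase_vol)"
  by (rule nn_integral_cmult) (rule measurable_phase_volI, use f(1) in measurable)
 also have "... < \<infinity>" using mom by (simp add: case_prod_beta' ennreal_mult_less_top)
 finally interpret rayleigh f0 g0 gb M \<alpha> T
  using f g gb assms(1) by unfold_locales auto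
 show ?thesis by (rule uniform_convergence)
qed

end
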